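(* Let $U\subset\Omega\subset X$ be such that $U$ is $1$-quasiopen and $\Omega$ is open, and let $u\in L^1_{\mathrm{loc}}(\Omega)$ with $\Vert Du\Vert(\Omega)<\infty$. Let $0<\varepsilon<1$. Then there exist a partition of unity $\{\eta_j\in N^{1,1}_c(U)\}_{j=1}^\infty$ in $U$ and functions $u_j\in N^{1,1}(\{\eta_j>0\})$, $j\in\mathbb N$, such that the function $$v:=\sum_{j=1}^\infty \eta_j u_j$$ satisfies $\Vert v-u\Vert_{L^1(U)}<\varepsilon$, $\int_U g_v\,d\mu<\Vert Du\Vert(U)+\varepsilon$ (where $g_v$ is the minimal $1$-weak upper gradient of $v$ in $U$), and $$\sup_U|v-u^\vee|\le 9\sup_U(u^\vee-u^\wedge)+\varepsilon.$$ Moreover, understanding $v-u$ to be extended by zero to $X\setminus U$, we have $$\Vert D(v-u)\Vert(X)<2\Vert Du\Vert(U)+\varepsilon\quad\text{and}\quad \Vert D(v-u)\Vert(X\setminus U)=0,$$ and $|v-u|^\vee=0$ $\mathcal H$-a.e. in $X\setminus U$.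
   Context: Setting. $(X,d,\mu)$ is a complete metric space equipped with a Borel regular outer measure $\mu$ that is doubling: there is $C_d\ge 1$ with $0<\mu(B(x,2r))\le C_d\,\mu(B(x,r))<\infty$ for every ball $B(x,r)=\{y\in X: d(y,x)<r\}$. Functions take values in $[-\infty,\infty]$. Upper gradients. A curve is a rectifiable continuous map from a compact interval into $X$. A nonnegative Borel function $g$ is an upper gradient of $u$ in a set $A\subset X$ if for all nonconstant curves $\gamma$ in $A$ with end points $x,y$ we have $|u(x)-u(y)|\le\int_\gamma g\,ds$ (the left side is interpreted as $\infty$ if $|u(x)|$ or $|u(y)|$ is infinite). A family of curves has zero $1$-modulus if there is a nonnegative Borel $\rho\in L^1(X)$ with $\int_\gamma\rho\,ds=\infty$ for all $\gamma$ in the family. A nonnegative $\mu$-measurable $g$ is a $1$-weak upper gradient of $u$ in $A$ if the inequality holds for all nonconstant curves in $A$ outside a family of zero $1$-modulus. $X$ is assumed to support a $(1,1)$-Poincaré inequality: there are $C_P>0$, $\lambda\ge1$ such that for every ball $B(x,r)$, every $u\in L^1_{\mathrm{loc}}(X)$ and every upper gradient $g$ of $u$ in $X$, $$\frac1{\mu(B(x,r))}\int_{B(x,r)}|u-u_{B(x,r)}|\,d\mu\le C_P r\,\frac1{\mu(B(x,\lambda r))}\int_{B(x,\lambda r)}g\,d\mu,$$ where $u_{B(x,r)}$ is the integral average of $u$ over $B(x,r)$. Newton-Sobolev spaces. For a $\mu$-measurable $H\subset X$, $\Vert u\Vert_{N^{1,1}(H)}=\Vert u\Vert_{L^1(H)}+\inf\Vert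 g\Vert_{L^1(H)}$, the infimum over all $1$-weak upper gradients $g$ of $u$ in $H$, and $N^{1,1}(H)=\{u:\Vert u\Vert_{N^{1,1}(H)}<\infty\}$ (functions defined everywhere in $H$). A local space on $H$ consists of the functions $u$ such that every $x\in H$ has $r>0$ with $u$ in the corresponding space on $H\cap B(x,r)$. Each $u\in N^{1,1}_{\mathrm{loc}}(H)$ has a minimal (a.e. smallest) $1$-weak upper gradient $g_u$ in $H$; writing $g_u$ presupposes $u\in N^{1,1}_{\mathrm{loc}}(H)$. $N^{1,1}_c(H)$ is the class of $u\in N^{1,1}(X)$ whose support is a compact subset of $H$. Capacity and quasiopen sets. $\mathrm{Cap}_1(A)=\inf\Vert u\Vert_{N^{1,1}(X)}$ over $u\in N^{1,1}(X)$ with $u\ge1$ in $A$. "$1$-q.e." means outside a set of zero $\mathrm{Cap}_1$. $U\subset X$ is $1$-quasiopen if for every $\varepsilon>0$ there is an open $G\subset X$ with $\mathrm{Cap}_1(G)<\varepsilon$ and $U\cup G$ open ($1$-quasiopen sets are $\mu$-measurable). Partition of unity. A partition of unity in a $1$-quasiopen set $U$ is a family of nonnegative functions $\eta_j$ with $\sum_{j=1}^\infty\eta_j=1$ $1$-q.e. in $U$. The product $\eta_ju_j$ is understood to be $0$ where $\eta_j=0$. Total variation. For open $\Omega\subset X$ and $u\in L^1_{\mathrm{loc}}(\Omega)$, $$\Vert Du\Vert(\Omega)=\inf\Big\{\liminf_{i\to\infty}\int_\Omega g_{u_i}\,d\mu:\ u_i\in N^{1,1}_{\mathrm{loc}}(\Omega),\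 u_i\to u\text{ in }L^1_{\mathrm{loc}}(\Omega)\Big\},$$ with $g_{u_i}$ the minimal $1$-weak upper gradient of $u_i$ in $\Omega$. For arbitrary $A$, $\Vert Du\Vert(A)=\inf\{\Vert Du\Vert(W): A\subset W,\ W\text{ open}\}$. Hausdorff measure. $\mathcal H(A)=\lim_{R\to0}\mathcal H_R(A)$, where $\mathcal H_R(A)=\inf\{\sum_{i}\mu(B(x_i,r_i))/r_i:\ A\subset\bigcup_i B(x_i,r_i),\ r_i\le R\}$ over finite or countable covers. Approximate limits. For $u$ on an open set $\Omega$ and $x\in\Omega$, $$u^\wedge(x)=\sup\Big\{t\in\mathbb R:\lim_{r\to0}\tfrac{\mu(B(x,r)\cap\{u<t\})}{\mu(B(x,r))}=0\Big\},\qquad u^\vee(x)=\inf\Big\{t\in\mathbb R:\lim_{r\to0}\tfrac{\mu(B(x,r)\cap\{u>t\})}{\mu(B(x,r))}=0\Big\}.$$ Always $u^\wedge\le u^\vee$. The functions $v$, $u^\wedge$, $u^\vee$ are pointwise defined. The quantity $\sup_U(u^\vee-u^\wedge)$ may be $\infty$, in which case the bound on $\sup_U|v-u^\vee|$ is vacuous.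
   Formalization: The supremum of |v-u^∨| is taken only over the points of U where the η_j sum to 1 (1-q.e. point of U); over all of U the bound is false, e.g. for U a comeagre length-zero subset of a segment in the plane and u=1, since the η_j have compact supports in U and U is not σ-compact. *)

theory Defs
  imports "HOL-Analysis.Analysis"
begin

section \<open>The measure\<close>

definition borel_regular_outer_measure :: "('a::topological_space set \<Rightarrow> ennreal) \<Rightarrow> bool" where
  "borel_regular_outer_measure \<mu> \<longleftrightarrow>
     outer_measure_space (Pow UNIV) \<mu> \<and>
     sets borel \<subseteq> lambda_system UNIV (Pow UNIV) \<mu> \<and>
     (\<forall>A. \<exists>B\<in>sets borel. A \<subseteq> B \<and> \<mu> B = \<mu> A)"

text \<open>An outer measure restricted to its Caratheodory measurable sets; these are the
  \<open>\<mu>\<close>-measurable sets.\<close>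

definition outer_meas :: "('a set \<Rightarrow> ennreal) \<Rightarrow> 'a measure" where
  "outer_meas \<mu> = measure_of UNIV (lambda_system UNIV (Pow UNIV) \<mu>) \<mu>"

lemma space_outer_meas [simp]: "space (outer_meas \<mu>) = UNIV"
  by (simp add: outer_meas_def space_measure_of_conv)

lemma
  assumes "outer_measure_space (Pow UNIV) \<mu>"
  shows sets_outer_meas: "sets (outer_meas \<mu>) = lambda_system UNIV (Pow UNIV) \<mu>"
    and emeasure_outer_meas: "A \<in> lambda_system UNIV (Pow UNIV) \<mu> \<Longrightarrow> emeasure (outer_meas \<mu>) A = \<mu> A"
proof -
  have ms: "measure_space UNIV (lambda_system UNIV (Pow UNIV) \<mu>) \<mu>"
    by (rule sigma_algebra.caratheodory_lemma[OF sigma_algebra_Pow assms])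
  then interpret sigma_algebra UNIV "lambda_system UNIV (Pow UNIV) \<mu>"
    by (simp add: measure_space_def)
  show sets: "sets (outer_meas \<mu>) = lambda_system UNIV (Pow UNIV) \<mu>"
    unfolding outer_meas_def by (rule sets_measure_of_eq)
  show "emeasure (outer_meas \<mu>) A = \<mu> A" if "A \<in> lambda_system UNIV (Pow UNIV) \<mu>"
    unfolding outer_meas_def using ms that
    by (auto simp: measure_space_def intro!: emeasure_measure_of_sigma)
qed

definition doubling :: "('a::metric_space set \<Rightarrow> ennreal) \<Rightarrow> bool" where
  "doubling \<mu> \<longleftrightarrow> (\<exists>C\<ge>1::real. \<forall>x. \<forall>r>0.
     0 < \<mu> (ball x (2 * r)) \<and> \<mu> (ball x (2 * r)) \<le> ennreal C * \<mu> (ball x r) \<and> \<mu> (ball x r) < \<infinity>)"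

section \<open>Integrable functions\<close>

text \<open>A function on a set \<open>H\<close> is a total function of which only the values on \<open>H\<close> are used.\<close>

definition L1_norm :: "('a set \<Rightarrow> ennreal) \<Rightarrow> 'a set \<Rightarrow> ('a \<Rightarrow> ereal) \<Rightarrow> ennreal" where
  "L1_norm \<mu> H u = (\<integral>\<^sup>+x\<in>H. e2ennreal \<bar>u x\<bar> \<partial>outer_meas \<mu>)"

definition L1 :: "('a set \<Rightarrow> ennreal) \<Rightarrow> 'a set \<Rightarrow> ('a \<Rightarrow> ereal) set" where
  "L1 \<mu> H = {u. u \<in> borel_measurable (restrict_space (outer_meas \<mu>) H) \<and> L1_norm \<mu> H u < \<infinity>}"

definition L1_loc :: "('a::metric_space set \<Rightarrow> ennreal) \<Rightarrow> 'a set \<Rightarrow> ('a \<Rightarrow> ereal) set" where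
  "L1_loc \<mu> H = {u. \<forall>x\<in>H. \<exists>r>0. u \<in> L1 \<mu> (H \<inter> ball x r)}"

definition L1_loc_tendsto ::
    "('a::metric_space set \<Rightarrow> ennreal) \<Rightarrow> 'a set \<Rightarrow> (nat \<Rightarrow> 'a \<Rightarrow> ereal) \<Rightarrow> ('a \<Rightarrow> ereal) \<Rightarrow> bool" where
  "L1_loc_tendsto \<mu> H us u \<longleftrightarrow>
     (\<forall>x\<in>H. \<exists>r>0. (\<lambda>i. L1_norm \<mu> (H \<inter> ball x r) (\<lambda>y. us i y - u y)) \<longlonglongrightarrow> 0)"

section \<open>Curves and upper gradients\<close>

text \<open>A curve is given by a map together with the end points of its parameter interval.\<close>

type_synonym 'a curve = "(real \<Rightarrow> 'a) \<times> real \<times> real"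

definition curve_length :: "(real \<Rightarrow> 'a::metric_space) \<Rightarrow> real \<Rightarrow> real \<Rightarrow> ennreal" where
  "curve_length \<gamma> a b =
     (SUP t \<in> {t :: nat \<Rightarrow> real. mono t \<and> range t \<subseteq> {a..b}}.
        SUP n. \<Sum>i<n. ennreal (dist (\<gamma> (t i)) (\<gamma> (t (Suc i)))))"

definition is_curve :: "'a::metric_space curve \<Rightarrow> bool" where
  "is_curve = (\<lambda>(\<gamma>, a, b). a \<le> b \<and> continuous_on {a..b} \<gamma> \<and> curve_length \<gamma> a b < \<infinity>)"

definition nonconstant_curves_in :: "'a::metric_space set \<Rightarrow> 'a curve set" where
  "nonconstant_curves_in A = {(\<gamma>, a, b). is_curve (\<gamma>, a, b) \<and> \<not> \<gamma> constant_on {a..b} \<and> \<gamma> ` {a..b} \<subseteq> A}"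

text \<open>Arc-length parametrization on \<open>[0, \<ell>]\<close>: for a curve, the point does not depend on the
  chosen parameter \<open>t\<close>, since the curve is constant between two parameters with the same
  arc length.\<close>

definition arclength_param :: "(real \<Rightarrow> 'a::metric_space) \<Rightarrow> real \<Rightarrow> real \<Rightarrow> real \<Rightarrow> 'a" where
  "arclength_param \<gamma> a b s = \<gamma> (SOME t. t \<in> {a..b} \<and> curve_length \<gamma> a t = ennreal s)"

text \<open>Lebesgue rather than Borel measure on the parameter interval, because a 1-weak upper gradient
  \<open>g\<close> is only \<open>\<mu>\<close>-measurable: along curves outside a family of zero 1-modulus,
  \<open>g\<close> composed with the arc-length parametrization is Lebesgue measurable.\<close>

definition curve_integral :: "'a::metric_space curve \<Rightarrow> ('a \<Rightarrow> ennreal) \<Rightarrow> ennreal" where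
  "curve_integral = (\<lambda>(\<gamma>, a, b) g.
     \<integral>\<^sup>+s\<in>{0..enn2real (curve_length \<gamma> a b)}. g (arclength_param \<gamma> a b s) \<partial>lebesgue)"

text \<open>Subtraction on \<^typ>\<open>ereal\<close> already has the convention that
  \<open>\<bar>u x - u y\<bar>\<close> is infinite when one of the values is.\<close>

lemma ereal_abs_diff_infinite:
  fixes a b :: ereal
  assumes "\<bar>a\<bar> = \<infinity> \<or> \<bar>b\<bar> = \<infinity>"
  shows "\<bar>a - b\<bar> = \<infinity>"
  using assms by (cases a; cases b) auto

definition ug_inequality :: "('a::metric_space \<Rightarrow> ereal) \<Rightarrow> ('a \<Rightarrow> ennreal) \<Rightarrow> 'a curve \<Rightarrow> bool" where
  "ug_inequality u g = (\<lambda>(\<gamma>, a, b). e2ennreal \<bar>u (\<gamma> a) - u (\<gamma> b)\<bar> \<le> curve_integral (\<gamma>, a, b) g)"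

definition upper_gradient :: "'a::metric_space set \<Rightarrow> ('a \<Rightarrow> ereal) \<Rightarrow> ('a \<Rightarrow> ennreal) \<Rightarrow> bool" where
  "upper_gradient A u g \<longleftrightarrow>
     g \<in> borel_measurable (restrict_space borel A) \<and> (\<forall>\<gamma>\<in>nonconstant_curves_in A. ug_inequality u g \<gamma>)"

definition zero_1_modulus :: "('a::metric_space set \<Rightarrow> ennreal) \<Rightarrow> 'a curve set \<Rightarrow> bool" where
  "zero_1_modulus \<mu> \<Gamma> \<longleftrightarrow>
     (\<exists>\<rho>. \<rho> \<in> borel_measurable borel \<and> (\<integral>\<^sup>+x. \<rho> x \<partial>outer_meas \<mu>) < \<infinity> \<and>
          (\<forall>\<gamma>\<in>\<Gamma>. curve_integral \<gamma> \<rho> = \<infinity>))"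

definition weak_upper_gradient ::
    "('a::metric_space set \<Rightarrow> ennreal) \<Rightarrow> 'a set \<Rightarrow> ('a \<Rightarrow> ereal) \<Rightarrow> ('a \<Rightarrow> ennreal) \<Rightarrow> bool" where
  "weak_upper_gradient \<mu> A u g \<longleftrightarrow>
     g \<in> borel_measurable (restrict_space (outer_meas \<mu>) A) \<and>
     (\<exists>\<Gamma>. zero_1_modulus \<mu> \<Gamma> \<and> (\<forall>\<gamma>\<in>nonconstant_curves_in A - \<Gamma>. ug_inequality u g \<gamma>))"

text \<open>In the average, \<^const>\<open>real_of_ereal\<close> only discards the infinite values of \<open>u\<close>, which a
  function integrable on the ball takes on a null set.\<close>

definition ball_average :: "('a::metric_space set \<Rightarrow> ennreal) \<Rightarrow> ('a \<Rightarrow> ereal) \<Rightarrow> 'a \<Rightarrow> real \<Rightarrow> real" where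
  "ball_average \<mu> u x r =
     (LINT y:ball x r|outer_meas \<mu>. real_of_ereal (u y)) / enn2real (\<mu> (ball x r))"

definition poincare_1_1 :: "('a::metric_space set \<Rightarrow> ennreal) \<Rightarrow> bool" where
  "poincare_1_1 \<mu> \<longleftrightarrow>
     (\<exists>C>0::real. \<exists>\<Lambda>\<ge>1::real. \<forall>x. \<forall>r>0. \<forall>u\<in>L1_loc \<mu> UNIV. \<forall>g. upper_gradient UNIV u g \<longrightarrow>
        L1_norm \<mu> (ball x r) (\<lambda>y. u y - ereal (ball_average \<mu> u x r)) / \<mu> (ball x r)
        \<le> ennreal (C * r) *
          ((\<integral>\<^sup>+y\<in>ball x (\<Lambda> * r). g y \<partial>outer_meas \<mu>) / \<mu> (ball x (\<Lambda> * r))))"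

section \<open>Newton--Sobolev spaces\<close>

definition N11_norm :: "('a::metric_space set \<Rightarrow> ennreal) \<Rightarrow> 'a set \<Rightarrow> ('a \<Rightarrow> ereal) \<Rightarrow> ennreal" where
  "N11_norm \<mu> H u =
     L1_norm \<mu> H u + (INF g\<in>{g. weak_upper_gradient \<mu> H u g}. \<integral>\<^sup>+x\<in>H. g x \<partial>outer_meas \<mu>)"

definition N11 :: "('a::metric_space set \<Rightarrow> ennreal) \<Rightarrow> 'a set \<Rightarrow> ('a \<Rightarrow> ereal) set" where
  "N11 \<mu> H = {u. u \<in> borel_measurable (restrict_space (outer_meas \<mu>) H) \<and> N11_norm \<mu> H u < \<infinity>}"

definition N11_loc :: "('a::metric_space set \<Rightarrow> ennreal) \<Rightarrow> 'a set \<Rightarrow> ('a \<Rightarrow> ereal) set" where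
  "N11_loc \<mu> H = {u. \<forall>x\<in>H. \<exists>r>0. u \<in> N11 \<mu> (H \<inter> ball x r)}"

definition N11_c :: "('a::metric_space set \<Rightarrow> ennreal) \<Rightarrow> 'a set \<Rightarrow> ('a \<Rightarrow> ereal) set" where
  "N11_c \<mu> H = {u \<in> N11 \<mu> UNIV. compact (closure {x. u x \<noteq> 0}) \<and> closure {x. u x \<noteq> 0} \<subseteq> H}"

definition locally_integrable_on ::
    "('a::metric_space set \<Rightarrow> ennreal) \<Rightarrow> 'a set \<Rightarrow> ('a \<Rightarrow> ennreal) \<Rightarrow> bool" where
  "locally_integrable_on \<mu> H g \<longleftrightarrow>
     (\<forall>x\<in>H. \<exists>r>0. (\<integral>\<^sup>+y\<in>H \<inter> ball x r. g y \<partial>outer_meas \<mu>) < \<infinity>)"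

text \<open>As usual, minimality is among the locally integrable 1-weak upper gradients. Without this
  restriction there is in general no a.e. smallest one: on the real line, a function whose integral
  over every interval is infinite is an upper gradient of everything, and it may vanish on a nowhere
  dense set of positive measure.\<close>

definition is_minimal_wug ::
    "('a::metric_space set \<Rightarrow> ennreal) \<Rightarrow> 'a set \<Rightarrow> ('a \<Rightarrow> ereal) \<Rightarrow> ('a \<Rightarrow> ennreal) \<Rightarrow> bool" where
  "is_minimal_wug \<mu> H u g \<longleftrightarrow>
     weak_upper_gradient \<mu> H u g \<and> locally_integrable_on \<mu> H g \<and>
     (\<forall>g'. weak_upper_gradient \<mu> H u g' \<and> locally_integrable_on \<mu> H g' \<longrightarrow>
        (AE x in outer_meas \<mu>. x \<in> H \<longrightarrow> g x \<le> g' x))"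

text \<open>Meaningful for \<^term>\<open>u \<in> N11_loc \<mu> H\<close>, and then determined a.e. in \<open>H\<close>.\<close>

definition minimal_wug ::
    "('a::metric_space set \<Rightarrow> ennreal) \<Rightarrow> 'a set \<Rightarrow> ('a \<Rightarrow> ereal) \<Rightarrow> 'a \<Rightarrow> ennreal" where
  "minimal_wug \<mu> H u = (SOME g. is_minimal_wug \<mu> H u g)"

section \<open>Capacity, quasiopen sets, partitions of unity\<close>

definition Cap1 :: "('a::metric_space set \<Rightarrow> ennreal) \<Rightarrow> 'a set \<Rightarrow> ennreal" where
  "Cap1 \<mu> A = (INF u\<in>{u \<in> N11 \<mu> UNIV. \<forall>x\<in>A. 1 \<le> u x}. N11_norm \<mu> UNIV u)"

definition quasiopen1 :: "('a::metric_space set \<Rightarrow> ennreal) \<Rightarrow> 'a set \<Rightarrow> bool" where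
  "quasiopen1 \<mu> U \<longleftrightarrow> (\<forall>\<epsilon>>0::real. \<exists>G. open G \<and> Cap1 \<mu> G < ennreal \<epsilon> \<and> open (U \<union> G))"

definition partition_of_unity ::
    "('a::metric_space set \<Rightarrow> ennreal) \<Rightarrow> 'a set \<Rightarrow> (nat \<Rightarrow> 'a \<Rightarrow> ereal) \<Rightarrow> bool" where
  "partition_of_unity \<mu> U \<eta> \<longleftrightarrow>
     (\<forall>j x. 0 \<le> \<eta> j x) \<and> Cap1 \<mu> {x\<in>U. (\<Sum>j. \<eta> j x) \<noteq> 1} = 0"

section \<open>Total variation\<close>

definition total_variation_open ::
    "('a::metric_space set \<Rightarrow> ennreal) \<Rightarrow> 'a set \<Rightarrow> ('a \<Rightarrow> ereal) \<Rightarrow> ennreal" where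
  "total_variation_open \<mu> W u =
     (INF us\<in>{us. (\<forall>i. us i \<in> N11_loc \<mu> W) \<and> L1_loc_tendsto \<mu> W us u}.
        liminf (\<lambda>i. \<integral>\<^sup>+x\<in>W. minimal_wug \<mu> W (us i) x \<partial>outer_meas \<mu>))"

text \<open>The variation of a function \<open>u\<close> on the open set \<open>\<Omega>\<close>, on an arbitrary subset \<open>A\<close> of
  \<open>\<Omega>\<close>. The open sets \<open>W\<close> range over subsets of the domain \<open>\<Omega>\<close> of \<open>u\<close>; in particular the value for
  \<open>A = \<Omega>\<close> is \<^term>\<open>total_variation_open \<mu> \<Omega> u\<close>.\<close>

definition total_variation ::
    "('a::metric_space set \<Rightarrow> ennreal) \<Rightarrow> 'a set \<Rightarrow> ('a \<Rightarrow> ereal) \<Rightarrow> 'a set \<Rightarrow> ennreal" where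
  "total_variation \<mu> \<Omega> u A =
     (INF W\<in>{W. open W \<and> A \<subseteq> W \<and> W \<subseteq> \<Omega>}. total_variation_open \<mu> W u)"

lemma total_variation_domain:
  "open \<Omega> \<Longrightarrow> total_variation \<mu> \<Omega> u \<Omega> = total_variation_open \<mu> \<Omega> u"
proof -
  assume "open \<Omega>"
  then have "{W. open W \<and> \<Omega> \<subseteq> W \<and> W \<subseteq> \<Omega>} = {\<Omega>}" by auto
  then show ?thesis by (simp add: total_variation_def)
qed

section \<open>Codimension one Hausdorff measure and approximate limits\<close>

text \<open>The index set \<open>I\<close> allows for finite as well as countably infinite covers.\<close>

definition hausdorff_content :: "('a::metric_space set \<Rightarrow> ennreal) \<Rightarrow> real \<Rightarrow> 'a set \<Rightarrow> ennreal" where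
  "hausdorff_content \<mu> R A =
     (INF (I, x, r) \<in> {(I :: nat set, x :: nat \<Rightarrow> 'a, r :: nat \<Rightarrow> real).
          (\<forall>i\<in>I. 0 < r i \<and> r i \<le> R) \<and> A \<subseteq> (\<Union>i\<in>I. ball (x i) (r i))}.
        \<Sum>i. if i \<in> I then \<mu> (ball (x i) (r i)) / ennreal (r i) else 0)"

definition hausdorff_codim1 :: "('a::metric_space set \<Rightarrow> ennreal) \<Rightarrow> 'a set \<Rightarrow> ennreal" where
  "hausdorff_codim1 \<mu> A = Lim (at_right 0) (\<lambda>R. hausdorff_content \<mu> R A)"

definition lower_approx_limit ::
    "('a::metric_space set \<Rightarrow> ennreal) \<Rightarrow> ('a \<Rightarrow> ereal) \<Rightarrow> 'a \<Rightarrow> ereal" where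
  "lower_approx_limit \<mu> u x =
     (SUP t\<in>{t::real. ((\<lambda>r. \<mu> (ball x r \<inter> {y. u y < ereal t}) / \<mu> (ball x r)) \<longlongrightarrow> 0) (at_right 0)}.
        ereal t)"

definition upper_approx_limit ::
    "('a::metric_space set \<Rightarrow> ennreal) \<Rightarrow> ('a \<Rightarrow> ereal) \<Rightarrow> 'a \<Rightarrow> ereal" where
  "upper_approx_limit \<mu> u x =
     (INF t\<in>{t::real. ((\<lambda>r. \<mu> (ball x r \<inter> {y. u y > ereal t}) / \<mu> (ball x r)) \<longlongrightarrow> 0) (at_right 0)}.
        ereal t)"

definition zero_ext :: "'a set \<Rightarrow> ('a \<Rightarrow> ereal) \<Rightarrow> 'a \<Rightarrow> ereal" where
  "zero_ext U f = (\<lambda>x. if x \<in> U then f x else 0)"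

text \<open>The set over which \<open>\<bar>v - u\<^sup>\<or>\<bar>\<close> is bounded, for \<open>v = (\<Sum>j. \<eta>\<^sub>j u\<^sub>j)\<close>: the points of \<open>U\<close> at which
  the partition of unity does sum to one, i.e. all of \<open>U\<close> up to zero 1-capacity. At the other points
  \<open>v\<close> carries no information about \<open>u\<close>, and they cannot be avoided in general: the functions
  \<open>\<eta>\<^sub>j\<close> all vanish outside a \<open>\<sigma>\<close>-compact subset of \<open>U\<close>, but a 1-quasiopen set need not be
  \<open>\<sigma>\<close>-compact, every set of zero 1-capacity being 1-quasiopen. (Take \<open>U\<close> to be a residual Lebesgue
  null subset of a line segment in the plane and \<open>u = 1\<close>: then \<open>v = 0 \<noteq> u\<^sup>\<or>\<close> somewhere
  in \<open>U\<close>.)\<close>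

definition unity_set :: "'a set \<Rightarrow> (nat \<Rightarrow> 'a \<Rightarrow> ereal) \<Rightarrow> 'a set" where
  "unity_set U \<eta> = {x\<in>U. (\<Sum>j. \<eta> j x) = 1}"

end

theory Submission imports Defs begin

text \<open>Off open sets \<open>G\<close> of small capacity, the sets of points at which a superlevel set of
 \<open>u\<close> has density zero are open: by the coarea inequality almost all superlevel sets have finite
 perimeter, and the relative isoperimetric and boxing inequalities bound the capacity of the exceptional
 points. Hence on a compact \<open>K\<close> disjoint from some \<open>G\<close> there are Lipschitz functions
 \<open>\<alpha> \<le> u \<le> \<beta>\<close> whose difference exceeds the largest jump of \<open>u\<close> by an arbitrarily
 small amount. A partition of unity \<open>\<eta>\<^sub>k\<close> with compact supports in such sets \<open>K\<^sub>k\<close> comes from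
 the capacitary potentials of the sets \<open>G\<close>. Let \<open>F\<^sub>i \<rightarrow> u\<close> have gradients \<open>g\<^sub>i\<close> with
 nearly optimal integrals, and let \<open>u\<^sub>k\<close> be some \<open>F\<^sub>i\<close>, \<open>i\<close> large, truncated at
 \<open>\<alpha>\<^sub>k\<close> and \<open>\<beta>\<^sub>k\<close>; since \<open>u\<close> stays away from these bounds, the truncation hardly adds to
 the gradient. In \<open>v = (\<Sum>k. \<eta>\<^sub>k u\<^sub>k)\<close> the gradients of the \<open>\<eta>\<^sub>k\<close> are only multiplied by
 the differences \<open>u\<^sub>k - u\<close>, which are small in \<open>L\<^sup>1\<close>. The tail of the series for \<open>v - u\<close> has small
 variation and agrees with \<open>v - u\<close> off a compact subset of \<open>U\<close>, which gives the
 statements on the complement of \<open>U\<close>.\<close>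

text \<open>The variation enters only as an infimum over approximating sequences, never as a
  measure, and two devices stand in for additivity. Where a set \<open>E\<close> has low density at
  all small scales around a point, cutting \<open>E\<close> away near such points saves more energy
  than it costs unless the energy there was small already. Since the perimeter is an infimum, it has
  to be small (\<open>thin_small\<close>). This gives the null sets and the openness statements with
  no structure theory for sets of finite perimeter. In the sum defining \<open>v\<close> each term
  uses its own index i; the lower limits \<open>bb k\<close> of the energy seen by the first k
  partition functions telescope, so i can be chosen such that the k-th term costs at most
  \<open>bb (Suc k) - bb k\<close> plus an error. All gradient estimates are made on subarcs of
  arc-length parametrised curves: increments glue by bisection of the parameter interval, hence a
  gradient may be chosen differently on sets such as {w < t} that are open merely along almost every
  curve.\<close>

abbreviation "en \<equiv> ennreal"
abbreviation "ea x \<equiv> ennreal (abs x)"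
abbreviation "bB \<equiv> borel_measurable borel"
no_notation fps_compose (infixl "oo" 55)
abbreviation "oo \<equiv> \<infinity>"
abbreviation "clen \<equiv> curve_length"
abbreviation "evs P \<equiv> eventually P sequentially"
abbreviation "rs n \<equiv> 1 / real (Suc n)"
abbreviation "NL A f \<equiv> \<integral>\<^sup>+x\<in>A. f x \<partial>lborel"
abbreviation "ctr \<equiv> undefined"
abbreviation "ind \<equiv> indicator"
abbreviation "indr \<equiv> indicat_real"
notation LIMSEQ ("((_)/ ~~> (_))" [60, 60] 60)

section \<open>Length of curves and arc-length parametrisation\<close>

lemma SUP_add_SUP_le:
 fixes C :: ennreal
 assumes "I ~= {}" "J ~= {}" "!!i j. i:I ==> j:J ==> f i + g j <= C"
 shows "(SUP i\<in>I. f i) + (SUP j\<in>J. g j) <= C"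
proof -
 have "f i + (SUP j\<in>J. g j) <= C" if "i:I" for i
 unfolding ennreal_SUP_add_right[OF assms(2)] using assms(3) that
 by (auto intro: SUP_least)
 thus ?thesis
 unfolding ennreal_SUP_add_left[OF assms(1), symmetric] by (auto intro: SUP_least)
qed

lemma sum_lessThan_split:"sum f {..<n + m} = sum f {..<n} + sum (%i. f (n + i)) {..<m}"
 for f :: "nat => 'b::comm_monoid_add"
 by (induction m) (auto simp: add.assoc)

definition plen :: "(real => 'a::metric_space) => (nat => real) => nat => ennreal" where
 "plen ga t n = (SUM i<n. en (dist (ga (t i)) (ga (t (Suc i)))))"

lemma clen_eq:
 "clen ga a b = (SUP t \<in> {t. mono t & range t <= {a..b}}. SUP n. plen ga t n)"
 by (simp add: curve_length_def plen_def)

lemma plen_le_clen: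
 assumes "mono t" "range t <= {a..b}"
 shows "plen ga t n <= clen ga a b"
 unfolding clen_eq using assms
 by (intro SUP_upper2[of t] SUP_upper2[of n]) auto

lemma clen_le:
 assumes "!!t n. mono t ==> range t <= {a..b} ==> plen ga t n <= C"
 shows "clen ga a b <= C"
 unfolding clen_eq using assms by (intro SUP_least) auto

lemma dist_le_clen:
 assumes "a <= s" "s <= t" "t <= b"
 shows "en (dist (ga s) (ga t)) <= clen ga a b"
proof -
 define u where "u = (%n::nat. if n = 0 then s else t)"
 have "plen ga u 1 <= clen ga a b"
 by (rule plen_le_clen) (use assms in "auto simp: u_def mono_def")
 thus ?thesis by (simp add: plen_def u_def)
qed

lemma clen_refl [simp]:"clen ga a a = 0"
proof -
 have "clen ga a a <= 0"
 proof (rule clen_le)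
 fix t :: "nat => real" and n assume "range t <= {a..a}"
 hence "t i = a" for i by auto
 thus "plen ga t n <= 0" by (simp add: plen_def)
 qed
 thus ?thesis by simp
qed

text \<open>For one inequality a partition of the long interval is clamped to either side of
  \<open>b\<close>. For the other, two partitions are concatenated and the segment joining them is
  discarded.\<close>

lemma clen_add:
 assumes "a <= b" "b <= c"
 shows "clen ga a c = clen ga a b + clen ga b c"
proof (rule antisym)
 show "clen ga a c <= clen ga a b + clen ga b c"
 proof (rule clen_le)
 fix t :: "nat => real" and n assume t:"mono t" "range t <= {a..c}"
 let ?l = "%i. min (t i) b" and ?r = "%i. max (t i) b"
 have ti:"a <= t i" "t i <= c" "t i <= t (Suc i)" for i
 using t by (auto simp: image_subset_iff intro: incseq_SucD)
 have "en (dist (ga (t i)) (ga (t (Suc i)))) <=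
 en (dist (ga (?l i)) (ga (?l (Suc i)))) + en (dist (ga (?r i)) (ga (?r (Suc i))))" for i
 proof -
 have "dist (ga (t i)) (ga (t (Suc i))) <= dist (ga (?l i)) (ga (?l (Suc i))) + dist (ga (?r i)) (ga (?r (Suc i)))"
 using ti(3)[of i] dist_triangle[of "ga (t i)" "ga (t (Suc i))" "ga b"] by (auto simp: min_def max_def)
 thus ?thesis by (simp flip: ennreal_plus)
 qed
 hence "plen ga t n <= plen ga ?l n + plen ga ?r n"
 unfolding plen_def sum.distrib[symmetric] by (intro sum_mono) auto
 also have "... <= clen ga a b + clen ga b c"
 using t(1) assms ti(1,2)
 by (intro add_mono plen_le_clen)
 (auto simp: mono_def image_subset_iff min.coboundedI1 max.coboundedI1)
 finally show "plen ga t n <= clen ga a b + clen ga b c" .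
 qed
 have *: "plen ga t n + plen ga t' m <= clen ga a c"
 if t:"mono t" "range t <= {a..b}" and t':"mono t'" "range t' <= {b..c}" for t t' :: "nat => real" and n m
 proof -
 \<comment> \<open>The shift by \<open>n + 1\<close> inserts the jump from \<open>t n\<close> to
   \<open>t' 0\<close>; its contribution is dropped below, whence the split
   \<open>n + (1 + m)\<close>.\<close>
 define s where "s i = (if i <= n then t i else t' (i - n - 1))" for i
 have ti:"a <= t i" "t i <= b" "b <= t' i" "t' i <= c" for i
 using t(2) t'(2) by (auto simp: image_subset_iff)
 have "mono s" unfolding mono_def s_def
 using t(1) t'(1) ti order_trans[OF ti(2) ti(3)] by (auto simp: mono_def)
 moreover have "range s <= {a..c}"
 using order_trans[OF ti(2) assms(2)] order_trans[OF assms(1) ti(3)] ti unfolding s_def by auto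
 ultimately have "plen ga s (n + (1 + m)) <= clen ga a c"
 by (rule plen_le_clen)
 moreover have "plen ga t n + plen ga t' m <= plen ga s (n + (1 + m))"
 unfolding plen_def sum_lessThan_split[of _ n] sum_lessThan_split[of _ 1]
 by (intro add_mono) (auto simp: s_def intro!: sum_mono order_trans[OF _ le_add2])
 ultimately show ?thesis by (rule order_trans[rotated])
 qed
 have ne:"{t::nat => real. mono t & range t <= {a..b}} ~= {}" if "a <= b" for a b
 using that by (auto intro!: exI[of _ "%_. a"] simp: mono_def)
 show "clen ga a b + clen ga b c <= clen ga a c"
 unfolding clen_eq[of ga a b] clen_eq[of ga b c]
 using assms by (intro SUP_add_SUP_le) (auto intro!: ne *)
qed

lemma clen_mono:
 assumes "a <= a'" "a' <= b'" "b' <= b"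
 shows "clen ga a' b' <= clen ga a b"
 using assms clen_add[of a a' b ga] clen_add[of a' b' b ga]
 by (auto intro: add_increasing add_increasing2)

lemma plen_tendsto:
 assumes "!!i. continuous_on S (%s. ga (t s i))"
 shows "continuous_on S (%s. plen ga (t s) n)"
proof -
 have "plen ga (t s) n = en (SUM i<n. dist (ga (t s i)) (ga (t s (Suc i))))" for s
 by (simp add: plen_def sum_ennreal)
 thus ?thesis
 using assms by (auto intro!: continuous_on_ennreal continuous_intros)
qed

text \<open>Lower semicontinuity of length under moving end points: a fixed partition clamped to
  \<open>[lo s, hi s]\<close> has a polygonal length that is continuous in \<open>s\<close>, and the
  length is the supremum of these.\<close>

lemma openin_clen:
 fixes lo hi :: "real => real"
 assumes cont:"continuous_on {a..b} ga" and lh:"continuous_on {a..b} lo" "continuous_on {a..b} hi"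
 "!!s. s:{a..b} ==> a <= lo s & lo s <= hi s & hi s <= b"
 shows "openin (top_of_set {a..b}) {t:{a..b}. clen ga (lo t) (hi t) > c}"
proof -
 let ?T = "{u::nat => real. mono u & range u <= {a..b}}" and ?m = "%u s i. max (lo s) (min (hi s) (u i))"
 let ?S = "%u n. {s:{a..b}. plen ga (?m u s) n > c}"
 have op:"openin (top_of_set {a..b}) (?S u n)" for u n
 proof -
 have "continuous_on {a..b} (%s. plen ga (?m u s) n)"
 proof (rule plen_tendsto)
 fix i
 have "continuous_on {a..b} (%s. ?m u s i)" by (intro continuous_on_max continuous_on_min lh continuous_on_const)
 moreover have "(%s. ?m u s i) ` {a..b} <= {a..b}" using lh(3) by force
 ultimately show "continuous_on {a..b} (%s. ga (?m u s i))" by (rule continuous_on_compose2[OF cont])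
 qed
 from continuous_openin_preimage_gen[OF this, of "{c<..}"] show ?thesis by (simp add: vimage_def Int_def)
 qed
 have "{t:{a..b}. clen ga (lo t) (hi t) > c} = (UN u:?T. UN n. ?S u n)"
 proof (intro set_eqI iffI)
 fix t assume t:"t:{t:{a..b}. clen ga (lo t) (hi t) > c}"
 then obtain u n where u:"mono u" "range u <= {lo t..hi t}" "plen ga u n > c"
 unfolding clen_eq less_SUP_iff by blast
 have m:"?m u t = u" using u(2) by (auto simp: fun_eq_iff image_subset_iff)
 have "u:?T" using u(1,2) lh(3)[of t] t by fastforce
 thus "t:(UN u:?T. UN n. ?S u n)" using t u(3) m by (intro UN_I[of u] UN_I[of n]) auto
 next
 fix t assume "t:(UN u:?T. UN n. ?S u n)"
 then obtain u n where u:"mono u" "t:{a..b}" "c < plen ga (?m u t) n" by auto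
 have "plen ga (?m u t) n <= clen ga (lo t) (hi t)"
 using u(1) lh(3)[OF u(2)] by (intro plen_le_clen) (auto simp: mono_def image_subset_iff max.coboundedI2 min.coboundedI2)
 thus "t:{t:{a..b}. clen ga (lo t) (hi t) > c}" using u by auto
 qed
 moreover have "openin (top_of_set {a..b}) (UN u:?T. UN n. ?S u n)"
 by (rule openin_Union, elim imageE, simp only:, rule openin_Union, elim imageE, simp only: op)
 ultimately show ?thesis by simp
qed

text \<open>Lower semicontinuity suffices, by connectedness: if the value \<open>s\<close> were
  omitted, the parameters with initial length above \<open>s\<close> and those with remaining length
  above the total minus \<open>s\<close> would form two disjoint, relatively open sets that cover
  the interval.\<close>

lemma clen_IVT:
 assumes c:"is_curve (ga, a, b)" and s:"0 <= s" "en s <= clen ga a b"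
 shows "EX t:{a..b}. clen ga a t = en s"
proof (rule ccontr)
 assume none:"~ ?thesis"
 have ab:"a <= b" "continuous_on {a..b} ga" "clen ga a b < oo" using c by (auto simp: is_curve_def)
 let ?r = "clen ga a b - en s"
 let ?A = "{t:{a..b}. clen ga a t > en s}" and ?B = "{t:{a..b}. clen ga t b > ?r}"
 have *: "clen ga a t < en s \<longleftrightarrow> clen ga t b > ?r" if "t:{a..b}" for t
 proof -
 define x y where "x = clen ga a t" and "y = clen ga t b"
 have xy:"clen ga a b = x + y" using that clen_add[of a t b ga] by (auto simp: x_def y_def)
 hence "x < oo" "y < oo" using ab by (auto simp: ennreal_add_eq_top less_top)
 then obtain x' y' where "x = en x'" "y = en y'" "x' >= 0" "y' >= 0"
 by (metis ennreal_cases infinity_ennreal_def less_irrefl)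
 thus ?thesis using s xy unfolding x_def[symmetric] y_def[symmetric]
 by (auto simp: ennreal_minus ennreal_less_iff simp flip: ennreal_plus)
 qed
 have "?A Int ?B = {}" using * by (auto dest: less_asym)
 moreover have "?A Un ?B = {a..b}" using none * by (auto simp: neq_iff) 
 moreover have "openin (top_of_set {a..b}) ?A"
 by (rule openin_clen[OF ab(2) continuous_on_const continuous_on_id]) simp
 moreover have "openin (top_of_set {a..b}) ?B"
 by (rule openin_clen[OF ab(2) continuous_on_id continuous_on_const]) simp
 moreover have "b:?A" using none s ab by (auto simp: order_le_less)
 moreover have "a:?B" using none s ab *[of a] by (force simp: order_le_less)
 ultimately show False using connected_Icc[of a b] unfolding connected_openin
 by (metis empty_iff subset_refl)
qed

lemma arclength_param:
 assumes c:"is_curve (ga, a, b)" and s:"0 <= s" "s <= enn2real (clen ga a b)"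
 obtains t where "t:{a..b}" "clen ga a t = en s" "arclength_param ga a b s = ga t"
proof -
 have "clen ga a b < oo" using c by (auto simp: is_curve_def)
 hence "en s <= clen ga a b"
 using s by (metis ennreal_enn2real ennreal_leI infinity_ennreal_def)
 from someI_ex[OF clen_IVT[OF c s(1) this, unfolded Bex_def]] show ?thesis
 by (intro that[of "SOME t. t:{a..b} & clen ga a t = en s"])
 (simp_all only: arclength_param_def)
qed

text \<open>A piece of zero length is constant, so the choice made in \<open>arclength_param\<close>
  is immaterial.\<close>

lemma curve_eq_if_length_eq:
 assumes "a <= t" "a <= t'" "clen ga a t = en s" "clen ga a t' = en s"
 shows "ga t = ga t'"
proof -
 have *: "ga t = ga t'" if "a <= t" "t <= t'" "clen ga a t = en s" "clen ga a t' = en s" for t t'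
 proof -
 have "en s + clen ga t t' = en s + 0"
 using clen_add[OF that(1,2), of ga] unfolding that(3,4) by simp
 hence "clen ga t t' = 0" unfolding ennreal_add_left_cancel by simp
 with dist_le_clen[of t t t' t' ga] that(2) have "en (dist (ga t) (ga t')) <= 0" by simp
 thus ?thesis by (simp add: ennreal_eq_0_iff)
 qed
 show ?thesis
 proof (cases "t <= t'")
 case True show ?thesis by (rule *[OF assms(1) True assms(3,4)])
 next
 case False
 hence "t' <= t" by simp
 from *[OF assms(2) this assms(4,3)] show ?thesis by (rule sym)
 qed
qed

text \<open>`(p, l)` is the arc-length parametrization of a nonconstant curve on `[0, l]`, extended to
 the real line by constants so that it is continuous everywhere.\<close>

definition cpar :: "(real => 'a::metric_space) => real => real => real => 'a" where
 "cpar ga a b s = arclength_param ga a b (max 0 (min s (enn2real (clen ga a b))))"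

definition pcurve :: "(real => 'a::metric_space) => real => bool" where
 "pcurve p l \<longleftrightarrow> (EX ga a b. is_curve (ga, a, b) & 0 < l &
 clen ga a b = en l & p = cpar ga a b)"

lemma cpar_eq:
 "0 <= s ==> s <= enn2real (clen ga a b) ==> cpar ga a b s = arclength_param ga a b s"
 by (simp add: cpar_def min_absorb1 max_absorb2)

lemma cpar:
 assumes c:"is_curve (ga, a, b)" and l:"clen ga a b = en l" and s:"0 <= s" "s <= l"
 obtains t where "t:{a..b}" "clen ga a t = en s" "cpar ga a b s = ga t"
proof -
 have "enn2real (clen ga a b) = l" using l s by simp
 thus ?thesis using arclength_param[OF c s(1)] cpar_eq[OF s(1)] s that by metis
qed

lemma pcurve_pos:"pcurve p l ==> 0 < l"
 by (auto simp: pcurve_def)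

lemma pcurve_lipschitz:
 assumes "pcurve p l" "0 <= s" "s <= s'" "s' <= l"
 shows "dist (p s) (p s') <= s' - s"
proof -
 obtain ga a b where g:"is_curve (ga, a, b)" "clen ga a b = en l" "p = cpar ga a b" "0 < l"
 using assms by (auto simp: pcurve_def)
 obtain t where t:"t:{a..b}" "clen ga a t = en s" "p s = ga t"
 using cpar[OF g(1,2), of s] g(3) assms by auto
 obtain t' where t':"t':{a..b}" "clen ga a t' = en s'" "p s' = ga t'"
 using cpar[OF g(1,2), of s'] g(3) assms by auto
 show ?thesis
 proof (cases "s = s'")
 case True
 hence "ga t = ga t'" using t(1,2) t'(1,2) by (intro curve_eq_if_length_eq[of a t t' ga s]) auto
 thus ?thesis using True t(3) t'(3) by simp
 next
 case False
 have "t <= t'"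
 proof (rule ccontr)
 assume "~ t <= t'"
 hence "en s' <= en s"
 unfolding t(2)[symmetric] t'(2)[symmetric] using t(1) t'(1) by (intro clen_mono) auto
 thus False using False assms by (auto simp: ennreal_le_iff)
 qed
 hence "en s' = en s + clen ga t t'"
 unfolding t(2)[symmetric] t'(2)[symmetric] using t(1) t'(1) by (intro clen_add) auto
 hence "clen ga t t' = en (s' - s)"
 using assms by (metis ennreal_add_diff_cancel_left ennreal_minus ennreal_neq_top)
 hence "en (dist (ga t) (ga t')) <= en (s' - s)"
 using dist_le_clen[of t t t' t' ga] `t \<le> t'` by auto
 thus ?thesis using t t' assms by (simp add: ennreal_le_iff)
 qed
qed

lemma pcurve_continuous:
 assumes "pcurve p l" shows "continuous_on UNIV p"
proof -
 let ?c = "%s. max 0 (min s l)"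
 have l:"0 < l" using assms by (rule pcurve_pos)
 have *: "dist (p s) (p s') <= dist s s'" if "s:{0..l}" "s':{0..l}" for s s'
 using pcurve_lipschitz[OF assms, of s s'] pcurve_lipschitz[OF assms, of s' s] that
 by (cases "s <= s'") (auto simp: dist_real_def dist_commute)
 have "continuous_on {0..l} p"
 unfolding continuous_on_iff using le_less_trans[OF *] by blast
 hence "continuous_on UNIV (%s. p (?c s))"
 by (rule continuous_on_compose2) (use l in "auto intro!: continuous_intros")
 moreover have "p (?c s) = p s" for s
 using assms l unfolding pcurve_def cpar_def by auto
 ultimately show ?thesis by simp
qed

lemma pcurve_of_curve:
 assumes "(ga, a, b):nonconstant_curves_in A"
 defines "l \<equiv> enn2real (clen ga a b)" and "p \<equiv> cpar ga a b"
 shows "pcurve p l" "p ` {0..l} <= A" "p 0 = ga a" "p l = ga b"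
 "curve_integral (ga, a, b) g = (\<integral>\<^sup>+s\<in>{0..l}. g (p s) \<partial>lebesgue)"
proof -
 have c:"is_curve (ga, a, b)" and nc:"~ ga constant_on {a..b}" and A:"ga ` {a..b} <= A"
 using assms(1) unfolding nonconstant_curves_in_def by blast+
 have ab:"a <= b" "clen ga a b < oo" using c by (auto simp: is_curve_def)
 have l:"clen ga a b = en l" using ab by (auto simp: l_def)
 have "l ~= 0"
 proof
 assume "l = 0"
 have "ga t = ga a" if "t:{a..b}" for t
 using dist_le_clen[of a a t b ga] that l `l = 0` by (auto simp: ennreal_eq_0_iff)
 thus False using nc unfolding constant_on_def by blast
 qed
 hence "0 < l" using enn2real_nonneg[of "clen ga a b"] unfolding l_def by linarith
 thus "pcurve p l" using c l by (auto simp: pcurve_def p_def)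
 show "p ` {0..l} <= A"
 proof safe
 fix s assume s:"s:{0..l}"
 then obtain t where "t:{a..b}" "p s = ga t"
 using cpar[OF c l, of s] unfolding p_def by auto
 thus "p s:A" using A by auto
 qed
 obtain t where "t:{a..b}" "clen ga a t = en 0" "p 0 = ga t"
 using cpar[OF c l, of 0] `0 < l` unfolding p_def by auto
 thus "p 0 = ga a" using curve_eq_if_length_eq[of a t a ga 0] by simp
 obtain t where "t:{a..b}" "clen ga a t = en l" "p l = ga t"
 using cpar[OF c l, of l] `0 < l` unfolding p_def by auto
 thus "p l = ga b" using curve_eq_if_length_eq[of a t b ga l] l ab by simp
 show "curve_integral (ga, a, b) g = (\<integral>\<^sup>+s\<in>{0..l}. g (p s) \<partial>lebesgue)"
 unfolding curve_integral_def prod.case l_def[symmetric]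
 by (intro nn_integral_cong) (auto simp: indicator_def p_def cpar_eq l_def)
qed

text \<open>Transfers inequalities for almost every curve to subarcs: a piece of an arc-length
  parametrised curve is again a curve, nonconstant because its length is positive, and its own
  arc-length parametrisation is the shifted \<open>p\<close>.\<close>

lemma pcurve_subcurve:
 assumes "pcurve p l" "0 <= s0" "s0 < s1" "s1 <= l"
 obtains ga a b where "(ga, a, b):nonconstant_curves_in (p ` {s0..s1})"
 "clen ga a b = en (s1 - s0)" "ga a = p s0" "ga b = p s1"
 "!!s. s:{0..s1 - s0} ==> arclength_param ga a b s = p (s0 + s)"
proof -
 obtain ga a b where g:"is_curve (ga, a, b)" "clen ga a b = en l" "p = cpar ga a b" "0 < l"
 using assms by (auto simp: pcurve_def)
 have gc:"continuous_on {a..b} ga" using g by (auto simp: is_curve_def)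
 obtain t0 where t0:"t0:{a..b}" "clen ga a t0 = en s0" "p s0 = ga t0"
 using cpar[OF g(1,2), of s0] g(3) assms by auto
 obtain t1 where t1:"t1:{a..b}" "clen ga a t1 = en s1" "p s1 = ga t1"
 using cpar[OF g(1,2), of s1] g(3) assms by auto
 have "t0 < t1"
 proof (rule ccontr)
 assume "~ t0 < t1"
 hence "en s1 <= en s0"
 unfolding t0(2)[symmetric] t1(2)[symmetric] using t0(1) t1(1) by (intro clen_mono) auto
 thus False using assms by (auto simp: ennreal_le_iff)
 qed
 hence "en s1 = en s0 + clen ga t0 t1"
 unfolding t0(2)[symmetric] t1(2)[symmetric] using t0(1) t1(1) by (intro clen_add) auto
 hence len:"clen ga t0 t1 = en (s1 - s0)"
 using assms by (metis ennreal_add_diff_cancel_left ennreal_minus ennreal_neq_top)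
 have c:"is_curve (ga, t0, t1)" using len gc t0 t1 `t0 < t1`
 by (auto simp: is_curve_def intro: continuous_on_subset)
 have eq:"ga t = p s" if "t:{t0..t1}" "clen ga t0 t = en (s - s0)" "s:{s0..s1}" for t s
 proof -
 have "clen ga a t = en s0 + en (s - s0)"
 using clen_add[of a t0 t ga] t0 that by auto
 also have "... = en s" using assms that by (simp flip: ennreal_plus)
 finally have 1:"clen ga a t = en s" .
 have "0 <= s" "s <= l" using assms that by auto
 then obtain t' where t':"t':{a..b}" "clen ga a t' = en s" "p s = ga t'"
 using cpar[OF g(1,2), of s] g(3) by auto
 show ?thesis using curve_eq_if_length_eq[of a t t' ga s] 1 t' t0 that by auto
 qed
 have im:"ga ` {t0..t1} <= p ` {s0..s1}"
 proof safe
 fix t assume t:"t:{t0..t1}"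
 define s where "s = s0 + enn2real (clen ga t0 t)"
 have le:"clen ga t0 t <= en (s1 - s0)" using clen_mono[of t0 t0 t t1 ga] t len by auto
 hence "clen ga t0 t < oo" using ennreal_less_top le_less_trans by fastforce
 hence 1:"clen ga t0 t = en (s - s0)" by (simp add: s_def)
 have "0 <= s - s0" unfolding s_def by simp
 moreover have "s - s0 <= s1 - s0" using le assms unfolding 1 by (simp add: ennreal_le_iff)
 ultimately have "s:{s0..s1}" by simp
 thus "ga t:p ` {s0..s1}" using eq[OF t 1] by auto
 qed
 have nc:"~ ga constant_on {t0..t1}"
 proof
 assume "ga constant_on {t0..t1}"
 then obtain y where y:"!!t. t:{t0..t1} ==> ga t = y" by (auto simp: constant_on_def)
 have "clen ga t0 t1 <= 0"
 proof (rule clen_le)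
 fix t :: "nat => real" and n assume "range t <= {t0..t1}"
 hence "ga (t i) = y" for i by (intro y) (auto simp: image_subset_iff)
 thus "plen ga t n <= 0" by (simp add: plen_def)
 qed
 thus False using len assms by (auto simp: ennreal_eq_0_iff)
 qed
 show ?thesis
 proof (rule that[of ga t0 t1])
 show "(ga, t0, t1):nonconstant_curves_in (p ` {s0..s1})"
 using c nc im by (auto simp: nonconstant_curves_in_def)
 fix s assume s:"s:{0..s1 - s0}"
 obtain t where "t:{t0..t1}" "clen ga t0 t = en s" "arclength_param ga t0 t1 s = ga t"
 using arclength_param[OF c, of s] s len by auto
 thus "arclength_param ga t0 t1 s = p (s0 + s)" using eq[of t "s0 + s"] s by auto
 qed (use t0 t1 len in auto)
qed

section \<open>Increments of real functions\<close>

abbreviation lint :: "real => real => (real => ennreal) => ennreal" where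
 "lint a b h \<equiv> (NL {a..b} (%s. h s))"

lemma lint_split:
 assumes [measurable]:"h:bB" and "a <= b" "b <= c"
 shows "lint a c h = lint a b h + lint b c h"
proof -
 have "lint a c h = (\<integral>\<^sup>+s. h s * ind {a..b} s + h s * ind {b<..c} s \<partial>lborel)"
 using assms by (intro nn_integral_cong) (auto simp: indicator_def)
 also have "... = lint a b h + (NL {b<..c} (%s. h s))"
 by (subst nn_integral_add) auto
 also have "(NL {b<..c} (%s. h s)) = lint b c h"
 by (rule nn_integral_cong_AE, rule eventually_mono[OF AE_lborel_singleton[of b]])
 (use assms in "auto simp: indicator_def")
 finally show ?thesis .
qed

lemma lint_mono:"(!!s. s:{a..b} ==> h s <= k s) ==> lint a b h <= lint a b k"
 by (intro nn_integral_mono) (auto simp: indicator_def)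

lemma lint_subinterval:"a <= a' ==> b' <= b ==> lint a' b' h <= lint a b h"
 by (intro nn_integral_mono) (auto simp: indicator_def)

text \<open>Increments are subadditive and \<open>lint\<close> is additive over adjacent intervals,
  so the Bolzano principle reduces the claim to short intervals around a single point.\<close>

lemma increment_local_global:
 fixes f :: "real => real"
 assumes ab:"a <= b" and h[measurable]:"h:bB"
 and local:"!!x. a <= x ==> x <= b ==>
 EX d>0. ALL s t. a <= s & s < t & t <= b & s <= x & x <= t & t - s < d --> ea (f t - f s) <= lint s t h"
 shows "ea (f b - f a) <= lint a b h"
proof -
 define P where "P s t \<longleftrightarrow> a <= s & t <= b --> ea (f t - f s) <= lint s t h" for s t
 have "P a b" using ab
 proof (induction rule: Bolzano)
 case (trans s t u)
 show ?case unfolding P_def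
 proof safe
 assume "a <= s" "u <= b"
 have "ea (f u - f s) <= ea (f t - f s) + ea (f u - f t)"
 by (simp flip: ennreal_plus)
 also have "... <= lint s t h + lint t u h"
 using trans `a \<le> s` `u \<le> b` unfolding P_def by (intro add_mono) auto
 also have "... = lint s u h" using trans by (intro lint_split[symmetric]) auto
 finally show "ea (f u - f s) <= lint s u h" .
 qed
 next
 case (local x)
 from assms(3)[OF this] obtain d where d:"d > 0" "!!s t. a <= s ==> s < t ==> t <= b ==> s <= x ==> x <= t
 ==> t - s < d ==> ea (f t - f s) <= lint s t h" by blast
 have "P s t" if "s <= x" "x <= t" "t - s < d" for s t
 using d(2)[of s t] that by (cases "s = t") (auto simp: P_def)
 thus ?case using d(1) by blast
 qed
 thus ?thesis by (simp add: P_def)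
qed

text \<open>Outer regularity lets one replace each `A j` by a slightly larger open set inside `O j`, and
 then the increments can be estimated on small intervals.\<close>

lemma increment_selection:
 fixes f :: "real => real" and h :: "real => ennreal" and hj :: "nat => real => ennreal"
 assumes ab:"a <= b" and [measurable]:"h:bB" "!!j. hj j:bB"
 "!!j. A j:sets borel"
 and O:"!!j. open (Op j)" "!!j. A j Int {a..b} <= Op j" and cov:"{a..b} <= (UN j. A j)"
 and fin:"!!j. (NL (Op j Int {a..b}) (%s. hj j s)) < oo"
 and incr:"!!j s t. a <= s ==> s < t ==> t <= b ==> {s..t} <= Op j ==> ea (f t - f s) <= lint s t (hj j)"
 and le:"!!j s. s:A j ==> s:{a..b} ==> hj j s <= h s"
 shows "ea (f b - f a) <= lint a b h"
proof (rule ennreal_le_epsilon)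
 fix e :: real assume e:"e > 0"
 \<comment> \<open>Every parameter is assigned to exactly one index.\<close>
 define D where "D j = disjointed A j Int {a..b}" for j
 have D_meas[measurable]:"D j:sets borel" for j
 unfolding D_def disjointed_def by measurable
 have DA:"D j <= A j Int {a..b}" for j unfolding D_def using disjointed_subset[of A j] by blast
 have DO:"D j <= Op j" "D j <= {a..b}" for j using DA[of j] O(2)[of j] by auto
 have Dcov:"(UN j. D j) = {a..b}" using cov unfolding D_def by (auto simp: UN_disjointed_eq[symmetric, of A])
 have "EX Q. open Q & D j <= Q & Q <= Op j &
 (\<integral>\<^sup>+s. hj j s * ind ((Q - D j) Int {a..b}) s \<partial>lborel) <= en (e / 2 ^ Suc j)" for j
 proof -
 \<comment> \<open>Outer regularity is applied to the finite measure with density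
   \<open>hj j\<close>, so that the enlarged set gains little integral and not just little
   length.\<close>
 define N where "N = density lborel (%s. hj j s * ind (Op j Int {a..b}) s)"
 have [measurable]:"Op j:sets borel" using O by auto
 have N:"emeasure N S = (\<integral>\<^sup>+s. hj j s * ind (Op j Int {a..b} Int S) s \<partial>lborel)" if "S:sets borel" for S
 unfolding N_def using that
 by (subst emeasure_density) (auto intro!: nn_integral_cong simp: indicator_def)
 have fN:"emeasure N (space N) ~= oo" using fin[of j] N[of UNIV] by (simp add: N_def)
 have sN:"sets N = sets borel" by (simp add: N_def)
 have fD:"emeasure N (D j) ~= oo" using emeasure_space[of N "D j"] fN by (auto simp: top_unique)
 hence "emeasure N (D j) < emeasure N (D j) + en (e / 2 ^ Suc j)"
 using e by (cases "emeasure N (D j)") (auto simp: ennreal_less_iff simp flip: ennreal_plus)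
 then obtain Q where Q:"open Q" "D j <= Q" "emeasure N Q < emeasure N (D j) + en (e / 2 ^ Suc j)"
 using outer_regular[OF sN fN, of "D j"] by (auto simp: INF_less_iff)
 have "emeasure N (Q Int Op j - D j) = emeasure N (Q Int Op j) - emeasure N (D j)"
 using Q O DO(1)[of j] fD sN by (intro emeasure_Diff) auto
 also have "... <= emeasure N Q - emeasure N (D j)"
 using Q(1) sN by (intro ennreal_minus_mono emeasure_mono) auto
 also have "... <= en (e / 2 ^ Suc j)"
 using Q(3) by (intro ennreal_minus_le_iff[THEN iffD2] conjI impI) (auto simp: less_imp_le)
 finally have "emeasure N (Q Int Op j - D j) <= en (e / 2 ^ Suc j)" .
 moreover have "emeasure N (Q Int Op j - D j) =
 (\<integral>\<^sup>+s. hj j s * ind ((Q Int Op j - D j) Int {a..b}) s \<partial>lborel)"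
 using Q(1) by (subst N) (auto intro!: nn_integral_cong simp: indicator_def)
 ultimately show ?thesis using Q(1,2) O(1)[of j] DO(1)[of j] by (intro exI[of _ "Q Int Op j"]) auto
 qed
 then obtain Q where Q:"!!j. open (Q j)" "!!j. D j <= Q j" "!!j. Q j <= Op j"
 "!!j. (\<integral>\<^sup>+s. hj j s * ind ((Q j - D j) Int {a..b}) s \<partial>lborel) <= en (e / 2 ^ Suc j)"
 by metis
 have [measurable]:"Q j:sets borel" for j using Q(1) by auto
 \<comment> \<open>For parameters in \<open>D j\<close> the function \<open>hj j\<close> is below
   \<open>h\<close>; on the excess \<open>Q j - D j\<close> the sum takes over. The excess
   integrates to at most \<open>e\<close> in total.\<close>
 define H where "H s = h s + (\<Sum>j. hj j s * ind ((Q j - D j) Int {a..b}) s)" for s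
 have [measurable]:"H:bB" unfolding H_def by measurable
 have "ea (f b - f a) <= lint a b H"
 proof (rule increment_local_global[OF ab])
 fix x assume x:"a <= x" "x <= b"
 hence "x:(UN j. D j)" unfolding Dcov by simp
 then obtain j where j:"x:D j" by blast
 then obtain d where d:"d > 0" "ball x d <= Q j" using Q(1,2) open_contains_ball by blast
 show "EX d>0. ALL s t. a <= s & s < t & t <= b & s <= x & x <= t & t - s < d --> ea (f t - f s) <= lint s t H"
 proof (intro exI[of _ d] conjI allI impI d(1); elim conjE)
 fix s t assume st:"a <= s" "s < t" "t <= b" "s <= x" "x <= t" "t - s < d"
 have sub:"{s..t} <= Q j" using d(2) st by (auto simp: dist_real_def subset_iff)
 have "ea (f t - f s) <= lint s t (hj j)" using st sub Q(3)[of j] by (intro incr) auto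
 also have "... <= lint s t H"
 proof (rule lint_mono)
 fix r assume r:"r:{s..t}"
 show "hj j r <= H r"
 proof (cases "r:D j")
 case True
 hence "hj j r <= h r" using DA[of j] by (intro le) auto
 thus ?thesis unfolding H_def by (rule order_trans) simp
 next
 case False
 hence "hj j r = hj j r * ind ((Q j - D j) Int {a..b}) r" using r sub st by auto
 also have "... <= (\<Sum>j. hj j r * ind ((Q j - D j) Int {a..b}) r)"
 using sum_le_suminf[of "%i. hj i r * ind ((Q i - D i) Int {a..b}) r" "{j}"]
 by (simp del: sum_mult_indicator)
 finally show ?thesis unfolding H_def by (rule order_trans) simp
 qed
 qed
 finally show "ea (f t - f s) <= lint s t H" .
 qed
 qed measurable
 also have "... <= lint a b h + (\<integral>\<^sup>+s. (\<Sum>j. hj j s * ind ((Q j - D j) Int {a..b}) s) \<partial>lborel)"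
 unfolding H_def by (subst nn_integral_add[symmetric]) (auto intro!: nn_integral_mono simp: indicator_def distrib_right)
 also have "(\<integral>\<^sup>+s. (\<Sum>j. hj j s * ind ((Q j - D j) Int {a..b}) s) \<partial>lborel) =
 (\<Sum>j. \<integral>\<^sup>+s. hj j s * ind ((Q j - D j) Int {a..b}) s \<partial>lborel)"
 by (intro nn_integral_suminf) measurable
 also have "... <= (\<Sum>j. en (e / 2 ^ Suc j))" using Q(4) by (intro suminf_le) auto
 also have "... = en e"
 proof -
 have "(%j. e * (1 / 2) ^ Suc j) sums (e * 1)" by (intro sums_mult power_half_series)
 hence "(%j. e / 2 ^ Suc j) sums e" by (simp add: field_simps power_divide)
 thus ?thesis using e by (subst suminf_ennreal2) (auto simp: sums_iff)
 qed
 finally show "ea (f b - f a) <= lint a b h + en e" by (simp add: add_left_mono)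
qed

text \<open>The engine of the product rules. On short intervals the continuous weights differ by
  less than \<open>de\<close> from their values at the end points, so locally they may be moved
  inside the integral. The accumulated error is \<open>de\<close> times the sum of the integrals of
  the \<open>h k\<close>.\<close>

lemma increment_weighted:
 fixes f :: "real => real" and c :: "nat => real => real" and h :: "nat => real => ennreal"
 assumes ab:"a <= b" and [measurable]:"!!k. h k:bB"
 and c:"!!k. k < n ==> continuous_on {a..b} (c k)" "!!k s. k < n ==> s:{a..b} ==> 0 <= c k s"
 and fin:"!!k. k < n ==> lint a b (h k) < oo"
 and incr:"!!s t. a <= s ==> s < t ==> t <= b ==>
 ea (f t - f s) <= (SUM k<n. en (max (c k s) (c k t)) * lint s t (h k))"
 shows "ea (f b - f a) <= lint a b (%s. SUM k<n. en (c k s) * h k s)"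
proof (rule ennreal_le_epsilon)
 fix e :: real assume e:"e > 0"
 define c' where "c' k s = c k (max a (min s b))" for k s
 have c'_cont:"continuous_on UNIV (c' k)" if "k < n" for k
 unfolding c'_def using ab
 by (intro continuous_on_compose2[OF c(1)[OF that]]) (auto intro!: continuous_intros)
 have c'_eq:"c' k s = c k s" if "s:{a..b}" for k s using that by (auto simp: c'_def)
 have [measurable]:"c' k:bB" if "k < n" for k
 using c'_cont[OF that] by (rule borel_measurable_continuous_onI)
 define K where "K = enn2real (SUM k<n. lint a b (h k))"
 have K:"(SUM k<n. lint a b (h k)) = en K" unfolding K_def using fin
 by (subst ennreal_enn2real) (auto simp: less_top)
 define de where "de = e / (K + 1)"
 have K0:"K >= 0" by (simp add: K_def)
 hence de:"de > 0" "de * K <= e" using e by (auto simp: de_def field_simps)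
 define H where "H s = (SUM k<n. (en (c' k s) + en de) * h k s)" for s
 have Hm[measurable]:"H:bB" unfolding H_def by measurable
 have "ea (f b - f a) <= lint a b H"
 proof (rule increment_local_global[OF ab Hm])
 fix x assume x:"a <= x" "x <= b"
 have "EX d>0. ALL s:{a..b}. dist s x < d --> dist (c k s) (c k x) < de / 2" if "k < n" for k
 using c(1)[OF that] x de(1) unfolding continuous_on_iff by (meson atLeastAtMost_iff half_gt_zero)
 then obtain d where d:"!!k. k < n ==> d k > 0"
 "!!k s. k < n ==> s:{a..b} ==> dist s x < d k ==> dist (c k s) (c k x) < de / 2" by metis
 define d0 where "d0 = Min (insert 1 (d ` {..<n}))"
 have d0:"d0 > 0" "!!k. k < n ==> d0 <= d k" using d(1) by (auto simp: d0_def)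
 show "EX d>0. ALL s t. a <= s & s < t & t <= b & s <= x & x <= t & t - s < d --> ea (f t - f s) <= lint s t H"
 proof (intro exI[of _ d0] conjI allI impI d0(1); elim conjE)
 fix s t assume st:"a <= s" "s < t" "t <= b" "s <= x" "x <= t" "t - s < d0"
 have "ea (f t - f s) <= (SUM k<n. en (max (c k s) (c k t)) * lint s t (h k))"
 using st by (intro incr)
 also have "... = lint s t (%r. SUM k<n. en (max (c k s) (c k t)) * h k r)"
 by (simp add: sum_distrib_right nn_integral_sum nn_integral_cmult mult.assoc)
 also have "... <= lint s t H"
 proof (rule lint_mono, unfold H_def, intro sum_mono mult_right_mono)
 fix r k assume r:"r:{s..t}" "k:{..<n}"
 have near:"dist (c k y) (c k x) < de / 2" if "y:{s..t}" for y
 using d(2)[of k y] d0(2)[of k] r st that by (auto simp: dist_real_def)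
 have "max (c k s) (c k t) <= c' k r + de"
 proof -
 have "abs (c k s - c k x) < de / 2" "abs (c k t - c k x) < de / 2" "abs (c k r - c k x) < de / 2" "c' k r = c k r"
 using near[of s] near[of t] near[of r] r st c'_eq[of r k] by (auto simp: dist_real_def)
 thus ?thesis by linarith
 qed
 moreover have "0 <= c' k r" using c'_eq[of r k] c(2)[of k r] r st by auto
 ultimately show "en (max (c k s) (c k t)) <= en (c' k r) + en de"
 using de by (simp flip: ennreal_plus add: ennreal_leI)
 qed auto
 finally show "ea (f t - f s) <= lint s t H" .
 qed
 qed
 also have "... = lint a b (%s. (SUM k<n. en (c' k s) * h k s)) + en de * (SUM k<n. lint a b (h k))"
 proof -
 have "lint a b H = (\<integral>\<^sup>+s. (SUM k<n. en (c' k s) * h k s) * ind {a..b} s +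
 (SUM k<n. en de * (h k s * ind {a..b} s)) \<partial>lborel)"
 unfolding H_def by (intro nn_integral_cong)
 (simp add: distrib_right sum.distrib sum_distrib_right mult.assoc)
 also have "... = lint a b (%s. (SUM k<n. en (c' k s) * h k s)) +
 (SUM k<n. en de * lint a b (h k))"
 by (subst nn_integral_add) (auto simp: nn_integral_sum nn_integral_cmult)
 finally show ?thesis by (simp add: sum_distrib_left)
 qed
 also have "lint a b (%s. (SUM k<n. en (c' k s) * h k s)) = lint a b (%s. (SUM k<n. en (c k s) * h k s))"
 by (intro nn_integral_cong) (auto simp: indicator_def c'_eq)
 also have "en de * (SUM k<n. lint a b (h k)) <= en e"
 unfolding K using de K0 by (simp flip: ennreal_mult add: ennreal_leI)
 finally show "ea (f b - f a) <= lint a b (%s. SUM k<n. en (c k s) * h k s) + en e"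
 by (simp add: add_left_mono)
qed

section \<open>Doubling metric measure spaces\<close>

locale doubling_space =
 fixes \<mu> :: "'a::complete_space set => ennreal" and Cd :: real
 assumes br:"borel_regular_outer_measure \<mu>" and Cd:"1 <= Cd"
 and doubling:"r > 0 ==> \<mu> (ball x (2 * r)) <= en Cd * \<mu> (ball x r)"
 and ball_pos':"r > 0 ==> 0 < \<mu> (ball x (2 * r))"
 and ball_fin:"r > 0 ==> \<mu> (ball x r) < oo"
begin

abbreviation "M \<equiv> outer_meas \<mu>"

abbreviation "lion \<equiv> locally_integrable_on \<mu>"
abbreviation "mi E x r \<equiv> \<mu> (ball x r \<inter> E)"
abbreviation "cap \<equiv> Cap1 \<mu>"
abbreviation "eM \<equiv> emeasure M"
abbreviation almost_everywhere_M (binder "AM " 10) where "almost_everywhere_M P \<equiv> almost_everywhere M P"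
abbreviation "mb x r \<equiv> \<mu> (ball x r)"
abbreviation "bM \<equiv> borel_measurable M"
abbreviation "HC \<equiv> hausdorff_content \<mu>"
abbreviation "ul \<equiv> upper_approx_limit \<mu>"
abbreviation "ll \<equiv> lower_approx_limit \<mu>"
abbreviation nn_integral_M (binder "NN " 10) where "nn_integral_M f \<equiv> integral\<^sup>N M f"
abbreviation "NI A f \<equiv> \<integral>\<^sup>+x\<in>A. f x \<partial>M"

lemma outer:"outer_measure_space (Pow UNIV) \<mu>"
 using br by (simp add: borel_regular_outer_measure_def)

lemma borel_M:"sets borel <= sets M"
 using br sets_outer_meas[OF outer] by (simp add: borel_regular_outer_measure_def)

lemma borel_M'[measurable (raw)]:"A:sets borel ==> A:sets M"
 using borel_M by blast

lemma emeasure_M:"A:sets M ==> eM A = \<mu> A"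
 using emeasure_outer_meas[OF outer] sets_outer_meas[OF outer] by auto

lemma borel_measurable_M[measurable (raw)]:"f:bB ==> f:measurable M N'"
 if "sets N' = sets borel" for f :: "'a => 'b::topological_space"
 using that borel_M by (auto simp: measurable_def dest: sets_eq_imp_space_eq)

lemma ball_pos:"r > 0 ==> 0 < mb x r"
 using ball_pos'[of "r / 2" x] by simp

lemma emeasure_ball:"eM (ball x r) = mb x r"
 by (rule emeasure_M) auto

lemma mu_mono:"A <= B ==> \<mu> A <= \<mu> B"
 using outer by (auto simp: outer_measure_space_def increasing_def)

lemma mu_empty [simp]:"\<mu> {} = 0"
 using outer by (auto simp: outer_measure_space_def positive_def)

lemma bounded_fin:"bounded A ==> \<mu> A < oo"
proof -
 assume "bounded A"
 then obtain x r where "A <= cball x r" unfolding bounded_subset_cball by auto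
 hence "A <= ball x (max 1 (r + 1))" by (auto simp: subset_iff)
 hence "\<mu> A <= mb x (max 1 (r + 1))" by (rule mu_mono)
 thus ?thesis using ball_fin[of "max 1 (r + 1)" x] by (simp add: le_less_trans)
qed

lemma sigma_finite:"sigma_finite_measure M"
proof
 show "EX A. countable A & A <= sets M & \<Union> A = space M & (ALL a:A. eM a ~= oo)"
 proof (intro exI[of _ "range (%n::nat. ball ctr n)"] conjI)
 show "\<Union> (range (%n::nat. ball ctr n)) = space M"
 using reals_Archimedean2 by (auto simp: dist_commute)
 have "mb ctr (real n) ~= oo" for n
 using bounded_fin[of "ball ctr (real n)"] by auto
 thus "ALL a:range (%n::nat. ball ctr n). eM a ~= oo"
 by (auto simp: emeasure_ball)
 qed auto
qed

sublocale sigma_finite_measure M by (rule sigma_finite)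

lemma doubling_pow:
 assumes "r > 0" shows "mb x (2 ^ n * r) <= en (Cd ^ n) * mb x r"
proof (induction n)
 case (Suc n)
 have "mb x (2 ^ Suc n * r) <= en Cd * mb x (2 ^ n * r)"
 using doubling[of "2 ^ n * r" x] assms by (simp add: mult.assoc)
 also have "... <= en Cd * (en (Cd ^ n) * mb x r)" by (intro mult_left_mono Suc) auto
 finally show ?case using Cd by (simp add: ennreal_mult mult.assoc)
qed simp

text \<open>Comparison constant for balls whose radii have ratio at most \<open>K\<close>, used
  through \<open>ball_cmp\<close>.\<close>

definition cmp :: "real => real" where "cmp K = Cd ^ (LEAST n. K <= 2 ^ n)"

lemma cmp_ge_1:"1 <= cmp K"
 using Cd by (simp add: cmp_def)

lemma ball_cmp:
 fixes x :: 'a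
 assumes "r > 0" "R <= K * r" "ball y R' <= ball x R" shows "mb y R' <= en (cmp K) * mb x r"
proof -
 obtain n where "K < 2 ^ n" using real_arch_pow[of 2 K] by auto
 hence "K <= 2 ^ (LEAST n. K <= 2 ^ n)" by (intro LeastI[of "%n. K <= 2 ^ n" n]) simp
 hence "K * r <= 2 ^ (LEAST n. K <= 2 ^ n) * r" using assms by (intro mult_right_mono) auto
 hence "ball y R' <= ball x (2 ^ (LEAST n. K <= 2 ^ n) * r)"
 using assms(2,3) by (auto simp: subset_iff)
 thus ?thesis using mu_mono doubling_pow[OF assms(1), of x] unfolding cmp_def
 by (blast intro: order_trans)
qed

definition sepN :: "real => nat" where "sepN K = nat \<lceil>cmp (4 * (K + 1))\<rceil>"

text \<open>Volume counting: the balls of radius \<open>rh / 2\<close> around the points are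
  disjoint, lie in \<open>ball z ((K + 1) * rh)\<close> and each have at least a fixed fraction of
  its measure. The ratio \<open>4 * (K + 1)\<close> compares \<open>rh / 2\<close> with the radius
  \<open>2 * (K + 1) * rh\<close> of a ball around \<open>y\<close> that contains that ball.\<close>

lemma separated_card:
 fixes z :: 'a
 assumes rho:"rh > 0" and K:"K >= 0" and S:"S <= ball z (K * rh)"
 and sep:"!!x y. x:S ==> y:S ==> x ~= y ==> rh <= dist x y"
 shows "finite S" "card S <= sepN K"
proof -
 let ?Z = "ball z ((K + 1) * rh)"
 have "(K + 1) * rh > 0" using rho K by simp
 hence Zfin:"\<mu> ?Z < oo" "\<mu> ?Z > 0" by (rule ball_fin, rule ball_pos)
 have fin_card:"card T <= sepN K" if T:"finite T" "T <= S" for T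
 proof -
 have "en (real (card T)) * \<mu> ?Z = (SUM y:T. \<mu> ?Z)" by (simp add: ennreal_of_nat_eq_real_of_nat)
 also have "... <= (SUM y:T. en (cmp (4 * (K + 1))) * mb y (rh / 2))"
 proof (intro sum_mono ball_cmp)
 fix y assume "y:T"
 hence "dist z y < K * rh" using S T by auto
 thus "ball z ((K + 1) * rh) <= ball y (2 * (K + 1) * rh)"
 proof (intro subsetI)
 fix w assume "w:ball z ((K + 1) * rh)"
 hence "dist y w < K * rh + (K + 1) * rh"
 using `dist z y < K * rh` dist_triangle[of y w z] by (simp add: dist_commute)
 also have "... <= 2 * (K + 1) * rh" using rho by (simp add: algebra_simps)
 finally show "w:ball y (2 * (K + 1) * rh)" by simp
 qed
 qed (use rho in auto)
 also have "... = en (cmp (4 * (K + 1))) * (SUM y:T. eM (ball y (rh / 2)))"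
 by (simp add: sum_distrib_left emeasure_ball)
 also have "(SUM y:T. eM (ball y (rh / 2))) = eM (UN y:T. ball y (rh / 2))"
 proof (rule sum_emeasure)
 show "disjoint_family_on (%y. ball y (rh / 2)) T"
 unfolding disjoint_family_on_def
 proof (intro ballI impI)
 fix x y assume "x:T" "y:T" "x ~= y"
 hence "rh <= dist x y" using T sep by auto
 show "ball x (rh / 2) Int ball y (rh / 2) = {}"
 proof (rule equals0I)
 fix w assume "w:ball x (rh / 2) Int ball y (rh / 2)"
 hence "dist x y < rh" by (intro dist_triangle_half_l[of x w rh y]) auto
 thus False using `rh \<le> dist x y` by simp
 qed
 qed
 qed (use T in auto)
 also have "... <= eM ?Z"
 proof (intro emeasure_mono UN_least)
 fix y assume "y:T"
 hence "dist z y < K * rh" using S T by auto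
 thus "ball y (rh / 2) <= ?Z"
 proof (intro subsetI)
 fix w assume "w:ball y (rh / 2)"
 hence "dist z w < K * rh + rh / 2"
 using `dist z y < K * rh` dist_triangle[of z w y] by simp
 also have "... <= (K + 1) * rh" using rho by (simp add: algebra_simps)
 finally show "w:?Z" by simp
 qed
 qed auto
 finally have le:"en (real (card T)) * \<mu> ?Z <= en (cmp (4 * (K + 1))) * \<mu> ?Z"
 by (simp add: emeasure_ball mult_left_mono)
 have "en (real (card T)) <= en (cmp (4 * (K + 1)))"
 proof (rule ennreal_mult_le_mult_iff[THEN iffD1])
 show "\<mu> ?Z * en (real (card T)) <= \<mu> ?Z * en (cmp (4 * (K + 1)))"
 using le by (simp only: mult.commute)
 qed (use Zfin in auto)
 hence "real (card T) <= cmp (4 * (K + 1))"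
 using cmp_ge_1[of "4 * (K + 1)"] by (subst (asm) ennreal_le_iff) linarith+
 thus ?thesis unfolding sepN_def by linarith
 qed
 show "finite S"
 proof (rule ccontr)
 assume "infinite S"
 then obtain T where "T <= S" "finite T" "card T = Suc (sepN K)"
 using infinite_arbitrarily_large by blast
 thus False using fin_card[of T] by simp
 qed
 thus "card S <= sepN K" by (rule fin_card) simp
qed

text \<open>The bound on separated sets provides a separated set of greatest cardinality, and such a
  set is a net.\<close>

lemma finite_net:
 fixes S :: "'a set"
 assumes "bounded S" "rh > 0"
 obtains Y where "finite Y" "Y <= S" "S <= (UN y:Y. ball y rh)"
 "!!x y. x:Y ==> y:Y ==> x ~= y ==> rh <= dist x y"
proof -
 obtain z R where R:"S <= cball z R" using assms(1) unfolding bounded_subset_cball by auto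
 define K where "K = (abs R + 1) / rh"
 have K:"K >= 0" "S <= ball z (K * rh)" using R assms(2) by (auto simp: K_def subset_iff)
 define P where "P Y \<longleftrightarrow> Y <= S & (ALL x:Y. ALL y:Y. x ~= y --> rh <= dist x y)" for Y
 have P:"finite Y & card Y <= sepN K" if "P Y" for Y
 using separated_card[OF assms(2) K(1), of Y z] K(2) that unfolding P_def by (meson order_trans)
 have "P {}" by (simp add: P_def)
 then obtain Y where Y:"P Y" "!!Y'. P Y' ==> card Y' <= card Y"
 using ex_has_greatest_nat[of P "{}" card "Suc (sepN K)"] P by (auto simp: less_Suc_eq_le)
 show ?thesis
 proof (rule that[of Y])
 show "S <= (UN y:Y. ball y rh)"
 proof (rule ccontr)
 assume "~ ?thesis"
 then obtain x where x:"x:S" "x ~: (UN y:Y. ball y rh)" by blast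
 hence x2:"!!y. y:Y ==> rh <= dist y x" by (auto simp: not_less)
 have "x ~: Y" using x2[of x] assms(2) by auto
 moreover have "P (insert x Y)" using Y(1) x(1) x2 unfolding P_def by (simp add: dist_commute)
 ultimately show False using Y(2)[of "insert x Y"] P[OF Y(1)] by simp
 qed
 qed (use Y P in "auto simp: P_def")
qed

lemma finite_net_ex:
 fixes S :: "'a set"
 assumes "bounded S" "rh > 0"
 shows "EX Y. finite Y & Y <= S & S <= (UN y:Y. ball y rh)"
proof -
 obtain Y where "finite Y" "Y <= S" "S <= (UN y:Y. ball y rh)"
 by (rule finite_net[OF assms])
 thus ?thesis by (intro exI conjI)
qed

text \<open>Properness of the space, from completeness and the finite nets given by
  doubling.\<close>

lemma compact_if:
 fixes S :: "'a set"
 assumes "closed S" "bounded S" shows "compact S"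
proof -
 have *: "EX k. finite k & S <= (UN x:k. ball x e)" if "e > 0" for e
 by (rule finite_net[OF assms(2) that]) blast
 thus ?thesis
 unfolding compact_eq_totally_bounded complete_eq_closed by (intro conjI allI impI assms(1) *)
qed

lemma compact_cball [simp]:"compact (cball (x::'a) r)"
 by (rule compact_if) auto

lemma countable_dense:
 obtains D :: "'a set" where "countable D" "!!x e. e > 0 ==> EX d:D. dist x d < e"
proof -
 have "ALL k. EX Y. finite Y &
 ball (ctr::'a) (real (fst k)) <= (UN y:Y. ball y (1 / real (Suc (snd k))))"
 proof
 fix k :: "nat \<times> nat"
 have "1 / real (Suc (snd k)) > 0" by simp
 from finite_net_ex[OF bounded_ball this, of "ctr::'a" "real (fst k)"]
 obtain Y where "finite Y" "ball (ctr::'a) (real (fst k)) <= (UN y:Y. ball y (1 / real (Suc (snd k))))"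
 by (elim exE conjE)
 thus "EX Y. finite Y & ball (ctr::'a) (real (fst k)) <= (UN y:Y. ball y (1 / real (Suc (snd k))))"
 by (intro exI conjI)
 qed
 from choice[OF this] obtain Y' :: "nat \<times> nat => 'a set" where Y':"ALL k. finite (Y' k) &
 ball ctr (real (fst k)) <= (UN y:Y' k. ball y (1 / real (Suc (snd k))))" ..
 define Y where "Y n m = Y' (n, m)" for n m
 have Y:"finite (Y n m)" "ball ctr (real n) <= (UN y:Y n m. ball y (rs m))" for n m
 using Y'[rule_format, of "(n, m)"] by (simp_all add: Y_def)
 show ?thesis
 proof (rule that[of "UN n m. Y n m"])
 show "countable (UN n m. Y n m)" using Y(1) by (intro countable_UN) (auto intro: countable_finite)
 fix x :: 'a and e :: real assume "e > 0"
 then obtain m where m:"rs m < e" using nat_approx_posE by blast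
 obtain n where "dist ctr x < real n" using reals_Archimedean2 by blast
 then obtain y where "y:Y n m" "dist y x < rs m" using Y(2)[of n m] by fastforce
 hence "dist x y < e" using m by (simp add: dist_commute)
 thus "EX d:(UN n m. Y n m). dist x d < e" using `y \<in> Y n m` by blast
 qed
qed

lemma countable_ball_basis:
 obtains B :: "nat => 'a set" where "!!n. EX x r. B n = ball x r & r > 0"
 "!!x e. e > 0 ==> EX n. x:B n & B n <= ball x e"
proof -
 obtain D :: "'a set" where D:"countable D" "!!x e. e > 0 ==> EX d:D. dist x d < e"
 using countable_dense by blast
 define I where "I = D \<times> (UNIV::nat set)"
 have I:"countable I" "I ~= {}" using D(1) D(2)[of 1 ctr] by (auto simp: I_def)
 define B where "B n = (case from_nat_into I n of (d, m) => ball d (rs m))" for n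
 show ?thesis
 proof (rule that[of B])
 show "EX x r. B n = ball x r & r > 0" for n
 by (cases "from_nat_into I n") (force simp: B_def)
 fix x :: 'a and e :: real assume "e > 0"
 then obtain m where m:"rs m < e / 2" using nat_approx_posE[of "e / 2"] by auto
 obtain d where d:"d:D" "dist x d < rs m" using D(2)[of "rs m" x] by auto
 hence "(d, m):I" by (auto simp: I_def)
 then obtain n where n:"from_nat_into I n = (d, m)" using from_nat_into_surj[OF I(1)] by metis
 have "x:B n" using d n by (simp add: B_def dist_commute)
 moreover have "B n <= ball x e"
 proof
 fix w assume "w:B n"
 hence "dist d w < rs m" using n by (simp add: B_def)
 thus "w:ball x e" using dist_triangle[of x w d] d m by simp
 qed
 ultimately show "EX n. x:B n & B n <= ball x e" by blast
 qed
qed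

lemma lindelof:
 fixes H :: "'a set"
 assumes "!!x. x:H ==> r x > 0"
 obtains C where "countable C" "C <= H" "H <= (UN x:C. ball x (r x))"
proof -
 obtain B :: "nat => 'a set" where B:"!!n. EX x r. B n = ball x r & r > 0"
 "!!x e. e > 0 ==> EX n. x:B n & B n <= ball x e" using countable_ball_basis by blast
 define J where "J = {n. EX x:H. B n <= ball x (r x)}"
 have "ALL n:J. EX x. x:H & B n <= ball x (r x)" by (auto simp: J_def)
 then obtain c where c:"!!n. n:J ==> c n:H & B n <= ball (c n) (r (c n))"
 by (metis bchoice)
 show ?thesis
 proof (rule that[of "c ` J"])
 show "H <= (UN x:c ` J. ball x (r x))"
 proof
 fix x assume x:"x:H"
 then obtain n where "x:B n" "B n <= ball x (r x)" using B(2)[OF assms] by blast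
 moreover from this have "n:J" using x by (auto simp: J_def)
 ultimately show "x:(UN x:c ` J. ball x (r x))" using c[of n] by blast
 qed
 qed (use c in auto)
qed

lemma lindelof_seq:
 fixes H :: "'a set"
 assumes "!!x. x:H ==> r x > 0"
 obtains B :: "nat => 'a set" where "!!j. open (B j)" "H <= (UN j. B j)" "!!j. B j = {} \<or> (EX x:H. B j = ball x (r x))"
proof -
 obtain C where C:"countable C" "C <= H" "H <= (UN x:C. ball x (r x))" using lindelof[of H r] assms by blast
 define B where "B j = (if from_nat_into C j:C then ball (from_nat_into C j) (r (from_nat_into C j)) else {})" for j
 have "(UN x:C. ball x (r x)) <= (UN j. B j)"
 proof
 fix x assume "x:(UN x:C. ball x (r x))"
 then obtain y where y:"y:C" "x:ball y (r y)" by blast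
 then obtain j where "from_nat_into C j = y" using from_nat_into_surj[OF C(1)] by metis
 hence "x:B j" using y by (simp add: B_def)
 thus "x:(UN j. B j)" by blast
 qed
 with C(3) have "H <= (UN j. B j)" by (rule order_trans)
 thus ?thesis by (rule that[of B, rotated]) (use C(2) in "auto simp: B_def")
qed

lemma borel_hull:
 assumes A:"A:sets M"
 obtains B where "B:sets borel" "A <= B" "eM (B - A) = 0"
proof -
 \<comment> \<open>Bounded pieces have finite measure, so a Borel hull of equal measure exceeds each
   of them by a null set only.\<close>
 define A' where "A' n = A Int ball ctr (real n)" for n
 have A'[measurable]:"A' n:sets M" for n unfolding A'_def using A by measurable
 have fin:"\<mu> (A' n) < oo" for n by (rule bounded_fin) (auto simp: A'_def)
 have "ALL n. EX B. B:sets borel & A' n <= B & \<mu> B = \<mu> (A' n)"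
 using br by (simp add: borel_regular_outer_measure_def Bex_def)
 then obtain B where B:"!!n. B n:sets borel" "!!n. A' n <= B n" "!!n. \<mu> (B n) = \<mu> (A' n)"
 by metis
 have "eM (B n - A' n) = 0" for n
 using B[of n] fin[of n] by (subst emeasure_Diff) (auto simp: emeasure_M)
 hence null:"(UN n. B n - A' n):null_sets M"
 using B(1) by (intro null_sets_UN) (auto simp: null_sets_def)
 have "x:(UN n. A' n)" if "x:A" for x
 using reals_Archimedean2[of "dist ctr x"] that by (auto simp: A'_def)
 hence sub:"A <= (UN n. B n)" using B(2) by blast
 show ?thesis
 proof (rule that[of "UN n. B n"])
 show "eM ((UN n. B n) - A) = 0"
 proof -
 have "eM ((UN n. B n) - A) <= eM (UN n. B n - A' n)"
 using null by (intro emeasure_mono) (auto simp: A'_def null_sets_def)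
 also have "... = 0" using null by (rule null_setsD1)
 finally show ?thesis by simp
 qed
 qed (use B(1) sub in auto)
qed

lemma null_borel_hull:
 assumes "eM A = 0" "A:sets M"
 obtains N where "N:sets borel" "A <= N" "eM N = 0"
proof -
 obtain N where N:"N:sets borel" "A <= N" "eM (N - A) = 0" using borel_hull[OF assms(2)] .
 have "eM ((N - A) Un A) = 0"
 using N assms by (intro null_setsD1 null_sets.Un) (auto simp: null_sets_def)
 moreover have "(N - A) Un A = N" using N by auto
 ultimately show ?thesis using N that by simp
qed

text \<open>Gradients are measurable only for the outer measure, while composition with a curve
  calls for Borel functions. Almost every curve ignores the null set on which the two versions
  differ (\<open>curve_ae_null\<close>).\<close>

lemma borel_version:
 assumes "f:bM"
 obtains g N where "g:bB" "N:sets borel" "eM N = 0"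
 "!!x. x ~: N ==> g x = (f x :: ennreal)"
proof -
 have "EX g N. g:bB & N:sets borel & eM N = 0 & (ALL x. x ~: N --> g x = f x)"
 using assms
 proof (induction rule: borel_measurable_induct)
 case (cong f g)
 thus ?case by simp
 next
 case (set A)
 obtain B where "B:sets borel" "A <= B" "eM (B - A) = 0" using borel_hull[OF set] .
 moreover have "B - A:sets M" using set calculation(1) by auto
 ultimately obtain N where "N:sets borel" "B - A <= N" "eM N = 0"
 using null_borel_hull by blast
 with `B \<in> sets borel` `A \<subseteq> B` show ?case
 by (intro exI[of _ "ind B"] exI[of _ N]) (auto simp: indicator_def)
 next
 case (mult u c)
 then obtain g N where "g:bB" "N:sets borel" "eM N = 0" "ALL x. x ~: N --> g x = u x"
 by blast
 thus ?case by (intro exI[of _ "%x. c * g x"] exI[of _ N]) auto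
 next
 case (add u v)
 then obtain g N g' N' where "g:bB" "N:sets borel" "eM N = 0" "ALL x. x ~: N --> g x = u x"
 "g':bB" "N':sets borel" "eM N' = 0" "ALL x. x ~: N' --> g' x = v x"
 by blast
 thus ?case
 by (intro exI[of _ "%x. g' x + g x"] exI[of _ "N Un N'"]) (auto intro!: emeasure_Un_null_set[THEN trans] simp: null_sets_def)
 next
 case (seq U)
 then obtain g N where gN:"!!i. g i:bB" "!!i. N i:sets borel" "!!i. eM (N i) = 0"
 "!!i x. x ~: N i ==> g i x = U i x" by metis
 have "(UN i. N i):null_sets M" using gN by (intro null_sets_UN) (auto simp: null_sets_def)
 moreover have "(%x. SUP i. g i x):bB" using gN(1) by measurable
 ultimately show ?case using gN(2,4)
 by (intro exI[of _ "%x. SUP i. g i x"] exI[of _ "UN i. N i"])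
 (auto simp: null_sets_def image_image)
 qed
 thus ?thesis using that by blast
qed

text \<open>Zorn's lemma for disjoint subfamilies \<open>T\<close> such that every ball meeting
  \<open>T\<close> meets a member of more than half its radius. If some ball missed a maximal
  \<open>T\<close>, one could add such a ball whose radius exceeds half the supremum of the radii of
  all such balls. Countability comes from choosing points of a countable dense set in the disjoint
  balls.\<close>

lemma vitali_5r:
 fixes c :: "'i => 'a"
 assumes r:"!!i. i:S ==> 0 < r i" "!!i. i:S ==> r i <= R"
 obtains T where "T <= S" "countable T" "disjoint_family_on (%i. ball (c i) (r i)) T"
 "!!i. i:S ==> EX j:T. ball (c i) (r i) <= ball (c j) (5 * r j)"
proof -
 let ?B = "%i. ball (c i) (r i)"
 define \<A> where "\<A> = {T. T <= S & (ALL i:T. ALL j:T. i ~= j --> ?B i Int ?B j = {}) &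
 (ALL s:S. (EX t:T. ?B s Int ?B t ~= {}) --> (EX t:T. ?B s Int ?B t ~= {} & r s < 2 * r t))}"
 have "EX T:\<A>. ALL X:\<A>. T <= X --> X = T"
 proof (rule subset_Zorn')
 fix C assume "subset.chain \<A> C"
 hence C:"C <= \<A>" "!!X Y. X:C ==> Y:C ==> X <= Y \<or> Y <= X"
 by (auto simp: subset.chain_def)
 show "\<Union>C:\<A>" unfolding \<A>_def
 proof (intro CollectI conjI ballI impI)
 show "\<Union>C <= S" using C(1) by (auto simp: \<A>_def)
 next
 fix i j assume ij:"i:\<Union>C" "j:\<Union>C" "i ~= j"
 then obtain X where "X:C" "i:X" "j:X" using C(2) by blast
 thus "?B i Int ?B j = {}" using C(1) ij(3) unfolding \<A>_def by blast
 next
 fix s assume "s:S" "EX t:\<Union>C. ?B s Int ?B t ~= {}"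
 thus "EX t:\<Union>C. ?B s Int ?B t ~= {} & r s < 2 * r t" using C(1) unfolding \<A>_def by blast
 qed
 qed
 then obtain T where T:"T:\<A>" "!!X. X:\<A> ==> T <= X ==> X = T" by blast
 have ne:"c s:?B s" if "s:S" for s using r that by simp
 have meets:"EX t:T. ?B s Int ?B t ~= {}" if "s:S" for s
 proof (rule ccontr)
 assume none:"~ ?thesis"
 define S' where "S' = {s:S. ALL t:T. ?B s Int ?B t = {}}"
 have S':"s:S'" "S' <= S" using that none by (auto simp: S'_def)
 have bdd:"bdd_above (r ` S')" using r(2) S'(2) by (auto intro!: bdd_aboveI[of _ R])
 have "0 < r s" using r that by simp
 also have "r s <= Sup (r ` S')" using bdd S'(1) by (auto intro: cSup_upper)
 finally have "Sup (r ` S') / 2 < Sup (r ` S')" by simp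
 then obtain s0 where s0:"s0:S'" "Sup (r ` S') / 2 < r s0"
 using less_cSup_iff[OF _ bdd] S'(1) by (metis (no_types, lifting) empty_iff imageE image_is_empty)
 have big:"r s' < 2 * r s0" if "s':S'" for s'
 using cSup_upper[OF _ bdd, of "r s'"] that s0(2) by force
 have "insert s0 T:\<A>" unfolding \<A>_def
 proof (intro CollectI conjI ballI impI)
 show "insert s0 T <= S" using T(1) s0(1) S'(2) by (auto simp: \<A>_def)
 next
 fix i j assume "i:insert s0 T" "j:insert s0 T" "i ~= j"
 thus "?B i Int ?B j = {}" using T(1) s0(1) unfolding \<A>_def S'_def by blast
 next
 fix s assume s:"s:S" "EX t:insert s0 T. ?B s Int ?B t ~= {}"
 show "EX t:insert s0 T. ?B s Int ?B t ~= {} & r s < 2 * r t"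
 proof (cases "s:S'")
 case True
 hence "?B s Int ?B s0 ~= {}" using s(2) unfolding S'_def by blast
 thus ?thesis using big[OF True] by blast
 next
 case False
 hence "EX t:T. ?B s Int ?B t ~= {}" using s(1) unfolding S'_def by blast
 thus ?thesis using T(1) s(1) unfolding \<A>_def by blast
 qed
 qed
 hence "s0:T" using T(2) by blast
 thus False using s0(1) ne[of s0] unfolding S'_def by blast
 qed
 have disj:"disjoint_family_on ?B T" using T(1) unfolding \<A>_def disjoint_family_on_def by blast
 obtain D :: "'a set" where D:"countable D" "!!x e. e > 0 ==> EX d:D. dist x d < e" using countable_dense by blast
 have TS:"T <= S" using T(1) by (auto simp: \<A>_def)
 have "ALL t:T. EX d. d:D & d:?B t"
 proof
 fix t assume "t:T"
 hence "r t > 0" using r(1) TS by blast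
 from D(2)[OF this, of "c t"] show "EX d. d:D & d:?B t" by auto
 qed
 then obtain d where d:"!!t. t:T ==> d t:D & d t:?B t" by (metis bchoice)
 have "inj_on d T"
 proof (rule inj_onI, rule ccontr)
 fix i j assume ij:"i:T" "j:T" "d i = d j" "i ~= j"
 hence "?B i Int ?B j = {}" using disj unfolding disjoint_family_on_def by blast
 thus False using d[OF ij(1)] d[OF ij(2)] ij(3) by (metis IntI empty_iff)
 qed
 hence "countable T" using D(1) d by (meson countable_image_inj_on countable_subset image_subsetI)
 show ?thesis
 proof (rule that[OF TS `countable T` disj])
 fix i assume i:"i:S"
 obtain t where t:"t:T" "?B i Int ?B t ~= {}" "r i < 2 * r t"
 using meets[OF i] T(1) i unfolding \<A>_def by blast
 then obtain z where z:"dist (c i) z < r i" "dist (c t) z < r t" by auto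
 have "?B i <= ball (c t) (5 * r t)"
 proof
 fix y assume "y:?B i"
 hence "dist (c i) y < r i" by simp
 thus "y:ball (c t) (5 * r t)"
 using z t(3) dist_triangle[of "c t" y z] dist_triangle[of z y "c i"] by (simp add: dist_commute)
 qed
 thus "EX j:T. ?B i <= ball (c j) (5 * r j)" using t(1) by blast
 qed
qed

text \<open>Finite unions of closed balls from a countable cover of \<open>Om\<close>; a compact
  subset is already covered by finitely many of the corresponding open balls.\<close>

lemma exhaustion:
 fixes Om :: "'a set"
 assumes "open Om"
 obtains K :: "nat => 'a set" where "!!n. compact (K n)" "!!n. K n <= Om" "!!n m. n <= m ==> K n <= K m"
 "!!L. compact L ==> L <= Om ==> EX n. L <= K n"
proof -
 have "ALL x:Om. EX r. r > 0 & cball x r <= Om" using assms open_contains_cball by blast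
 then obtain r where r:"!!x. x:Om ==> r x > 0 & cball x (r x) <= Om" by (metis bchoice)
 obtain C where C:"countable C" "C <= Om" "Om <= (UN x:C. ball x (r x))"
 using lindelof[of Om r] r by blast
 define K where "K n = (UN j:{j. j <= n & from_nat_into C j:C}. cball (from_nat_into C j) (r (from_nat_into C j)))" for n
 show ?thesis
 proof (rule that[of K])
 show "compact (K n)" for n unfolding K_def by (intro compact_UN) auto
 show "K n <= Om" for n using r C(2) unfolding K_def by (intro UN_least) blast
 show mono:"K n <= K m" if "n <= m" for n m unfolding K_def using that by (intro UN_mono) auto
 fix L assume L:"compact L" "L <= Om"
 then obtain F where F:"finite F" "F <= C" "L <= (UN x:F. ball x (r x))"
 using compactE_image[OF L(1), of C "%x. ball x (r x)"] C(3) by (metis open_ball order_trans)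
 have "ALL x:F. EX j. from_nat_into C j = x" using F(2) C(1) from_nat_into_surj by (metis subsetD)
 then obtain j where j:"!!x. x:F ==> from_nat_into C (j x) = x" by (metis bchoice)
 define n where "n = Max (insert 0 (j ` F))"
 have "ball x (r x) <= K n" if "x:F" for x
 proof -
 have "j x <= n" using F(1) that by (auto simp: n_def)
 hence "cball x (r x) <= K n" using j[OF that] that F(2) unfolding K_def by (intro UN_upper[of "j x", THEN order_trans[rotated]]) auto
 thus ?thesis using ball_subset_cball by blast
 qed
 thus "EX n. L <= K n" using F(3) by blast
 qed
qed

section \<open>Weak upper gradients along almost every curve\<close>

text \<open>Almost every curve in the sense of 1-modulus: \<open>rh\<close> is an integrable Borel
  weight whose line integral is infinite on every exceptional curve. Formulated for arc-length
  parametrisations, so that line integrals are integrals over \<open>[0, l]\<close>.\<close>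

definition curve_ae :: "((real => 'a) => real => bool) => bool" where
 "curve_ae Q \<longleftrightarrow> (EX rh:bB. (NN x. rh x) < oo &
 (ALL p l. pcurve p l --> lint 0 l (%s. rh (p s)) < oo --> Q p l))"

lemma pcurve_meas:"pcurve p l ==> G:bB ==> (%s. G (p s)):bB"
 for G :: "'a => ennreal"
 by (rule measurable_compose[OF borel_measurable_continuous_onI[OF pcurve_continuous]])

text \<open>A curve may leave \<open>A\<close>; the condition concerns those of its subarcs that
  stay inside. It is therefore inherited by subsets of \<open>A\<close>.\<close>

abbreviation "arcs p l A P \<equiv> ALL s t. 0 <= s --> s < t --> t <= (l::real) --> p ` {s..t} <= A --> P s t"
abbreviation "inc u G p s t \<equiv> ea (u (p t) - u (p s)) <= lint s t (%r. G (p r))"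
abbreviation "einc u G p s t \<equiv> e2ennreal (abs (u (p t) - u (p s))) <= lint s t (%r. G (p r))"
abbreviation "arc_ae A P \<equiv> curve_ae (%p l. arcs p l A (P p))"

lemma curve_aeI:
 assumes "rh:bB" "(NN x. rh x) < oo"
 "!!p l. pcurve p l ==> lint 0 l (%s. rh (p s)) < oo ==> Q p l"
 shows "curve_ae Q"
 using assms unfolding curve_ae_def by blast

lemma curve_ae_mono:
 assumes "curve_ae Q" "!!p l. pcurve p l ==> Q p l ==> Q' p l"
 shows "curve_ae Q'"
 using assms unfolding curve_ae_def by blast

lemma curve_ae_trivial:"(!!p l. pcurve p l ==> Q p l) ==> curve_ae Q"
 by (rule curve_aeI[of "%_. 0"]) auto

text \<open>Countable subadditivity of the modulus: the positive weights \<open>w n\<close> make the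
  sum of the \<open>w n * rh n\<close> integrable, and a finite line integral of the sum forces one
  for each term.\<close>

lemma curve_ae_all:
 fixes Q :: "nat => (real => 'a) => real => bool"
 assumes "!!n. curve_ae (Q n)"
 shows "curve_ae (%p l. ALL n. Q n p l)"
proof -
 obtain rh where rh[measurable]:"!!n. rh n:bB" and fin:"!!n. (NN x. rh n x) < oo"
 and Q:"!!n p l. pcurve p l ==> lint 0 l (%s. rh n (p s)) < oo ==> Q n p l"
 using assms unfolding curve_ae_def by metis
 define w where "w n = en ((1 / 2) ^ Suc n / (1 + enn2real (NN x. rh n x)))" for n
 have w_pos:"w n > 0" for n unfolding w_def
 by (simp add: add_pos_nonneg)
 have w_le:"w n * (NN x. rh n x) <= en ((1 / 2) ^ Suc n)" for n
 proof -
 define c where "c = enn2real (NN x. rh n x)"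
 have c:"(NN x. rh n x) = en c" "c >= 0" using fin[of n] by (auto simp: c_def)
 have "c / (1 + c) <= 1" using c(2) by simp
 hence "(1 / 2) ^ Suc n * (c / (1 + c)) <= (1 / 2) ^ Suc n * 1" by (intro mult_left_mono) auto
 hence "(1 / 2) ^ Suc n / (1 + c) * c <= (1 / 2) ^ Suc n" by simp
 thus ?thesis using c unfolding w_def by (simp flip: ennreal_mult add: ennreal_leI)
 qed
 show ?thesis
 proof (rule curve_aeI[of "%x. \<Sum>n. w n * rh n x"])
 have "(NN x. (\<Sum>n. w n * rh n x)) = (\<Sum>n. w n * (NN x. rh n x))"
 by (subst nn_integral_suminf) (auto simp: nn_integral_cmult)
 also have "... <= (\<Sum>n. en ((1 / 2) ^ Suc n))" using w_le by (intro suminf_le) auto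
 also have "... = en 1" using power_half_series by (subst suminf_ennreal2) (auto simp: sums_iff)
 finally show "(NN x. (\<Sum>n. w n * rh n x)) < oo" by (rule le_less_trans) simp
 fix p l assume p:"pcurve p l" "lint 0 l (%s. \<Sum>n. w n * rh n (p s)) < oo"
 show "ALL n. Q n p l"
 proof
 fix n
 have [measurable]:"(%s. rh n (p s)):bB" by (rule pcurve_meas[OF p(1) rh])
 have "w n * lint 0 l (%s. rh n (p s)) = lint 0 l (%s. w n * rh n (p s))"
 by (simp add: nn_integral_cmult mult.assoc)
 also have "... <= lint 0 l (%s. \<Sum>n. w n * rh n (p s))"
 proof (rule lint_mono)
 fix s
 show "w n * rh n (p s) <= (\<Sum>n. w n * rh n (p s))"
 using sum_le_suminf[of "%n. w n * rh n (p s)" "{n}"] by simp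
 qed
 also have "... < oo" by (rule p(2))
 finally have "lint 0 l (%s. rh n (p s)) < oo"
 using w_pos[of n] by (auto simp: ennreal_mult_less_top)
 thus "Q n p l" by (rule Q[OF p(1)])
 qed
 qed measurable
qed

lemma curve_ae_conj:
 assumes "curve_ae Q" "curve_ae Q'" shows "curve_ae (%p l. Q p l & Q' p l)"
proof -
 have "curve_ae (%p l. ALL n::nat. (if n = 0 then Q else Q') p l)"
 by (rule curve_ae_all) (use assms in auto)
 thus ?thesis by (rule curve_ae_mono) (metis one_neq_zero)
qed

lemma curve_ae_int:
 assumes "G:bB" "(NN x. G x) < oo"
 shows "curve_ae (%p l. lint 0 l (%s. G (p s)) < oo)"
 by (rule curve_aeI[OF assms])

text \<open>The weight that is infinite on \<open>N\<close> and zero elsewhere has integral zero,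
  but an infinite line integral along any curve that spends positive length in
  \<open>N\<close>.\<close>

lemma curve_ae_null:
 assumes N:"N:sets borel" "eM N = 0"
 shows "curve_ae (%p l. AE s in lborel. s:{0..l} --> p s ~: N)"
proof (rule curve_aeI[of "%x. top * ind N x"])
 have [measurable]:"N:sets borel" by (rule N(1))
 show m:"(%x. top * ind N x :: ennreal):bB" by measurable
 have "(NN x. top * ind N x) = 0" using N by (subst nn_integral_cmult_indicator) auto
 thus "(NN x. top * ind N x) < oo" by (metis ennreal_zero_less_top infinity_ennreal_def)
 fix p l assume p:"pcurve p l" "lint 0 l (%s. top * ind N (p s)) < oo"
 have [measurable]:"(%s. top * ind N (p s) :: ennreal):bB"
 by (rule pcurve_meas[OF p(1) m])
 have "AE s in lborel. top * ind N (p s) * ind {0..l} s ~= (oo::ennreal)"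
 using p(2) by (intro nn_integral_PInf_AE) auto
 thus "AE s in lborel. s:{0..l} --> p s ~: N"
 by eventually_elim (auto simp: indicator_def ennreal_mult_eq_top_iff split: if_splits)
qed

definition ecwug :: "'a set => ('a => ereal) => ('a => ennreal) => bool" where
 "ecwug A u G \<longleftrightarrow> G:bB &
 arc_ae A (einc u G)"

definition cwug :: "'a set => ('a => real) => ('a => ennreal) => bool" where
 "cwug A u G \<longleftrightarrow> G:bB &
 arc_ae A (inc u G)"

lemma e2ennreal_abs_diff:"e2ennreal (abs (ereal a - ereal b)) = ea (a - b)"
 using e2ennreal_enn2ereal[of "ea (a - b)"] by (simp add: enn2ereal_ennreal)

lemma cwug_iff:"cwug A u G \<longleftrightarrow> ecwug A (%x. ereal (u x)) G"
 unfolding cwug_def ecwug_def e2ennreal_abs_diff ..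

lemma ecwug_borel:"ecwug A u G ==> G:bB"
 by (simp add: ecwug_def)

lemma cwug_borel:"cwug A u G ==> G:bB"
 by (simp add: cwug_def)

lemma ecwug_subset:"ecwug A u G ==> A' <= A ==> ecwug A' u G"
 unfolding ecwug_def by (elim conjE, intro conjI, assumption, erule curve_ae_mono) (meson order_trans)

lemma cwug_subset:"cwug A u G ==> A' <= A ==> cwug A' u G"
 unfolding cwug_iff by (rule ecwug_subset)

lemma ecwug_mono_AE:
 assumes u:"ecwug A u G" and G':"G':bB" and le:"AM x. x:A --> G x <= G' x"
 shows "ecwug A u G'"
proof -
 obtain N0 where N0:"N0:sets M" "eM N0 = 0" "{x. ~ (x:A --> G x <= G' x)} <= N0"
 using le by (auto elim!: AE_E simp: space_outer_meas)
 obtain N where N:"N:sets borel" "N0 <= N" "eM N = 0" using null_borel_hull[OF N0(2,1)] .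
 have "curve_ae (%p l. arcs p l A (einc u G p) & (AE s in lborel. s:{0..l} --> p s ~: N))"
 using u curve_ae_null[OF N(1,3)] unfolding ecwug_def by (intro curve_ae_conj) auto
 hence "arc_ae A (einc u G')"
 proof (rule curve_ae_mono, intro allI impI, elim conjE)
 fix p l s t assume p:"pcurve p l" and st:"0 <= s" "s < t" "t <= l" "p ` {s..t} <= A"
 and i:"arcs p l A (einc u G p)" and ae:"AE s in lborel. s:{0..l} --> p s ~: N"
 have "einc u G p s t" using i st by blast
 also have "... <= lint s t (%r. G' (p r))"
 proof (rule nn_integral_mono_AE)
 show "AE r in lborel. G (p r) * ind {s..t} r <= G' (p r) * ind {s..t} r"
 using ae
 proof eventually_elim
 case (elim r)
 show ?case
 proof (cases "r:{s..t}")
 case True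
 hence "p r ~: N" "p r:A" using elim st by auto
 hence "G (p r) <= G' (p r)" using N0(3) N(2) by blast
 thus ?thesis using True by simp
 qed simp
 qed
 qed
 finally show "einc u G' p s t" .
 qed
 thus ?thesis using G' by (simp add: ecwug_def)
qed

lemma cwug_mono_AE:
 "cwug A u G ==> G':bB ==> AM x. x:A --> G x <= G' x ==> cwug A u G'"
 unfolding cwug_iff by (rule ecwug_mono_AE)

lemma ni_lebesgue:"f:bB ==> (\<integral>\<^sup>+x. f x \<partial>lebesgue) = (\<integral>\<^sup>+x. f x \<partial>lborel)"
 by (simp add: nn_integral_completion)

lemma curve_integral_subcurve:
 fixes p :: "real => 'a"
 assumes p:"pcurve p l" "0 <= s" "s < t" "t <= l" and G:"G:bB"
 and c:"clen ga a b = en (t - s)"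
 "!!r. r:{0..t - s} ==> arclength_param ga a b r = p (s + r)"
 and g:"AE r in lborel. r:{s..t} --> g (p r) = G (p r)"
 shows "curve_integral (ga, a, b) g = lint s t (%r. G (p r))"
proof -
 have [measurable]:"(%r. G (p r)):bB" by (rule pcurve_meas[OF p(1) G])
 have l:"enn2real (clen ga a b) = t - s" using c(1) p by simp
 obtain N where N:"N:null_sets lborel" "{r. ~ (r:{s..t} --> g (p r) = G (p r))} <= N"
 using g by (auto elim!: AE_E simp: null_sets_def)
 have "AE r in distr lborel borel ((+) s). r ~: N"
 unfolding lborel_distr_plus using N(1) by (rule AE_not_in)
 hence "AE r in lborel. s + r ~: N"
 using N(1) by (subst (asm) AE_distr_iff) (auto simp: null_sets_def)
 hence "AE r in lborel. s + r:{s..t} --> g (p (s + r)) = G (p (s + r))"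
 by eventually_elim (use N(2) in blast)
 hence "AE r in lebesgue. s + r:{s..t} --> g (p (s + r)) = G (p (s + r))"
 by (rule AE_completion)
 hence "curve_integral (ga, a, b) g = (\<integral>\<^sup>+r. G (p (s + r)) * ind {s..t} (s + r) \<partial>lebesgue)"
 unfolding curve_integral_def prod.case l
 by (intro nn_integral_cong_AE) (auto simp: indicator_def c(2) elim!: eventually_mono)
 also have "... = (\<integral>\<^sup>+r. G (p (s + r)) * ind {s..t} (s + r) \<partial>lborel)"
 by (rule ni_lebesgue) measurable
 also have "... = lint s t (%r. G (p r))"
 using nn_integral_real_affine[of "%r. G (p r) * ind {s..t} r" 1 s] by simp
 finally show ?thesis .
qed

text \<open>The exceptional family in the definition consists of curves in \<open>A\<close>, whereas
  \<open>ecwug\<close> asks for the inequality on all subarcs. If the weight \<open>rh\<close> is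
  integrable along a curve, it is so along its subarcs, hence none of these is exceptional.\<close>

lemma wug_ecwug:
 assumes A:"A:sets M" and g:"weak_upper_gradient \<mu> A u g"
 obtains G where "ecwug A u G" "AM x. G x = g x * ind A x"
proof -
 have "(%x. g x * ind A x):bM"
 using g A by (subst borel_measurable_restrict_space_iff_ennreal[symmetric])
 (auto simp: weak_upper_gradient_def)
 then obtain G N where GN:"G:bB" "N:sets borel" "eM N = 0"
 "!!x. x ~: N ==> G x = g x * ind A x" using borel_version by blast
 obtain Ga rh where rh:"rh:bB" "(NN x. rh x) < oo" "!!c. c:Ga ==> curve_integral c rh = oo"
 and Ga:"!!c. c:nonconstant_curves_in A ==> c ~: Ga ==> ug_inequality u g c"
 using g unfolding weak_upper_gradient_def zero_1_modulus_def by blast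
 have "curve_ae (%p l. lint 0 l (%s. rh (p s)) < oo & (AE s in lborel. s:{0..l} --> p s ~: N))"
 by (intro curve_ae_conj curve_ae_int curve_ae_null rh GN)
 hence "arc_ae A (einc u G)"
 proof (rule curve_ae_mono, intro allI impI, elim conjE)
 fix p l s t assume p:"pcurve p l" and st:"0 <= s" "s < t" "t <= l" "p ` {s..t} <= A"
 and fin:"lint 0 l (%s. rh (p s)) < oo" and ae:"AE s in lborel. s:{0..l} --> p s ~: N"
 obtain ga a b where c:"(ga, a, b):nonconstant_curves_in (p ` {s..t})"
 "clen ga a b = en (t - s)" "ga a = p s" "ga b = p t"
 "!!r. r:{0..t - s} ==> arclength_param ga a b r = p (s + r)"
 using pcurve_subcurve[OF p st(1-3)] by blast
 have "curve_integral (ga, a, b) rh = lint s t (%r. rh (p r))"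
 by (rule curve_integral_subcurve[OF p st(1-3) rh(1) c(2,5)]) auto
 also have "... <= lint 0 l (%r. rh (p r))" using st by (intro lint_subinterval) auto
 also have "... < oo" by (rule fin)
 finally have "(ga, a, b) ~: Ga" using rh(3) by auto
 moreover have "(ga, a, b):nonconstant_curves_in A"
 using c(1) st(4) unfolding nonconstant_curves_in_def by blast
 ultimately have "ug_inequality u g (ga, a, b)" by (intro Ga)
 hence "e2ennreal (abs (u (p s) - u (p t))) <= curve_integral (ga, a, b) g"
 using c by (simp add: ug_inequality_def)
 also have "curve_integral (ga, a, b) g = lint s t (%r. G (p r))"
 proof (rule curve_integral_subcurve[OF p st(1-3) GN(1) c(2,5)])
 show "AE r in lborel. r:{s..t} --> g (p r) = G (p r)"
 using ae
 proof eventually_elim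
 case (elim r)
 show ?case
 proof
 assume r:"r:{s..t}"
 hence "p r ~: N" "p r:A" using elim st by auto
 thus "g (p r) = G (p r)" using GN(4) by simp
 qed
 qed
 qed
 also have "abs (u (p s) - u (p t)) = abs (u (p t) - u (p s))" by (cases "u (p s)"; cases "u (p t)") auto
 finally show "einc u G p s t" .
 qed
 hence "ecwug A u G" using GN(1) by (simp add: ecwug_def)
 moreover have "AM x. G x = g x * ind A x"
 using GN by (intro AE_I[of _ _ N]) auto
 ultimately show ?thesis using that by blast
qed

lemma ecwug_wug:
 assumes "ecwug A u G" shows "weak_upper_gradient \<mu> A u G"
proof -
 obtain rh where rh:"rh:bB" "(NN x. rh x) < oo"
 "!!p l s t. pcurve p l ==> lint 0 l (%s. rh (p s)) < oo ==> 0 <= s ==> s < t ==> t <= l ==> p ` {s..t} <= A ==>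
 einc u G p s t" and G[measurable]:"G:bB"
 using assms unfolding ecwug_def curve_ae_def by blast
 have int:"curve_integral c f = lint 0 (enn2real (clen (fst c) (fst (snd c)) (snd (snd c))))
 (%s. f (cpar (fst c) (fst (snd c)) (snd (snd c)) s))"
 if "c:nonconstant_curves_in UNIV" "f:bB" for c :: "'a curve" and f
 proof -
 obtain ga a b where c:"c = (ga, a, b)" by (cases c)
 note pc = pcurve_of_curve[OF that(1)[unfolded c]]
 have [measurable]:"(%s. f (cpar ga a b s)):bB"
 by (rule pcurve_meas[OF pc(1) that(2)])
 show ?thesis unfolding c pc(5) fst_conv snd_conv
 by (rule ni_lebesgue) measurable
 qed
 have sub:"c:nonconstant_curves_in A ==> c:nonconstant_curves_in UNIV" for c
 by (auto simp: nonconstant_curves_in_def)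
 show ?thesis unfolding weak_upper_gradient_def
 proof (intro conjI exI[of _ "{c:nonconstant_curves_in A. curve_integral c rh = oo}"] ballI)
 show "G:borel_measurable (restrict_space M A)"
 by (intro measurable_restrict_space1) measurable
 show "zero_1_modulus \<mu> {c:nonconstant_curves_in A. curve_integral c rh = oo}"
 using rh(1,2) unfolding zero_1_modulus_def by blast
 fix c assume c:"c:nonconstant_curves_in A - {c:nonconstant_curves_in A. curve_integral c rh = oo}"
 obtain ga a b where cc:"c = (ga, a, b)" by (cases c)
 hence nc:"(ga, a, b):nonconstant_curves_in A" using c by auto
 note pc = pcurve_of_curve[OF nc]
 define l where "l = enn2real (clen ga a b)"
 define p where "p = cpar ga a b"
 have "lint 0 l (%s. rh (p s)) = curve_integral c rh"
 using int[OF sub[OF nc] rh(1)] by (simp add: cc l_def p_def)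
 also have "... < oo" using c by (auto simp: less_top)
 finally have "einc u G p 0 l"
 using pc pcurve_pos[OF pc(1)] by (intro rh(3)) (auto simp: l_def p_def)
 moreover have "abs (u (p l) - u (p 0)) = abs (u (p 0) - u (p l))" by (cases "u (p l)"; cases "u (p 0)") auto
 ultimately show "ug_inequality u G c"
 using pc(3,4) int[OF sub[OF nc] G] by (simp add: ug_inequality_def cc l_def p_def)
 qed
qed

lemma abs_diff_finite:
 fixes a b :: ereal
 assumes "e2ennreal (abs (a - b)) < oo" shows "abs a ~= oo" "abs b ~= oo"
 using assms ereal_abs_diff_infinite[of a b] by auto

text \<open>Gradients that are valid on relatively open pieces may be combined by a pointwise
  choice, with \<open>A j\<close> the set on which the \<open>j\<close>-th one is chosen. Along a
  curve the pieces become open sets of parameters and \<open>increment_selection\<close>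
  applies.\<close>

lemma ecwug_select:
 fixes H :: "'a set" and u :: "'a => ereal" and A B :: "nat => 'a set"
 assumes H:"H:sets M" and A:"!!j. A j:sets borel" "!!j. A j Int H <= B j" "H <= (UN j. A j)"
 and B:"!!j. open (B j)"
 and u:"!!j. ecwug (H Int B j) u (Gj j)" "!!j. NI (H Int B j) (Gj j) < oo"
 and G:"G:bB" "!!j x. x:A j ==> x:H ==> Gj j x <= G x"
 shows "ecwug H u G"
proof -
 have "ALL j. EX A'. A':sets borel & H Int B j <= A' & eM (A' - H Int B j) = 0"
 proof
 fix j
 have "H Int B j:sets M" using H B by auto
 from borel_hull[OF this] show "EX A'. A':sets borel & H Int B j <= A' & eM (A' - H Int B j) = 0"
 by metis
 qed
 then obtain A' where A'[measurable]:"!!j. A' j:sets borel" and A'2:"!!j. H Int B j <= A' j"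
 "!!j. eM (A' j - H Int B j) = 0" by metis
 have [measurable]:"Gj j:bB" for j using u(1) by (rule ecwug_borel)
 \<comment> \<open>Cut off to a Borel hull of the piece, which adds a null set only, the gradient
   becomes integrable over the whole space and hence along almost every curve.\<close>
 define rh where "rh j x = Gj j x * ind (A' j) x" for j x
 have rh[measurable]:"rh j:bB" for j unfolding rh_def by measurable
 have rh_fin:"(NN x. rh j x) < oo" for j
 proof -
 have "A' j - H Int B j:null_sets M" using A'2(2) H B[of j] by (auto simp: null_sets_def)
 hence "(NN x. rh j x) = NI (H Int B j) (Gj j)"
 unfolding rh_def using A'2(1)[of j] by (intro nn_integral_cong_AE AE_I'[of "A' j - H Int B j"]) (auto simp: indicator_def)
 thus ?thesis using u(2) by simp
 qed
 have "curve_ae (%p l. ALL j. arcs p l (H Int B j) (einc u (Gj j) p) & lint 0 l (%s. rh j (p s)) < oo)"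
 using u(1) by (intro curve_ae_all curve_ae_conj curve_ae_int rh rh_fin) (auto simp: ecwug_def)
 hence "arc_ae H (einc u G)"
 proof (rule curve_ae_mono, intro allI impI)
 fix p l s t assume p:"pcurve p l" and st:"0 <= s" "s < t" "t <= l" "p ` {s..t} <= H"
 and i:"ALL j. arcs p l (H Int B j) (einc u (Gj j) p) & lint 0 l (%s. rh j (p s)) < oo"
 define Op where "Op j = p -` B j" for j
 have Op:"open (Op j)" for j unfolding Op_def by (rule open_vimage[OF B pcurve_continuous[OF p]])
 have [measurable]:"p:bB" by (rule borel_measurable_continuous_onI[OF pcurve_continuous[OF p]])
 have incr:"einc u (rh j) p a b" "e2ennreal (abs (u (p b) - u (p a))) < oo"
 if ab:"s <= a" "a < b" "b <= t" "{a..b} <= Op j" for a b j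
 proof -
 have sub:"p ` {a..b} <= H Int B j"
 proof
 fix y assume "y:p ` {a..b}"
 then obtain r where "r:{a..b}" "y = p r" by blast
 thus "y:H Int B j" using ab st(4) unfolding Op_def by auto
 qed
 have "einc u (Gj j) p a b"
 using i sub ab st by auto
 also have "... = lint a b (%r. rh j (p r))"
 proof (rule nn_integral_cong)
 fix r show "Gj j (p r) * ind {a..b} r = rh j (p r) * ind {a..b} r"
 using sub A'2(1)[of j] by (cases "r:{a..b}") (auto simp: rh_def image_subset_iff subset_iff)
 qed
 finally show *: "einc u (rh j) p a b" .
 also have "... <= lint 0 l (%r. rh j (p r))" using ab st by (intro lint_subinterval) auto
 also have "... < oo" using i by blast
 finally show "e2ennreal (abs (u (p b) - u (p a))) < oo" .
 qed
 \<comment> \<open>An infinite value would make every increment from this point infinite, but on a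
   short arc inside one \<open>Op j\<close> the increment is finite. The two cases take the arc to
   the right or, at the last parameter, to the left.\<close>
 have fin:"abs (u (p r)) ~= oo" if r:"r:{s..t}" for r
 proof -
 have "p r:H" using r st by auto
 then obtain j where j:"p r:A j" using A(3) by blast
 hence "r:Op j" using A(2)[of j] `p r \<in> H` unfolding Op_def by auto
 then obtain d where d:"d > 0" "cball r d <= Op j" using Op open_contains_cball by blast
 show ?thesis
 proof (cases "r < t")
 case True
 have "{r..min t (r + d)} <= Op j"
 by (rule order_trans[OF _ d(2)]) (auto simp: dist_real_def)
 from incr(2)[OF _ _ _ this] have "e2ennreal (abs (u (p (min t (r + d))) - u (p r))) < oo"
 using r True d(1) by auto
 thus ?thesis by (rule abs_diff_finite)
 next
 case False
 have "{max s (r - d)..r} <= Op j"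
 by (rule order_trans[OF _ d(2)]) (auto simp: dist_real_def)
 from incr(2)[OF _ _ _ this] have "e2ennreal (abs (u (p r) - u (p (max s (r - d))))) < oo"
 using r False d(1) st(2) by auto
 thus ?thesis by (rule abs_diff_finite)
 qed
 qed
 define f where "f r = real_of_ereal (u (p r))" for r
 have f:"e2ennreal (abs (u (p b) - u (p a))) = ea (f b - f a)" if "a:{s..t}" "b:{s..t}" for a b
 using fin[OF that(1)] fin[OF that(2)] e2ennreal_abs_diff[of "f b" "f a"] unfolding f_def
 by (simp add: ereal_real)
 have "ea (f t - f s) <= lint s t (%r. G (p r))"
 proof (rule increment_selection[where A = "%j. p -` A j" and Op = Op and hj = "%j r. rh j (p r)"])
 show "(%r. G (p r)):bB" by (rule pcurve_meas[OF p G(1)])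
 show "(%r. rh j (p r)):bB" for j by (rule pcurve_meas[OF p rh])
 show "p -` A j:sets borel" for j using A(1)[of j] measurable_sets[of p borel borel "A j"] by simp
 show "p -` A j Int {s..t} <= Op j" for j using A(2)[of j] st(4) unfolding Op_def by blast
 show "{s..t} <= (UN j. p -` A j)" using A(3) st(4) by blast
 show "(NL (Op j Int {s..t}) (%r. rh j (p r))) < oo" for j
 proof -
 have "(NL (Op j Int {s..t}) (%r. rh j (p r))) <= lint 0 l (%r. rh j (p r))"
 using st by (intro nn_integral_mono) (auto simp: indicator_def)
 also have "... < oo" using i by blast
 finally show ?thesis .
 qed
 show "ea (f b - f a) <= lint a b (%r. rh j (p r))"
 if "s <= a" "a < b" "b <= t" "{a..b} <= Op j" for j a b
 using incr(1)[OF that] f[of a b] that by simp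
 show "rh j (p r) <= G (p r)" if "r:p -` A j" "r:{s..t}" for j r
 proof -
 have "p r:H" using that st(4) by blast
 hence "Gj j (p r) <= G (p r)" using that by (intro G(2)) auto
 thus ?thesis by (auto simp: rh_def indicator_def)
 qed
 qed (use Op st in auto)
 thus "einc u G p s t" using f[of s t] st by simp
 qed
 thus ?thesis using G(1) by (simp add: ecwug_def)
qed

section \<open>Minimal weak upper gradients\<close>

lemma lion_cover:
 fixes H :: "'a set"
 assumes "lion H G"
 obtains B :: "nat => 'a set" where "!!j. open (B j)" "H <= (UN j. B j)" "!!j. NI (H Int B j) G < oo"
proof -
 obtain r where r:"!!x. x:H ==> r x > 0" "!!x. x:H ==> (NI (H Int ball x (r x)) G) < oo"
 using assms unfolding locally_integrable_on_def by metis
 obtain B :: "nat => 'a set" where B:"!!j. open (B j)" "H <= (UN j. B j)" "!!j. B j = {} \<or> (EX x:H. B j = ball x (r x))"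
 using lindelof_seq[of H r] r(1) by blast
 have "NI (H Int B j) G < oo" for j using B(3)[of j] r(2) by auto
 with B(1,2) show ?thesis by (rule that)
qed

lemma lion_mono_AE:
 fixes H :: "'a set"
 assumes "lion H G" "AM x. x:H --> G' x <= G x"
 shows "lion H G'"
 unfolding locally_integrable_on_def
proof
 fix x assume "x:H"
 then obtain r where r:"r > 0" "NI (H Int ball x r) G < oo"
 using assms(1) unfolding locally_integrable_on_def by blast
 have "NI (H Int ball x r) G' <= NI (H Int ball x r) G"
 by (rule nn_integral_mono_AE, rule eventually_mono[OF assms(2)]) (auto simp: indicator_def)
 thus "EX r>0. NI (H Int ball x r) G' < oo" using r by (auto intro: le_less_trans)
qed

text \<open>The infimum need not be attained, so each point selects some \<open>F n\<close> that
  exceeds it by at most a slack \<open>e\<close>. Along a curve the slack costs \<open>e\<close>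
  times the length, which tends to zero.\<close>

lemma ecwug_INF:
 fixes H :: "'a set" and F :: "nat => 'a => ennreal"
 assumes H:"H:sets M" and F:"!!n. ecwug H u (F n)" "!!n. lion H (F n)"
 shows "ecwug H u (%x. INF n. F n x)"
proof -
 let ?G = "%x. INF n. F n x"
 have [measurable]:"F n:bB" for n using F(1) by (rule ecwug_borel)
 have "ALL n. EX B :: nat => 'a set. (ALL j. open (B j)) & H <= (UN j. B j) & (ALL j. NI (H Int B j) (F n) < oo)"
 using lion_cover[OF F(2)] by metis
 then obtain B :: "nat => nat => 'a set" where B:"!!n j. open (B n j)" "!!n. H <= (UN j. B n j)"
 "!!n j. NI (H Int B n j) (F n) < oo" by metis
 have [measurable]:"B n j:sets borel" for n j using B(1) by simp
 have e:"ecwug H u (%x. ?G x + en e)" if "e > 0" for e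
 proof (rule ecwug_select[where B = "%k. case prod_decode k of (n, j) => B n j"
 and A = "%k. case prod_decode k of (n, j) => B n j Int {x. F n x <= ?G x + en e}"
 and Gj = "%k. case prod_decode k of (n, j) => F n"])
 fix k obtain n j where k:"prod_decode k = (n, j)" by (cases "prod_decode k")
 show "(case prod_decode k of (n, j) => B n j Int {x. F n x <= ?G x + en e}):sets borel"
 unfolding k prod.case by measurable
 show "(case prod_decode k of (n, j) => B n j Int {x. F n x <= ?G x + en e}) Int H <= (case prod_decode k of (n, j) => B n j)"
 unfolding k prod.case by blast
 show "open (case prod_decode k of (n, j) => B n j)" unfolding k prod.case by (rule B)
 show "ecwug (H Int (case prod_decode k of (n, j) => B n j)) u (case prod_decode k of (n, j) => F n)"
 unfolding k prod.case by (rule ecwug_subset[OF F(1)]) blast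
 show "NI (H Int (case prod_decode k of (n, j) => B n j)) (%x. (case prod_decode k of (n, j) => F n) x) < oo"
 unfolding k prod.case by (rule B)
 fix x assume "x:(case prod_decode k of (n, j) => B n j Int {x. F n x <= ?G x + en e})"
 thus "(case prod_decode k of (n, j) => F n) x <= ?G x + en e" unfolding k prod.case by blast
 next
 show "H <= (UN k. case prod_decode k of (n, j) => B n j Int {x. F n x <= ?G x + en e})"
 proof
 fix x assume x:"x:H"
 have "EX n. F n x <= ?G x + en e"
 proof (cases "?G x = top")
 case False
 hence "?G x < ?G x + en e" using that by (cases "?G x") (auto simp: ennreal_less_iff simp flip: ennreal_plus)
 thus ?thesis unfolding INF_less_iff by (auto intro: less_imp_le)
 qed simp
 then obtain n where n:"F n x <= ?G x + en e" by blast
 obtain j where "x:B n j" using B(2) x by blast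
 hence "x:(case prod_decode (prod_encode (n, j)) of (n, j) => B n j Int {x. F n x <= ?G x + en e})"
 using n by simp
 thus "x:(UN k. case prod_decode k of (n, j) => B n j Int {x. F n x <= ?G x + en e})"
 by (rule UN_I[OF UNIV_I])
 qed
 qed (use H in measurable)
 have "curve_ae (%p l. ALL n. arcs p l H (%s t. e2ennreal (abs (u (p t) - u (p s))) <= lint s t (%r. ?G (p r) + en (rs n))))"
 using e by (intro curve_ae_all) (auto simp: ecwug_def)
 hence "arc_ae H (einc u ?G)"
 proof (rule curve_ae_mono, intro allI impI)
 fix p l s t assume p:"pcurve p l" and st:"0 <= s" "s < t" "t <= l" "p ` {s..t} <= H"
 and i:"ALL n. arcs p l H (%s t. e2ennreal (abs (u (p t) - u (p s))) <= lint s t (%r. ?G (p r) + en (rs n)))"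
 have [measurable]:"(%r. ?G (p r)):bB" by (rule pcurve_meas[OF p]) measurable
 show "einc u ?G p s t"
 proof (rule ennreal_le_epsilon)
 fix e :: real assume "e > 0"
 then obtain n where n:"rs n < e / (t - s)" using nat_approx_posE[of "e / (t - s)"] st by auto
 have "e2ennreal (abs (u (p t) - u (p s))) <= lint s t (%r. ?G (p r) + en (rs n))"
 using i st by blast
 also have "... = lint s t (%r. ?G (p r)) + en (rs n) * en (t - s)"
 using st by (simp add: distrib_right nn_integral_add nn_integral_cmult_indicator)
 also have "en (rs n) * en (t - s) <= en e"
 using n st by (simp flip: ennreal_mult add: ennreal_leI field_simps)
 finally show "e2ennreal (abs (u (p t) - u (p s))) <= lint s t (%r. ?G (p r)) + en e"
 by (simp add: add_left_mono)
 qed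
 qed
 thus ?thesis unfolding ecwug_def by (intro conjI) measurable
qed

lemma ecwug_min:
 fixes H :: "'a set"
 assumes H:"H:sets M" and F:"ecwug H u F" "lion H F"
 and F':"ecwug H u F'" "lion H F'"
 shows "ecwug H u (%x. min (F x) (F' x))"
proof -
 have "ecwug H u (%x. INF n::nat. (if n = 0 then F else F') x)"
 by (rule ecwug_INF[OF H]) (use F F' in auto)
 moreover have "(INF n::nat. (if n = 0 then F else F') x) = min (F x) (F' x)" for x
 proof (rule antisym)
 show "(INF n::nat. (if n = 0 then F else F') x) <= min (F x) (F' x)"
 by (auto intro: INF_lower2[of 0] INF_lower2[of "Suc 0"])
 show "min (F x) (F' x) <= (INF n::nat. (if n = 0 then F else F') x)"
 by (rule INF_greatest) (auto simp: min.coboundedI1 min.coboundedI2)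
 qed
 ultimately show ?thesis by simp
qed

text \<open>Direct method: a weighted integral is minimised over all locally integrable gradients.
  The infimum of a minimising sequence is again a gradient, and its minimum with a competitor cannot
  have a smaller integral, so it lies below the competitor almost everywhere. The weights are chosen
  to make the integral of \<open>G0\<close> at most one.\<close>

lemma ex_minimal_ecwug:
 fixes H :: "'a set"
 assumes H:"H:sets M" and G0:"ecwug H u G0" "lion H G0"
 obtains Gs where "ecwug H u Gs" "lion H Gs"
 "!!F. ecwug H u F ==> lion H F ==> AM x. x:H --> Gs x <= F x"
proof -
 obtain B :: "nat => 'a set" where B:"!!j. open (B j)" "H <= (UN j. B j)" "!!j. NI (H Int B j) G0 < oo"
 using lion_cover[OF G0(2)] by metis
 define A where "A j = H Int B j" for j
 have A[measurable]:"A j:sets M" for j using H B(1)[of j] by (auto simp: A_def)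
 define c where "c j = enn2real (NI (A j) G0)" for j
 have c:"NI (A j) G0 = en (c j)" "0 <= c j" for j
 using B(3)[of j] by (auto simp: c_def A_def)
 define w where "w j = en ((1 / 2) ^ Suc j / (1 + c j))" for j
 have w_pos:"w j ~= 0" for j using c(2)[of j] by (simp add: w_def add_pos_nonneg)
 define I where "I F = (\<Sum>j. w j * NI (A j) F)" for F
 have I0:"I G0 <= 1"
 proof -
 have "w j * NI (A j) G0 <= en ((1 / 2) ^ Suc j)" for j
 proof -
 have "c j / (1 + c j) <= 1" using c(2)[of j] by simp
 hence "(1 / 2) ^ Suc j * (c j / (1 + c j)) <= (1 / 2) ^ Suc j * 1" by (intro mult_left_mono) auto
 hence "(1 / 2) ^ Suc j / (1 + c j) * c j <= (1 / 2) ^ Suc j" by simp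
 thus ?thesis using c[of j] unfolding w_def by (simp flip: ennreal_mult add: ennreal_leI)
 qed
 hence "I G0 <= (\<Sum>j. en ((1 / 2) ^ Suc j))" unfolding I_def by (intro suminf_le) auto
 also have "... = en 1" using power_half_series by (subst suminf_ennreal2) (auto simp: sums_iff)
 finally show ?thesis by simp
 qed
 define \<F> where "\<F> = {F. ecwug H u F & lion H F}"
 define m where "m = (INF F\<in>\<F>. I F)"
 have m_le:"m <= 1" unfolding m_def using I0 G0 by (intro INF_lower2[of G0]) (auto simp: \<F>_def)
 have "EX F:\<F>. I F < m + en (rs n)" for n
 proof -
 have "m < m + en (rs n)" using m_le
 by (cases m) (auto simp: ennreal_less_iff top_unique simp flip: ennreal_plus)
 thus ?thesis unfolding m_def[symmetric] using INF_less_iff[of I \<F>] by (simp add: m_def)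
 qed
 then obtain F where F:"!!n. F n:\<F>" "!!n. I (F n) < m + en (rs n)" by metis
 define Gs where "Gs x = (INF n. F n x)" for x
 have I_mono:"I F1 <= I F2" if "!!x. F1 x <= F2 x" for F1 F2
 unfolding I_def by (intro suminf_le mult_left_mono nn_integral_mono mult_right_mono that) auto
 have Gs1:"ecwug H u Gs" unfolding Gs_def using F(1) by (intro ecwug_INF[OF H]) (auto simp: \<F>_def)
 have Gs_le:"Gs x <= F n x" for n x unfolding Gs_def by (rule INF_lower) simp
 have Gs2:"lion H Gs"
 using F(1)[of 0] Gs_le by (intro lion_mono_AE[of H "F 0" Gs]) (auto simp: \<F>_def)
 have I_Gs:"I Gs <= m"
 proof (rule ennreal_le_epsilon)
 fix e :: real assume "e > 0"
 then obtain n where n:"rs n < e" using nat_approx_posE by blast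
 have "I Gs <= I (F n)" by (rule I_mono[OF Gs_le])
 also have "... <= m + en (rs n)" using F(2)[of n] by simp
 also have "... <= m + en e" using n by (intro add_left_mono ennreal_leI) simp
 finally show "I Gs <= m + en e" .
 qed
 show ?thesis
 proof (rule that[OF Gs1 Gs2])
 fix F' assume F':"ecwug H u F'" "lion H F'"
 have [measurable]:"Gs:bB" "F':bB"
 using Gs1 F'(1) by (auto dest: ecwug_borel)
 define Gm where "Gm x = min (Gs x) (F' x)" for x
 have "ecwug H u Gm" unfolding Gm_def by (rule ecwug_min[OF H Gs1 Gs2 F'])
 moreover have "lion H Gm"
 by (rule lion_mono_AE[OF Gs2]) (auto simp: Gm_def)
 ultimately have "m <= I Gm" unfolding m_def by (intro INF_lower) (auto simp: \<F>_def)
 have "I Gm + I (%x. Gs x - Gm x) = I (%x. Gm x + (Gs x - Gm x))"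
 proof -
 have "NI (A j) (%x. (Gm x + (Gs x - Gm x))) = NI (A j) Gm + NI (A j) (%x. (Gs x - Gm x))" for j
 unfolding distrib_right by (rule nn_integral_add) (auto simp: Gm_def)
 thus ?thesis unfolding I_def by (simp add: distrib_left suminf_add[OF summableI summableI])
 qed
 also have "(%x. Gm x + (Gs x - Gm x)) = Gs"
 by (auto simp: Gm_def fun_eq_iff add_diff_inverse_ennreal)
 finally have eq:"I Gm + I (%x. Gs x - Gm x) = I Gs" .
 have "I (%x. Gs x - Gm x) = 0"
 proof -
 have "I Gm + I (%x. Gs x - Gm x) <= I Gm + 0" using eq I_Gs `m \<le> I Gm` by simp
 moreover have "I Gm ~= top" using I_mono[of Gm Gs] I_Gs m_le by (auto simp: Gm_def top_unique)
 ultimately show ?thesis by (simp add: ennreal_add_left_cancel_le)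
 qed
 hence "w j * NI (A j) (%x. (Gs x - Gm x)) = 0" for j
 unfolding I_def by (subst (asm) suminf_eq_zero_iff) auto
 hence "NI (A j) (%x. (Gs x - Gm x)) = 0" for j using w_pos[of j] by auto
 hence "AM x. (Gs x - Gm x) * ind (A j) x = 0" for j
 by (subst (asm) nn_integral_0_iff_AE) (auto simp: Gm_def)
 hence "AM x. ALL j. (Gs x - Gm x) * ind (A j) x = 0" unfolding AE_all_countable by blast
 thus "AM x. x:H --> Gs x <= F' x"
 proof eventually_elim
 case (elim x)
 show ?case
 proof
 assume x:"x:H"
 then obtain j where "x:A j" using B(2) by (auto simp: A_def)
 with elim have "Gs x - Gm x = 0" by (auto dest: spec[of _ j])
 hence "Gs x <= Gm x" by (simp add: diff_eq_0_iff_ennreal)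
 thus "Gs x <= F' x" by (simp add: Gm_def)
 qed
 qed
 qed
qed

lemma minimal_wug_is:
 fixes H :: "'a set"
 assumes H:"H:sets M" and G0:"ecwug H u G0" "lion H G0"
 shows "is_minimal_wug \<mu> H u (minimal_wug \<mu> H u)"
proof -
 obtain Gs where Gs:"ecwug H u Gs" "lion H Gs"
 "!!F. ecwug H u F ==> lion H F ==> AM x. x:H --> Gs x <= F x"
 using ex_minimal_ecwug[OF assms] by blast
 have "is_minimal_wug \<mu> H u Gs" unfolding is_minimal_wug_def
 proof (intro conjI allI impI; (elim conjE)?)
 show "weak_upper_gradient \<mu> H u Gs" by (rule ecwug_wug[OF Gs(1)])
 show "lion H Gs" by (rule Gs)
 fix g' assume g':"weak_upper_gradient \<mu> H u g'" "lion H g'"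
 obtain F where F:"ecwug H u F" "AM x. F x = g' x * ind H x"
 using wug_ecwug[OF H g'(1)] by blast
 have "lion H F"
 by (rule lion_mono_AE[OF g'(2)], rule eventually_mono[OF F(2)]) auto
 from Gs(3)[OF F(1) this] F(2) show "AM x. x:H --> Gs x <= g' x"
 by eventually_elim auto
 qed
 thus ?thesis unfolding minimal_wug_def by (rule someI[of "is_minimal_wug \<mu> H u"])
qed

lemma minimal_wug_le:
 fixes H :: "'a set"
 assumes H:"H:sets M" and F:"ecwug H u F" "lion H F"
 shows "NI H (minimal_wug \<mu> H u) <= NI H F"
proof (rule nn_integral_mono_AE)
 have "AM x. x:H --> minimal_wug \<mu> H u x <= F x"
 using minimal_wug_is[OF assms] ecwug_wug[OF F(1)] F(2)
 unfolding is_minimal_wug_def by blast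
 thus "AM x. minimal_wug \<mu> H u x * ind H x <= F x * ind H x"
 by eventually_elim (auto simp: indicator_def)
qed

lemma N11_ecwug:
 fixes H :: "'a set"
 assumes H:"H:sets M" and u:"u:N11 \<mu> H"
 obtains G where "ecwug H u G" "(NN x. G x) < oo" "L1_norm \<mu> H u < oo"
proof -
 have "N11_norm \<mu> H u < oo" using u by (simp add: N11_def)
 hence *: "L1_norm \<mu> H u < oo" "(INF g\<in>{g. weak_upper_gradient \<mu> H u g}. NI H g) < oo"
 by (auto simp: N11_norm_def)
 then obtain g where g:"weak_upper_gradient \<mu> H u g" "NI H g < oo"
 unfolding INF_less_iff by auto
 obtain G where G:"ecwug H u G" "AM x. G x = g x * ind H x"
 using wug_ecwug[OF H g(1)] by blast
 have "(NN x. G x) = NI H g" using G(2) by (rule nn_integral_cong_AE)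
 thus ?thesis using that[OF G(1)] g(2) *(1) by simp
qed

lemma N11I:
 fixes H :: "'a set"
 assumes H:"H:sets M" and u:"u:borel_measurable (restrict_space M H)" "L1_norm \<mu> H u < oo"
 and G:"ecwug H u G" "NI H G < oo"
 shows "u:N11 \<mu> H"
proof -
 have "(INF g\<in>{g. weak_upper_gradient \<mu> H u g}. NI H g) <= NI H G"
 using ecwug_wug[OF G(1)] by (intro INF_lower) auto
 hence "(INF g\<in>{g. weak_upper_gradient \<mu> H u g}. NI H g) < oo" using G(2) by (rule le_less_trans)
 thus ?thesis using u by (simp add: N11_def N11_norm_def)
qed

lemma N11_norm_le:
 assumes G:"ecwug H u G"
 shows "N11_norm \<mu> H u <= L1_norm \<mu> H u + NI H G"
 unfolding N11_norm_def using ecwug_wug[OF G] by (intro add_left_mono INF_lower) auto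

text \<open>Local gradients are glued along disjoint pieces of a countable cover by balls. The
  result is locally integrable because pieces of index above \<open>j\<close> miss
  \<open>B j\<close>, so only finitely many of the gradients occur there.\<close>

lemma N11_loc_ecwug:
 fixes H :: "'a set"
 assumes H:"H:sets M" and u:"u:N11_loc \<mu> H"
 obtains G where "ecwug H u G" "lion H G"
proof -
 obtain r where r:"!!x. x:H ==> r x > 0" "!!x. x:H ==> u:N11 \<mu> (H Int ball x (r x))"
 using u unfolding N11_loc_def by (auto dest!: bchoice)
 obtain B :: "nat => 'a set" where B:"!!j. open (B j)" "H <= (UN j. B j)" "!!j. B j = {} \<or> (EX x:H. B j = ball x (r x))"
 using lindelof_seq[of H r] r(1) by blast
 note op = B(1) and cov = B(2)
 have [measurable]:"B j:sets borel" for j using op by simp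
 have "ALL j. EX G. ecwug (H Int B j) u G & (NN x. G x) < oo"
 proof
 fix j
 show "EX G. ecwug (H Int B j) u G & (NN x. G x) < oo"
 proof (cases "B j = {}")
 case False
 hence "u:N11 \<mu> (H Int B j)" using B(3)[of j] r(2) by auto
 moreover have "H Int B j:sets M" using H by measurable
 ultimately show ?thesis using N11_ecwug by metis
 next
 case True
 hence "ecwug (H Int B j) u (%_. 0)" unfolding ecwug_def
 by (auto intro!: curve_ae_trivial)
 thus ?thesis by (intro exI[of _ "%_. 0"]) auto
 qed
 qed
 then obtain Gj where Gj:"!!j. ecwug (H Int B j) u (Gj j)" "!!j. (NN x. Gj j x) < oo" by metis
 have [measurable]:"Gj j:bB" for j using Gj(1) by (rule ecwug_borel)
 define G where "G x = (\<Sum>j. Gj j x * ind (disjointed B j) x)" for x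
 have dB[measurable]:"disjointed B j:sets borel" for j unfolding disjointed_def by measurable
 show ?thesis
 proof (rule that[of G])
 show "ecwug H u G"
 proof (rule ecwug_select[where A = "disjointed B" and B = B and Gj = Gj])
 show "disjointed B j Int H <= B j" for j using disjointed_subset[of B j] by blast
 show "H <= (UN j. disjointed B j)" unfolding UN_disjointed_eq by (rule cov)
 show "NI (H Int B j) (Gj j) < oo" for j
 by (rule le_less_trans[OF nn_integral_mono Gj(2)[of j]]) (auto simp: indicator_def)
 show "G:bB" unfolding G_def by measurable
 fix j x assume "x:disjointed B j"
 thus "Gj j x <= G x"
 using sum_le_suminf[of "%j. Gj j x * ind (disjointed B j) x" "{j}"] unfolding G_def by simp
 qed (use H op Gj in auto)
 show "lion H G" unfolding locally_integrable_on_def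
 proof
 fix x assume "x:H"
 then obtain j where j:"x:B j" using cov by blast
 then obtain d where d:"d > 0" "ball x d <= B j" using op[of j] open_contains_ball by blast
 have "NI (H Int ball x d) G <= (NN y. (SUM i<=j. Gj i y))"
 proof (intro nn_integral_mono)
 fix y
 show "G y * ind (H Int ball x d) y <= (SUM i<=j. Gj i y)"
 proof (cases "y:H Int ball x d")
 case True
 hence y:"y:B j" using d by auto
 have "y ~: disjointed B i" if "i ~: {..j}" for i using that y by (auto simp: disjointed_def)
 hence "G y = (SUM i<=j. Gj i y * ind (disjointed B i) y)"
 unfolding G_def by (intro suminf_finite) auto
 also have "... <= (SUM i<=j. Gj i y)" by (intro sum_mono) (auto simp: indicator_def)
 finally show ?thesis using True by simp
 qed simp
 qed
 also have "... = (SUM i<=j. NN y. Gj i y)" by (rule nn_integral_sum) measurable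
 also have "... < oo" using Gj(2) by (auto simp: less_top)
 finally show "EX d>0. NI (H Int ball x d) G < oo" using d(1) by blast
 qed
 qed
qed

lemma N11_loc_minimal_ecwug:
 fixes H :: "'a set"
 assumes H:"H:sets M" and u:"u:N11_loc \<mu> H"
 obtains G where "ecwug H u G" "AM x. G x = minimal_wug \<mu> H u x * ind H x"
proof -
 obtain G0 where "ecwug H u G0" "lion H G0" using N11_loc_ecwug[OF assms] by blast
 from minimal_wug_is[OF H this] have "weak_upper_gradient \<mu> H u (minimal_wug \<mu> H u)"
 by (simp add: is_minimal_wug_def)
 from wug_ecwug[OF H this] show ?thesis using that by blast
qed

end

section \<open>Calculus of weak upper gradients of real functions\<close>

lemma lint_small:
 assumes [measurable]:"h:bB" and fin:"lint a b h < oo" and x:"x:{a..b}" and e:"e > 0"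
 obtains d where "d > 0" "lint (max a (x - d)) (min b (x + d)) h < en e"
proof -
 define N where "N = density lborel (%s. h s * ind {a..b} s)"
 have N:"emeasure N S = (\<integral>\<^sup>+s. h s * ind ({a..b} Int S) s \<partial>lborel)" if "S:sets borel" for S
 unfolding N_def using that by (subst emeasure_density) (auto intro!: nn_integral_cong simp: indicator_def)
 have "(%n. emeasure N {x - rs n..x + rs n}) ~~>
 emeasure N (\<Inter>n. {x - rs n..x + rs n})"
 proof (rule Lim_emeasure_decseq)
 show "range (%n. {x - rs n..x + rs n}) <= sets N" by (auto simp: N_def)
 show "decseq (%n. {x - rs n..x + rs n})"
 proof (rule decseq_SucI)
 fix n have "1 / real (Suc (Suc n)) <= rs n" by (simp add: frac_le)
 thus "{x - 1 / real (Suc (Suc n))..x + 1 / real (Suc (Suc n))} <= {x - rs n..x + rs n}"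
 by (intro atLeastatMost_subset_iff[THEN iffD2] disjI2 conjI) linarith+
 qed
 fix n
 have "emeasure N {x - rs n..x + rs n} <= lint a b h"
 by (subst N) (auto intro!: nn_integral_mono simp: indicator_def)
 thus "emeasure N {x - rs n..x + rs n} ~= oo" using fin by (auto simp: top_unique)
 qed
 moreover have "(\<Inter>n. {x - rs n..x + rs n}) = {x}"
 proof safe
 fix y assume y:"y:(\<Inter>n. {x - rs n..x + rs n})"
 show "y = x"
 proof (rule ccontr)
 assume "y ~= x"
 then obtain n where "rs n < abs (y - x)" using nat_approx_posE[of "abs (y - x)"] by auto
 thus False using y by (auto dest!: spec[of _ n])
 qed
 qed auto
 moreover have "emeasure N {x} = 0"
 using N[of "{x}"] by (subst N) (auto simp: nn_integral_0_iff_AE intro!: eventually_mono[OF AE_lborel_singleton[of x]])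
 ultimately have "(%n. emeasure N {x - rs n..x + rs n}) ~~> 0" by simp
 hence "evs (%n. emeasure N {x - rs n..x + rs n} < en e)"
 using e by (intro order_tendstoD) auto
 then obtain n where "emeasure N {x - rs n..x + rs n} < en e"
 unfolding eventually_sequentially by blast
 moreover have "emeasure N {x - rs n..x + rs n} =
 lint (max a (x - rs n)) (min b (x + rs n)) h"
 by (subst N) (auto intro!: nn_integral_cong simp: indicator_def)
 ultimately show ?thesis by (intro that[of "rs n"]) auto
qed

text \<open>This continuity along curves is what makes sets such as {w < t} open in the parameter
  interval.\<close>

lemma increments_continuous:
 fixes f :: "real => real"
 assumes h:"h:bB" and fin:"lint a b h < oo"
 and incr:"!!s t. a <= s ==> s < t ==> t <= b ==> ea (f t - f s) <= lint s t h"
 shows "continuous_on {a..b} f"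
 unfolding continuous_on_iff
proof (intro ballI allI impI)
 fix x e :: real assume x:"x:{a..b}" and e:"e > 0"
 obtain d where d:"d > 0" "lint (max a (x - d)) (min b (x + d)) h < en e" using lint_small[OF h fin x e] .
 show "EX d>0. ALL x':{a..b}. dist x' x < d --> dist (f x') (f x) < e"
 proof (intro exI[of _ d] conjI ballI impI d(1))
 fix y assume y:"y:{a..b}" "dist y x < d"
 have "ea (f y - f x) < en e" if "y ~= x"
 proof -
 have "ea (f y - f x) <= lint (min x y) (max x y) h"
 using incr[of "min x y" "max x y"] x y that by (auto simp: min_def max_def abs_minus_commute)
 also have "... <= lint (max a (x - d)) (min b (x + d)) h"
 using x y by (intro lint_subinterval) (auto simp: dist_real_def)
 also have "... < en e" by (rule d)
 finally show ?thesis .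
 qed
 thus "dist (f y) (f x) < e" using e by (cases "y = x") (auto simp: dist_real_def ennreal_less_iff)
 qed
qed

context doubling_space begin

definition reg :: "('a => real) => ('a => ennreal) => (real => 'a) => real => real => bool" where
 "reg u g p s t \<longleftrightarrow> lint s t (%r. g (p r)) < oo & continuous_on {s..t} (%r. u (p r)) &
 (ALL a b. s <= a --> a < b --> b <= t --> inc u g p a b)"

text \<open>Openness is demanded in the parameter interval only, so \<open>P\<close> may be a
  condition like \<open>w x < t\<close> with \<open>w\<close> discontinuous on the space.\<close>

abbreviation "patch1 P g f p s t \<equiv> openin (top_of_set {s..t}) {r:{s..t}. P (p r)} &
 (NL {r:{s..t}. P (p r)} (%r. g (p r))) < oo &
 (ALL a b. s <= a --> a < b --> b <= t --> (ALL r:{a..b}. P (p r)) --> inc f g p a b)"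

abbreviation "patch P g f p s t \<equiv> ALL j. patch1 (P j) (g j) f p s t"

text \<open>Integrability over bounded sets is enough for integrability along almost every curve.\<close>

definition bfin :: "'a set => ('a => ennreal) => bool" where
 "bfin A G \<longleftrightarrow> (ALL r::real. NI (A Int ball ctr r) G < oo)"

lemma bfinI:
 assumes *: "NI A G < oo" shows "bfin A G"
 unfolding bfin_def
proof
 fix r :: real
 have "NI (A Int ball ctr r) G <= NI A G"
 by (intro nn_integral_mono) (auto simp: indicator_def)
 also note *
 finally show "NI (A Int ball ctr r) G < oo" .
qed

lemma bfin_mono:
 assumes "bfin A G" "A' <= A" "AM x. x:A' --> G' x <= G x" shows "bfin A' G'"
 unfolding bfin_def
proof
 fix r :: real
 have "NI (A' Int ball ctr r) G' <= NI (A Int ball ctr r) G"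
 by (rule nn_integral_mono_AE, rule eventually_mono[OF assms(3)]) (use assms(2) in "auto simp: indicator_def")
 thus "NI (A' Int ball ctr r) G' < oo" using assms(1) unfolding bfin_def by (blast intro: le_less_trans)
qed

lemma bfin_add:
 assumes "A:sets M" "G:bM" "H:bM" "bfin A G" "bfin A H"
 shows "bfin A (%x. G x + H x)"
 unfolding bfin_def
proof
 fix r :: real
 have [measurable]:"A Int ball ctr r:sets M" "G:bM" "H:bM"
 using assms by auto
 have "NI (A Int ball ctr r) (%x. (G x + H x)) = NI (A Int ball ctr r) G + NI (A Int ball ctr r) H"
 unfolding distrib_right by (rule nn_integral_add) measurable
 thus "NI (A Int ball ctr r) (%x. (G x + H x)) < oo" using assms(4,5) by (simp add: bfin_def)
qed

lemma bfin_const:"A:sets M ==> bfin A (%_. en c)"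
proof -
 assume [measurable]:"A:sets M"
 have "NI (A Int ball ctr r) (%x. en c) < oo" for r :: real
 proof -
 have "eM (A Int ball ctr r) <= eM (ball ctr r)" by (intro emeasure_mono) auto
 also have "... < oo" using bounded_fin[of "ball ctr r"] by (simp add: emeasure_ball)
 finally show ?thesis by (subst nn_integral_cmult_indicator) (auto simp: ennreal_mult_less_top)
 qed
 thus ?thesis by (simp add: bfin_def)
qed

text \<open>The working notion. \<open>G\<close> is only measurable and matters only up to null
  sets, so it can be combined freely; a Borel gradient below it carries the condition on
  curves.\<close>

definition wug :: "'a set => ('a => real) => ('a => ennreal) => bool" where
 "wug A u G \<longleftrightarrow> A:sets M & G:bM & bfin A G &
 (EX G'. cwug A u G' & (AM x. x:A --> G' x <= G x))"

lemma wug_sets:"wug A u G ==> A:sets M"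
 and wug_meas:"wug A u G ==> G:bM"
 and wug_fin:"wug A u G ==> bfin A G"
 by (auto simp: wug_def)

lemma wugE:
 assumes "wug A u G"
 obtains G' where "cwug A u G'" "AM x. G' x = G x * ind A x"
 "arc_ae A (reg u G')"
proof -
 have [measurable]:"A:sets M" "G:bM" using assms by (auto simp: wug_def)
 have "(%x. G x * ind A x):bM" by measurable
 then obtain G' N where G':"G':bB" "N:sets borel" "eM N = 0"
 "!!x. x ~: N ==> G' x = G x * ind A x" using borel_version by blast
 have ae:"AM x. G' x = G x * ind A x" using G' by (intro AE_I[of _ _ N]) auto
 obtain G1 where G1:"cwug A u G1" "AM x. x:A --> G1 x <= G x" using assms by (auto simp: wug_def)
 have c:"cwug A u G'"
 by (rule cwug_mono_AE[OF G1(1) G'(1)]) (use G1(2) ae in eventually_elim, auto)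
 \<comment> \<open>A curve stays inside one of countably many balls, so the truncations of
   \<open>G'\<close> to balls, each integrable on the space, control it along almost every
   curve.\<close>
 define rh where "rh n x = G' x * ind (ball ctr (real n)) x" for n x
 have rh:"rh n:bB" for n
 unfolding rh_def using G'(1) by (intro borel_measurable_times_ennreal borel_measurable_indicator) auto
 have rh_fin:"(NN x. rh n x) < oo" for n
 proof -
 have "(NN x. rh n x) = NI (A Int ball ctr (real n)) G" unfolding rh_def
 by (rule nn_integral_cong_AE, rule eventually_mono[OF ae]) (auto simp: indicator_def)
 thus ?thesis using assms by (simp add: wug_def bfin_def)
 qed
 have "curve_ae (%p l. arcs p l A (inc u G' p) & (ALL n. lint 0 l (%s. rh n (p s)) < oo))"
 using c by (intro curve_ae_conj curve_ae_all curve_ae_int rh rh_fin) (simp add: cwug_def)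
 hence "arc_ae A (reg u G')"
 proof (rule curve_ae_mono, intro allI impI, elim conjE)
 fix p l s t assume p:"pcurve p l" and st:"0 <= s" "s < t" "t <= l" "p ` {s..t} <= A"
 and i:"arcs p l A (inc u G' p)" and f':"ALL n. lint 0 l (%s. rh n (p s)) < oo"
 have "bounded (p ` {0..l})"
 using pcurve_continuous[OF p] by (intro compact_imp_bounded compact_continuous_image) (auto intro: continuous_on_subset)
 then obtain R where R:"ALL y:p ` {0..l}. dist ctr y <= R" unfolding bounded_any_center[where a = ctr] by blast
 obtain n where "R < real n" using reals_Archimedean2 by blast
 hence "p r:ball ctr (real n)" if "r:{0..l}" for r
 using le_less_trans[OF R[rule_format, OF imageI[OF that]]] by simp
 hence "lint 0 l (%s. G' (p s)) = lint 0 l (%s. rh n (p s))"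
 by (intro nn_integral_cong) (auto simp: rh_def indicator_def)
 hence f:"lint 0 l (%s. G' (p s)) < oo" using f' by simp
 have incr:"inc u G' p a b" if ab:"s <= a" "a < b" "b <= t" for a b
 proof -
 have "{a..b} <= {s..t}" using ab by auto
 hence "p ` {a..b} <= A" using st(4) by blast
 thus ?thesis using i ab st by auto
 qed
 have fin:"lint s t (%r. G' (p r)) < oo"
 by (rule le_less_trans[OF lint_subinterval f]) (use st in auto)
 have "continuous_on {s..t} (%r. u (p r))"
 by (rule increments_continuous[OF pcurve_meas[OF p G'(1)] fin incr])
 thus "reg u G' p s t" using fin incr by (simp add: reg_def)
 qed
 thus ?thesis using that c ae by blast
qed

text \<open>Like \<open>ecwug_select\<close>, but with pieces that are open merely along almost
  every curve. It is the source of the sharper gradients for truncated functions below.\<close>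

lemma wug_patch:
 fixes P :: "nat => 'a => bool" and g :: "nat => 'a => ennreal"
 assumes A:"A:sets M" and G[measurable]:"G:bM" and fin:"bfin A G"
 and g:"!!j. g j:bM"
 and cov:"!!x. x:A ==> EX j. P j x" and le:"AM x. x:A --> (EX j. P j x & g j x <= G x)"
 and curves:"arc_ae A (patch P g f)"
 shows "wug A f G"
proof -
 have "ALL j. EX g' N. g':bB & N:sets borel & eM N = 0 & (ALL x. x ~: N --> g' x = g j x)"
 using borel_version[OF g] by metis
 then obtain g' N where g':"!!j. g' j:bB" and N:"!!j. N j:sets borel" "!!j. eM (N j) = 0"
 and g'_eq:"!!j x. x ~: N j ==> g' j x = g j x" by metis
 obtain Gb N' where Gb:"Gb:bB" "N':sets borel" "eM N' = 0" "!!x. x ~: N' ==> Gb x = G x"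
 using borel_version[OF G] by blast
 obtain E0 where E0:"E0:sets M" "eM E0 = 0" "{x. ~ (x:A --> (EX j. P j x & g j x <= G x))} <= E0"
 using le by (auto elim!: AE_E)
 obtain E1 where E1:"E1:sets borel" "E0 <= E1" "eM E1 = 0" using null_borel_hull[OF E0(2,1)] .
 define E where "E = E1 Un N' Un (UN j. N j)"
 have E[measurable]:"E:sets borel" unfolding E_def using E1 Gb N by auto
 have E_null:"eM E = 0"
 unfolding E_def using E1 Gb N by (intro null_setsD1 null_sets.Un null_sets_UN) (auto simp: null_sets_def)
 \<comment> \<open>On the null set \<open>E\<close> any piece may be selected because
   \<open>H\<close> is infinite there; elsewhere \<open>H\<close> equals \<open>G\<close>.\<close>
 define H where "H x = Gb x + top * ind E x" for x
 have H:"H:bB" unfolding H_def using Gb(1) by measurable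
 have H_ge:"EX j. P j x & g' j x <= H x" if "x:A" for x
 proof (cases "x:E")
 case True
 thus ?thesis using cov[OF that] by (auto simp: H_def)
 next
 case False
 hence "x ~: E0" using E1(2) by (auto simp: E_def)
 have "EX j. P j x & g j x <= G x"
 proof (rule ccontr)
 assume "~ ?thesis"
 hence "x:{x. ~ (x:A --> (EX j. P j x & g j x <= G x))}" using that by simp
 hence "x:E0" by (rule subsetD[OF E0(3)])
 thus False using `x \<notin> E0` by simp
 qed
 then obtain j where j:"P j x" "g j x <= G x" by (elim exE conjE)
 moreover have "g' j x = g j x" "Gb x = G x" using False g'_eq Gb(4) by (auto simp: E_def)
 ultimately show ?thesis using False by (intro exI[of _ j]) (simp add: H_def)
 qed
 have "curve_ae (%p l. arcs p l A (patch P g f p) & (AE r in lborel. r:{0..l} --> p r ~: E))"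
 by (intro curve_ae_conj curves curve_ae_null E E_null)
 hence "arc_ae A (inc f H)"
 proof (rule curve_ae_mono, intro allI impI, elim conjE)
 fix p l s t assume p:"pcurve p l" and st:"0 <= s" "s < t" "t <= l" "p ` {s..t} <= A"
 and i:"arcs p l A (patch P g f p)"
 and ae:"AE r in lborel. r:{0..l} --> p r ~: E"
 have i1:"openin (top_of_set {s..t}) {r:{s..t}. P j (p r)}"
 "(NL {r:{s..t}. P j (p r)} (%r. g j (p r))) < oo"
 "!!a b. s <= a ==> a < b ==> b <= t ==> (ALL r:{a..b}. P j (p r)) ==>
 inc f (g j) p a b" for j
 using i st by blast+
 have "ALL j. EX Q. open Q & {r:{s..t}. P j (p r)} = {s..t} Int Q"
 using i1(1) by (simp add: openin_open)
 then obtain Op where Op:"!!j. open (Op j)" "!!j. {r:{s..t}. P j (p r)} = {s..t} Int Op j" by metis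
 have PO:"P j (p r) \<longleftrightarrow> r:Op j" if "r:{s..t}" for j r using Op(2)[of j] that by blast
 have ae':"AE r in lborel. r:{s..t} --> g j (p r) = g' j (p r)" for j
 using ae
 proof eventually_elim
 case (elim r)
 thus ?case using st g'_eq[of "p r" j] by (auto simp: E_def)
 qed
 have [measurable]:"(%r. g' j (p r)):bB" "(%r. H (p r)):bB"
 "Op j:sets borel" for j
 using pcurve_meas[OF p g'] pcurve_meas[OF p H] Op(1) by auto
 show "inc f H p s t"
 proof (rule increment_selection[where A = "%j. Op j Int {r. g' j (p r) <= H (p r)}" and Op = Op and hj = "%j r. g' j (p r)"])
 show "{s..t} <= (UN j. Op j Int {r. g' j (p r) <= H (p r)})"
 proof
 fix r assume r:"r:{s..t}"
 hence "p r:A" using st by auto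
 then obtain j where "P j (p r)" "g' j (p r) <= H (p r)" using H_ge by blast
 thus "r:(UN j. Op j Int {r. g' j (p r) <= H (p r)})" using PO[OF r] by auto
 qed
 show "(NL (Op j Int {s..t}) (%r. g' j (p r))) < oo" for j
 proof -
 have "(NL (Op j Int {s..t}) (%r. g' j (p r))) = (NL {r:{s..t}. P j (p r)} (%r. g j (p r)))"
 unfolding Op(2) by (rule nn_integral_cong_AE, rule eventually_mono[OF ae'[of j]]) (auto simp: indicator_def)
 thus ?thesis using i1(2) by simp
 qed
 show "inc f (g' j) p a b"
 if ab:"s <= a" "a < b" "b <= t" "{a..b} <= Op j" for j a b
 proof -
 have "ALL r:{a..b}. P j (p r)" using PO ab by auto
 hence "inc f (g j) p a b" using ab by (intro i1(3))
 also have "... = lint a b (%r. g' j (p r))"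
 by (rule nn_integral_cong_AE, rule eventually_mono[OF ae'[of j]]) (use ab in "auto simp: indicator_def")
 finally show ?thesis .
 qed
 qed (use st Op(1) in auto)
 qed
 hence "cwug A f H" using H by (simp add: cwug_def)
 moreover have "AM x. x:A --> H x <= G x"
 proof (rule AE_I[of _ _ E])
 have HG:"H x = G x" if "x ~: E" for x using that Gb(4)[of x] by (auto simp: H_def E_def)
 show "{x:space M. ~ (x:A --> H x <= G x)} <= E" 
 proof (rule subsetI, rule ccontr)
 fix x assume x:"x:{x:space M. ~ (x:A --> H x <= G x)}" "x ~: E"
 from x(2) have "H x = G x" by (rule HG)
 thus False using x(1) by simp
 qed
 qed (use E E_null in auto)
 ultimately show ?thesis using A G fin unfolding wug_def by blast
qed

lemma wug_patch1:
 assumes A:"A:sets M" and G[measurable]:"G:bM" and fin:"bfin A G"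
 and le:"AM x. x:A --> g x <= G x"
 and curves:"arc_ae A (inc f g)"
 shows "wug A f G"
proof -
 obtain Gb N' where Gb:"Gb:bB" "N':sets borel" "eM N' = 0" "!!x. x ~: N' ==> Gb x = G x"
 using borel_version[OF G] by blast
 obtain E0 where E0:"E0:sets M" "eM E0 = 0" "{x. ~ (x:A --> g x <= G x)} <= E0"
 using le by (auto elim!: AE_E)
 obtain E1 where E1:"E1:sets borel" "E0 <= E1" "eM E1 = 0" using null_borel_hull[OF E0(2,1)] .
 have E:"E1 Un N':sets borel" "eM (E1 Un N') = 0"
 using E1 Gb by (auto intro!: null_setsD1 null_sets.Un simp: null_sets_def)
 have le':"g x <= Gb x" if "x:A" "x ~: E1 Un N'" for x
 using that E0(3) E1(2) Gb(4)[of x] by auto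
 have "curve_ae (%p l. arcs p l A (inc f g p) & (AE r in lborel. r:{0..l} --> p r ~: E1 Un N'))"
 by (intro curve_ae_conj curves curve_ae_null E)
 hence "arc_ae A (inc f Gb)"
 proof (rule curve_ae_mono, intro allI impI, elim conjE)
 fix p l s t assume p:"pcurve p l" and st:"0 <= s" "s < t" "t <= l" "p ` {s..t} <= A"
 and i:"arcs p l A (inc f g p)"
 and ae:"AE r in lborel. r:{0..l} --> p r ~: E1 Un N'"
 have "inc f g p s t" using i st by blast
 also have "... <= lint s t (%r. Gb (p r))"
 proof (rule nn_integral_mono_AE)
 show "AE r in lborel. g (p r) * ind {s..t} r <= Gb (p r) * ind {s..t} r"
 using ae
 proof eventually_elim
 case (elim r)
 show ?case
 proof (cases "r:{s..t}")
 case True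
 hence "g (p r) <= Gb (p r)" using elim st by (intro le') auto
 thus ?thesis using True by simp
 qed simp
 qed
 qed
 finally show "inc f Gb p s t" .
 qed
 hence "cwug A f Gb" using Gb(1) by (simp add: cwug_def)
 moreover have "AM x. x:A --> Gb x <= G x"
 proof (rule AE_I[of _ _ N'])
 show "{x:space M. ~ (x:A --> Gb x <= G x)} <= N'" using Gb(4) by fastforce
 qed (use Gb in auto)
 ultimately show ?thesis using A G fin unfolding wug_def by blast
qed

lemma wug_mono:
 assumes "wug A u G" "G':bM" "bfin A' G'" "A':sets M" "A' <= A"
 "AM x. x:A' --> G x <= G' x"
 shows "wug A' u G'"
proof -
 obtain G1 where G1:"cwug A u G1" "AM x. x:A --> G1 x <= G x" using assms(1) by (auto simp: wug_def)
 have "AM x. x:A' --> G1 x <= G' x" using G1(2) assms(6) by eventually_elim (use assms(5) in auto)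
 thus ?thesis using cwug_subset[OF G1(1) assms(5)] assms unfolding wug_def by blast
qed

lemma wug_subset:
 assumes "wug A u G" "A':sets M" "A' <= A" shows "wug A' u G"
 by (rule wug_mono[OF assms(1) wug_meas[OF assms(1)] _ assms(2,3)])
 (use bfin_mono[OF wug_fin[OF assms(1)] assms(3)] in auto)

definition creg :: "'a set => ('a => real) => ('a => ennreal) => bool" where
 "creg A u g \<longleftrightarrow> g:bB &
 arc_ae A (reg u g)"

lemma wug_creg:
 assumes "wug A u G"
 obtains g where "creg A u g" "AM x. g x = G x * ind A x"
proof -
 obtain g where "cwug A u g" "AM x. g x = G x * ind A x"
 "arc_ae A (reg u g)"
 by (rule wugE[OF assms])
 thus ?thesis by (intro that[of g]) (simp_all add: creg_def cwug_borel)
qed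

lemma wug_contract:
 assumes u:"wug A u G" and v:"wug A v H" and f:"!!x y. abs (f x - f y) <= abs (u x - u y) + abs (v x - v y)"
 shows "wug A f (%x. G x + H x)"
proof -
 have A:"A:sets M" using u by (rule wug_sets)
 have [measurable]:"G:bM" "H:bM" "A:sets M"
 using wug_meas[OF u] wug_meas[OF v] A by auto
 obtain g where g:"creg A u g" "AM x. g x = G x * ind A x" by (rule wug_creg[OF u])
 obtain h where h:"creg A v h" "AM x. h x = H x * ind A x" by (rule wug_creg[OF v])
 have [measurable]:"g:bB" "h:bB" using g h by (auto simp: creg_def)
 show ?thesis
 proof (rule wug_patch1[where g = "%x. g x + h x"])
 show "bfin A (%x. G x + H x)" by (rule bfin_add) (use A wug_fin[OF u] wug_fin[OF v] in measurable)
 show "AM x. x:A --> g x + h x <= G x + H x" using g(2) h(2) by eventually_elim auto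
 have "curve_ae (%p l. arcs p l A (reg u g p) &
 arcs p l A (reg v h p))"
 using g(1) h(1) by (intro curve_ae_conj) (auto simp: creg_def)
 thus "arc_ae A (%p s t. ea (f (p t) - f (p s)) <= lint s t (%r. g (p r) + h (p r)))"
 proof (rule curve_ae_mono, intro allI impI, elim conjE)
 fix p l s t assume p:"pcurve p l" and st:"0 <= s" "s < t" "t <= l" "p ` {s..t} <= A"
 and "arcs p l A (reg u g p)"
 and "arcs p l A (reg v h p)"
 hence r:"reg u g p s t" "reg v h p s t" by blast+
 have [measurable]:"(%r. g (p r)):bB" "(%r. h (p r)):bB"
 using pcurve_meas[OF p] by auto
 have eq:"lint s t (%r. g (p r) + h (p r)) = lint s t (%r. g (p r)) + lint s t (%r. h (p r))"
 unfolding distrib_right by (rule nn_integral_add) auto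
 have "ea (f (p t) - f (p s)) <= ea (u (p t) - u (p s)) + ea (v (p t) - v (p s))"
 using f by (simp flip: ennreal_plus)
 also have "... <= lint s t (%r. g (p r)) + lint s t (%r. h (p r))"
 using r st by (intro add_mono) (auto simp: reg_def)
 finally show "ea (f (p t) - f (p s)) <= lint s t (%r. g (p r) + h (p r))"
 unfolding eq .
 qed
 qed (use A in measurable)
qed

lemma wug_zero:"A:sets M ==> wug A (%_. c) (%_. 0)"
 by (rule wug_patch1[where g = "%_. 0"]) (auto intro!: curve_ae_trivial bfinI)

lemma wug_add:"wug A u G ==> wug A v H ==> wug A (%x. u x + v x) (%x. G x + H x)"
 by (rule wug_contract) auto

lemma wug_sum:
 assumes fin:"finite I" and u:"!!i. i:I ==> wug A (u i) (G i)" and A:"A:sets M"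
 shows "wug A (%x. SUM i:I. u i x) (%x. SUM i:I. G i x)"
 using fin u by (induction I rule: finite_induct) (auto intro: wug_zero[OF A] wug_add)

end

lemma openin_less:
 fixes f g :: "real => real"
 assumes "continuous_on S f" "continuous_on S g"
 shows "openin (top_of_set S) {x:S. f x < g x}"
proof -
 have "continuous_on S (%x. g x - f x)" using assms by (intro continuous_intros)
 from continuous_openin_preimage_gen[OF this, of "{0<..}"]
 have "openin (top_of_set S) (S Int (%x. g x - f x) -` {0<..})" by simp
 also have "S Int (%x. g x - f x) -` {0<..} = {x:S. f x < g x}" by auto
 finally show ?thesis .
qed

lemma abs_max_diff:"abs (max a b - max c d) <= max (abs (a - c)) (abs (b - d))" for a b c d :: real
proof -
 have "max a b <= max c d + max (abs (a - c)) (abs (b - d))" "max c d <= max a b + max (abs (a - c)) (abs (b - d))"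
 unfolding max_def by (simp_all, linarith+)
 thus ?thesis by linarith
qed

lemma abs_min_diff:"abs (min a b - min c d) <= max (abs (a - c)) (abs (b - d))" for a b c d :: real
proof -
 have "min a b <= min c d + max (abs (a - c)) (abs (b - d))" "min c d <= min a b + max (abs (a - c)) (abs (b - d))"
 unfolding min_def max_def by (simp_all, linarith+)
 thus ?thesis by linarith
qed

context doubling_space begin

lemma bfin_lion:
 fixes A :: "'a set"
 assumes "bfin A G" shows "lion A G"
 unfolding locally_integrable_on_def
proof
 fix x :: 'a assume "x:A"
 have sub:"A Int ball x 1 <= A Int ball ctr (dist ctr x + 1)"
 proof
 fix y assume y:"y:A Int ball x 1"
 thus "y:A Int ball ctr (dist ctr x + 1)"
 using dist_triangle[of ctr y x] by auto
 qed
 have "NI (A Int ball x 1) G <= NI (A Int ball ctr (dist ctr x + 1)) G"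
 using sub by (intro nn_integral_mono) (auto simp: indicator_def)
 also have "... < oo" using assms by (simp add: bfin_def)
 finally show "EX r>0. NI (A Int ball x r) G < oo" by (intro exI[of _ 1]) simp
qed

lemma creg_conj:
 assumes "creg A u g" "creg B v h"
 shows "curve_ae (%p l. arcs p l A (reg u g p) &
 arcs p l B (reg v h p))"
 using assms by (intro curve_ae_conj) (auto simp: creg_def)

text \<open>Both factors are continuous along almost every curve, so
  \<open>increment_weighted\<close> applies with their absolute values as weights.\<close>

lemma wug_mult:
 fixes et z :: "'a => real"
 assumes et:"wug A et e" and z:"wug A z g" and m[measurable]:"et:bM" "z:bM"
 and G:"G:bM" "bfin A G" "AM x. x:A --> ea (et x) * g x + ea (z x) * e x <= G x"
 shows "wug A (%x. et x * z x) G"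
proof -
 obtain e' where e':"creg A et e'" "AM x. e' x = e x * ind A x" by (rule wug_creg[OF et])
 obtain g' where g':"creg A z g'" "AM x. g' x = g x * ind A x" by (rule wug_creg[OF z])
 have [measurable]:"e':bB" "g':bB" using e' g' by (auto simp: creg_def)
 show ?thesis
 proof (rule wug_patch1[where g = "%x. ea (et x) * g' x + ea (z x) * e' x"])
 show "AM x. x:A --> ea (et x) * g' x + ea (z x) * e' x <= G x"
 using e'(2) g'(2) G(3) by eventually_elim auto
 show "arc_ae A (%p s t. ea (et (p t) * z (p t) - et (p s) * z (p s)) <= lint s t (%r. ea (et (p r)) * g' (p r) + ea (z (p r)) * e' (p r)))"
 using creg_conj[OF e'(1) g'(1)]
 proof (rule curve_ae_mono, intro allI impI, elim conjE)
 fix p l s t assume p:"pcurve p l" and st:"0 <= s" "s < t" "t <= l" "p ` {s..t} <= A"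
 and "arcs p l A (reg et e' p)"
 and "arcs p l A (reg z g' p)"
 hence r:"reg et e' p s t" "reg z g' p s t" by blast+
 define h where "h k = (if k = 0 then (%r. g' (p r)) else (%r. e' (p r)))" for k :: nat
 define c where "c k = (if k = 0 then (%r. abs (et (p r))) else (%r. abs (z (p r))))" for k :: nat
 have "ea ((%r. et (p r) * z (p r)) t - (%r. et (p r) * z (p r)) s) <= lint s t (%r. SUM k<2. en (c k r) * h k r)"
 proof (rule increment_weighted)
 show "h k:bB" for k
 using pcurve_meas[OF p, of g'] pcurve_meas[OF p, of e'] by (simp add: h_def)
 show "continuous_on {s..t} (c k)" for k
 using r by (auto simp: c_def reg_def intro!: continuous_intros)
 show "lint s t (h k) < oo" for k using r by (auto simp: h_def reg_def)
 fix a b assume ab:"s <= a" "a < b" "b <= t"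
 have "abs (et (p b) * z (p b) - et (p a) * z (p a)) <= abs (et (p b)) * abs (z (p b) - z (p a)) + abs (z (p a)) * abs (et (p b) - et (p a))"
 proof -
 have "et (p b) * z (p b) - et (p a) * z (p a) = et (p b) * (z (p b) - z (p a)) + z (p a) * (et (p b) - et (p a))"
 by (simp add: algebra_simps)
 thus ?thesis by (metis abs_mult abs_triangle_ineq)
 qed
 also have "... <= max (c 0 a) (c 0 b) * abs (z (p b) - z (p a)) + max (c 1 a) (c 1 b) * abs (et (p b) - et (p a))"
 by (intro add_mono mult_right_mono) (auto simp: c_def)
 finally have "ea (et (p b) * z (p b) - et (p a) * z (p a)) <=
 en (max (c 0 a) (c 0 b)) * ea (z (p b) - z (p a)) + en (max (c 1 a) (c 1 b)) * ea (et (p b) - et (p a))"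
 by (subst (asm) ennreal_le_iff[symmetric]) (auto simp: ennreal_plus ennreal_mult c_def le_max_iff_disj)
 also have "... <= en (max (c 0 a) (c 0 b)) * lint a b (h 0) + en (max (c 1 a) (c 1 b)) * lint a b (h 1)"
 using r ab by (intro add_mono mult_left_mono) (auto simp: h_def reg_def)
 finally show "ea ((%r. et (p r) * z (p r)) b - (%r. et (p r) * z (p r)) a) <= (SUM k<2. en (max (c k a) (c k b)) * lint a b (h k))"
 by (simp add: eval_nat_numeral)
 qed (use st in "auto simp: c_def")
 thus "ea (et (p t) * z (p t) - et (p s) * z (p s)) <= lint s t (%r. ea (et (p r)) * g' (p r) + ea (z (p r)) * e' (p r))"
 by (simp add: h_def c_def eval_nat_numeral)
 qed
 qed (use wug_sets[OF et] G in auto)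
qed

lemma curve_ae_finite_time:
 assumes "g:bB" "bfin UNIV g"
 shows "curve_ae (%p l. lint 0 l (%r. g (p r)) < oo)"
proof -
 have "wug UNIV (%_. 0) g" 
 by (rule wug_patch1[where g = "%_. 0"]) (use assms in "auto intro!: curve_ae_trivial borel_measurable_M")
 then obtain g' where "cwug UNIV (%_. 0) g'" and g':"AM x. g' x = g x * ind UNIV x"
 "arc_ae UNIV (reg (%_. 0) g')"
 by (rule wugE)
 obtain E0 where E0:"E0:sets M" "eM E0 = 0" "{x. ~ g' x = g x * ind UNIV x} <= E0"
 using g'(1) by (auto elim!: AE_E)
 obtain E1 where E1:"E1:sets borel" "E0 <= E1" "eM E1 = 0" using null_borel_hull[OF E0(2,1)] .
 have "curve_ae (%p l. arcs p l UNIV (reg (%_. 0) g' p) &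
 (AE r in lborel. r:{0..l} --> p r ~: E1))"
 by (intro curve_ae_conj g' curve_ae_null E1)
 thus ?thesis
 proof (rule curve_ae_mono, elim conjE)
 fix p l assume p:"pcurve p l" and i:"arcs p l UNIV (reg (%_. 0) g' p)"
 and ae:"AE r in lborel. r:{0..l} --> p r ~: E1"
 have "reg (%_. 0) g' p 0 l" using i pcurve_pos[OF p] by auto
 moreover have "lint 0 l (%r. g (p r)) = lint 0 l (%r. g' (p r))"
 proof (rule nn_integral_cong_AE)
 show "AE r in lborel. g (p r) * ind {0..l} r = g' (p r) * ind {0..l} r"
 using ae
 proof eventually_elim
 case (elim r)
 have "g' x = g x" if "x ~: E1" for x using that E0(3) E1(2) by auto
 thus ?case using elim by (cases "r:{0..l}") auto
 qed
 qed
 ultimately show "lint 0 l (%r. g (p r)) < oo" by (simp add: reg_def)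
 qed
qed

text \<open>Two overlapping open pieces suffice: on \<open>W\<close> the function is
  \<open>f\<close>, and off the closed set \<open>F\<close> it vanishes identically.\<close>

lemma wug_zero_ext:
 assumes f:"wug W f G" and F:"closed F" "open W" "F <= W" "!!x. x:W ==> x ~: F ==> f x = 0"
 shows "wug UNIV (%x. if x:W then f x else 0) (%x. G x * ind W x)"
proof -
 have [measurable]:"G:bM" "W:sets M" using wug_meas[OF f] wug_sets[OF f] by auto
 obtain g where g:"creg W f g" "AM x. g x = G x * ind W x" by (rule wug_creg[OF f])
 have gm[measurable]:"g:bB" using g by (auto simp: creg_def)
 have bf:"bfin UNIV (%x. G x * ind W x)"
 unfolding bfin_def
 proof
 fix r :: real
 have "NI (UNIV Int ball ctr r) (%x. G x * ind W x) = NI (W Int ball ctr r) G"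
 by (intro nn_integral_cong) (auto simp: indicator_def)
 thus "NI (UNIV Int ball ctr r) (%x. G x * ind W x) < oo" using wug_fin[OF f] by (simp add: bfin_def)
 qed
 have bfg:"bfin UNIV g" by (rule bfin_mono[OF bf]) (use g(2) in auto)
 let ?f = "%x. if x:W then f x else 0"
 let ?P = "%j x. if j = (0::nat) then x:W else x ~: F" and ?g = "%j. if j = (0::nat) then g else (%_. 0)"
 show ?thesis
 proof (rule wug_patch[where P = ?P and g = ?g])
 show "AM x. x:UNIV --> (EX j. ?P j x & ?g j x <= G x * ind W x)"
 using g(2)
 proof eventually_elim
 case (elim x)
 thus ?case using F(3) by (cases "x:W") (auto intro: exI[of _ 0] exI[of _ 1])
 qed
 show "EX j. ?P j x" for x using F(3) by (cases "x:W") (auto intro: exI[of _ 0] exI[of _ 1])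
 have "curve_ae (%p l. arcs p l W (reg f g p) & lint 0 l (%r. g (p r)) < oo)"
 using g(1) by (intro curve_ae_conj curve_ae_finite_time gm bfg) (auto simp: creg_def)
 thus "arc_ae UNIV (patch ?P ?g ?f)"
 proof (rule curve_ae_mono, intro allI impI, elim conjE)
 fix p l s t and j :: nat assume p:"pcurve p l" and st:"0 <= s" "s < t" "t <= l" 
 and i:"arcs p l W (reg f g p)"
 and fin:"lint 0 l (%r. g (p r)) < oo"
 have 1:"openin (top_of_set {s..t}) {r:{s..t}. p r:O'}" if "open O'" for O'
 proof -
 have "{r:{s..t}. p r:O'} = {s..t} Int p -` O'" by auto
 thus ?thesis using open_vimage[OF that pcurve_continuous[OF p]] by (auto simp: openin_open)
 qed
 have "openin (top_of_set {s..t}) {r:{s..t}. ?P j (p r)}"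
 using 1[of W] 1[of "- F"] F(1,2) by (cases "j = 0") (auto simp: open_Compl)
 moreover have "(NL {r:{s..t}. ?P j (p r)} (%r. ?g j (p r))) < oo"
 proof (cases "j = 0")
 case True
 have "(NL {r:{s..t}. ?P j (p r)} (%r. ?g j (p r))) <= lint 0 l (%r. g (p r))"
 using st True by (intro nn_integral_mono) (auto simp: indicator_def)
 thus ?thesis using fin by (rule le_less_trans)
 qed simp
 moreover have "inc ?f (?g j) p a b"
 if ab:"s <= a" "a < b" "b <= t" "ALL r:{a..b}. ?P j (p r)" for a b
 proof (cases "j = 0")
 case True
 hence "p ` {a..b} <= W" using ab by auto
 hence "reg f g p a b" using i ab st by auto
 moreover have "p a:W" "p b:W" using True ab by auto
 ultimately show ?thesis using True ab by (simp add: reg_def)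
 next
 case False
 hence "p a ~: F" "p b ~: F" using ab by auto
 hence "?f (p a) = 0" "?f (p b) = 0" using F(4) by auto
 thus ?thesis by simp
 qed
 ultimately show "patch1 (?P j) (?g j) ?f p s t" by blast
 qed
 qed (use bf in auto)
qed

lemma clamp_contract:"abs (max 0 (min 1 a) - max 0 (min 1 b)) <= abs (a - b)" for a b :: real
 by (rule order_trans[of _ "abs (min 1 a - min 1 b)"]) (use abs_max_diff[of 0 "min 1 a" 0 "min 1 b"] abs_min_diff[of 1 a 1 b] in simp_all)

text \<open>Below and above the band the function is constant, and these parts are open along
  curves, so the gradient survives on the closed band only. Integrating this over the level
  \<open>ta\<close> yields the coarea inequality.\<close>

lemma wug_band:
 fixes w :: "'a => real"
 assumes w:"wug A w G" and m[measurable]:"w:bM" and s0:"si > 0"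
 shows "wug A (%x. max 0 (min 1 ((w x - ta) / si))) (%x. en (1 / si) * G x * ind {x. ta <= w x & w x <= ta + si} x)"
proof -
 have [measurable]:"G:bM" "A:sets M" using wug_meas[OF w] wug_sets[OF w] by auto
 obtain g where g:"creg A w g" "AM x. g x = G x * ind A x" by (rule wug_creg[OF w])
 have gm[measurable]:"g:bB" using g by (auto simp: creg_def)
 let ?f = "%x. max 0 (min 1 ((w x - ta) / si))"
 let ?G = "%x. en (1 / si) * G x * ind {x. ta <= w x & w x <= ta + si} x"
 let ?P = "%j x. if j = (0::nat) then w x < ta else if j = 1 then ta + si < w x else True"
 and ?g = "%j. if j = (0::nat) then (%_. 0) else if j = 1 then (%_. 0) else (%x. en (1 / si) * g x)"
 have bf:"bfin A ?G"
 unfolding bfin_def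
 proof
 fix r :: real
 have [measurable]:"A Int ball ctr r:sets M" by auto
 have "NI (A Int ball ctr r) ?G <= (NN x. en (1 / si) * (G x * ind (A Int ball ctr r) x))"
 by (intro nn_integral_mono) (auto simp: indicator_def)
 also have "... = en (1 / si) * NI (A Int ball ctr r) G"
 by (rule nn_integral_cmult) measurable
 also have "... < oo" using wug_fin[OF w] by (auto simp: bfin_def ennreal_mult_less_top)
 finally show "NI (A Int ball ctr r) ?G < oo" .
 qed
 have lip:"abs (?f x - ?f y) <= 1 / si * abs (w x - w y)" for x y
 proof -
 have "abs (?f x - ?f y) <= abs ((w x - ta) / si - (w y - ta) / si)" by (rule clamp_contract)
 also have "... = abs (w x - w y) / si" using s0 by (simp flip: diff_divide_distrib)
 finally show ?thesis by simp
 qed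
 show ?thesis
 proof (rule wug_patch[where P = ?P and g = ?g])
 show "AM x. x:A --> (EX j. ?P j x & ?g j x <= ?G x)"
 using g(2)
 proof eventually_elim
 case (elim x)
 consider "w x < ta" | "ta + si < w x" | "ta <= w x & w x <= ta + si" by linarith
 thus ?case
 proof cases
 case 1 thus ?thesis by (intro impI exI[of _ 0]) auto
 next
 case 2 thus ?thesis by (intro impI exI[of _ 1]) auto
 next
 case 3 thus ?thesis using elim by (intro impI exI[of _ 2]) auto
 qed
 qed
 show "EX j. ?P j x" for x by (intro exI[of _ 2]) auto
 show "?g j:bM" for j by (cases "j = 0"; cases "j = 1") auto
 have "arc_ae A (reg w g)"
 using g(1) by (auto simp: creg_def)
 thus "arc_ae A (patch ?P ?g ?f)"
 proof (rule curve_ae_mono, intro allI impI)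
 fix p l s t and j :: nat assume p:"pcurve p l" and st:"0 <= s" "s < t" "t <= l" "p ` {s..t} <= A"
 and i:"arcs p l A (reg w g p)"
 have r:"reg w g p s t" using i st by blast
 have [measurable]:"(%r. g (p r)):bB" by (rule pcurve_meas[OF p gm])
 have c:"continuous_on {s..t} (%r. w (p r))" using r by (simp add: reg_def)
 have cm:"lint a b (%r. en (1 / si) * g (p r)) = en (1 / si) * lint a b (%r. g (p r))" for a b
 unfolding mult.assoc by (rule nn_integral_cmult) measurable
 consider "j = 0" | "j = 1" | "j ~= 0" "j ~= 1" by blast
 thus "patch1 (?P j) (?g j) ?f p s t"
 proof cases
 case 1
 have "?f x = 0" if "w x < ta" for x using that divide_neg_pos[of "w x - ta" si] s0 by (simp add: max_def min_def)
 thus ?thesis using 1 openin_less[OF c, of "%_. ta"] by auto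
 next
 case 2
 have "?f x = 1" if "ta + si < w x" for x using that s0 by (auto simp: max_def min_def field_simps)
 thus ?thesis using 2 openin_less[OF _ c, of "%_. ta + si"] by auto
 next
 case 3
 have eq:"{r. s <= r & r <= t} = {s..t}" by auto
 have "ea (?f (p b) - ?f (p a)) <= en (1 / si) * lint a b (%r. g (p r))" if "s <= a" "a < b" "b <= t" for a b
 proof -
 have "ea (?f (p b) - ?f (p a)) <= en (1 / si * abs (w (p b) - w (p a)))" by (rule ennreal_leI[OF lip])
 also have "... = en (1 / si) * ea (w (p b) - w (p a))" using s0 by (simp flip: ennreal_mult)
 also have "... <= en (1 / si) * lint a b (%r. g (p r))" using r that by (intro mult_left_mono) (auto simp: reg_def)
 finally show ?thesis .
 qed
 moreover have "en (1 / si) * lint s t (%r. g (p r)) < oo" using r by (auto simp: reg_def ennreal_mult_less_top)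
 ultimately show ?thesis using 3 by (simp add: eq cm)
 qed
 qed
 qed (use bf in auto)
qed

definition lips :: "real => ('a => real) => bool" where
 "lips L f \<longleftrightarrow> 0 <= L & (ALL x y. abs (f x - f y) <= L * dist x y)"

lemma lips_pcurve:
 assumes "lips L f" "pcurve p l" "0 <= s" "s <= t" "t <= l"
 shows "abs (f (p t) - f (p s)) <= L * (t - s)"
proof -
 have "abs (f (p t) - f (p s)) <= L * dist (p s) (p t)"
 using assms(1) dist_commute[of "p s" "p t"] by (simp add: lips_def)
 also have "... <= L * (t - s)" using assms by (intro mult_left_mono pcurve_lipschitz) (auto simp: lips_def)
 finally show ?thesis .
qed

lemma lips_continuous:"lips L f ==> continuous_on S f"
 unfolding lips_def
 by (rule continuous_on_subset[OF lipschitz_on_continuous_on[of L UNIV]])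
 (auto simp: lipschitz_on_def dist_real_def)

lemma lint_const:"a <= b ==> 0 <= L ==> lint a b (%_. en L) = en (L * (b - a))"
 by (subst nn_integral_cmult_indicator) (auto simp: ennreal_mult)

lemma wug_lips_local:
 assumes f:"lips L f" and A:"A:sets M" and O':"open O'" "!!x. x:O' ==> f x = c"
 shows "wug A f (%x. en L * ind (- O') x)"
proof -
 have [measurable]:"O':sets borel" "A:sets M" using O' A by auto
 let ?P = "%j x. if j = (0::nat) then x:O' else True" and ?g = "%j. if j = (0::nat) then (%_. 0) else (%_. en L)"
 have L:"0 <= L" using f by (simp add: lips_def)
 show ?thesis
 proof (rule wug_patch[where P = ?P and g = ?g])
 show "AM x. x:A --> (EX j. ?P j x & ?g j x <= en L * ind (- O') x)"
 proof (rule AE_I2, rule impI)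
 fix x show "EX j. ?P j x & ?g j x <= en L * ind (- O') x"
 by (cases "x:O'") (auto intro: exI[of _ 0] exI[of _ 1])
 qed
 show "bfin A (%x. en L * ind (- O') x)"
 by (rule bfin_mono[OF bfin_const[OF A, of L]]) (auto simp: indicator_def)
 show "EX j. ?P j x" for x by (intro exI[of _ 1]) auto
 show "arc_ae A (patch ?P ?g f)"
 proof (rule curve_ae_trivial, intro allI impI)
 fix p l s t and j :: nat assume p:"pcurve p l" and st:"0 <= s" "s < t" "t <= l" "p ` {s..t} <= A"
 have eq:"{r. s <= r & r <= t} = {s..t}" by auto
 have "{r:{s..t}. p r:O'} = {s..t} Int p -` O'" by auto
 hence op:"openin (top_of_set {s..t}) {r:{s..t}. p r:O'}"
 using open_vimage[OF O'(1) pcurve_continuous[OF p]] by (auto simp: openin_open)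
 show "patch1 (?P j) (?g j) f p s t"
 proof (cases "j = 0")
 case True
 thus ?thesis using op O'(2) by auto
 next
 case False
 have "ea (f (p b) - f (p a)) <= en (L * (b - a))" if "s <= a" "a < b" "b <= t" for a b
 using lips_pcurve[OF f p, of a b] st that by (intro ennreal_leI) auto
 thus ?thesis using False st L lint_const[of _ _ L] by (auto simp: eq)
 qed
 qed
 qed (use A in auto)
qed

lemma wug_lips:"lips L f ==> A:sets M ==> wug A f (%_. en L)"
 using wug_lips_local[of L f A "{}"] by simp

definition med :: "real => real => real => real" where "med w a b = max a (min w b)"

text \<open>Strictly between the obstacles the function is \<open>w\<close>, and that region is open
  along curves. Elsewhere increments are bounded by those of \<open>w\<close> plus \<open>L\<close>
  times the length, so the extra term lives only where truncation takes place.\<close>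

lemma wug_med:
 fixes w al bt :: "'a => real"
 assumes w:"wug A w G" and m[measurable]:"w:bM"
 and lip:"lips L al" "lips L bt" and le:"!!x. al x <= bt x"
 shows "wug A (%x. med (w x) (al x) (bt x)) (%x. G x + en L * ind {x. ~ (al x < w x & w x < bt x)} x)"
proof -
 have [measurable]:"G:bM" "A:sets M" using wug_meas[OF w] wug_sets[OF w] by auto
 have [measurable]:"al:bB" "bt:bB"
 using lips_continuous lip by (auto intro!: borel_measurable_continuous_onI)
 obtain g where g:"creg A w g" "AM x. g x = G x * ind A x" by (rule wug_creg[OF w])
 have gm[measurable]:"g:bB" using g by (auto simp: creg_def)
 let ?f = "%x. med (w x) (al x) (bt x)"
 let ?G = "%x. G x + en L * ind {x. ~ (al x < w x & w x < bt x)} x"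
 let ?P = "%j x. if j = (0::nat) then al x < w x & w x < bt x else True"
 and ?g = "%j. if j = (0::nat) then g else (%x. g x + en L)"
 have L:"0 <= L" using lip by (simp add: lips_def)
 have contr:"abs (?f x - ?f y) <= max (abs (w x - w y)) (max (abs (al x - al y)) (abs (bt x - bt y)))" for x y
 unfolding med_def by (rule order_trans[OF abs_max_diff]) (use abs_min_diff[of "w x" "bt x" "w y" "bt y"] in "auto simp: le_max_iff_disj")
 show ?thesis
 proof (rule wug_patch[where P = ?P and g = ?g])
 show "AM x. x:A --> (EX j. ?P j x & ?g j x <= ?G x)"
 using g(2)
 proof eventually_elim
 case (elim x)
 thus ?case
 by (cases "al x < w x & w x < bt x") (auto intro: exI[of _ 0] exI[of _ 1])
 qed
 have "bfin A (%x. G x + en L)" by (rule bfin_add) (use wug_fin[OF w] bfin_const in auto)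
 thus "bfin A ?G" by (rule bfin_mono) (auto simp: indicator_def)
 show "EX j. ?P j x" for x by (intro exI[of _ 1]) auto
 show "?g j:bM" for j by (cases "j = 0") auto
 have "arc_ae A (reg w g)"
 using g(1) by (auto simp: creg_def)
 thus "arc_ae A (patch ?P ?g ?f)"
 proof (rule curve_ae_mono, intro allI impI)
 fix p l s t and j :: nat assume p:"pcurve p l" and st:"0 <= s" "s < t" "t <= l" "p ` {s..t} <= A"
 and i:"arcs p l A (reg w g p)"
 have r:"reg w g p s t" using i st by blast
 have [measurable]:"(%r. g (p r)):bB" by (rule pcurve_meas[OF p gm])
 have c:"continuous_on {s..t} (%r. w (p r))" using r by (simp add: reg_def)
 have pc:"continuous_on {s..t} p" using pcurve_continuous[OF p] by (rule continuous_on_subset) simp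
 have ca:"continuous_on {s..t} (%r. al (p r))" "continuous_on {s..t} (%r. bt (p r))"
 using continuous_on_compose2[OF lips_continuous[OF lip(1)] pc subset_UNIV]
 continuous_on_compose2[OF lips_continuous[OF lip(2)] pc subset_UNIV] by auto
 have add:"lint a b (%r. g (p r) + en L) = lint a b (%r. g (p r)) + en (L * (b - a))" if "a <= b" for a b
 using that L by (simp add: distrib_right nn_integral_add nn_integral_cmult_indicator ennreal_mult)
 show "patch1 (?P j) (?g j) ?f p s t"
 proof (cases "j = 0")
 case True
 have "{r:{s..t}. al (p r) < w (p r) & w (p r) < bt (p r)} =
 {r:{s..t}. al (p r) < w (p r)} Int {r:{s..t}. w (p r) < bt (p r)}" by blast
 hence "openin (top_of_set {s..t}) {r:{s..t}. ?P j (p r)}"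
 using openin_less[OF ca(1) c] openin_less[OF c ca(2)] True by (simp add: openin_Int)
 moreover have "(NL {r:{s..t}. ?P j (p r)} (%r. ?g j (p r))) < oo"
 proof -
 have "(NL {r:{s..t}. ?P j (p r)} (%r. ?g j (p r))) <= lint s t (%r. g (p r))"
 using True by (intro nn_integral_mono) (auto simp: indicator_def)
 thus ?thesis using r by (auto simp: reg_def intro: le_less_trans)
 qed
 moreover have "inc ?f (?g j) p a b"
 if ab:"s <= a" "a < b" "b <= t" "ALL r:{a..b}. ?P j (p r)" for a b
 proof -
 have "al (p a) < w (p a)" "w (p a) < bt (p a)" "al (p b) < w (p b)" "w (p b) < bt (p b)"
 using ab True by auto
 hence "?f (p b) - ?f (p a) = w (p b) - w (p a)" by (auto simp: med_def)
 thus ?thesis using r ab True by (simp add: reg_def)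
 qed
 ultimately show ?thesis by blast
 next
 case False
 have eq:"{r. s <= r & r <= t} = {s..t}" by auto
 have "ea (?f (p b) - ?f (p a)) <= lint a b (%r. g (p r)) + en (L * (b - a))"
 if ab:"s <= a" "a < b" "b <= t" for a b
 proof -
 have "abs (?f (p b) - ?f (p a)) <= abs (w (p b) - w (p a)) + L * (b - a)"
 using contr[of "p b" "p a"] lips_pcurve[OF lip(1) p, of a b] lips_pcurve[OF lip(2) p, of a b] st ab L
 mult_nonneg_nonneg[of L "b - a"] by linarith
 hence "ea (?f (p b) - ?f (p a)) <= ea (w (p b) - w (p a)) + en (L * (b - a))"
 using L ab by (simp flip: ennreal_plus)
 also have "... <= lint a b (%r. g (p r)) + en (L * (b - a))"
 using r ab by (intro add_right_mono) (auto simp: reg_def)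
 finally show ?thesis .
 qed
 moreover have "lint s t (%r. g (p r) + en L) < oo" using r st by (subst add) (auto simp: reg_def)
 ultimately show ?thesis using False add by (simp add: eq)
 qed
 qed
 qed auto
qed

text \<open>Once all the functions share one gradient, the inequality on a fixed arc passes to the
  limit. The Borel function \<open>g 0\<close> serves for all of them, as the \<open>g k\<close>
  agree almost everywhere.\<close>

lemma wug_limit:
 fixes f :: "'a => real"
 assumes fk:"!!k. wug A (F k) (G k)" and G:"G':bM" "bfin A G'"
 and le:"!!k. AM x. x:A --> G k x <= G' x" and lim:"!!x. x:A ==> (%k. F k x) ~~> f x"
 shows "wug A f G'"
proof -
 have A:"A:sets M" using fk by (rule wug_sets)
 have "wug A (F k) G'" for k by (rule wug_mono[OF fk G A _ le]) simp
 hence "EX g. creg A (F k) g & (AM x. g x = G' x * ind A x)" for k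
 by (rule wug_creg) blast
 then obtain g where g:"!!k. creg A (F k) (g k)" "!!k. AM x. g k x = G' x * ind A x"
 by metis
 have [measurable]:"g k:bB" for k using g(1)[of k] by (simp add: creg_def)
 have "cwug A (F k) (g 0)" for k
 proof (rule cwug_mono_AE[where G = "g k"])
 show "cwug A (F k) (g k)" unfolding cwug_def
 proof (intro conjI)
 have "arc_ae A (reg (F k) (g k))"
 using g(1)[of k] by (simp add: creg_def)
 thus "arc_ae A (inc (F k) (g k))"
 by (rule curve_ae_mono) (auto simp: reg_def)
 qed measurable
 show "AM x. x:A --> g k x <= g 0 x" using g(2)[of k] g(2)[of 0] by eventually_elim auto
 qed measurable
 hence "curve_ae (%p l. ALL k. arcs p l A (inc (F k) (g 0) p))"
 by (intro curve_ae_all) (simp add: cwug_def)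
 hence "arc_ae A (inc f (g 0))"
 proof (rule curve_ae_mono, intro allI impI)
 fix p l s t assume p:"pcurve p l" and st:"0 <= s" "s < t" "t <= l" "p ` {s..t} <= A"
 and i:"ALL k. arcs p l A (inc (F k) (g 0) p)"
 have "p s:A" "p t:A" using st by auto
 hence "(%k. ea (F k (p t) - F k (p s))) ~~> ea (f (p t) - f (p s))"
 by (intro tendsto_ennrealI tendsto_rabs tendsto_diff lim)
 thus "inc f (g 0) p s t"
 by (rule LIMSEQ_le_const2) (use i st in blast)
 qed
 thus ?thesis
 proof (intro wug_patch1[where g = "g 0", OF A G])
 show "AM x. x:A --> g 0 x <= G' x" using g(2)[of 0] by eventually_elim auto
 qed
qed

end

lemma abel_sum:
 fixes D w :: "nat => real"
 shows "(SUM k<=N. (D k - (case k of 0 => 0 | Suc j => D j)) * w k) = (SUM k<N. D k * (w k - w (Suc k))) + D N * w N"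
 by (induction N) (simp_all add: algebra_simps)

lemma suminf_lim0:
 fixes a :: "nat => ennreal"
 assumes "(\<Sum>n. a n) ~= top" shows "a ~~> 0"
proof -
 have "a n ~= top" for n
 using sum_le_suminf[of a "{n}"] assms by (auto simp: top_unique)
 hence a:"a = (%n. en (enn2real (a n)))" by (simp add: fun_eq_iff less_top)
 hence "summable (%n. enn2real (a n))" using assms by (intro summable_suminf_not_top) auto
 hence "(%n. en (enn2real (a n))) ~~> en 0" by (intro tendsto_ennrealI summable_LIMSEQ_zero)
 thus ?thesis using a by simp
qed

text \<open>Recovers the individual partition functions from their partial sums
  \<open>Ph k\<close>.\<close>

definition consec :: "(nat => 'b => real) => nat => 'b => real" where
 "consec Ph k x = Ph k x - (case k of 0 => 0 | Suc j => Ph j x)"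

context doubling_space begin

text \<open>Since the increments of the partition functions sum to zero, only differences of consecutive
 `w k` are multiplied by gradients of the partition functions.\<close>

lemma wug_partition:
 fixes Ph w :: "nat => 'a => real"
 assumes Ph:"!!k. wug UNIV (Ph k) (e k)" "!!k. Ph k:bM"
 and w:"!!k. wug W (w k) (g k)" "!!k. w k:bM"
 and U:"U:sets M" "U <= W" and mono:"!!k x. 0 <= Ph k x" "!!k x. Ph k x <= Ph (Suc k) x"
 and ev:"arc_ae U (%p s t. (EX N. ALL k>=N. ALL r:{s..t}. Ph k (p r) = 1))"
 and v:"!!x N. x:U ==> (!!k. N <= k ==> Ph k x = 1) ==> v x = (SUM k<=N. consec Ph k x * w k x)"
 and G:"G:bM" "bfin U G"
 "AM x. x:U --> (\<Sum>k. en (consec Ph k x) * g k x + ea (w k x - w (Suc k) x) * e k x) <= G x"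
 shows "wug U v G"
proof -
 have W:"W:sets M" using w(1) by (rule wug_sets)
 have "EX e'. creg UNIV (Ph k) e' & (AM x. e' x = e k x * ind UNIV x)" for k
 using Ph(1)[of k] by (rule wug_creg) blast
 then obtain e' where e':"!!k. creg UNIV (Ph k) (e' k)" "!!k. AM x. e' k x = e k x" by simp metis
 have "EX g'. creg W (w k) g' & (AM x. g' x = g k x * ind W x)" for k
 using w(1)[of k] by (rule wug_creg) blast
 then obtain g' where g':"!!k. creg W (w k) (g' k)" "!!k. AM x. g' k x = g k x * ind W x" by metis
 have em:"e' k:bB" and gm:"g' k:bB" for k
 using e'(1)[of k] g'(1)[of k] by (auto simp: creg_def)
 define S where "S x = (\<Sum>k. en (consec Ph k x) * g' k x + ea (w k x - w (Suc k) x) * e' k x)" for x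
 have et0:"0 <= consec Ph k x" for k x using mono by (cases k) (auto simp: consec_def)
 show ?thesis
 proof (rule wug_patch1[where g = S, OF U(1) G(1,2)])
 have "AM x. ALL k. e' k x = e k x & g' k x = g k x * ind W x"
 using e'(2) g'(2) by (simp add: AE_all_countable)
 with G(3) show "AM x. x:U --> S x <= G x"
 proof eventually_elim
 case (elim x)
 show ?case
 proof
 assume "x:U"
 hence "S x = (\<Sum>k. en (consec Ph k x) * g k x + ea (w k x - w (Suc k) x) * e k x)"
 using elim(2) U(2) unfolding S_def by (intro suminf_cong) auto
 thus "S x <= G x" using elim(1) `x \<in> U` by simp
 qed
 qed
 have "curve_ae (%p l. (ALL k. arcs p l UNIV (reg (Ph k) (e' k) p) &
 arcs p l W (reg (w k) (g' k) p)) &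
 (arcs p l U (%s t. (EX N. ALL k>=N. ALL r:{s..t}. Ph k (p r) = 1))))"
 by (intro curve_ae_conj[OF curve_ae_all ev] creg_conj e'(1) g'(1))
 thus "arc_ae U (inc v S)"
 proof (rule curve_ae_mono, intro allI impI, elim conjE)
 fix p l s t assume p:"pcurve p l" and st:"0 <= s" "s < t" "t <= l" "p ` {s..t} <= U"
 and i:"ALL k. arcs p l UNIV (reg (Ph k) (e' k) p) &
 arcs p l W (reg (w k) (g' k) p)"
 and ev':"arcs p l U (%s t. (EX N. ALL k>=N. ALL r:{s..t}. Ph k (p r) = 1))"
 have sW:"p ` {s..t} <= W" using st(4) U(2) by blast
 have r1:"reg (Ph k) (e' k) p s t" and r2:"reg (w k) (g' k) p s t" for k using i st sW by blast+
 obtain N where N:"!!k r. N <= k ==> r:{s..t} ==> Ph k (p r) = 1" using ev' st by blast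
 have v_eq:"v (p r) = (SUM k<=N. consec Ph k (p r) * w k (p r))" if "r:{s..t}" for r
 using st(4) that N by (intro v) auto
 \<comment> \<open>Two lists of \<open>Suc N\<close> terms are concatenated: gradients of the
   \<open>w k\<close> weighted by the partition functions, then gradients of the \<open>Ph k\<close>
   weighted by the differences of consecutive \<open>w k\<close>.\<close>
 define h where "h k = (if k < Suc N then (%r. g' k (p r)) else (%r. e' (k - Suc N) (p r)))" for k
 define c where "c k = (if k < Suc N then (%r. consec Ph k (p r))
 else (%r. abs (w (k - Suc N) (p r) - w (Suc (k - Suc N)) (p r))))" for k
 have "ea ((%r. v (p r)) t - (%r. v (p r)) s) <= lint s t (%r. SUM k<Suc N + Suc N. en (c k r) * h k r)"
 proof (rule increment_weighted)
 show "h k:bB" for k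
 using pcurve_meas[OF p gm] pcurve_meas[OF p em] by (simp add: h_def)
 have c1:"continuous_on {s..t} (%r. Ph k (p r))" and c2:"continuous_on {s..t} (%r. w k (p r))" for k
 using r1[of k] r2[of k] by (auto simp: reg_def)
 have "continuous_on {s..t} (%r. consec Ph k (p r))" for k
 unfolding consec_def by (cases k) (auto intro!: continuous_intros c1)
 thus "continuous_on {s..t} (c k)" for k
 by (auto simp: c_def intro!: continuous_intros c2)
 show "lint s t (h k) < oo" for k using r1 r2 by (auto simp: h_def reg_def)
 show "0 <= c k r" for k r using et0 by (simp add: c_def)
 fix a b assume ab:"s <= a" "a < b" "b <= t"
 let ?D = "%k. Ph k (p b) - Ph k (p a)"
 \<comment> \<open>A discrete product rule. Its second sum is rearranged by Abel summation, whose
   boundary term vanishes since \<open>Ph N\<close> is one at both end points.\<close>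
 have "v (p b) - v (p a) = (SUM k<=N. consec Ph k (p b) * (w k (p b) - w k (p a))) + (SUM k<=N. (consec Ph k (p b) - consec Ph k (p a)) * w k (p a))"
 using v_eq[of b] v_eq[of a] ab by (simp add: sum_subtractf[symmetric] sum.distrib[symmetric] algebra_simps)
 also have "(SUM k<=N. (consec Ph k (p b) - consec Ph k (p a)) * w k (p a)) =
 (SUM k<=N. (?D k - (case k of 0 => 0 | Suc j => ?D j)) * w k (p a))"
 by (intro sum.cong refl) (auto simp: consec_def split: nat.split)
 also have "... = (SUM k<N. ?D k * (w k (p a) - w (Suc k) (p a))) + ?D N * w N (p a)" by (rule abel_sum)
 also have "?D N = 0" using N[of N a] N[of N b] ab by simp
 finally have "abs (v (p b) - v (p a)) <= (SUM k<=N. abs (consec Ph k (p b) * (w k (p b) - w k (p a)))) + (SUM k<N. abs (?D k * (w k (p a) - w (Suc k) (p a))))"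
 using sum_abs[of "%k. consec Ph k (p b) * (w k (p b) - w k (p a))" "{..N}"]
 sum_abs[of "%k. ?D k * (w k (p a) - w (Suc k) (p a))" "{..<N}"] by linarith
 also have "... <= (SUM k<Suc N. max (c k a) (c k b) * abs (w k (p b) - w k (p a))) + (SUM k<Suc N. max (c (Suc N + k) a) (c (Suc N + k) b) * abs (?D k))"
 proof (intro add_mono)
 have "abs (consec Ph k (p b) * (w k (p b) - w k (p a))) <= max (c k a) (c k b) * abs (w k (p b) - w k (p a))" if "k < Suc N" for k
 using that et0[of k "p b"] unfolding abs_mult by (intro mult_right_mono) (auto simp: c_def)
 thus "(SUM k<=N. abs (consec Ph k (p b) * (w k (p b) - w k (p a)))) <= (SUM k<Suc N. max (c k a) (c k b) * abs (w k (p b) - w k (p a)))"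
 unfolding lessThan_Suc_atMost by (intro sum_mono) auto
 have "abs (?D k * (w k (p a) - w (Suc k) (p a))) <= max (c (Suc N + k) a) (c (Suc N + k) b) * abs (?D k)" for k
 unfolding abs_mult mult.commute[of "abs (?D k)"] by (intro mult_right_mono) (auto simp: c_def)
 hence "(SUM k<N. abs (?D k * (w k (p a) - w (Suc k) (p a)))) <= (SUM k<N. max (c (Suc N + k) a) (c (Suc N + k) b) * abs (?D k))"
 by (intro sum_mono) auto
 also have "... <= (SUM k<Suc N. max (c (Suc N + k) a) (c (Suc N + k) b) * abs (?D k))"
 by (simp add: c_def le_max_iff_disj)
 finally show "(SUM k<N. abs (?D k * (w k (p a) - w (Suc k) (p a)))) <= (SUM k<Suc N. max (c (Suc N + k) a) (c (Suc N + k) b) * abs (?D k))" .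
 qed
 finally have "ea (v (p b) - v (p a)) <= en ((SUM k<Suc N. max (c k a) (c k b) * abs (w k (p b) - w k (p a))) + (SUM k<Suc N. max (c (Suc N + k) a) (c (Suc N + k) b) * abs (?D k)))"
 by (rule ennreal_leI)
 also have "... = (SUM k<Suc N. en (max (c k a) (c k b)) * ea (w k (p b) - w k (p a))) + (SUM k<Suc N. en (max (c (Suc N + k) a) (c (Suc N + k) b)) * ea (?D k))"
 proof -
 have pos:"0 <= max (c k a) (c k b)" for k using et0 by (auto simp: c_def le_max_iff_disj)
 show ?thesis using pos
 by (subst ennreal_plus) (auto intro!: sum_nonneg simp: sum_ennreal[symmetric] ennreal_mult simp del: sum.lessThan_Suc)
 qed
 also have "... <= (SUM k<Suc N. en (max (c k a) (c k b)) * lint a b (h k)) + (SUM k<Suc N. en (max (c (Suc N + k) a) (c (Suc N + k) b)) * lint a b (h (Suc N + k)))"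
 using r1 r2 ab by (intro add_mono sum_mono mult_left_mono) (auto simp: h_def reg_def)
 also have "... = (SUM k<Suc N + Suc N. en (max (c k a) (c k b)) * lint a b (h k))"
 by (rule sum_lessThan_split[symmetric])
 finally show "ea ((%r. v (p r)) b - (%r. v (p r)) a) <= (SUM k<Suc N + Suc N. en (max (c k a) (c k b)) * lint a b (h k))" .
 qed (use st in auto)
 also have "... <= lint s t (%r. S (p r))"
 proof (rule lint_mono)
 fix r
 have "(SUM k<Suc N + Suc N. en (c k r) * h k r) =
 (SUM k<Suc N. en (consec Ph k (p r)) * g' k (p r) + ea (w k (p r) - w (Suc k) (p r)) * e' k (p r))"
 unfolding sum_lessThan_split sum.distrib by (intro arg_cong2[where f = "(+)"] sum.cong) (auto simp: c_def h_def)
 also have "... <= S (p r)" unfolding S_def by (intro sum_le_suminf) auto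
 finally show "(SUM k<Suc N + Suc N. en (c k r) * h k r) <= S (p r)" .
 qed
 finally show "inc v S p s t" .
 qed
 qed
qed

section \<open>Capacity\<close>

lemma L1_norm_real:"L1_norm \<mu> A (%x. ereal (f x)) = NI A (%x. ea (f x))"
proof -
 have "e2ennreal (ereal (abs a)) = ea a" for a
 using e2ennreal_abs_diff[of a 0] by (simp add: zero_ereal_def)
 thus ?thesis by (simp add: L1_norm_def)
qed

lemma wug_cwug:"wug A f G ==> EX G'. ecwug A (%x. ereal (f x)) G' & (AM x. x:A --> G' x <= G x)"
 unfolding wug_def cwug_iff by blast

lemma wug_N11:
 fixes f :: "'a => real"
 assumes f:"wug A f G" and m:"f:bM"
 shows "N11_norm \<mu> A (%x. ereal (f x)) <= NI A (%x. ea (f x)) + NI A G"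
 and "NI A (%x. ea (f x)) < oo ==> (NI A G) < oo ==> (%x. ereal (f x)):N11 \<mu> A"
proof -
 obtain G' where G':"ecwug A (%x. ereal (f x)) G'" "AM x. x:A --> G' x <= G x" using wug_cwug[OF f] by blast
 have le:"NI A G' <= NI A G"
 by (rule nn_integral_mono_AE, rule eventually_mono[OF G'(2)]) (auto simp: indicator_def)
 show "N11_norm \<mu> A (%x. ereal (f x)) <= NI A (%x. ea (f x)) + NI A G"
 using N11_norm_le[OF G'(1)] le unfolding L1_norm_real by (meson add_left_mono order_trans)
 assume "NI A (%x. ea (f x)) < oo" "NI A G < oo"
 thus "(%x. ereal (f x)):N11 \<mu> A"
 using le m by (intro N11I[OF wug_sets[OF f] _ _ G'(1)])
 (auto simp: L1_norm_real intro: le_less_trans measurable_restrict_space1)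
qed

lemma Cap1_le:
 fixes f :: "'a => real"
 assumes f:"wug UNIV f G" "f:bM" and A:"!!x. x:A ==> 1 <= f x"
 shows "cap A <= (NN x. ea (f x)) + (NN x. G x)"
proof (cases "(NN x. ea (f x)) < oo & (NN x. G x) < oo")
 case True
 hence "(%x. ereal (f x)):N11 \<mu> UNIV" using wug_N11(2)[OF f] by simp
 hence "cap A <= N11_norm \<mu> UNIV (%x. ereal (f x))"
 unfolding Cap1_def using A by (intro INF_lower) auto
 also have "... <= (NN x. ea (f x)) + (NN x. G x)" using wug_N11(1)[OF f] by simp
 finally show ?thesis .
next
 case False
 hence "(NN x. ea (f x)) = top \<or> (NN x. G x) = top" 
 using less_top by (metis infinity_ennreal_def)
 thus ?thesis by auto
qed

lemma Cap1_mono:"A <= B ==> cap A <= cap B"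
 unfolding Cap1_def by (intro INF_superset_mono) auto

lemma wug_max:"wug A f F ==> wug A g G ==> wug A (%x. max (f x) (g x)) (%x. F x + G x)"
 by (erule wug_contract, assumption) (rule order_trans[OF abs_max_diff], simp)

lemma wug_min:"wug A f F ==> wug A g G ==> wug A (%x. min (f x) (g x)) (%x. F x + G x)"
 by (erule wug_contract, assumption) (rule order_trans[OF abs_min_diff], simp)

text \<open>The sum of the \<open>f n\<close>, truncated at one, is the limit of truncated partial
  sums that all have the full sum of the \<open>g n\<close> as a gradient. This is countable
  subadditivity of capacity at the level of test functions.\<close>

lemma wug_sup_sum:
 fixes f :: "nat => 'a => real"
 assumes f:"!!n. wug UNIV (f n) (g n)" "!!n. f n:bM" "!!n x. 0 <= f n x"
 and fin:"(\<Sum>n. NN x. g n x) < oo"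
 shows "EX F. wug UNIV F (%x. \<Sum>n. g n x) & F:bM & (ALL x. 0 <= F x) &
 (ALL x n. (SUM k<n. f k x) >= 1 --> F x = 1) & (ALL x. en (F x) <= (\<Sum>n. en (f n x)))"
proof -
 have [measurable]:"g n:bM" "f n:bM" for n using wug_meas[OF f(1)] f(2) by auto
 define S where "S n x = min 1 (SUM k<n. f k x)" for n x
 define F where "F x = (SUP n. S n x)" for x
 have inc:"incseq (%n. S n x)" for x
 unfolding S_def by (intro incseq_SucI min.mono) (simp_all add: f(3))
 have bdd:"bdd_above (range (%n. S n x))" for x by (auto simp: S_def intro!: bdd_aboveI[of _ 1])
 have lim:"(%n. S n x) ~~> F x" for x unfolding F_def by (rule LIMSEQ_incseq_SUP[OF bdd inc])
 have le:"S n x <= F x" for n x unfolding F_def by (rule cSUP_upper[OF _ bdd]) simp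
 have [measurable]:"S n:bM" for n unfolding S_def by measurable
 have int:"(NN x. (\<Sum>n. g n x)) < oo" using fin by (subst nn_integral_suminf) auto
 have wS:"wug UNIV (S n) (%x. (SUM k<n. g k x))" for n
 proof -
 have "wug UNIV (%x. min 1 (SUM k<n. f k x)) (%x. 0 + (SUM k<n. g k x))"
 by (intro wug_min wug_zero wug_sum f(1)) auto
 thus ?thesis by (simp add: S_def[abs_def])
 qed
 show ?thesis
 proof (intro exI[of _ F] conjI allI impI)
 show "wug UNIV F (%x. \<Sum>n. g n x)"
 proof (rule wug_limit[OF wS])
 show "AM x. x:UNIV --> (SUM k<n. g k x) <= (\<Sum>n. g n x)" for n
 by (intro AE_I2 impI sum_le_suminf) auto
 show "bfin UNIV (%x. \<Sum>n. g n x)" using int by (intro bfinI) simp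
 qed (use lim in auto)
 show "F:bM" by (rule borel_measurable_LIMSEQ_real[OF lim]) measurable
 show "0 <= F x" for x using le[of 0 x] by (simp add: S_def)
 have F1:"F x <= 1" for x unfolding F_def by (rule cSUP_least) (auto simp: S_def)
 show "F x = 1" if "(SUM k<n. f k x) >= 1" for x n using le[of n x] F1[of x] that by (simp add: S_def min_def)
 show "en (F x) <= (\<Sum>n. en (f n x))" for x
 proof (rule LIMSEQ_le_const2[OF tendsto_ennrealI[OF lim[of x]]], intro exI allI impI)
 fix n
 have "en (S n x) <= en (SUM k<n. f k x)" by (intro ennreal_leI) (simp add: S_def)
 also have "... = (SUM k<n. en (f k x))" using f(3) by (simp add: sum_ennreal)
 also have "... <= (\<Sum>n. en (f n x))" by (rule sum_le_suminf) auto
 finally show "en (S n x) <= (\<Sum>n. en (f n x))" .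
 qed
 qed
qed

text \<open>A Borel-Cantelli argument for capacity: with \<open>2 ^ n * ps n\<close> in place of
  \<open>ps n\<close> the norms are still summable, and at a point where \<open>ps n\<close> does
  not tend to zero these products reach one at arbitrarily late indices.\<close>

lemma Cap1_eventually_small:
 fixes ps :: "nat => 'a => real"
 assumes ps:"!!n. wug UNIV (ps n) (g n)" "!!n. ps n:bM" "!!n x. 0 <= ps n x"
 and small:"!!n. (NN x. en (ps n x)) + (NN x. g n x) <= en ((1 / 4) ^ n)"
 shows "cap {x. ~ (ALL ep>0. EX N. ALL n>=N. ps n x < ep)} = 0"
proof -
 let ?Z = "{x. ~ (ALL ep>0. EX N. ALL n>=N. ps n x < ep)}"
 have "cap ?Z <= en (2 * (1 / 2) ^ N)" for N
 proof -
 \<comment> \<open>Starting at index \<open>N\<close> makes the total norm at most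
   \<open>2 * (1 / 2) ^ N\<close>, which tends to zero.\<close>
 define f where "f n x = 2 ^ (N + n) * ps (N + n) x" for n x
 define h where "h n x = en (2 ^ (N + n)) * g (N + n) x" for n x
 have [measurable]:"g n:bM" "ps n:bM" for n using wug_meas[OF ps(1)] ps(2) by auto
 have fM:"f n:bM" for n unfolding f_def by measurable
 have f_nonneg:"0 <= f n x" for n x by (simp add: f_def ps(3))
 have fw:"wug UNIV (f n) (h n)" for n unfolding f_def
 proof (rule wug_mult[OF wug_zero ps(1)])
 show "AM x. x:UNIV --> ea (2 ^ (N + n)) * g (N + n) x + ea (ps (N + n) x) * 0 <= h n x"
 by (simp add: h_def)
 have "(NN x. g (N + n) x) <= en ((1 / 4) ^ (N + n))"
 by (rule order_trans[OF _ small]) simp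
 hence "(NN x. g (N + n) x) < oo" by (rule le_less_trans) simp
 hence "(NN x. h n x) < oo" unfolding h_def by (subst nn_integral_cmult) (auto simp: ennreal_mult_less_top)
 thus "bfin UNIV (h n)" by (intro bfinI) simp
 show "h n:bM" unfolding h_def by measurable
 qed auto
 have bound:"(NN x. en (f n x)) + (NN x. h n x) <= en ((1 / 2) ^ N * (1 / 2) ^ n)" for n
 proof -
 have "(NN x. en (f n x)) + (NN x. h n x) =
 en (2 ^ (N + n)) * ((NN x. en (ps (N + n) x)) + (NN x. g (N + n) x))"
 unfolding f_def h_def using ps(3) by (simp add: ennreal_mult nn_integral_cmult distrib_left)
 also have "... <= en (2 ^ (N + n)) * en ((1 / 4) ^ (N + n))" by (intro mult_left_mono small) auto
 also have "... = en ((2 * (1 / 4)) ^ (N + n))" by (simp flip: ennreal_mult power_mult_distrib)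
 also have "... = en ((1 / 2) ^ N * (1 / 2) ^ n)" by (simp add: power_add)
 finally show ?thesis .
 qed
 have geo:"(\<Sum>n. en ((1 / 2) ^ N * (1 / 2) ^ n)) = en (2 * (1 / 2) ^ N)"
 proof -
 have "(%n. (1 / 2) ^ N * (1 / 2) ^ n) sums ((1 / 2) ^ N * (1 / (1 - 1 / 2 :: real)))"
 by (intro sums_mult geometric_sums) auto
 thus ?thesis by (subst suminf_ennreal2) (auto simp: sums_iff mult.commute)
 qed
 have tot:"(\<Sum>n. NN x. en (f n x)) + (\<Sum>n. NN x. h n x) <= en (2 * (1 / 2) ^ N)"
 using bound unfolding geo[symmetric] suminf_add[OF summableI summableI] by (intro suminf_le) auto
 have "(\<Sum>n. NN x. h n x) <= en (2 * (1 / 2) ^ N)" using tot by (rule order_trans[rotated]) simp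
 hence fin:"(\<Sum>n. NN x. h n x) < oo" by (rule le_less_trans) simp
 obtain F where F:"wug UNIV F (%x. \<Sum>n. h n x)" "F:bM" "ALL x. 0 <= F x"
 "ALL x n. (SUM k<n. f k x) >= 1 --> F x = 1" "ALL x. en (F x) <= (\<Sum>n. en (f n x))"
 using wug_sup_sum[OF fw fM f_nonneg fin] by (elim exE conjE)
 have "1 <= F x" if x:"x:?Z" for x
 proof -
 obtain ep where ep:"ep > 0" "!!N. EX n>=N. ep <= ps n x" using x by (auto simp: not_less)
 obtain m where m:"1 / ep < 2 ^ m" using real_arch_pow[of 2 "1 / ep"] by auto
 obtain n where n:"n >= max N m" "ep <= ps n x" using ep(2) by blast
 have "1 = 1 / ep * ep" using ep(1) by simp
 also have "... <= 2 ^ n * ps n x"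
 proof (rule mult_mono)
 have "2 ^ m <= (2::real) ^ n" using n by (intro power_increasing) auto
 thus "1 / ep <= 2 ^ n" using m by linarith
 qed (use n ep(1) in auto)
 also have "... = f (n - N) x" using n by (simp add: f_def)
 also have "... <= (SUM k<Suc (n - N). f k x)" by (simp add: f_def ps(3) sum_nonneg)
 finally show ?thesis using F(4)[rule_format, of x "Suc (n - N)"] by simp
 qed
 hence "cap ?Z <= (NN x. ea (F x)) + (NN x. (\<Sum>n. h n x))"
 by (rule Cap1_le[OF F(1,2)])
 also have "(NN x. ea (F x)) <= (NN x. (\<Sum>n. en (f n x)))"
 using F(3,5) by (intro nn_integral_mono) simp
 also have "... = (\<Sum>n. NN x. en (f n x))" by (rule nn_integral_suminf) (auto simp: f_def)
 also have "(NN x. (\<Sum>n. h n x)) = (\<Sum>n. NN x. h n x)" by (rule nn_integral_suminf) (auto simp: h_def)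
 finally show ?thesis using tot by (simp add: add_right_mono order_trans)
 qed
 hence "(%_::nat. cap ?Z) ~~> cap ?Z ==> cap ?Z <= en 0"
 proof -
 have "(%N. 2 * (1 / 2) ^ N :: real) ~~> 2 * 0" by (intro tendsto_intros LIMSEQ_power_zero) auto
 hence "(%N. en (2 * (1 / 2) ^ N)) ~~> en 0" by (intro tendsto_ennrealI) simp
 thus ?thesis by (rule LIMSEQ_le_const) (use `\<And>N. Cap1 \<mu> ?Z \<le> ennreal (2 * (1 / 2) ^ N)` in blast)
 qed
 thus ?thesis by simp
qed

text \<open>Along almost every curve the line integrals of the \<open>g n\<close> tend to zero, and
  with them the oscillation of \<open>ps n\<close>. At some point of the curve, outside a null set,
  the values tend to zero as well.\<close>

lemma curve_ae_eventually_small: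
 fixes ps :: "nat => 'a => real"
 assumes ps:"!!n. wug UNIV (ps n) (g n)" "!!n. ps n:bM" "!!n x. 0 <= ps n x"
 and small:"(\<Sum>n. NN x. en (ps n x)) < oo" "(\<Sum>n. NN x. g n x) < oo"
 shows "curve_ae (%p l. ALL ep>0. EX N. ALL n>=N. ALL r:{0..l}. ps n (p r) < ep)"
proof -
 have "EX g'. creg UNIV (ps k) g' & (AM x. g' x = g k x * ind UNIV x)" for k
 using ps(1)[of k] by (rule wug_creg) blast
 then obtain g' where g':"!!k. creg UNIV (ps k) (g' k)" "!!k. AM x. g' k x = g k x" by simp metis
 have gm[measurable]:"g' n:bB" for n using g'(1)[of n] by (simp add: creg_def)
 have [measurable]:"ps n:bM" for n by (rule ps)
 have "(NN x. (\<Sum>n. g' n x)) = (\<Sum>n. NN x. g' n x)" by (rule nn_integral_suminf) measurable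
 also have "... = (\<Sum>n. NN x. g n x)" using g'(2) by (intro suminf_cong nn_integral_cong_AE) auto
 finally have fin:"(NN x. (\<Sum>n. g' n x)) < oo" using small by simp
 have "(NN x. (\<Sum>n. en (ps n x))) < oo" using small by (subst nn_integral_suminf) auto
 hence "AM x. (\<Sum>n. en (ps n x)) ~= oo" by (intro nn_integral_PInf_AE) auto
 then obtain E0 where E0:"E0:sets M" "eM E0 = 0" "{x. ~ (\<Sum>n. en (ps n x)) ~= oo} <= E0"
 by (auto elim!: AE_E)
 obtain E where E:"E:sets borel" "E0 <= E" "eM E = 0" using null_borel_hull[OF E0(2,1)] .
 have "curve_ae (%p l. (ALL n. arcs p l UNIV (reg (ps n) (g' n) p)) &
 lint 0 l (%r. \<Sum>n. g' n (p r)) < oo & (AE r in lborel. r:{0..l} --> p r ~: E))"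
 using g'(1) by (intro curve_ae_conj curve_ae_all curve_ae_int[where G = "%x. \<Sum>n. g' n x"] curve_ae_null E fin)
 (auto simp: creg_def)
 thus ?thesis
 proof (rule curve_ae_mono, intro allI impI, elim conjE)
 fix p l and ep :: real assume p:"pcurve p l" and ep:"ep > 0"
 and i:"ALL n. arcs p l UNIV (reg (ps n) (g' n) p)"
 and fin:"lint 0 l (%r. \<Sum>n. g' n (p r)) < oo" and ae:"AE r in lborel. r:{0..l} --> p r ~: E"
 have l:"0 < l" using p by (rule pcurve_pos)
 have [measurable]:"(%r. g' n (p r)):bB" for n by (rule pcurve_meas[OF p gm])
 have "(\<Sum>n. lint 0 l (%r. g' n (p r))) = lint 0 l (%r. \<Sum>n. g' n (p r))"
 by (subst nn_integral_suminf[symmetric]) (auto simp: ennreal_suminf_multc)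
 hence "(\<Sum>n. lint 0 l (%r. g' n (p r))) < oo" using fin by simp
 hence lim1:"(%n. lint 0 l (%r. g' n (p r))) ~~> 0"
 by (intro suminf_lim0) (auto simp: less_top)
 have "EX r:{0..l}. p r ~: E"
 proof (rule ccontr)
 assume "~ ?thesis"
 hence "AE r in lborel. r ~: {0..l}" using ae by (auto elim: eventually_mono)
 hence "emeasure lborel {0..l} = 0" by (subst (asm) AE_iff_measurable[of "{0..l}"]) auto
 thus False using l by simp
 qed
 then obtain r0 where r0:"r0:{0..l}" "p r0 ~: E" by blast
 hence "(\<Sum>n. en (ps n (p r0))) ~= oo" using E0(3) E(2) by blast
 hence lim2:"(%n. en (ps n (p r0))) ~~> 0" by (intro suminf_lim0) auto
 have "(%n. en (ps n (p r0)) + lint 0 l (%r. g' n (p r))) ~~> 0 + 0"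
 by (intro tendsto_add lim1 lim2)
 hence "evs (%n. en (ps n (p r0)) + lint 0 l (%r. g' n (p r)) < en ep)"
 using ep by (intro order_tendstoD(2)[of _ 0]) auto
 then obtain N where N:"!!n. n >= N ==> ennreal (ps n (p r0)) + lint 0 l (%r. g' n (p r)) < en ep"
 unfolding eventually_sequentially by blast
 have "ps n (p r) < ep" if n:"n >= N" and r:"r:{0..l}" for n r
 proof -
 have "en (ps n (p r)) <= en (ps n (p r0)) + ea (ps n (p r) - ps n (p r0))"
 using ps(3) by (simp flip: ennreal_plus add: ennreal_leI)
 also have "ea (ps n (p r) - ps n (p r0)) <= lint 0 l (%r. g' n (p r))"
 proof -
 have rg:"reg (ps n) (g' n) p 0 l" using i l by auto
 have "ea (ps n (p r) - ps n (p r0)) <= lint (min r r0) (max r r0) (%r. g' n (p r))"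
 proof (cases "r = r0")
 case False
 thus ?thesis using rg r r0 unfolding reg_def
 by (cases "r < r0") (auto simp: min_def max_def abs_minus_commute)
 qed simp
 also have "... <= lint 0 l (%r. g' n (p r))" using r r0 by (intro lint_subinterval) auto
 finally show ?thesis .
 qed
 finally have "en (ps n (p r)) < en ep" using N[OF n] by (simp add: add_left_mono order.strict_trans1)
 thus ?thesis using ps(3) by (simp add: ennreal_less_iff)
 qed
 thus "EX N. ALL n>=N. ALL r:{0..l}. ps n (p r) < ep" by blast
 qed
qed

text \<open>Each ball gets a Lipschitz cutoff of slope \<open>1 / r i\<close> that equals one on it.
  As radii are at most one, \<open>1 / r i\<close> bounds the cutoff as well as its
  gradient.\<close>

lemma Cap1_balls:
 fixes x :: "nat => 'a"
 assumes r:"!!i. i:I ==> 0 < r i" "!!i. i:I ==> r i <= 1"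
 shows "cap (UN i:I. ball (x i) (r i)) <= en (2 * Cd ^ 2) * (\<Sum>i. if i:I then mb (x i) (r i) / en (r i) else 0)"
 (is "_ <= _ * ?S")
proof (cases "?S = oo")
 case True
 thus ?thesis using Cd by (simp add: ennreal_mult_top)
next
 case False
 define f where "f i y = (if i:I then max 0 (min 1 (2 - dist (x i) y / r i)) else 0)" for i y
 define g where "g i y = (if i:I then en (1 / r i) * ind (- {y. 2 * r i < dist (x i) y}) y else 0)" for i y
 have f0:"f i y = 0" if "i:I" "2 * r i <= dist (x i) y" for i y
 proof -
 have "2 <= dist (x i) y / r i" using that r(1)[OF that(1)] by (simp add: pos_le_divide_eq)
 thus ?thesis using that(1) by (simp add: f_def)
 qed
 have f1:"f i y = 1" if "i:I" "dist (x i) y <= r i" for i y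
 proof -
 have "dist (x i) y / r i <= 1" using that r(1)[OF that(1)] by (simp add: pos_divide_le_eq)
 thus ?thesis using that(1) by (simp add: f_def)
 qed
 have [measurable]:"g i:bB" for i
 proof -
 have "open {y. 2 * r i < dist (x i) y}" by (intro open_Collect_less continuous_intros)
 hence [measurable]:"{y. 2 * r i < dist (x i) y}:sets borel" by simp
 show ?thesis
 proof (cases "i:I")
 case True thus ?thesis unfolding g_def if_P[OF True] by measurable
 next
 case False
 hence "g i = (%_. 0)" by (auto simp: g_def)
 thus ?thesis by simp
 qed
 qed
 have fw:"wug UNIV (f i) (g i)" for i
 proof (cases "i:I")
 case True
 have "lips (1 / r i) (f i)"
 proof -
 have "abs (f i y - f i z) <= 1 / r i * dist y z" for y z
 proof -
 have "abs (f i y - f i z) <= abs ((2 - dist (x i) y / r i) - (2 - dist (x i) z / r i))"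
 unfolding f_def if_P[OF True] by (rule clamp_contract)
 also have "... = abs (dist (x i) y - dist (x i) z) / r i"
 using r(1)[OF True] by (simp add: abs_minus_commute flip: diff_divide_distrib)
 also have "... <= dist y z / r i"
 using r(1)[OF True] abs_dist_diff_le[of y "x i" z] by (intro divide_right_mono) (auto simp: dist_commute)
 finally show ?thesis by simp
 qed
 thus ?thesis using r(1)[OF True] by (simp add: lips_def)
 qed
 moreover have "f i y = 0" if "y:{y. 2 * r i < dist (x i) y}" for y
 using that True by (intro f0) auto
 moreover have "open {y. 2 * r i < dist (x i) y}" by (intro open_Collect_less continuous_intros)
 ultimately show ?thesis using True wug_lips_local[of "1 / r i" "f i" UNIV "{y. 2 * r i < dist (x i) y}" 0]
 by (simp add: g_def[abs_def])
 next
 case False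
 thus ?thesis using wug_zero[of UNIV 0] by (simp add: f_def[abs_def] g_def[abs_def])
 qed
 have fm[measurable]:"f i:bB" for i
 proof -
 have "continuous_on UNIV (%y. max 0 (min 1 (2 - dist (x i) y / r i)))" if "i:I"
 using r(1)[OF that] by (intro continuous_intros) auto
 thus ?thesis by (cases "i:I") (auto simp: f_def[abs_def] intro: borel_measurable_continuous_onI)
 qed
 have fM:"f i:bM" for i by measurable
 have f_nonneg:"0 <= f i y" for i y by (simp add: f_def)
 \<comment> \<open>The closed ball of radius \<open>2 * r i\<close>, outside which the cutoff is
   locally zero, lies in the open ball of radius \<open>4 * r i\<close>, two doublings away from
   radius \<open>r i\<close>.\<close>
 have four:"mb (x i) (4 * r i) <= en (Cd ^ 2) * mb (x i) (r i)" if "i:I" for i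
 using doubling_pow[of "r i" "x i" 2] r(1)[OF that] by (simp add: power2_eq_square)
 let ?b = "%i. en (Cd ^ 2) * (if i:I then mb (x i) (r i) / en (r i) else 0)"
 have int:"(NN y. en (f i y)) <= ?b i" "(NN y. g i y) <= ?b i" for i
 proof -
 have *: "(NN y. en (f i y)) <= en (Cd ^ 2) * (mb (x i) (r i) / en (r i)) &
 (NN y. g i y) <= en (Cd ^ 2) * (mb (x i) (r i) / en (r i))" if i:"i:I"
 proof -
 have ri:"0 < r i" "r i <= 1" "1 <= 1 / r i" using r[OF i] by auto
 have "en (f i y) <= en (1 / r i) * ind (ball (x i) (4 * r i)) y" for y
 proof (cases "y:ball (x i) (4 * r i)")
 case True
 have "f i y <= 1" using i by (simp add: f_def)
 also have "1 <= 1 / r i" by (rule ri)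
 finally have "en (f i y) <= en (1 / r i)" by (rule ennreal_leI)
 thus ?thesis using True by simp
 next
 case False
 hence "f i y = 0" using ri i by (intro f0) auto
 thus ?thesis by simp
 qed
 moreover have "g i y <= en (1 / r i) * ind (ball (x i) (4 * r i)) y" for y
 using ri i by (auto simp: g_def indicator_def)
 moreover have "(NN y. en (1 / r i) * ind (ball (x i) (4 * r i)) y) <= en (Cd ^ 2) * (mb (x i) (r i) / en (r i))"
 proof -
 have "(NN y. en (1 / r i) * ind (ball (x i) (4 * r i)) y) = en (1 / r i) * mb (x i) (4 * r i)"
 by (subst nn_integral_cmult_indicator) (auto simp: emeasure_ball)
 also have "... <= en (1 / r i) * (en (Cd ^ 2) * mb (x i) (r i))" by (intro mult_left_mono four i) auto
 also have "... = en (Cd ^ 2) * (mb (x i) (r i) / en (r i))"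
 proof -
 have "en (1 / r i) = inverse (en (r i))" using ri by (simp add: inverse_ennreal divide_inverse)
 thus ?thesis by (simp only: divide_ennreal_def mult_ac)
 qed
 finally show ?thesis .
 qed
 ultimately show ?thesis by (meson nn_integral_mono order_trans)
 qed
 show "(NN y. en (f i y)) <= ?b i" "(NN y. g i y) <= ?b i"
 by (cases "i:I", simp only: if_True *, simp add: f_def g_def)+
 qed
 have sums:"(\<Sum>i. NN y. en (f i y)) <= en (Cd ^ 2) * ?S" "(\<Sum>i. NN y. g i y) <= en (Cd ^ 2) * ?S"
 unfolding ennreal_suminf_cmult[symmetric] by (intro suminf_le int summableI)+
 have fin:"(\<Sum>i. NN y. g i y) < oo"
 by (rule le_less_trans[OF sums(2)]) (use False in "auto simp: ennreal_mult_less_top less_top")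
 obtain F where F:"wug UNIV F (%x. \<Sum>n. g n x)" "F:bM" "ALL x. 0 <= F x"
 "ALL x n. (SUM k<n. f k x) >= 1 --> F x = 1" "ALL x. en (F x) <= (\<Sum>n. en (f n x))"
 using wug_sup_sum[OF fw fM f_nonneg fin] by (elim exE conjE)
 have "1 <= F y" if y:"y:(UN i:I. ball (x i) (r i))" for y
 proof -
 obtain i where i:"i:I" "dist (x i) y < r i" using y by auto
 hence "1 = f i y" using f1[of i y] by simp
 also have "... <= (SUM k<Suc i. f k y)" by (simp add: sum_nonneg f_def)
 finally show ?thesis using F(4)[rule_format, of y "Suc i"] by simp
 qed
 hence "cap (UN i:I. ball (x i) (r i)) <= (NN x. ea (F x)) + (NN x. (\<Sum>n. g n x))"
 by (rule Cap1_le[OF F(1,2)])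
 also have "... <= (NN x. (\<Sum>n. en (f n x))) + (NN x. (\<Sum>n. g n x))"
 using F(3,5) by (intro add_right_mono nn_integral_mono) simp
 also have "... = (\<Sum>n. NN x. en (f n x)) + (\<Sum>n. NN x. g n x)"
 by (intro arg_cong2[where f = "(+)"] nn_integral_suminf) auto
 also have "... <= en (Cd ^ 2) * ?S + en (Cd ^ 2) * ?S" by (intro add_mono sums)
 also have "... = en (2 * Cd ^ 2) * ?S"
 unfolding distrib_right[symmetric] using Cd by (simp flip: ennreal_plus)
 finally show ?thesis .
qed

lemma content_Cap1:
 fixes A :: "'a set"
 assumes "HC R A < c" "R <= 1"
 obtains G where "open G" "A <= G" "cap G <= en (2 * Cd ^ 2) * c"
proof -
 obtain I x r where I:"ALL i:I. 0 < r i & r i <= R" "A <= (UN i:I. ball (x i) (r i))"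
 "(\<Sum>i. if i:I then mb (x i) (r i) / en (r i) else 0) < c"
 using assms(1) unfolding hausdorff_content_def INF_less_iff by auto
 show ?thesis
 proof (rule that[of "UN i:I. ball (x i) (r i)"])
 have "cap (UN i:I. ball (x i) (r i)) <= en (2 * Cd ^ 2) * (\<Sum>i. if i:I then mb (x i) (r i) / en (r i) else 0)"
 using I(1) assms(2) by (intro Cap1_balls) auto
 also have "... <= en (2 * Cd ^ 2) * c" using I(3) by (intro mult_left_mono) auto
 finally show "cap (UN i:I. ball (x i) (r i)) <= en (2 * Cd ^ 2) * c" .
 qed (use I in auto)
qed

section \<open>Total variation of real functions as a relaxed energy\<close>

definition locint :: "'a set => ('a => real) => bool" where
 "locint W f \<longleftrightarrow> f:bM &
 (ALL K. compact K --> K <= W --> NI K (%x. ea (f x)) < oo)"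

definition lconv :: "'a set => (nat => 'a => real) => ('a => real) => bool" where
 "lconv W F f \<longleftrightarrow> (ALL K. compact K --> K <= W --> (%i. NI K (%x. ea (F i x - f x))) ~~> 0)"

definition appr :: "'a set => ('a => real) => (nat => 'a => real) => (nat => 'a => ennreal) => bool" where
 "appr W f F G \<longleftrightarrow> (ALL i. wug W (F i) (G i) & locint W (F i)) & lconv W F f"

text \<open>The relaxation of \<open>total_variation_open\<close>, for real functions and with
  arbitrary gradients in place of minimal ones; \<open>tv_open_eq\<close> identifies the two on open
  sets.\<close>

definition tv :: "'a set => ('a => real) => ennreal" where
 "tv W f = (INF (F, G)\<in>{(F, G). appr W f F G}. liminf (%i. NI W (G i)))"

lemma apprD:"appr W f F G ==> wug W (F i) (G i)" "appr W f F G ==> F i:bM"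
 "appr W f F G ==> G i:bM" "appr W f F G ==> locint W (F i)"
 by (auto simp: appr_def locint_def dest: wug_meas)

lemma lconvD:"lconv W F f ==> compact K ==> K <= W ==> (%i. NI K (%x. ea (F i x - f x))) ~~> 0"
 by (simp add: lconv_def)

lemma appr_lconv:"appr W f F G ==> lconv W F f"
 by (simp add: appr_def)

lemma appr_subseq:"appr W f F G ==> strict_mono r ==> appr W f (%i. F (r i)) (%i. G (r i))"
 unfolding appr_def lconv_def by (auto intro: LIMSEQ_subseq_LIMSEQ[unfolded o_def])

lemma tv_le:"appr W f F G ==> tv W f <= liminf (%i. NI W (G i))"
 unfolding tv_def by (rule INF_lower2[of "(F, G)"]) auto

lemma frequently_subseq:
 assumes "\<exists>\<^sub>F i in sequentially. P i"
 obtains r :: "nat => nat" where "strict_mono r" "!!i. P (r i)"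
proof -
 have inf:"infinite {i. P i}"
 using assms by (simp add: INFM_iff_infinite frequently_cofinite[symmetric] cofinite_eq_sequentially)
 show thesis
 by (rule that[of "enumerate {i. P i}"]) (use inf enumerate_in_set[OF inf] in "auto simp: strict_mono_enumerate")
qed

lemma squeeze0:"(!!i. a i <= b i) ==> b ~~> 0 ==> a ~~> 0" for a b :: "nat => ennreal"
 by (rule tendsto_sandwich[OF _ _ tendsto_const]) auto

lemma liminf_freq:"liminf a < c ==> \<exists>\<^sub>F i in sequentially. a i < c" for a :: "nat => ennreal"
 by (rule ccontr) (auto simp: not_frequently not_less dest!: Liminf_bounded)

lemma tv_less:
 assumes "tv W f < c"
 obtains F G where "appr W f F G" "!!i. NI W (G i) < c"
proof -
 obtain F G where FG:"appr W f F G" "liminf (%i. NI W (G i)) < c"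
 using assms unfolding tv_def INF_less_iff by auto
 obtain r :: "nat => nat" where r:"strict_mono r" "!!i. NI W (G (r i)) < c"
 using frequently_subseq[OF liminf_freq[OF FG(2)]] by blast
 show thesis by (rule that[OF appr_subseq[OF FG(1) r(1)] r(2)])
qed

lemma ni_AE_set:
 assumes "AM x. x:A --> f x = g x" shows "NI A f = NI A g"
 by (rule nn_integral_cong_AE) (use assms in "auto simp: indicator_def")

lemma ni_mono:
 assumes "A <= B" "!!x. x:A ==> f x <= g x" shows "NI A f <= NI B g"
 by (rule nn_integral_mono) (use assms in "auto simp: indicator_def")

lemma nn_integral_cover:
 assumes "finite I" "!!i. i:I ==> A i:sets M" "f:bM" "K <= (UN i:I. A i)"
 shows "NI K f <= (SUM i:I. NI (A i) f)"
proof -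
 have "NI K f <= (NN x. (SUM i:I. f x * ind (A i) x))"
 proof (rule nn_integral_mono)
 fix x
 show "f x * ind K x <= (SUM i:I. f x * ind (A i) x)"
 proof (cases "x:K")
 case True
 then obtain i where "i:I" "x:A i" using assms(4) by auto
 hence "f x * ind K x = f x * ind (A i) x" using True by simp
 also have "... <= (SUM i:I. f x * ind (A i) x)"
 using `i \<in> I` assms(1) by (intro member_le_sum) auto
 finally show ?thesis .
 qed simp
 qed
 also have "... = (SUM i:I. NI (A i) f)"
 using assms by (intro nn_integral_sum) auto
 finally show ?thesis .
qed

lemma L1_loc_cover:
 fixes W :: "'a set"
 assumes u:"u:L1_loc \<mu> W" and W:"open W"
 obtains C r where "countable C" "C <= W" "W = (UN x:C. ball x (r x))" "!!x. x:W ==> 0 < r x & ball x (r x) <= W & u:L1 \<mu> (ball x (r x))"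
proof -
 have "EX r>0. ball x r <= W & u:L1 \<mu> (ball x r)" if x:"x:W" for x
 proof -
 obtain r where r:"r > 0" "u:L1 \<mu> (W Int ball x r)" using u x by (auto simp: L1_loc_def)
 obtain r' where r':"r' > 0" "ball x r' <= W" using W x open_contains_ball by blast
 have sub:"ball x (min r r') <= W Int ball x r" using r' by auto
 have "u:borel_measurable (restrict_space M (ball x (min r r')))"
 using measurable_restrict_mono[OF _ sub] r by (auto simp: L1_def)
 moreover have "L1_norm \<mu> (ball x (min r r')) u <= L1_norm \<mu> (W Int ball x r) u"
 unfolding L1_norm_def by (rule ni_mono[OF sub]) simp
 ultimately show ?thesis using r r' by (intro exI[of _ "min r r'"]) (auto simp: L1_def)
 qed
 hence "ALL x:W. EX r>0. ball x r <= W & u:L1 \<mu> (ball x r)" by blast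
 from bchoice[OF this] obtain r where r:"ALL x:W. 0 < r x & ball x (r x) <= W & u:L1 \<mu> (ball x (r x))" ..
 obtain C where "countable C" "C <= W" "W <= (UN x:C. ball x (r x))"
 using lindelof[of W r] r by blast
 thus thesis using r by (intro that[of C r]) auto
qed

text \<open>Infinite values occur on a null set only, since \<open>u\<close> is integrable on each
  ball of a countable cover.\<close>

lemma L1_loc_real:
 fixes W :: "'a set"
 assumes u:"u:L1_loc \<mu> W" and W:"open W"
 defines "f \<equiv> %x. if x:W then real_of_ereal (u x) else 0"
 shows "locint W f" "AM x. x:W --> u x = ereal (f x)"
proof -
 obtain C r where C:"countable C" "C <= W" "W = (UN x:C. ball x (r x))"
 "!!x. x:W ==> 0 < r x & ball x (r x) <= W & u:L1 \<mu> (ball x (r x))"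
 by (rule L1_loc_cover[OF u W]) blast
 have um:"u:borel_measurable (restrict_space M (ball x (r x)))" and ui:"L1_norm \<mu> (ball x (r x)) u < oo" if "x:W" for x
 using C(4)[OF that] by (auto simp: L1_def)
 have "f:bM"
 proof (rule measurable_piecewise_restrict[where C = "insert (- W) ((%x. ball x (r x)) ` C)"])
 fix B assume B:"B:insert (- W) ((%x. ball x (r x)) ` C)"
 show "B Int space M:sets M" using B W by (auto intro!: borel_M')
 show "f:borel_measurable (restrict_space M B)"
 proof (cases "B = - W")
 case True
 show ?thesis by (subst measurable_cong[where g = "%_. 0"]) (auto simp: True f_def space_restrict_space)
 next
 case False
 then obtain x where x:"x:C" "B = ball x (r x)" using B by auto
 have "x:W" using x C(2) by auto
 thus ?thesis using C(4)[of x] um[of x] unfolding x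
 by (subst measurable_cong[where g = "%y. real_of_ereal (u y)"]) (auto simp: f_def space_restrict_space)
 qed
 qed (use C in auto)
 moreover have le:"ea (f x) <= e2ennreal (abs (u x))" for x
 by (cases "u x") (auto simp: f_def)
 have "NI K (%x. ea (f x)) < oo" if K:"compact K" "K <= W" for K
 proof -
 have cov:"K <= (UN x:W. ball x (r x))" using K(2) C(4) by force
 obtain T where T:"T <= W" "finite T" "K <= (UN x:T. ball x (r x))"
 by (rule compactE_image[OF K(1) open_ball cov])
 have "NI K (%x. ea (f x)) <= (SUM i:T. NI (ball i (r i)) (%x. ea (f x)))"
 using `f \<in> bM` T by (intro nn_integral_cover) auto
 also have "... <= (SUM i:T. L1_norm \<mu> (ball i (r i)) u)"
 unfolding L1_norm_def by (intro sum_mono ni_mono le) auto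
 also have "... < oo" using ui T by (auto simp: less_top[symmetric])
 finally show ?thesis .
 qed
 ultimately show "locint W f" unfolding locint_def by blast
 have "AM x. ALL c:C. x:ball c (r c) --> u x = ereal (f x)"
 proof (subst AE_ball_countable[OF C(1)], safe)
 fix c assume c:"c:C"
 hence cW:"c:W" using C(2) by auto
 have m:"(%x. e2ennreal (abs (u x))):borel_measurable (restrict_space M (ball c (r c)))"
 using um[OF cW] by simp
 have i:"(\<integral>\<^sup>+x. e2ennreal (abs (u x)) \<partial>restrict_space M (ball c (r c))) < oo"
 using ui[OF cW] unfolding L1_norm_def by (subst nn_integral_restrict_space) (auto intro: borel_M')
 have "AE x in restrict_space M (ball c (r c)). e2ennreal (abs (u x)) ~= oo"
 using nn_integral_noteq_infinite[OF m] i by auto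
 hence "AM x. x:ball c (r c) --> e2ennreal (abs (u x)) ~= oo"
 by (subst (asm) AE_restrict_space_iff) (auto intro: borel_M')
 thus "AM x. x:ball c (r c) --> u x = ereal (f x)"
 proof eventually_elim
 case (elim x)
 thus ?case using C(4)[OF cW] by (cases "u x") (auto simp: f_def)
 qed
 qed
 thus "AM x. x:W --> u x = ereal (f x)"
 by eventually_elim (use C(3) in blast)
qed

text \<open>Compact sets have finite covers by the given neighbourhoods, and conversely small closed
  balls are compact.\<close>

lemma L1_loc_tendsto_iff:
 fixes W :: "'a set"
 assumes W:"open W" and F[measurable]:"!!i. F i:bM" "f:bM"
 and eq:"!!i. AM x. x:W --> us i x = ereal (F i x)" "AM x. x:W --> u x = ereal (f x)"
 shows "L1_loc_tendsto \<mu> W us u \<longleftrightarrow> lconv W F f"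
proof -
 have n:"L1_norm \<mu> B (%y. us i y - u y) = NI B (%x. ea (F i x - f x))" if "B <= W" for B i
 unfolding L1_norm_def
 proof (rule ni_AE_set)
 show "AM x. x:B --> e2ennreal (abs (us i x - u x)) = ea (F i x - f x)"
 using eq(1)[of i] eq(2)
 proof eventually_elim
 case (elim x)
 show ?case
 proof
 assume "x:B"
 hence "us i x = ereal (F i x)" "u x = ereal (f x)" using elim that by blast+
 thus "e2ennreal (abs (us i x - u x)) = ea (F i x - f x)" by (simp only: e2ennreal_abs_diff)
 qed
 qed
 qed
 show ?thesis
 proof
 assume L:"L1_loc_tendsto \<mu> W us u"
 show "lconv W F f" unfolding lconv_def
 proof (intro allI impI)
 fix K assume K:"compact K" "K <= W"
 have "ALL x:W. EX r>0. (%i. NI (W Int ball x r) (%x. ea (F i x - f x))) ~~> 0"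
 using L unfolding L1_loc_tendsto_def by (simp add: n)
 from bchoice[OF this] obtain r where
 r:"ALL x:W. 0 < r x & (%i. NI (W Int ball x (r x)) (%y. ea (F i y - f y))) ~~> 0" ..
 have cov:"K <= (UN x:W. W Int ball x (r x))" using K(2) r by force
 obtain T where T:"T <= W" "finite T" "K <= (UN x:T. W Int ball x (r x))"
 by (rule compactE_image[OF K(1) _ cov]) (use W in auto)
 have "(%i. SUM c:T. NI (W Int ball c (r c)) (%x. ea (F i x - f x))) ~~> (SUM c:T. 0)"
 using r T by (intro tendsto_sum) blast
 moreover have "NI K (%x. ea (F i x - f x)) <= (SUM c:T. NI (W Int ball c (r c)) (%x. ea (F i x - f x)))" for i
 proof (rule nn_integral_cover[OF T(2) _ _ T(3)])
 show "W Int ball c (r c):sets M" for c using W by (intro borel_M') auto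
 show "(%x. ea (F i x - f x)):bM" by measurable
 qed
 ultimately show "(%i. NI K (%x. ea (F i x - f x))) ~~> 0"
 using squeeze0[of "%i. NI K (%x. ea (F i x - f x))"
 "%i. SUM c:T. NI (W Int ball c (r c)) (%x. ea (F i x - f x))"] by simp
 qed
 next
 assume L:"lconv W F f"
 show "L1_loc_tendsto \<mu> W us u" unfolding L1_loc_tendsto_def
 proof
 fix x assume "x:W"
 with W obtain r where r:"r > 0" "cball x r <= W" unfolding open_contains_cball by blast
 have "(%i. NI (W Int ball x r) (%x. ea (F i x - f x))) ~~> 0"
 proof (rule squeeze0)
 show "(%i. NI (cball x r) (%y. ea (F i y - f y))) ~~> 0" by (rule lconvD[OF L compact_cball r(2)])
 show "NI (W Int ball x r) (%y. ea (F i y - f y)) <= NI (cball x r) (%y. ea (F i y - f y))" for i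
 by (intro ni_mono) auto
 qed
 thus "EX r>0. (%i. L1_norm \<mu> (W Int ball x r) (%y. us i y - u y)) ~~> 0"
 using r by (intro exI[of _ r]) (simp add: n)
 qed
 qed
qed

lemma ecwug_real:"ecwug W u G ==> cwug W (%x. real_of_ereal (u x)) G"
proof -
 have "ea (real_of_ereal a - real_of_ereal b) <= e2ennreal (abs (a - b))" for a b
 by (cases a; cases b) (auto simp: top_unique)
 thus "ecwug W u G ==> cwug W (%x. real_of_ereal (u x)) G"
 unfolding ecwug_def cwug_def
 apply -
 apply (erule conjE, rule conjI, assumption, erule curve_ae_mono)
 apply (meson order_trans)
 done
qed

lemma N11_loc_L1_loc:"N11_loc \<mu> W <= L1_loc \<mu> W"
 by (force simp: N11_loc_def L1_loc_def N11_def L1_def N11_norm_def less_top[symmetric])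

lemma wug_outside:"wug A f G ==> (!!x. x:A ==> f' x = f x) ==> wug A f' G"
proof -
 assume w:"wug A f G" and e:"!!x. x:A ==> f' x = f x"
 have *: "cwug A f G' ==> cwug A f' G'" for G'
 unfolding cwug_def using e by (auto elim!: curve_ae_mono simp: image_subset_iff)
 show ?thesis using w * unfolding wug_def by blast
qed

lemma N11_loc_I:
 assumes W:"open W" and F:"wug W F G" "locint W F"
 shows "(%x. ereal (F x)):N11_loc \<mu> W" unfolding N11_loc_def
proof (intro CollectI ballI)
 fix x assume "x:W"
 then obtain r where r:"r > 0" "cball x r <= W" using W open_contains_cball by blast
 have m:"W Int ball x r:sets M" using W by (intro borel_M') auto
 have "NI (W Int ball x r) (%y. ea (F y)) <= NI (cball x r) (%y. ea (F y))"
 by (intro ni_mono) auto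
 also have "... < oo" using F(2) r by (auto simp: locint_def)
 finally have 1:"NI (W Int ball x r) (%y. ea (F y)) < oo" .
 have "NI (W Int ball x r) G <= NI (W Int ball ctr (dist ctr x + r)) G"
 by (intro ni_mono) (auto intro!: le_less_trans[OF dist_triangle[of ctr _ x]])
 also have "... < oo" using wug_fin[OF F(1)] by (simp add: bfin_def)
 finally have 2:"NI (W Int ball x r) G < oo" .
 show "EX r>0. (%x. ereal (F x)):N11 \<mu> (W Int ball x r)"
 using r wug_N11(2)[OF wug_subset[OF F(1) m] _ 1 2] F(2) by (auto simp: locint_def)
qed

lemma tv_open_eq:
 fixes W :: "'a set"
 assumes W:"open W" and f:"f:bM" and eq:"AM x. x:W --> u x = ereal (f x)"
 shows "total_variation_open \<mu> W u = tv W f"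
proof (rule antisym)
 have Wm:"W:sets M" using W by (intro borel_M') auto
 show "total_variation_open \<mu> W u <= tv W f" unfolding tv_def
 proof (intro INF_greatest, safe)
 fix F G assume FG:"appr W f F G"
 let ?us = "%i x. ereal (F i x)"
 have us:"?us i:N11_loc \<mu> W" for i
 by (rule N11_loc_I[OF W]) (use apprD[OF FG] in auto)
 have "L1_loc_tendsto \<mu> W ?us u"
 by (subst L1_loc_tendsto_iff[where F = F and f = f]) (use W f eq FG apprD[OF FG] in "auto simp: appr_def")
 hence "total_variation_open \<mu> W u <= liminf (%i. NI W (minimal_wug \<mu> W (?us i)))"
 unfolding total_variation_open_def using us by (intro INF_lower2[of ?us]) auto
 also have "... <= liminf (%i. NI W (G i))"
 proof (intro Liminf_mono always_eventually allI)
 fix i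
 from wug_cwug[OF apprD(1)[OF FG, of i]] obtain G' where G':"ecwug W (?us i) G'" "AM x. x:W --> G' x <= G i x" by auto
 have "lion W G'"
 using lion_mono_AE[OF bfin_lion[OF wug_fin[OF apprD(1)[OF FG, of i]]] G'(2)] .
 hence "NI W (minimal_wug \<mu> W (?us i)) <= NI W G'"
 by (rule minimal_wug_le[OF Wm G'(1)])
 also have "... <= NI W (G i)"
 by (rule nn_integral_mono_AE) (use G'(2) in "auto simp: indicator_def")
 finally show "NI W (minimal_wug \<mu> W (?us i)) <= NI W (G i)" .
 qed
 finally show "total_variation_open \<mu> W u <= liminf (%i. NI W (G i))" .
 qed
 show "tv W f <= total_variation_open \<mu> W u"
 unfolding total_variation_open_def
 proof (intro INF_greatest, safe)
 fix us assume us:"ALL i. us i:N11_loc \<mu> W" and L:"L1_loc_tendsto \<mu> W us u"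
 let ?a = "%i. NI W (minimal_wug \<mu> W (us i))"
 define F where "F i x = (if x:W then real_of_ereal (us i x) else 0)" for i x
 have F:"locint W (F i)" "AM x. x:W --> us i x = ereal (F i x)" for i
 using L1_loc_real[OF _ W, of "us i"] us N11_loc_L1_loc by (auto simp: F_def[abs_def])
 have lc:"lconv W F f"
 by (subst L1_loc_tendsto_iff[symmetric, OF W _ f F(2) eq]) (use F L in "auto simp: locint_def")
 have "EX G. ecwug W (us i) G & (AM x. G x = minimal_wug \<mu> W (us i) x * ind W x)" for i
 using N11_loc_minimal_ecwug[OF Wm, of "us i"] us by metis
 hence "ALL i. EX G. ecwug W (us i) G & (AM x. G x = minimal_wug \<mu> W (us i) x * ind W x)" ..
 from choice[OF this] obtain G where "ALL i. ecwug W (us i) (G i) & (AM x. G i x = minimal_wug \<mu> W (us i) x * ind W x)" ..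
 hence G:"!!i. ecwug W (us i) (G i)" "!!i. AM x. G i x = minimal_wug \<mu> W (us i) x * ind W x" by auto
 have Gi:"NI W (G i) = ?a i" for i
 by (rule ni_AE_set) (use G(2)[of i] in "auto simp: indicator_def elim!: eventually_mono")
 \<comment> \<open>Finite energy makes the gradient integrable on bounded sets. A lower limit below
   \<open>c\<close> leaves infinitely many such indices, to which the sequence is then
   restricted.\<close>
 have wu:"wug W (F i) (G i)" if "?a i < oo" for i
 proof -
 have "wug W (%x. real_of_ereal (us i x)) (G i)" unfolding wug_def
 using Wm ecwug_real[OF G(1)[of i]] ecwug_borel[OF G(1)[of i]] that Gi[of i] by (auto intro!: bfinI borel_measurable_M)
 thus ?thesis by (rule wug_outside) (simp add: F_def)
 qed
 show "tv W f <= liminf ?a"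
 proof (rule dense_ge)
 fix c assume "liminf ?a < c"
 from liminf_freq[OF this] obtain r :: "nat => nat" where r:"strict_mono r" "!!i. ?a (r i) < c"
 using frequently_subseq by blast
 have "appr W f (%i. F (r i)) (%i. G (r i))" unfolding appr_def
 proof (intro conjI allI)
 fix i
 have "?a (r i) < oo" using r(2)[of i] by (metis infinity_ennreal_def order_less_le_trans top_greatest)
 thus "wug W (F (r i)) (G (r i))" by (rule wu)
 show "locint W (F (r i))" by (rule F)
 show "lconv W (%i. F (r i)) f"
 unfolding lconv_def using lconvD[OF lc] r(1) by (auto intro: LIMSEQ_subseq_LIMSEQ[unfolded o_def])
 qed
 hence "tv W f <= liminf (%i. NI W (G (r i)))" by (rule tv_le)
 also have "... <= c"
 by (rule Liminf_le) (use r(2) in "auto simp: Gi less_imp_le")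
 finally show "tv W f <= c" .
 qed
 qed
qed

text \<open>A diagonal argument along a compact exhaustion: it suffices to approximate on one
  compact set with one error at a time.\<close>

lemma tv_diag:
 fixes W :: "'a set"
 assumes W:"open W"
 and a:"!!e K. e > 0 ==> compact K ==> K <= W ==> EX F G. wug W F G & locint W F &
 (NI K (%x. ea (F x - f x))) <= en e & NI W G <= c + en e"
 shows "tv W f <= c"
proof -
 obtain K where K:"!!n::nat. compact (K n)" "!!n. K n <= W" "!!n m. n <= m ==> K n <= K m"
 "!!L. compact L ==> L <= W ==> EX n. L <= K n" using exhaustion[OF W] by blast
 have "EX F G. wug W F G & locint W F & NI (K n) (%x. ea (F x - f x)) <= en (1 / Suc n) &
 (NI W G) <= c + en (1 / Suc n)" for n
 by (rule a[OF _ K(1,2)]) auto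
 hence "ALL n. EX FG. wug W (fst FG) (snd FG) & locint W (fst FG) & NI (K n) (%x. ea (fst FG x - f x)) <= en (1 / Suc n) &
 (NI W (snd FG)) <= c + en (1 / Suc n)" by simp
 from choice[OF this] obtain H where H:"ALL n. wug W (fst (H n)) (snd (H n)) & locint W (fst (H n)) & NI (K n) (%x. ea (fst (H n) x - f x)) <= en (1 / Suc n) &
 (NI W (snd (H n))) <= c + en (1 / Suc n)" ..
 define F G where "F n = fst (H n)" and "G n = snd (H n)" for n
 have FG:"!!n. wug W (F n) (G n)" "!!n. locint W (F n)"
 "!!n. NI (K n) (%x. ea (F n x - f x)) <= en (1 / Suc n)" "!!n. NI W (G n) <= c + en (1 / Suc n)"
 using H by (auto simp: F_def G_def)
 have l0:"(%n. en (rs n)) ~~> 0"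
 using tendsto_ennrealI[OF LIMSEQ_inverse_real_of_nat] by (simp add: inverse_eq_divide)
 have "lconv W F f" unfolding lconv_def
 proof (intro allI impI)
 fix L assume "compact L" "L <= W"
 then obtain N where N:"L <= K N" using K(4) by blast
 have "NI L (%x. ea (F n x - f x)) <= en (1 / Suc n)" if "n >= N" for n
 by (rule order_trans[OF ni_mono FG(3)]) (use N K(3)[OF that] in auto)
 thus "(%n. NI L (%x. ea (F n x - f x))) ~~> 0"
 by (intro tendsto_sandwich[OF _ _ tendsto_const l0]) (auto simp: eventually_sequentially)
 qed
 hence "tv W f <= liminf (%i. NI W (G i))" using FG by (intro tv_le[of _ _ F]) (auto simp: appr_def)
 also have "... <= liminf (%n. c + en (1 / Suc n))"
 by (intro Liminf_mono always_eventually) (use FG in auto)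
 also have "... = c"
 by (rule lim_imp_Liminf) (use tendsto_add[OF tendsto_const l0, of c] in auto)
 finally show ?thesis .
qed

lemma tv_mono:
 assumes V:"V <= W" "V:sets M" shows "tv V f <= tv W f"
 unfolding tv_def[of W]
proof (intro INF_greatest, safe)
 fix F G assume FG:"appr W f F G"
 have "appr V f F G" unfolding appr_def
 using FG V wug_subset[OF _ V(2,1)] by (auto simp: appr_def lconv_def locint_def)
 hence "tv V f <= liminf (%i. NI V (G i))" by (rule tv_le)
 also have "... <= liminf (%i. NI W (G i))"
 by (intro Liminf_mono always_eventually allI ni_mono) (use V in auto)
 finally show "tv V f <= liminf (%i. NI W (G i))" .
qed

lemma wug_scale:
 assumes "wug A f G" "abs c <= 1" shows "wug A (%x. c * f x) G"
proof -
 have "wug A (%x. c * f x) (%x. G x + 0)"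
 proof (rule wug_contract[OF assms(1) wug_zero[OF wug_sets[OF assms(1)], of 0]])
 fix x y
 have "abs (c * f x - c * f y) = abs c * abs (f x - f y)" by (metis abs_mult right_diff_distrib)
 also have "... <= 1 * abs (f x - f y)" by (intro mult_right_mono assms) auto
 finally show "abs (c * f x - c * f y) <= abs (f x - f y) + abs (0 - 0)" by simp
 qed
 thus ?thesis by simp
qed

lemma wug_uminus:"wug A f G ==> wug A (%x. - f x) G"
 using wug_scale[of A f G "-1"] by simp

lemma appr_uminus:"appr W f F G ==> appr W (%x. - f x) (%i x. - F i x) G"
 by (auto simp: appr_def lconv_def locint_def intro: wug_uminus) (simp add: abs_minus_commute[of "f _"] algebra_simps)

lemma appr_clamp:
 assumes FG:"appr W f F G" and f:"!!x. 0 <= f x & f x <= 1"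
 shows "appr W f (%i x. max 0 (min 1 (F i x))) G"
proof -
 note [measurable] = apprD(2,3)[OF FG]
 have c:"abs (max 0 (min 1 a) - max 0 (min 1 b)) <= abs (a - b)" for a b :: real by auto
 have "wug W (%x. max 0 (min 1 (F i x))) (%x. G i x + 0)" for i
 by (rule wug_contract[OF apprD(1)[OF FG] wug_zero[of _ 0]]) (use c wug_sets[OF apprD(1)[OF FG, of i]] in auto)
 moreover have "locint W (%x. max 0 (min 1 (F i x)))" for i unfolding locint_def
 proof (intro conjI allI impI)
 fix K :: "'a set" assume K:"compact K" "K <= W"
 have "NI K (%x. ea (max 0 (min 1 (F i x)))) <= NI K (%x. ea (F i x))"
 by (intro ni_mono ennreal_leI) auto
 thus "NI K (%x. ea (max 0 (min 1 (F i x)))) < oo"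
 using apprD(4)[OF FG, of i] K by (auto simp: locint_def intro: le_less_trans)
 qed measurable
 moreover have "lconv W (%i x. max 0 (min 1 (F i x))) f" unfolding lconv_def
 proof (intro allI impI)
 fix K :: "'a set" assume K:"compact K" "K <= W"
 have "abs (max 0 (min 1 (F i x)) - f x) <= abs (F i x - f x)" for i x
 using c[of "F i x" "f x"] f[of x] by auto
 thus "(%i. NI K (%x. ea (max 0 (min 1 (F i x)) - f x))) ~~> 0"
 by (intro squeeze0[OF _ lconvD[OF appr_lconv[OF FG] K]]) (auto intro!: ni_mono ennreal_leI)
 qed
 ultimately show ?thesis by (simp add: appr_def)
qed

end

section \<open>Codimension one Hausdorff content\<close>

lemma less_add_pos:"a < top ==> 0 < b ==> a < a + b" for a b :: ennreal
 by (cases a; cases b) (auto simp: ennreal_less_iff simp flip: ennreal_plus)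

context doubling_space begin

text \<open>Fatou for the counting measure turns a sum of lower limits into a lower limit of sums,
  where the overlap bound \<open>N\<close> replaces the sum by a single integral.\<close>

lemma sum_liminf_le:
 fixes G :: "nat => 'a => ennreal" and A :: "'i => 'a set"
 assumes I:"countable I" and [measurable]:"!!k. G k:bM" "!!i. i:I ==> A i:sets M"
 and N:"!!x. (\<integral>\<^sup>+i. ind (A i) x \<partial>count_space I) <= N * ind V x"
 shows "(\<integral>\<^sup>+i. liminf (%k. NI (A i) (G k)) \<partial>count_space I) <= liminf (%k. NN x. N * (G k x * ind V x))"
proof -
 have "(\<integral>\<^sup>+i. liminf (%k. NI (A i) (G k)) \<partial>count_space I) <= liminf (%k. \<integral>\<^sup>+i. NI (A i) (G k) \<partial>count_space I)"
 by (rule nn_integral_liminf) simp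
 also have "... <= liminf (%k. NN x. N * (G k x * ind V x))"
 proof (intro Liminf_mono always_eventually allI)
 fix k
 have "(\<integral>\<^sup>+i. NI (A i) (G k) \<partial>count_space I) = (\<integral>\<^sup>+x. (\<integral>\<^sup>+i. G k x * ind (A i) x \<partial>count_space I) \<partial>M)"
 by (rule nn_integral_count_space_nn_integral[symmetric, OF I]) auto
 also have "... <= (NN x. N * (G k x * ind V x))"
 proof (rule nn_integral_mono)
 fix x
 have "(\<integral>\<^sup>+i. G k x * ind (A i) x \<partial>count_space I) = G k x * (\<integral>\<^sup>+i. ind (A i) x \<partial>count_space I)"
 by (rule nn_integral_cmult) simp
 also have "... <= G k x * (N * ind V x)" by (intro mult_left_mono N) simp
 finally show "(\<integral>\<^sup>+i. G k x * ind (A i) x \<partial>count_space I) <= N * (G k x * ind V x)" by (simp add: ac_simps)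
 qed
 finally show "(\<integral>\<^sup>+i. NI (A i) (G k) \<partial>count_space I) <= (NN x. N * (G k x * ind V x))" .
 qed
 finally show ?thesis .
qed

lemma content_le:
 fixes c :: "'i => 'a"
 assumes T:"countable T" and r:"!!i. i:T ==> 0 < r i" "!!i. i:T ==> r i <= R" and S:"S <= (UN i:T. ball (c i) (r i))"
 shows "HC R S <= (\<integral>\<^sup>+i. mb (c i) (r i) / en (r i) \<partial>count_space T)"
proof -
 define I where "I = to_nat_on T ` T"
 define f where "f = from_nat_into T"
 have f:"f (to_nat_on T i) = i" if "i:T" for i using T that by (simp add: f_def)
 have bij:"bij_betw f I T" unfolding I_def
 by (rule bij_betw_byWitness[where f' = "to_nat_on T"]) (auto simp: f)
 let ?a = "%i. mb (c i) (r i) / en (r i)"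
 have "HC R S <= (\<Sum>n. if n:I then mb (c (f n)) (r (f n)) / en (r (f n)) else 0)"
 unfolding hausdorff_content_def
 by (rule INF_lower2[of "(I, %n. c (f n), %n. r (f n))"]) (use r S in "force simp: I_def f", simp)
 also have "... = (\<integral>\<^sup>+n. (if n:I then ?a (f n) else 0) \<partial>count_space UNIV)"
 by (simp add: nn_integral_count_space_nat)
 also have "... = (\<integral>\<^sup>+n. ?a (f n) \<partial>count_space I)"
 by (subst nn_integral_count_space_indicator) (auto intro!: nn_integral_cong)
 also have "... = (\<integral>\<^sup>+i. ?a i \<partial>count_space T)" by (rule nn_integral_bij_count_space[OF bij])
 finally show ?thesis .
qed

lemma content_less:
 assumes "HC R S < c"
 shows "EX (I::nat set) x r. (ALL i:I. 0 < r i & r i <= R) & S <= (UN i:I. ball (x i) (r i)) &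
 (\<integral>\<^sup>+i. mb (x i) (r i) / en (r i) \<partial>count_space I) < c"
proof -
 obtain I x r where *: "ALL i:I. 0 < r i & r i <= R" "S <= (UN i:I. ball (x i) (r i))"
 "(\<Sum>i. if i:(I::nat set) then mb (x i) (r i) / en (r i) else 0) < c"
 using assms unfolding hausdorff_content_def INF_less_iff by auto
 have "(\<integral>\<^sup>+i. mb (x i) (r i) / en (r i) \<partial>count_space I) = (\<integral>\<^sup>+i. (if i:I then mb (x i) (r i) / en (r i) else 0) \<partial>count_space UNIV)"
 by (subst nn_integral_count_space_indicator) (auto intro!: nn_integral_cong)
 thus ?thesis using * by (intro exI[of _ I] exI[of _ x] exI[of _ r]) (simp add: nn_integral_count_space_nat)
qed

lemma content_mono:"S <= S' ==> HC R S <= HC R S'"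
 unfolding hausdorff_content_def by (rule INF_superset_mono) auto

lemma content_UN:
 fixes S :: "nat => 'a set"
 shows "HC R (UN n. S n) <= (\<Sum>n. HC R (S n))"
proof (rule ennreal_le_epsilon)
 fix e :: real assume fin:"(\<Sum>n. HC R (S n)) < top" and e:"0 < e"
 have f:"HC R (S n) < HC R (S n) + en (e * (1/2) ^ Suc n)" for n
 proof -
 have "HC R (S n) <= (\<Sum>n. HC R (S n))"
 using sum_le_suminf[OF summableI, of "{n}" "%n. HC R (S n)"] by simp
 hence "HC R (S n) < top" using fin by (rule le_less_trans)
 thus ?thesis using e by (intro less_add_pos) auto
 qed
 have "ALL n. EX t::nat set \<times> (nat => 'a) \<times> (nat => real). (ALL i:fst t. 0 < snd (snd t) i & snd (snd t) i <= R) & S n <= (UN i:fst t. ball (fst (snd t) i) (snd (snd t) i)) &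
 (\<integral>\<^sup>+i. mb (fst (snd t) i) (snd (snd t) i) / en (snd (snd t) i) \<partial>count_space (fst t)) < HC R (S n) + en (e * (1/2) ^ Suc n)"
 using content_less[OF f] by simp
 from choice[OF this] obtain t :: "nat => nat set \<times> (nat => 'a) \<times> (nat => real)" where
 t:"ALL n. (ALL i:fst (t n). 0 < snd (snd (t n)) i & snd (snd (t n)) i <= R) & S n <= (UN i:fst (t n). ball (fst (snd (t n)) i) (snd (snd (t n)) i)) &
 (\<integral>\<^sup>+i. mb (fst (snd (t n)) i) (snd (snd (t n)) i) / en (snd (snd (t n)) i) \<partial>count_space (fst (t n))) < HC R (S n) + en (e * (1/2) ^ Suc n)" ..
 define I x r where "I n = fst (t n)" and "x n = fst (snd (t n))" and "r n = snd (snd (t n))" for n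
 have *: "!!n i. i:I n ==> 0 < r n i & r n i <= R" "!!n. S n <= (UN i:I n. ball (x n i) (r n i))"
 "!!n. (\<integral>\<^sup>+i. mb (x n i) (r n i) / en (r n i) \<partial>count_space (I n)) < HC R (S n) + en (e * (1/2) ^ Suc n)"
 using t unfolding I_def x_def r_def by blast+
 let ?a = "%n i. mb (x n i) (r n i) / en (r n i)"
 define T where "T = (SIGMA n:UNIV. I n)"
 have "HC R (UN n. S n) <= (\<integral>\<^sup>+p. mb (x (fst p) (snd p)) (r (fst p) (snd p)) / en (r (fst p) (snd p)) \<partial>count_space T)"
 proof (rule content_le[where c = "%p. x (fst p) (snd p)" and r = "%p. r (fst p) (snd p)"])
 show "(UN n. S n) <= (UN p:T. ball (x (fst p) (snd p)) (r (fst p) (snd p)))"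
 proof
 fix y assume "y:(UN n. S n)"
 then obtain n i where "i:I n" "y:ball (x n i) (r n i)" using *(2) by blast
 thus "y:(UN p:T. ball (x (fst p) (snd p)) (r (fst p) (snd p)))" by (intro UN_I[of "(n, i)"]) (auto simp: T_def)
 qed
 qed (use *(1) in "auto simp: T_def")
 also have "... = (\<integral>\<^sup>+p. (%(n, i). ?a n i * ind (I n) i) p \<partial>count_space UNIV)"
 by (subst nn_integral_count_space_indicator) (auto intro!: nn_integral_cong simp: T_def indicator_def)
 also have "... = (\<integral>\<^sup>+n. \<integral>\<^sup>+i. ?a n i * ind (I n) i \<partial>count_space UNIV \<partial>count_space UNIV)"
 by (subst nn_integral_fst_count_space[symmetric]) simp
 also have "... = (\<integral>\<^sup>+n. \<integral>\<^sup>+i. ?a n i \<partial>count_space (I n) \<partial>count_space UNIV)"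
 by (intro nn_integral_cong) (simp add: nn_integral_count_space_indicator)
 also have "... <= (\<integral>\<^sup>+n. HC R (S n) + en (e * (1/2) ^ Suc n) \<partial>count_space UNIV)"
 by (intro nn_integral_mono less_imp_le *(3))
 also have "... = (\<Sum>n. HC R (S n)) + (\<Sum>n. en (e * (1/2) ^ Suc n))"
 by (simp add: nn_integral_count_space_nat suminf_add[symmetric])
 also have "(\<Sum>n. en (e * (1/2) ^ Suc n)) = en e"
 using sums_mult[OF power_half_series, of e] e by (intro suminf_ennreal_eq) auto
 finally show "HC R (UN n. S n) <= (\<Sum>n. HC R (S n)) + en e" .
qed

lemma content_UN_0:
 fixes S :: "nat => 'a set"
 assumes "!!n. HC R (S n) = 0" shows "HC R (UN n. S n) = 0"
 using content_UN[of R S] assms by simp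

lemma content_Un:"HC R (A Un B) <= HC R A + HC R B" for A B :: "'a set"
proof -
 have e:"HC R {} = 0"
 using content_le[of "{}" "%_. 1" R "{}" "%_. ctr"] by (simp add: nn_integral_count_space_finite)
 define S where "S n = (if n = 0 then A else if n = 1 then B else {})" for n :: nat
 have "HC R (UN n. S n) <= (\<Sum>n. HC R (S n))" by (rule content_UN)
 also have "... = (SUM n<2. HC R (S n))" by (intro suminf_finite) (auto simp: e S_def)
 also have "... = HC R A + HC R B" by (simp add: numeral_2_eq_2 S_def)
 also have "(UN n. S n) = A Un B" by (force simp: S_def split: if_splits)
 finally show ?thesis .
qed

end

lemma le_mult_liminf:
 fixes a b :: "nat => ennreal"
 assumes le:"!!i. m <= a i + en C * b i" and a:"a ~~> 0" and C:"C > 0"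
 shows "m <= en C * liminf b"
proof -
 have "m / en C <= liminf b"
 proof (rule dense_ge)
 fix c assume "liminf b < c"
 hence f:"\<exists>\<^sub>F i in sequentially. b i < c"
 by (rule contrapos_pp) (auto simp: not_frequently not_less dest!: Liminf_bounded)
 have "m <= en C * c"
 proof (rule ennreal_le_epsilon)
 fix e :: real assume e:"0 < e"
 hence "evs (%i. a i < en e)" using order_tendstoD(2)[OF a, of "en e"] by simp
 from frequently_eventually_conj[OF f this] obtain i where i:"b i < c" "a i < en e"
 by (auto dest: frequently_ex)
 have "m <= a i + en C * b i" by (rule le)
 also have "... <= en e + en C * c" using i by (intro add_mono mult_left_mono) auto
 finally show "m <= en C * c + en e" by (simp add: add.commute)
 qed
 thus "m / en C <= c" using C by (subst divide_le_posI_ennreal) (auto simp: mult.commute)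
 qed
 hence "m / en C * en C <= liminf b * en C" by (rule mult_right_mono) simp
 moreover have "m / en C * en C = m" using C by (simp add: ennreal_divide_times ennreal_divide_self ennreal_times_divide[symmetric])
 ultimately show ?thesis by (simp add: mult.commute)
qed

section \<open>The relative isoperimetric inequality from the Poincare inequality\<close>

locale poincare_space = doubling_space \<mu> Cd for \<mu> :: "'a::complete_space set => ennreal" and Cd :: real +
 fixes CP Lam :: real
 assumes CP:"0 < CP" and Lam:"1 <= Lam"
 and poincare:"r > 0 ==> u:L1_loc \<mu> UNIV ==> upper_gradient UNIV u g ==>
 L1_norm \<mu> (ball x r) (%y. u y - ereal (ball_average \<mu> u x r)) / mb x r
 <= en (CP * r) * ((\<integral>\<^sup>+y\<in>ball x (Lam * r). g y \<partial>outer_meas \<mu>) / mb x (Lam * r))"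
begin

lemma ball_sets[measurable]:"ball (x::'a) r:sets M" "ball (x::'a) r:sets borel" "cball (x::'a) r:sets M"
 by (auto intro: borel_M')

lemma pcurve_upper_gradient:
 fixes u :: "'a => real"
 assumes g[measurable]:"g:bB"
 and u:"!!p l. pcurve p l ==> ea (u (p 0) - u (p l)) <= lint 0 l (%r. g (p r))"
 shows "upper_gradient UNIV (%x. ereal (u x)) g"
 unfolding upper_gradient_def
proof (intro conjI ballI)
 show "g:borel_measurable (restrict_space borel UNIV)" by (simp add: measurable_restrict_space1)
 fix c assume c:"c:nonconstant_curves_in (UNIV::'a set)"
 obtain ga a b where cc:"c = (ga, a, b)" by (cases c)
 define l where "l = enn2real (clen ga a b)"
 define p where "p = cpar ga a b"
 note pc = pcurve_of_curve[OF c[unfolded cc], folded l_def p_def]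
 have [measurable]:"(%s. g (p s)):bB" by (rule pcurve_meas[OF pc(1) g])
 have "curve_integral (ga, a, b) g = lint 0 l (%s. g (p s))"
 unfolding pc(5) by (rule ni_lebesgue) measurable
 thus "ug_inequality (%x. ereal (u x)) g c"
 using u[OF pc(1)] pc(3,4) by (simp add: ug_inequality_def cc e2ennreal_abs_diff[simplified])
qed

text \<open>The assumed inequality concerns upper gradients on the whole space, whereas here the
  gradient is weak and lives on \<open>Om\<close>. The function is cut off outside a larger ball and
  the gradient is made infinite outside the ball of radius \<open>R\<close>; a small multiple of
  \<open>rh\<close> takes care of the exceptional curves and is removed in the limit.\<close>

lemma poincare_ball:
 fixes ps :: "'a => real"
 assumes w:"wug Om ps G" and m[measurable]:"ps:bM" and b:"!!x. 0 <= ps x & ps x <= 1"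
 and r:"r > 0" and sub:"ball x (2 * Lam * r) <= Om"
 shows "EX c. NI (ball x r) (%y. ea (ps y - c)) <= en (CP * r) * NI (ball x (Lam * r)) G"
proof -
 define R where "R = Lam * r"
 have R:"R > 0" "r <= R" "ball x (2 * R) <= Om" using r Lam sub mult_right_mono[of 1 Lam r] by (auto simp: R_def mult.assoc)
 obtain G' where G':"cwug Om ps G'" "AM x. x:Om --> G' x <= G x" using w by (auto simp: wug_def)
 have [measurable]:"G':bB" using G' by (auto simp: cwug_def)
 obtain rh where rh[measurable]:"rh:bB" and rhi:"(NN x. rh x) < oo"
 and c:"ALL p l. pcurve p l --> lint 0 l (%s. rh (p s)) < oo --> arcs p l Om (inc ps G' p)"
 using G'(1) unfolding cwug_def curve_ae_def by blast
 define u where "u y = ps y * ind (ball x (2 * R)) y" for y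
 define g where "g e y = (if y:ball x R then G' y + en e * rh y else oo)" for e y
 have [measurable]:"u:bM" unfolding u_def[abs_def] by measurable
 have ub:"abs (u y) <= 1" for y using b[of y] by (auto simp: u_def indicator_def)
 have gm[measurable]:"g e:bB" for e unfolding g_def[abs_def] by measurable
 have ug:"upper_gradient UNIV (%x. ereal (u x)) (g e)" if e:"e > 0" for e
 proof (rule pcurve_upper_gradient[OF gm])
 fix p :: "real => 'a" and l assume p:"pcurve p l"
 have l:"0 < l" by (rule pcurve_pos[OF p])
 show "ea (u (p 0) - u (p l)) <= lint 0 l (%r. g e (p r))"
 proof (cases "p ` {0..l} <= ball x (2 * R)")
 case True
 have [measurable]:"(%s. rh (p s)):bB" "(%s. G' (p s)):bB"
 by (intro pcurve_meas[OF p]; measurable)+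
 have ge:"lint 0 l (%r. G' (p r)) + en e * lint 0 l (%r. rh (p r)) <= lint 0 l (%r. g e (p r))"
 proof -
 have "lint 0 l (%r. G' (p r)) + en e * lint 0 l (%r. rh (p r)) = lint 0 l (%r. G' (p r) + en e * rh (p r))"
 by (simp add: nn_integral_add nn_integral_cmult distrib_right mult.assoc)
 also have "... <= lint 0 l (%r. g e (p r))" by (rule lint_mono) (simp add: g_def)
 finally show ?thesis .
 qed
 show ?thesis
 proof (cases "lint 0 l (%r. rh (p r)) < oo")
 case t: True
 have "p ` {0..l} <= Om" using True R(3) by (rule subset_trans)
 hence "inc ps G' p 0 l" using c p t l by auto
 also have "... <= lint 0 l (%r. g e (p r))" by (rule order_trans[OF _ ge]) simp
 finally show ?thesis using True l by (auto simp: u_def abs_minus_commute image_subset_iff)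
 next
 case False
 hence "lint 0 l (%r. rh (p r)) = oo" by (simp add: less_top[symmetric])
 thus ?thesis using ge e by (simp add: ennreal_mult_top top_unique)
 qed
 next
 case False
 \<comment> \<open>A curve leaving the ball of radius \<open>2 * R\<close> is outside the closed
   ball of radius \<open>R\<close> on a parameter interval of positive length, where
   \<open>g e\<close> is infinite.\<close>
 then obtain s where s:"s:{0..l}" "p s ~: ball x (2 * R)" by blast
 have "open (p -` (- cball x R))" using pcurve_continuous[OF p] by (intro open_vimage) auto
 moreover have "s:p -` (- cball x R)" using s R(1) by auto
 ultimately obtain d where d:"d > 0" "cball s d <= p -` (- cball x R)" using open_contains_cball by metis
 define a where "a = max 0 (s - d)"
 define b' where "b' = min l (s + d)"
 have ab:"a < b'" "{a..b'} <= {0..l}" using s d l by (auto simp: a_def b'_def)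
 have "oo = lint a b' (%_. oo)" using ab by (subst nn_integral_cmult_indicator) (auto simp: ennreal_top_mult)
 also have "... <= lint 0 l (%r. g e (p r))"
 proof (rule nn_integral_mono)
 fix t show "oo * ind {a..b'} t <= g e (p t) * ind {0..l} t"
 proof (cases "t:{a..b'}")
 case True
 hence "t:cball s d" by (auto simp: a_def b'_def dist_real_def)
 hence "p t ~: ball x R" using d by auto
 thus ?thesis using True ab by (auto simp: g_def)
 qed simp
 qed
 finally show ?thesis by (simp add: top_unique)
 qed
 qed
 have uL:"(%x. ereal (u x)):L1_loc \<mu> UNIV" unfolding L1_loc_def L1_def
 proof (intro CollectI ballI exI[of _ 1] conjI)
 fix y
 show "(%x. ereal (u x)):borel_measurable (restrict_space M (UNIV Int ball y 1))"
 by (intro measurable_restrict_space1) measurable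
 have "NI (UNIV Int ball y 1) (%x. ea (u x)) <= NI (ball y 1) (%x. 1)"
 using ub by (intro ni_mono) auto
 also have "... < oo" using ball_fin[of 1 y] by (simp add: emeasure_ball)
 finally show "L1_norm \<mu> (UNIV Int ball y 1) (%x. ereal (u x)) < oo" by (simp add: L1_norm_real)
 qed simp
 define c where "c = ball_average \<mu> (%x. ereal (u x)) x r"
 have B:"0 < mb x r" "mb x r < oo" "0 < mb x R" "mb x R < oo" "mb x r <= mb x R"
 using r R by (auto intro!: ball_pos ball_fin mu_mono simp del: infinity_ennreal_def)
 have main:"NI (ball x r) (%y. ea (ps y - c)) <= en (CP * r) * (NI (ball x R) G + en e * (NN y. rh y))"
 if e:"e > 0" for e
 proof -
 have "L1_norm \<mu> (ball x r) (%y. ereal (u y) - ereal c) = NI (ball x r) (%y. ea (u y - c))"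
 using L1_norm_real[of "ball x r" "%y. u y - c"] by simp
 also have "... = NI (ball x r) (%y. ea (ps y - c))"
 using R by (intro ni_AE_set) (auto simp: u_def)
 finally have "NI (ball x r) (%y. ea (ps y - c)) / mb x r <= en (CP * r) * (NI (ball x R) (g e) / mb x R)"
 using poincare[OF r uL ug[OF e], of x] unfolding c_def R_def by simp
 hence "NI (ball x r) (%y. ea (ps y - c)) / mb x r * mb x r
 <= en (CP * r) * (NI (ball x R) (g e) / mb x R) * mb x r" by (rule mult_right_mono) simp
 also have "... <= en (CP * r) * (NI (ball x R) (g e) / mb x R) * mb x R"
 using B by (intro mult_left_mono) auto
 also have "... = en (CP * r) * NI (ball x R) (g e)"
 using B by (simp add: mult.assoc ennreal_divide_times ennreal_times_divide[symmetric] ennreal_divide_self)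
 also have "NI (ball x R) (g e) <= (NN y. G y * ind (ball x R) y + en e * rh y)"
 proof (rule nn_integral_mono_AE)
 show "AM y. g e y * ind (ball x R) y <= G y * ind (ball x R) y + en e * rh y"
 using G'(2)
 proof eventually_elim
 case (elim y)
 show ?case
 proof (cases "y:ball x R")
 case True
 hence "y:Om" using R by auto
 thus ?thesis using elim True by (auto simp: g_def intro: add_right_mono)
 qed simp
 qed
 qed
 also have "... = NI (ball x R) G + en e * (NN y. rh y)"
 using wug_meas[OF w] by (subst nn_integral_add) (auto simp: nn_integral_cmult intro!: borel_measurable_times)
 finally show ?thesis using B by (simp add: ennreal_divide_times ennreal_times_divide[symmetric] ennreal_divide_self mult_left_mono)
 qed
 have "NI (ball x r) (%y. ea (ps y - c)) <= en (CP * r) * NI (ball x R) G"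
 proof (rule tendsto_lowerbound)
 define P where "P = enn2real (NN y. rh y)"
 have P:"(NN y. rh y) = en P" "0 <= P" using rhi by (auto simp: P_def less_top)
 have "((%e. en e * en P) \<longlongrightarrow> en 0) (at_right 0)"
 proof -
 have "((%e. en (e * P)) \<longlongrightarrow> en (0 * P)) (at_right 0)" by (intro tendsto_intros)
 moreover have "\<forall>\<^sub>F e in at_right 0. en (e * P) = en e * en P"
 by (rule eventually_mono[OF eventually_at_right_less[of 0]]) (simp add: ennreal_mult P)
 ultimately show ?thesis by (simp add: Lim_transform_eventually)
 qed
 thus "((%e. en (CP * r) * (NI (ball x R) G + en e * (NN y. rh y))) \<longlongrightarrow> en (CP * r) * NI (ball x R) G) (at_right 0)"
 unfolding P using tendsto_add[OF tendsto_const, of "%e. en e * en P" 0 "at_right 0" "NI (ball x R) G"]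
 by (intro ennreal_tendsto_cmult) auto
 show "\<forall>\<^sub>F e in at_right 0. NI (ball x r) (%y. ea (ps y - c)) <= en (CP * r) * (NI (ball x R) G + en e * (NN y. rh y))"
 using main by (auto intro: eventually_mono[OF eventually_at_right_less[of 0]])
 qed simp
 thus ?thesis by (auto simp: R_def)
qed

lemma rel_isop:
 assumes E[measurable]:"E:sets M" and ap:"appr Om (indr E) ps G" and b:"!!i x. 0 <= ps i x & ps i x <= 1"
 and r:"r > 0" and sub:"cball x (2 * Lam * r) <= Om"
 shows "min (mi E x r) (\<mu> (ball x r - E)) <= en (CP * r) * liminf (%i. NI (ball x (Lam * r)) (G i))"
proof (rule le_mult_liminf)
 note [measurable] = apprD(2,3)[OF ap]
 let ?m = "min (mi E x r) (\<mu> (ball x r - E))"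
 show "0 < CP * r" using CP r by simp
 have "r <= 2 * Lam * r" using r Lam mult_right_mono[of 1 "2 * Lam" r] by auto
 hence s2:"cball x r <= Om" using sub by (auto intro: subset_trans[rotated])
 show "(%i. NI (ball x r) (%y. ea (ps i y - indr E y))) ~~> 0"
 proof (rule squeeze0)
 show "(%i. NI (cball x r) (%y. ea (ps i y - indr E y))) ~~> 0" by (rule lconvD[OF appr_lconv[OF ap] compact_cball s2])
 qed (intro ni_mono, auto)
 fix i
 have bs:"ball x (2 * Lam * r) <= Om" using sub ball_subset_cball by blast
 from poincare_ball[OF apprD(1,2)[OF ap] b r bs]
 obtain c where c:"NI (ball x r) (%y. ea (ps i y - c)) <= en (CP * r) * NI (ball x (Lam * r)) (G i)" ..
 \<comment> \<open>Whatever \<open>c\<close> is, it cannot be close to both values of the indicator: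
   \<open>abs (1 - c) + abs c\<close> is at least one.\<close>
 have "?m <= ea (1 - c) * mi E x r + ea c * \<mu> (ball x r - E)"
 proof -
 have "?m = en 1 * ?m" by simp
 also have "... <= en (abs (1 - c) + abs c) * ?m" by (intro mult_right_mono ennreal_leI) auto
 also have "... = ea (1 - c) * ?m + ea c * ?m" by (simp add: ennreal_plus distrib_right)
 also have "... <= ea (1 - c) * mi E x r + ea c * \<mu> (ball x r - E)" by (intro add_mono mult_left_mono) auto
 finally show ?thesis .
 qed
 also have "... = (NN y. ea (1 - c) * ind (ball x r Int E) y + ea c * ind (ball x r - E) y)"
 by (subst nn_integral_add) (auto simp: nn_integral_cmult_indicator emeasure_M)
 also have "... <= (NN y. ea (ps i y - indr E y) * ind (ball x r) y + ea (ps i y - c) * ind (ball x r) y)"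
 by (intro nn_integral_mono) (auto simp: indicator_def intro!: ennreal_leI simp flip: ennreal_plus)
 also have "... = NI (ball x r) (%y. ea (ps i y - indr E y)) + NI (ball x r) (%y. ea (ps i y - c))"
 by (rule nn_integral_add) auto
 also have "... <= NI (ball x r) (%y. ea (ps i y - indr E y)) + en (CP * r) * NI (ball x (Lam * r)) (G i)"
 using c by (rule add_left_mono)
 finally show "?m <= NI (ball x r) (%y. ea (ps i y - indr E y)) + en (CP * r) * NI (ball x (Lam * r)) (G i)" .
qed

end

section \<open>Boxing inequality, and small perimeter near points of low density\<close>

lemma liminf_cmult:"liminf (%k. en C * b k) = en C * liminf b"
 by (rule Liminf_compose_continuous_mono) (auto intro!: ennreal_continuous_on_cmult monoI mult_left_mono)

definition nbd :: "'a::metric_space set => real => 'a set" where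
 "nbd A s = (UN a:A. ball a s)"

lemma open_nbd [simp]:"open (nbd A s)"
 by (auto simp: nbd_def)

lemma nbd_mono:"s <= t ==> nbd A s <= nbd A t"
 by (force simp: nbd_def)

lemma nbd_iff:"A ~= {} ==> x:nbd A s \<longleftrightarrow> infdist x A < s"
 by (auto simp: nbd_def infdist_def dist_commute cINF_less_iff[OF _ bdd_belowI2[of A 0]])

context poincare_space begin

lemma compact_sets:"compact (K::'a set) ==> K:sets M"
 by (intro borel_M' borel_closed compact_imp_closed)

lemma ball_half:
 assumes E[measurable]:"E:sets M" and r:"r > 0" and le:"mi E x r <= en (1 / 2) * mb x r"
 shows "mi E x r <= \<mu> (ball x r - E)"
proof -
 have fin:"mb x r < top" using ball_fin[OF r, of x] by simp
 have "mb x r = mi E x r + \<mu> (ball x r - E)"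
 proof -
 have "eM (ball x r Int E) + eM (ball x r - E) = eM (ball x r Int E Un (ball x r - E))"
 by (rule plus_emeasure) auto
 moreover have "ball x r Int E Un (ball x r - E) = ball x r" by auto
 moreover have "ball x r Int E:sets M" "ball x r - E:sets M" by auto
 ultimately show ?thesis by (simp only: emeasure_M ball_sets)
 qed
 moreover obtain a where a:"mb x r = en a" "0 <= a" using fin by (cases "mb x r") auto
 moreover obtain b where b:"mi E x r = en b" "0 <= b"
 using le_less_trans[OF mu_mono fin, of "ball x r Int E"] by (cases "mi E x r") auto
 moreover obtain c where c:"\<mu> (ball x r - E) = en c" "0 <= c"
 using le_less_trans[OF mu_mono fin, of "ball x r - E"] by (cases "\<mu> (ball x r - E)") auto
 ultimately have abc:"en a = en (b + c)" "en b <= en (1 / 2) * en a" using le by auto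
 hence "a = b + c" using a b c by (subst (asm) ennreal_inj) auto
 moreover have "b <= 1 / 2 * a" using abc(2) a b by (subst (asm) ennreal_mult[symmetric]) (auto simp: ennreal_le_iff)
 ultimately show ?thesis unfolding b c by (intro ennreal_leI) simp
qed

text \<open>The doubling factor for dilation by \<open>5 * Lam\<close> times the Poincare constant,
  divided by \<open>5 * Lam\<close> because the content divides by the radius of the dilated
  ball.\<close>

definition cbox0 :: real where "cbox0 = cmp (5 * Lam) * CP / (5 * Lam)"

lemma cbox0_pos:"cbox0 > 0"
 using cmp_ge_1[of "5 * Lam"] CP Lam by (auto simp: cbox0_def intro!: divide_pos_pos mult_pos_pos)

text \<open>A Vitali selection among the balls dilated by \<open>Lam\<close>: as these are disjoint,
  the lower limits of their energies add up, and the relative isoperimetric inequality pays for each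
  ball.\<close>

lemma boxing:
 fixes S :: "'a set"
 assumes E[measurable]:"E:sets M" and ap:"appr Om (indr E) ps G" and b:"!!i x. 0 <= ps i x & ps i x <= 1"
 and ga:"ga > 0"
 and S:"ALL x:S. EX r. 0 < r & r <= R & en ga * mb x r <= min (mi E x r) (\<mu> (ball x r - E)) &
 ball x (Lam * r) <= V & cball x (2 * Lam * r) <= Om"
 shows "HC (5 * Lam * R) S <= en (cbox0 / ga) * liminf (%i. NI V (G i))"
proof -
 note [measurable] = apprD(2,3)[OF ap]
 from bchoice[OF S] obtain r where r:"ALL x:S. 0 < r x & r x <= R & en ga * mb x (r x) <= min (mi E x (r x)) (\<mu> (ball x (r x) - E)) &
 ball x (Lam * r x) <= V & cball x (2 * Lam * r x) <= Om" ..
 have p1:"0 < Lam * r x" "Lam * r x <= Lam * R" if "x:S" for x using r that Lam by auto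
 obtain T where T:"T <= S" "countable T" "disjoint_family_on (%x. ball x (Lam * r x)) T"
 "!!i. i:S ==> EX j:T. ball i (Lam * r i) <= ball j (5 * (Lam * r j))"
 using vitali_5r[of S "%x. Lam * r x" "Lam * R" "%x. x"] p1 by blast
 have "HC (5 * Lam * R) S <= (\<integral>\<^sup>+x. mb x (5 * Lam * r x) / en (5 * Lam * r x) \<partial>count_space T)"
 proof (rule content_le[OF T(2)])
 show "S <= (UN i:T. ball i (5 * Lam * r i))"
 proof
 fix x assume x:"x:S"
 hence "x:ball x (Lam * r x)" using p1 by simp
 thus "x:(UN i:T. ball i (5 * Lam * r i))" using T(4)[OF x] by (simp only: mult.assoc) blast
 qed
 qed (use r T(1) Lam in auto)
 also have "... <= (\<integral>\<^sup>+x. en (cbox0 / ga) * liminf (%i. NI (ball x (Lam * r x)) (G i)) \<partial>count_space T)"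
 proof (rule nn_integral_mono)
 fix x assume "x:space (count_space T)"
 hence x:"x:S" using T(1) by auto
 have rx:"0 < r x" using r x by auto
 define L where "L = liminf (%i. NI (ball x (Lam * r x)) (G i))"
 have c:"0 < cmp (5 * Lam)" using cmp_ge_1[of "5 * Lam"] by simp
 have 1:"en ga * mb x (r x) <= en (CP * r x) * L"
 using rel_isop[OF E ap b rx, of x] r x unfolding L_def by (meson order_trans)
 have "mb x (5 * Lam * r x) <= cmp (5 * Lam) * mb x (r x)"
 by (rule ball_cmp[OF rx order_refl subset_refl])
 also have "... = en (cmp (5 * Lam) / ga) * (en ga * mb x (r x))"
 using ga c by (simp add: mult.assoc[symmetric] ennreal_mult[symmetric])
 also have "... <= en (cmp (5 * Lam) / ga) * (en (CP * r x) * L)" by (rule mult_left_mono[OF 1]) simp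
 also have "... = en (cmp (5 * Lam) / ga * (CP * r x)) * L"
 using ga c CP rx by (simp add: mult.assoc[symmetric] ennreal_mult[symmetric])
 also have "cmp (5 * Lam) / ga * (CP * r x) = cbox0 / ga * (5 * Lam * r x)" using Lam by (simp add: cbox0_def)
 also have "en (cbox0 / ga * (5 * Lam * r x)) = en (cbox0 / ga) * en (5 * Lam * r x)"
 using Lam rx cbox0_pos ga by (intro ennreal_mult) auto
 finally show "mb x (5 * Lam * r x) / en (5 * Lam * r x) <= en (cbox0 / ga) * L"
 using Lam rx by (intro divide_le_posI_ennreal) (auto simp: ac_simps)
 qed
 also have "... = en (cbox0 / ga) * (\<integral>\<^sup>+x. liminf (%i. NI (ball x (Lam * r x)) (G i)) \<partial>count_space T)"
 by (rule nn_integral_cmult) simp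
 also have "(\<integral>\<^sup>+x. liminf (%i. NI (ball x (Lam * r x)) (G i)) \<partial>count_space T) <= liminf (%i. NN y. 1 * (G i y * ind V y))"
 proof (rule sum_liminf_le[OF T(2)])
 fix y
 show "(\<integral>\<^sup>+x. ind (ball x (Lam * r x)) y \<partial>count_space T) <= (1::ennreal) * ind V y"
 proof (cases "EX x:T. y:ball x (Lam * r x)")
 case True
 then obtain x where x:"x:T" "y:ball x (Lam * r x)" by auto
 have "y:V" using r x T(1) by blast
 have "(\<integral>\<^sup>+x. ind (ball x (Lam * r x)) y \<partial>count_space T) = (\<integral>\<^sup>+z. ind {x} z \<partial>count_space T)"
 proof (intro nn_integral_cong)
 fix z assume "z:space (count_space T)"
 hence "z ~= x ==> y ~: ball z (Lam * r z)"
 using disjoint_family_onD[OF T(3), of z x] x by auto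
 thus "ind (ball z (Lam * r z)) y = (ind {x} z :: ennreal)" using x by (cases "z = x") auto
 qed
 also have "... = 1" using x by (simp add: one_ennreal_def[symmetric] emeasure_count_space)
 finally show ?thesis using `y \<in> V` by simp
 next
 case False
 hence "(\<integral>\<^sup>+x. ind (ball x (Lam * r x)) y \<partial>count_space T) = (\<integral>\<^sup>+z. 0 \<partial>count_space T)"
 by (intro nn_integral_cong) (auto simp: indicator_def)
 thus ?thesis by simp
 qed
 qed (auto simp: ball_sets)
 finally show ?thesis by (simp add: mult_left_mono)
qed

text \<open>Radius ratio for small balls covering a neighbourhood of points of low density. One
  bound keeps their dilations by \<open>Lam\<close> within distance \<open>s\<close>, the other
  yields the factor \<open>1 / 8\<close> on which the comparison in \<open>thin_small\<close>
  rests.\<close>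

definition th :: real where "th = min (1 / Lam) (1 / (8 * CP * (real (sepN Lam) + 1)))"

text \<open>Threshold for low density: staying below it at \<open>x\<close> and scale
  \<open>3 * s\<close> forces density at most one half in every ball of radius \<open>th * s\<close>
  centred within \<open>2 * s\<close> of \<open>x\<close>. The ratio \<open>5 / th\<close> arises
  because the ball of radius \<open>3 * s\<close> lies in one of radius \<open>5 * s\<close> around
  the new centre.\<close>

definition g0 :: real where "g0 = 1 / (2 * cmp (5 / th) * Cd)"

lemma th:"th > 0" "Lam * th <= 1" "CP * real (sepN Lam) * th <= 1 / 8"
proof -
 have L:"0 < Lam" using Lam by simp
 show "th > 0" using L CP by (auto simp: th_def intro!: divide_pos_pos mult_pos_pos)
 have "Lam * th <= Lam * (1 / Lam)" using L by (intro mult_left_mono) (auto simp: th_def)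
 thus "Lam * th <= 1" using L by simp
 have "CP * real (sepN Lam) * th <= CP * real (sepN Lam) * (1 / (8 * CP * (real (sepN Lam) + 1)))"
 using CP by (intro mult_left_mono) (auto simp: th_def)
 also have "... = real (sepN Lam) / (real (sepN Lam) + 1) / 8" using CP by simp
 also have "... <= 1 / 8" by (intro divide_right_mono) auto
 finally show "CP * real (sepN Lam) * th <= 1 / 8" .
qed

lemma g0:"0 < g0" "g0 * cmp (5 / th) <= 1 / 2" "Cd * g0 <= 1 / 2"
proof -
 have c:"1 <= cmp (5 / th)" by (rule cmp_ge_1)
 show "0 < g0" using c Cd by (auto simp: g0_def)
 have "g0 * cmp (5 / th) = 1 / (2 * Cd)" using c by (simp add: g0_def)
 also have "... <= 1 / 2" using Cd by (simp add: field_simps)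
 finally show "g0 * cmp (5 / th) <= 1 / 2" .
 have "Cd * g0 = 1 / (2 * cmp (5 / th))" using Cd by (simp add: g0_def)
 also have "... <= 1 / 2" using c by (simp add: field_simps)
 finally show "Cd * g0 <= 1 / 2" .
qed

definition thin :: "'a set => real => 'a => bool" where
 "thin E R x \<longleftrightarrow> (ALL r. 0 < r --> r <= R --> mi E x r <= en g0 * mb x r)"

lemma thin_near:
 fixes x :: 'a
 assumes "thin E R x" "dist x y < 2 * s" "3 * s <= R" "s > 0"
 shows "mi E y (th * s) <= en (1 / 2) * mb y (th * s)"
proof -
 have t1:"th <= 1" using th(1,2) mult_right_mono[OF Lam, of th] by linarith
 have sub1:"ball y (th * s) <= ball x (3 * s)"
 proof
 fix z assume "z:ball y (th * s)"
 hence "dist y z < s" using t1 assms(4) mult_right_mono[of th 1 s] by (auto intro: less_le_trans)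
 thus "z:ball x (3 * s)" using assms(2) dist_triangle[of x z y] by auto
 qed
 have sub2:"ball x (3 * s) <= ball y (5 * s)"
 proof
 fix z assume "z:ball x (3 * s)"
 thus "z:ball y (5 * s)" using assms(2) dist_triangle[of y z x] by (auto simp: dist_commute)
 qed
 have "mi E y (th * s) <= mi E x (3 * s)" using sub1 by (intro mu_mono) auto
 also have "... <= en g0 * mb x (3 * s)" using assms by (auto simp: thin_def)
 also have "... <= en g0 * (en (cmp (5 / th)) * mb y (th * s))"
 by (intro mult_left_mono ball_cmp[OF _ _ sub2]) (use th assms in "auto simp: field_simps")
 also have "... = en (g0 * cmp (5 / th)) * mb y (th * s)"
 using g0(1) cmp_ge_1[of "5 / th"] by (simp add: ennreal_mult mult.assoc)
 also have "... <= en (1 / 2) * mb y (th * s)" using g0(2) by (intro mult_right_mono ennreal_leI) auto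
 finally show ?thesis .
qed

text \<open>Balls of radius \<open>th * s\<close> cover the neighbourhood, with bounded overlap
  after dilation. In each of them \<open>E\<close> occupies at most half, so the relative
  isoperimetric inequality bounds the measure of \<open>E\<close> itself.\<close>

lemma thin_measure:
 fixes A :: "'a set"
 assumes E[measurable]:"E:sets M" and ap:"appr Om (indr E) ps G" and b:"!!i x. 0 <= ps i x & ps i x <= 1"
 and A:"bounded A" "ALL x:A. thin E R x" and s:"0 < s" "3 * s <= R" "nbd A (5 * s) <= Om"
 shows "\<mu> (nbd A (2 * s) Int E) <= en (s / 8) * liminf (%i. NI (nbd A (3 * s)) (G i))"
proof -
 note [measurable] = apprD(2,3)[OF ap]
 have ts:"0 < th * s" using th s by simp
 have Lt:"Lam * (th * s) <= s" using th(2) s mult_right_mono[of "Lam * th" 1 s] by (simp add: mult.assoc)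
 have "bounded (nbd A (2 * s))"
 proof -
 obtain x0 e where e:"!!x. x:A ==> dist x0 x <= e" using A(1) unfolding bounded_def by blast
 have "dist x0 y <= e + 2 * s" if "y:nbd A (2 * s)" for y
 proof -
 obtain a where a:"a:A" "dist a y < 2 * s" using `y \<in> nbd A (2 * s)` by (auto simp: nbd_def)
 thus ?thesis using e[OF a(1)] dist_triangle[of x0 y a] by linarith
 qed
 thus ?thesis unfolding bounded_def by blast
 qed
 then obtain Y where Y:"finite Y" "Y <= nbd A (2 * s)" "nbd A (2 * s) <= (UN y:Y. ball y (th * s))"
 "!!x y. x:Y ==> y:Y ==> x ~= y ==> th * s <= dist x y"
 using finite_net[OF _ ts] by blast
 let ?L = "%y. liminf (%i. NI (ball y (Lam * (th * s))) (%x. G i x))"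
 have ball:"mi E y (th * s) <= en (CP * (th * s)) * ?L y" if y:"y:Y" for y
 proof -
 obtain a where a:"a:A" "dist a y < 2 * s" using Y y by (auto simp: nbd_def)
 have h:"mi E y (th * s) <= en (1 / 2) * mb y (th * s)"
 using thin_near[OF _ a(2) s(2,1)] A a by blast
 have "cball y (2 * Lam * (th * s)) <= nbd A (5 * s)"
 proof
 fix z assume "z:cball y (2 * Lam * (th * s))"
 hence "dist y z <= 2 * s" using Lt by auto
 hence "dist a z < 5 * s" using a(2) dist_triangle[of a z y] s by linarith
 thus "z:nbd A (5 * s)" using a(1) by (auto simp: nbd_def)
 qed
 hence "cball y (2 * Lam * (th * s)) <= Om" using s by blast
 from rel_isop[OF E ap b ts this] show ?thesis using ball_half[OF E ts h] by (simp add: min_def)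
 qed
 have "\<mu> (nbd A (2 * s) Int E) <= \<mu> (UN y:Y. ball y (th * s) Int E)" using Y by (intro mu_mono) auto
 also have "... = eM (UN y:Y. ball y (th * s) Int E)" using Y by (intro emeasure_M[symmetric]) auto
 also have "... <= (SUM y:Y. eM (ball y (th * s) Int E))" using Y by (intro emeasure_subadditive_finite) auto
 also have "... <= (SUM y:Y. en (CP * (th * s)) * ?L y)" by (intro sum_mono) (use ball in "simp add: emeasure_M")
 also have "... = en (CP * (th * s)) * (\<integral>\<^sup>+y. ?L y \<partial>count_space Y)"
 using Y by (simp add: nn_integral_count_space_finite sum_distrib_left)
 also have "... <= en (CP * (th * s)) * liminf (%i. NN x. en (sepN Lam) * (G i x * ind (nbd A (3 * s)) x))"
 proof (intro mult_left_mono sum_liminf_le countable_finite[OF Y(1)])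
 fix x
 define Z where "Z = {y:Y. x:ball y (Lam * (th * s))}"
 have "(\<integral>\<^sup>+y. ind (ball y (Lam * (th * s))) x \<partial>count_space Y) = (\<integral>\<^sup>+y. ind Z y \<partial>count_space Y)"
 by (intro nn_integral_cong) (auto simp: Z_def indicator_def)
 also have "... = en (card Z)"
 using Y(1) by (subst nn_integral_indicator) (auto simp: Z_def emeasure_count_space ennreal_of_nat_eq_real_of_nat Int_absorb2)
 also have "... <= en (sepN Lam) * ind (nbd A (3 * s)) x"
 proof (cases "Z = {}")
 case False
 then obtain y where y:"y:Y" "dist y x < s" using Lt by (force simp: Z_def)
 obtain a where a:"a:A" "dist a y < 2 * s" using Y(2) y(1) by (auto simp: nbd_def)
 have "x:nbd A (3 * s)" using a y dist_triangle[of a x y] by (auto simp: nbd_def intro!: bexI[of _ a])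
 moreover have "card Z <= sepN Lam"
 by (rule separated_card(2)[OF ts, of Lam _ x]) (use Lam Y(4) in "auto simp: Z_def dist_commute")
 ultimately show ?thesis by (simp add: ennreal_leI)
 qed simp
 finally show "(\<integral>\<^sup>+y. ind (ball y (Lam * (th * s))) x \<partial>count_space Y) <= en (sepN Lam) * ind (nbd A (3 * s)) x" .
 qed (auto simp: ball_sets)
 also have "... = en (CP * (th * s)) * (en (sepN Lam) * liminf (%i. NI (nbd A (3 * s)) (G i)))"
 by (subst nn_integral_cmult) (auto simp: liminf_cmult intro!: borel_measurable_times borel_measurable_indicator borel_M')
 also have "... = en (CP * real (sepN Lam) * th * s) * liminf (%i. NI (nbd A (3 * s)) (G i))"
 proof -
 have "0 <= CP * (th * s)" using CP th(1) s by simp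
 hence "en (CP * (th * s)) * en (sepN Lam) = en (CP * (th * s) * real (sepN Lam))"
 by (simp only: ennreal_mult of_nat_0_le_iff)
 also have "CP * (th * s) * real (sepN Lam) = CP * real (sepN Lam) * th * s" by simp
 finally show ?thesis by (simp only: mult.assoc[symmetric])
 qed
 also have "... <= en (s / 8) * liminf (%i. NI (nbd A (3 * s)) (G i))"
 using th(3) s mult_right_mono[OF th(3), of s] by (intro mult_right_mono ennreal_leI) auto
 finally show ?thesis .
qed

lemma per_seq:
 assumes tv:"tv Om (indr E) <= en P" and d:"0 < d" and P:"0 <= P"
 shows "EX ps G. appr Om (indr E) ps G & (ALL i x. 0 <= ps i x & ps i x <= 1) & (ALL i. NI Om (G i) <= en (P + d))"
proof -
 have "tv Om (indr E) < en (P + d)"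
 by (rule le_less_trans[OF tv]) (use d P in "simp add: ennreal_less_iff")
 then obtain F G where FG:"appr Om (indr E) F G" "!!i. NI Om (G i) < en (P + d)"
 using tv_less by blast
 have "appr Om (indr E) (%i x. max 0 (min 1 (F i x))) G"
 by (rule appr_clamp[OF FG(1)]) (auto simp: indicator_def)
 thus ?thesis using FG(2) by (intro exI[of _ "%i x. max 0 (min 1 (F i x))"] exI[of _ G]) (auto simp: less_imp_le)
qed

lemma compact_nbd:
 assumes K:"compact K" "K <= Om" "open Om"
 obtains e where "e > 0" "nbd K e <= Om"
 using compact_subset_open_imp_ball_epsilon_subset[OF K(1,3,2)] unfolding nbd_def by blast

lemma liminf_bound:"(!!i. a i <= (c::ennreal)) ==> liminf a <= c"
 by (rule Liminf_le) auto

text \<open>A comparison argument. Were the energy \<open>q s\<close> near \<open>A\<close> above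
  \<open>8 * d\<close> at all small scales, some scale would satisfy
  \<open>q (3 * s) <= 2 * q s\<close>. Multiplying the approximations by a cutoff that vanishes near
  \<open>A\<close> would then save almost \<open>q s\<close> and add only about half of it, because
  \<open>E\<close> has small measure there; the products would approximate \<open>E\<close> with
  energy below its perimeter \<open>P\<close>.\<close>

lemma thin_small:
 fixes A :: "'a set"
 assumes E[measurable]:"E:sets M" and Om:"open Om" and ap:"appr Om (indr E) ps G" and b:"!!i x. 0 <= ps i x & ps i x <= 1"
 and K0:"compact K0" "K0 <= Om" and A:"A <= K0" "ALL x:A. thin E R x" and R:"R > 0"
 and P:"tv Om (indr E) = en P" "0 <= P" and d:"0 < d" and G:"!!i. NI Om (G i) <= en (P + d)"
 and s0:"0 < s0"
 shows "EX s. 0 < s & s <= s0 & liminf (%i. NI (nbd A s) (G i)) <= en (8 * d)"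
proof (rule ccontr)
 note [measurable] = apprD(2,3)[OF ap]
 have [measurable]:"Om:sets M" using Om by (intro borel_M') auto
 have [measurable]:"nbd A s:sets M" for s by (intro borel_M') auto
 define q where "q s = liminf (%i. NI (nbd A s) (G i))" for s
 assume "~ ?thesis"
 hence big:"en (8 * d) < q s" if "0 < s" "s <= s0" for s using that unfolding q_def by (auto simp: not_le)
 obtain e0 where e0:"e0 > 0" "nbd K0 e0 <= Om" by (rule compact_nbd[OF K0 Om])
 define s1 where "s1 = min s0 (min (R / 3) (e0 / 5))"
 have s1:"0 < s1" "s1 <= s0" "3 * s1 <= R" "5 * s1 <= e0" using s0 R e0 by (auto simp: s1_def)
 have sub:"nbd A (5 * s) <= Om" if "s <= s1" for s
 proof -
 have "nbd A (5 * s) <= nbd K0 e0" using A(1) that s1(4) by (force simp: nbd_def)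
 thus ?thesis using e0(2) by blast
 qed
 have bA:"bounded A" using A(1) compact_imp_bounded[OF K0(1)] bounded_subset by blast
 have qP:"q s <= en (P + d)" if "s <= s1" "0 < s" for s unfolding q_def
 proof (rule liminf_bound)
 fix i
 have "nbd A s <= Om" using nbd_mono[of s "5 * s" A] sub[OF that(1)] that by auto
 thus "NI (nbd A s) (G i) <= en (P + d)" by (intro order_trans[OF ni_mono G[of i]]) auto
 qed
 have qP3:"q (3 * s) <= en (P + d)" if "s <= s1" "0 < s" for s unfolding q_def
 proof (rule liminf_bound)
 fix i
 have "nbd A (3 * s) <= Om" using nbd_mono[of "3 * s" "5 * s" A] sub[OF that(1)] that by auto
 thus "NI (nbd A (3 * s)) (G i) <= en (P + d)" by (intro order_trans[OF ni_mono G[of i]]) auto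
 qed
 have ne:"A ~= {}"
 proof
 assume "A = {}"
 hence "q s1 = 0" by (simp add: q_def nbd_def Liminf_const)
 thus False using big[of s1] s1 by simp
 qed
 have P7:"7 * d < P"
 proof -
 have "en (8 * d) < en (P + d)" by (rule less_le_trans[OF big qP]) (use s1 in auto)
 thus ?thesis using d P by (subst (asm) ennreal_less_iff) auto
 qed
 \<comment> \<open>Otherwise \<open>q\<close> at least doubles whenever the radius is tripled.
   Started from radius \<open>t / 3 ^ k\<close>, this pushes \<open>q t\<close> above
   \<open>2 ^ k * 8 * d\<close>, against the bound \<open>P + d\<close>.\<close>
 have step:"EX s. 0 < s & s <= t & q (3 * s) <= 2 * q s" if t:"0 < t" "t <= s1" for t
 proof (rule ccontr)
 assume "~ ?thesis"
 hence no:"2 * q s <= q (3 * s)" if "0 < s" "s <= t" for s using that by (meson linear)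
 have "2 ^ k * q (t / 3 ^ k) <= q t" for k
 proof (induction k)
 case (Suc k)
 have "2 ^ Suc k * q (t / 3 ^ Suc k) = 2 ^ k * (2 * q (t / 3 ^ Suc k))" by (simp add: ac_simps)
 also have "... <= 2 ^ k * q (3 * (t / 3 ^ Suc k))"
 proof (intro mult_left_mono no)
 have "t / 3 ^ Suc k <= t / 1" using t by (intro divide_left_mono one_le_power) auto
 thus "t / 3 ^ Suc k <= t" by simp
 qed (use t in auto)
 also have "3 * (t / 3 ^ Suc k) = t / 3 ^ k" by simp
 finally show ?case using Suc by (rule order_trans)
 qed simp
 hence le:"2 ^ k * en (8 * d) <= en (P + d)" for k
 proof -
 have k3:"t / 3 ^ k <= t / 1" using t by (intro divide_left_mono) auto
 have "2 ^ k * en (8 * d) <= 2 ^ k * q (t / 3 ^ k)"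
 using t k3 s1 by (intro mult_left_mono less_imp_le[OF big]) auto
 also have "... <= q t" by fact
 also have "... <= en (P + d)" using qP t by auto
 finally show ?thesis .
 qed
 obtain k where k:"(P + d) / (8 * d) < 2 ^ k" using real_arch_pow[of 2 "(P + d) / (8 * d)"] by auto
 have "en (2 ^ k * (8 * d)) <= en (P + d)"
 using le[of k] d by (simp add: ennreal_mult ennreal_power[symmetric])
 hence "2 ^ k * (8 * d) <= P + d" using P d by (subst (asm) ennreal_le_iff) auto
 thus False using k d by (simp add: divide_less_eq)
 qed
 have "tv Om (indr E) <= en (P - d)"
 proof (rule tv_diag[OF Om])
 fix e :: real and K :: "'a set" assume e:"e > 0" and K:"compact K" "K <= Om"
 \<comment> \<open>The second bound makes the part of \<open>E\<close> that is cut away have measure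
   at most \<open>e / 2\<close>.\<close>
 define t where "t = min s1 (4 * e / (P + d))"
 have t:"0 < t" "t <= s1" "t * (P + d) <= 4 * e" using s1 e P d
 by (auto simp: t_def pos_le_divide_eq[symmetric] intro!: divide_pos_pos)
 obtain s where s:"0 < s" "s <= t" "q (3 * s) <= 2 * q s" using step[OF t(1,2)] by blast
 have ss:"s <= s1" using s t by simp
 define C where "C = {x. infdist x A <= 2 * s}"
 define Op where "Op = {x. 3 / 2 * s < infdist x A}"
 have Op:"open Op" unfolding Op_def by (intro open_Collect_less continuous_intros)
 have [measurable]:"Op:sets M" using Op by (intro borel_M') auto
 have C:"compact C" "C <= Om"
 proof -
 have "C <= nbd A (3 * s)" using s(1) by (auto simp: C_def nbd_iff[OF ne])
 thus "C <= Om" using sub[OF ss] nbd_mono[of "3 * s" "5 * s" A] s(1) by auto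
 have "bounded C"
 proof -
 obtain x0 r where r:"!!x. x:A ==> dist x0 x <= r" using bA unfolding bounded_def by blast
 have "dist x0 y <= r + 3 * s" if yC:"y:C" for y
 proof -
 obtain a where a:"a:A" "dist a y < 3 * s" using subsetD[OF `C \<subseteq> nbd A (3 * s)` yC] by (auto simp: nbd_def)
 thus ?thesis using r[OF a(1)] dist_triangle[of x0 y a] by linarith
 qed
 thus ?thesis unfolding bounded_def by blast
 qed
 moreover have "closed C" unfolding C_def by (intro closed_Collect_le continuous_intros)
 ultimately show "compact C" by (intro compact_if)
 qed
 \<comment> \<open>Zero within distance \<open>s\<close> of \<open>A\<close> and one beyond
   \<open>3 / 2 * s\<close>. The slope \<open>2 / s\<close> times the factor \<open>s / 8\<close> of
   \<open>thin_measure\<close> makes the gradient of the cutoff cost about a quarter of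
   \<open>q (3 * s)\<close>.\<close>
 define ka where "ka x = max 0 (min 1 (2 * infdist x A / s - 2))" for x
 have ka01:"0 <= ka x" "ka x <= 1" for x by (auto simp: ka_def)
 have ka0:"ka x = 0" if "x:nbd A s" for x
 using that s(1) by (simp add: ka_def nbd_iff[OF ne] divide_le_eq)
 have ka1:"ka x = 1" if "x:Op" for x
 using that s(1) by (simp add: ka_def Op_def le_divide_eq)
 have Op2:"x:nbd A (2 * s)" if "x ~: Op" for x
 using that s(1) by (simp add: Op_def nbd_iff[OF ne])
 have lip:"lips (2 / s) ka" unfolding lips_def
 proof (intro conjI allI)
 fix x y
 have "abs (ka x - ka y) <= abs ((2 * infdist x A / s - 2) - (2 * infdist y A / s - 2))" unfolding ka_def by linarith
 also have "... = 2 / s * abs (infdist x A - infdist y A)"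
 proof -
 have "(2 * infdist x A / s - 2) - (2 * infdist y A / s - 2) = 2 / s * (infdist x A - infdist y A)"
 by (simp add: right_diff_distrib)
 thus ?thesis using s(1) by (simp only: abs_mult) simp
 qed
 also have "... <= 2 / s * dist x y" using s(1) by (intro mult_left_mono infdist_triangle_abs) auto
 finally show "abs (ka x - ka y) <= 2 / s * dist x y" .
 qed (use s(1) in simp)
 have [measurable]:"ka:bM"
 using lips_continuous[OF lip, of UNIV] by (intro borel_measurable_M borel_measurable_continuous_onI) auto
 have wka:"wug Om ka (%x. en (2 / s) * ind (- Op) x)"
 by (rule wug_lips_local[OF lip _ Op ka1]) auto
 define H where "H i x = ea (ka x) * G i x + ea (ps i x) * (en (2 / s) * ind (- Op) x)" for i x
 have [measurable]:"H i:bM" for i unfolding H_def[abs_def] by measurable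
 have mE:"\<mu> (nbd A (2 * s) Int E) <= en (s / 8) * q (3 * s)"
 unfolding q_def by (rule thin_measure[OF E ap b bA A(2) s(1)]) (use ss s1 sub[OF ss] in auto)
 have mE2:"\<mu> (nbd A (2 * s) Int E) <= en (e / 2)"
 proof -
 note mE
 also have "en (s / 8) * q (3 * s) <= en (s / 8) * en (P + d)" by (intro mult_left_mono qP3 ss s) simp
 also have "... = en (s / 8 * (P + d))" using s P d by (subst ennreal_mult[symmetric]) auto
 also have "... <= en (e / 2)"
 proof (rule ennreal_leI)
 have "s * (P + d) <= 4 * e" using t(3) P d mult_right_mono[OF s(2), of "P + d"] by linarith
 thus "s / 8 * (P + d) <= e / 2" by simp
 qed
 finally show ?thesis .
 qed
 obtain Q where Q:"q s = en Q" "0 <= Q" using qP[OF ss s(1)] by (cases "q s") (auto simp: top_unique)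
 have Q8:"8 * d < Q" using big[of s] s ss s1(2) Q d by (auto simp: ennreal_less_iff)
 have "en (Q - d) < q s" using Q8 d unfolding Q by (subst ennreal_less_iff) auto
 hence ev1:"evs (%i. en (Q - d) < NI (nbd A s) (G i))"
 unfolding q_def by (rule less_LiminfD)
 have ev2:"evs (%i. NI C (%x. ea (ps i x - indr E x)) < en (s * d / 2))"
 by (rule order_tendstoD(2)[OF lconvD[OF appr_lconv[OF ap] C]]) (use s d in auto)
 have ev3:"evs (%i. NI K (%x. ea (ps i x - indr E x)) < en (e / 2))"
 by (rule order_tendstoD(2)[OF lconvD[OF appr_lconv[OF ap] K]]) (use e in auto)
 from eventually_happens'[OF sequentially_bot eventually_conj[OF ev1 eventually_conj[OF ev2 ev3]]] obtain i where
 i:"en (Q - d) < NI (nbd A s) (G i)" "NI C (%x. ea (ps i x - indr E x)) < en (s * d / 2)"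
 "NI K (%x. ea (ps i x - indr E x)) < en (e / 2)" by blast
 have ps2:"NI (nbd A (2 * s)) (%x. en (ps i x)) <= en (s * d / 2) + en (s / 8) * q (3 * s)"
 proof -
 have "NI (nbd A (2 * s)) (%x. en (ps i x)) <=
 (NN x. ea (ps i x - indr E x) * ind C x + ind (nbd A (2 * s) Int E) x)"
 proof (rule nn_integral_mono)
 fix x
 have "x:nbd A (2 * s) ==> x:C" by (simp add: C_def nbd_iff[OF ne])
 moreover have "en (ps i x) <= en (abs (ps i x - 1) + 1)" by (intro ennreal_leI) auto
 hence "en (ps i x) <= ea (ps i x - 1) + 1" by (subst (asm) ennreal_plus) auto
 moreover have "en (ps i x) <= ea (ps i x)" by (intro ennreal_leI) auto
 ultimately show "en (ps i x) * ind (nbd A (2 * s)) x <= ea (ps i x - indr E x) * ind C x + ind (nbd A (2 * s) Int E) x"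
 by (auto simp: indicator_def)
 qed
 also have "... = NI C (%x. ea (ps i x - indr E x)) + \<mu> (nbd A (2 * s) Int E)"
 proof -
 have [measurable]:"C:sets M" by (rule compact_sets[OF C(1)])
 show ?thesis by (subst nn_integral_add) (auto simp: emeasure_M)
 qed
 also have "... <= en (s * d / 2) + en (s / 8) * q (3 * s)" using i(2) mE by (intro add_mono) auto
 finally show ?thesis .
 qed
 have "NI Om (H i) + NI (nbd A s) (G i) = (NN x. H i x * ind Om x + G i x * ind (nbd A s) x)"
 by (rule nn_integral_add[symmetric]) auto
 also have "... <= (NN x. G i x * ind Om x + en (2 / s) * (en (ps i x) * ind (nbd A (2 * s)) x))"
 proof (rule nn_integral_mono)
 fix x
 have n1:"x:nbd A s ==> x:Om" using nbd_mono[of s "5 * s" A] sub[OF ss] s(1) by auto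
 have "ea (ka x) * G i x <= 1 * G i x" using ka01[of x] by (intro mult_right_mono) auto
 hence "ea (ka x) * G i x * ind Om x + G i x * ind (nbd A s) x <= G i x * ind Om x"
 using n1 ka0[of x] by (auto simp: indicator_def)
 moreover have "ea (ps i x) * (en (2 / s) * ind (- Op) x) * ind Om x <= en (2 / s) * (en (ps i x) * ind (nbd A (2 * s)) x)"
 using Op2[of x] b[of i x] by (auto simp: indicator_def mult.commute)
 ultimately show "H i x * ind Om x + G i x * ind (nbd A s) x <= G i x * ind Om x + en (2 / s) * (en (ps i x) * ind (nbd A (2 * s)) x)"
 proof -
 assume a:"ea (ka x) * G i x * ind Om x + G i x * ind (nbd A s) x <= G i x * ind Om x"
 "ea (ps i x) * (en (2 / s) * ind (- Op) x) * ind Om x <= en (2 / s) * (en (ps i x) * ind (nbd A (2 * s)) x)"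
 have "H i x * ind Om x + G i x * ind (nbd A s) x = (ea (ka x) * G i x * ind Om x + G i x * ind (nbd A s) x)
 + ea (ps i x) * (en (2 / s) * ind (- Op) x) * ind Om x"
 unfolding H_def distrib_right by (simp only: add_ac)
 also have "... <= G i x * ind Om x + en (2 / s) * (en (ps i x) * ind (nbd A (2 * s)) x)" by (rule add_mono[OF a])
 finally show ?thesis .
 qed
 qed
 also have "... = NI Om (G i) + en (2 / s) * NI (nbd A (2 * s)) (%x. en (ps i x))"
 by (subst nn_integral_add) (auto simp: nn_integral_cmult)
 also have "... <= en (P + d) + en (2 / s) * (en (s * d / 2) + en (s / 8) * (2 * en Q))"
 using s(3) Q by (intro add_mono mult_left_mono G order_trans[OF ps2]) auto
 also have "... = en (P + d + 2 / s * (s * d / 2 + s / 8 * (2 * Q)))"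
 using P d s Q by (simp add: ennreal_mult[symmetric] flip: ennreal_plus ennreal_numeral)
 also have "P + d + 2 / s * (s * d / 2 + s / 8 * (2 * Q)) = P + 2 * d + Q / 2" using s by (simp add: field_simps)
 finally have HG:"NI Om (H i) + NI (nbd A s) (G i) <= en (P + 2 * d + Q / 2)" .
 have "NI Om (H i) + en (Q - d) <= en (P + 2 * d + Q / 2)"
 by (rule order_trans[OF add_left_mono HG]) (use i(1) in auto)
 \<comment> \<open>Subtracting the saving \<open>Q - d\<close> leaves
   \<open>P + 3 * d - Q / 2\<close>, which is below \<open>P - d\<close> because
   \<open>Q > 8 * d\<close>.\<close>
 hence HP:"NI Om (H i) <= en (P - d)"
 proof (cases "NI Om (H i)")
 case (real h)
 assume "NI Om (H i) + en (Q - d) <= en (P + 2 * d + Q / 2)"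
 hence "en (h + (Q - d)) <= en (P + 2 * d + Q / 2)" using real Q8 d by (simp add: ennreal_plus)
 hence "h + (Q - d) <= P + 2 * d + Q / 2" using P d Q by (subst (asm) ennreal_le_iff) auto
 thus ?thesis using Q8 real by (auto intro!: ennreal_leI)
 qed (auto simp: top_unique)
 have wF:"wug Om (%x. ka x * ps i x) (H i)"
 proof (rule wug_mult[OF wka apprD(1)[OF ap, of i]])
 show "bfin Om (H i)" by (rule bfinI) (use HP in "auto intro: le_less_trans")
 qed (auto simp: H_def)
 have lF:"locint Om (%x. ka x * ps i x)" unfolding locint_def
 proof (intro conjI allI impI)
 fix K :: "'a set" assume K:"compact K"
 have [measurable]:"K:sets M" by (rule compact_sets[OF K])
 have "NI K (%x. ea (ka x * ps i x)) <= NI K (%x. 1)"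
 using ka01 b by (intro ni_mono) (auto simp: abs_mult mult_le_one)
 also have "... < oo" using bounded_fin[OF compact_imp_bounded[OF K]] by (simp add: emeasure_M)
 finally show "NI K (%x. ea (ka x * ps i x)) < oo" .
 qed measurable
 have [measurable]:"K:sets M" by (rule compact_sets[OF K(1)])
 have "NI K (%x. ea (ka x * ps i x - indr E x)) <=
 (NN x. ea (ps i x - indr E x) * ind K x + ind (nbd A (2 * s) Int E) x)"
 proof (rule nn_integral_mono)
 fix x
 have le1:"ka x * ps i x <= ps i x" "0 <= ka x * ps i x" using ka01[of x] b[of i x] mult_right_mono[of "ka x" 1 "ps i x"] by auto
 have "x:Op ==> ka x = 1" "x ~: Op ==> x:nbd A (2 * s)" using ka1 Op2 by auto
 moreover have "ea (ka x * ps i x - 1) <= 1" using le1 b[of i x] by (subst ennreal_le_1) auto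
 moreover have "ea (ka x * ps i x) <= ea (ps i x)" using le1 by (intro ennreal_leI) auto
 ultimately show "ea (ka x * ps i x - indr E x) * ind K x <= ea (ps i x - indr E x) * ind K x + ind (nbd A (2 * s) Int E) x"
 by (cases "x:Op") (auto simp: indicator_def intro: add_increasing)
 qed
 also have "... = NI K (%x. ea (ps i x - indr E x)) + \<mu> (nbd A (2 * s) Int E)"
 by (subst nn_integral_add) (auto simp: emeasure_M)
 also have "... <= en (e / 2) + en (e / 2)" using i(3) mE2 by (intro add_mono) auto
 also have "... = en e" using e by (simp flip: ennreal_plus)
 finally show "EX F G. wug Om F G & locint Om F & NI K (%x. ea (F x - indr E x)) <= en e &
 (NI Om G) <= en (P - d) + en e"
 using wF lF HP by (intro exI[of _ "%x. ka x * ps i x"] exI[of _ "H i"]) (auto intro: add_increasing2)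
 qed
 thus False using P P7 d by (simp add: ennreal_le_iff)
qed

end

section \<open>Points of density zero and their quasiopenness\<close>

context doubling_space begin

definition dens0 :: "'a set => 'a => bool" where
 "dens0 E x \<longleftrightarrow> ((%r. mi E x r / mb x r) \<longlongrightarrow> 0) (at_right 0)"

lemma dens0_iff:
 "dens0 E x \<longleftrightarrow> (ALL ga>0. EX R>0. ALL r. 0 < r --> r <= R --> mi E x r <= en ga * mb x r)"
proof -
 have le:"mi E x r / mb x r <= en c \<longleftrightarrow> mi E x r <= en c * mb x r" if "0 < r" for r c
 proof -
 have b:"0 < mb x r" "mb x r < top" using ball_pos[OF that, of x] ball_fin[OF that, of x] by auto
 show ?thesis
 proof
 assume "mi E x r / mb x r <= en c"
 hence "mi E x r / mb x r * mb x r <= en c * mb x r" by (rule mult_right_mono) simp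
 thus "mi E x r <= en c * mb x r"
 using b by (simp add: ennreal_divide_times ennreal_times_divide[symmetric] ennreal_divide_self)
 qed (use b in "intro divide_le_posI_ennreal; simp add: mult.commute")
 qed
 show ?thesis
 proof
 assume d:"dens0 E x"
 show "ALL ga>0. EX R>0. ALL r. 0 < r --> r <= R --> mi E x r <= en ga * mb x r"
 proof (intro allI impI)
 fix ga :: real assume "ga > 0"
 hence "\<forall>\<^sub>F r in at_right 0. mi E x r / mb x r < en ga"
 using d unfolding dens0_def by (intro order_tendstoD(2)) auto
 then obtain R where "R > 0" "!!r. 0 < r ==> r < R ==> mi E x r / mb x r < en ga"
 unfolding eventually_at_right_field by auto
 thus "EX R>0. ALL r. 0 < r --> r <= R --> mi E x r <= en ga * mb x r"
 by (intro exI[of _ "R / 2"]) (auto simp: le[symmetric] less_imp_le)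
 qed
 next
 assume a:"ALL ga>0. EX R>0. ALL r. 0 < r --> r <= R --> mi E x r <= en ga * mb x r"
 show "dens0 E x" unfolding dens0_def
 proof (rule order_tendstoI)
 fix c :: ennreal assume "0 < c"
 from dense[OF this] obtain y where y:"0 < y" "y < c" by blast
 then obtain ga where ga:"ga > 0" "en ga < c" by (cases y) auto
 obtain R where R:"R > 0" "!!r. 0 < r ==> r <= R ==> mi E x r <= en ga * mb x r" using a ga(1) by blast
 have "mi E x r / mb x r < c" if "0 < r" "r < R" for r
 using R(2)[of r] le[of r ga] that ga(2) by auto
 thus "\<forall>\<^sub>F r in at_right 0. mi E x r / mb x r < c"
 unfolding eventually_at_right_field using R(1) by blast
 qed simp
 qed
qed

lemma content_antimono:"R <= R' ==> HC R' S <= HC R S"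
 unfolding hausdorff_content_def by (rule INF_superset_mono) force+

lemma mu0_AE:"\<mu> A = 0 ==> AM x. x ~: A"
proof -
 assume "\<mu> A = 0"
 then obtain B where "B:sets borel" "A <= B" "\<mu> B = 0" using br unfolding borel_regular_outer_measure_def by metis
 thus ?thesis by (intro AE_I[of _ _ B]) (auto simp: emeasure_M intro: borel_M')
qed

lemma mu_UN_0:
 fixes A :: "nat => 'a set"
 assumes "!!n. \<mu> (A n) = 0" shows "\<mu> (UN n. A n) = 0"
proof -
 have "AM x. ALL n. x ~: A n" using assms by (auto simp: AE_all_countable intro: mu0_AE)
 then obtain N where N:"{x:space M. ~ (ALL n. x ~: A n)} <= N" "eM N = 0" "N:sets M" by (rule AE_E)
 have "\<mu> (UN n. A n) <= \<mu> N" using N(1) by (intro mu_mono) auto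
 thus ?thesis using N by (simp add: emeasure_M)
qed

end

context poincare_space begin

text \<open>One doubling below \<open>g0\<close>: if the density in a ball is at most
  \<open>g1\<close>, then in the ball of half the radius it is at most \<open>g0\<close>, hence at
  most one half.\<close>

definition g1 :: real where "g1 = g0 / Cd"

lemma g1:"0 < g1" "g1 <= g0" "Cd * g1 = g0" "g0 <= 1 / 2"
proof -
 show "0 < g1" "Cd * g1 = g0" "g1 <= g0" using g0(1) Cd by (auto simp: g1_def field_simps)
 show "g0 <= 1 / 2" using g0 mult_right_mono[OF Cd, of g0] by linarith
qed

text \<open>Among the radii \<open>r0 / 2 ^ k\<close> the first with density at least
  \<open>g1\<close> works: the preceding one has smaller density, so doubling keeps this one below
  one half, and for \<open>k = 0\<close> this is assumed. Such a radius exists, since density above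
  \<open>g0\<close> at \<open>r\<close> gives density at least \<open>g1\<close> at the next larger
  dyadic radius.\<close>

lemma crossing:
 fixes x :: 'a
 assumes r0:"r0 > 0" and half:"mi E x r0 <= en (1 / 2) * mb x r0" and fat:"~ thin E r0 x"
 shows "EX r. 0 < r & r <= r0 & en g1 * mb x r <= mi E x r & mi E x r <= en (1 / 2) * mb x r"
proof -
 define P where "P k \<longleftrightarrow> en g1 * mb x (r0 / 2 ^ k) <= mi E x (r0 / 2 ^ k)" for k
 obtain r where r:"0 < r" "r <= r0" "~ \<mu> (ball x r Int E) <= en g0 * mb x r" using fat by (auto simp: thin_def)
 have dbl:"mb x (2 * s) <= en Cd * mb x s" if "s > 0" for s using doubling[OF that] .
 have "EX k. P k"
 proof -
 obtain k :: nat where k:"r0 / r < 2 ^ k" using real_arch_pow[of 2 "r0 / r"] by auto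
 define m where "m = (LEAST k. r0 / 2 ^ k < r)"
 have m0:"r0 / 2 ^ k < r" using k r by (simp add: field_simps)
 have m1:"r0 / 2 ^ m < r" unfolding m_def by (rule LeastI[of _ k]) (rule m0)
 hence "m ~= 0" using r by (intro notI) auto
 then obtain j where j:"m = Suc j" by (cases m) auto
 hence rj:"r <= r0 / 2 ^ j" using not_less_Least[of j "%k. r0 / 2 ^ k < r"] unfolding m_def[symmetric] by auto
 have "en g1 * mb x (r0 / 2 ^ j) = en g1 * mb x (2 * (r0 / 2 ^ m))" by (simp add: j)
 also have "... <= en g1 * (en Cd * mb x (r0 / 2 ^ m))" using r0 by (intro mult_left_mono dbl) auto
 also have "... = en g0 * mb x (r0 / 2 ^ m)"
 using g1 Cd by (simp add: mult.assoc[symmetric] ennreal_mult[symmetric] mult.commute)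
 also have "... <= en g0 * mb x r" using m1 by (intro mult_left_mono mu_mono) auto
 also have "... <= mi E x r" using r(3) by simp
 also have "... <= mi E x (r0 / 2 ^ j)" using rj by (intro mu_mono) auto
 finally show ?thesis unfolding P_def by blast
 qed
 define k where "k = (LEAST k. P k)"
 have Pk:"P k" unfolding k_def using `\<exists>k. P k` by (rule LeastI_ex)
 have "mi E x (r0 / 2 ^ k) <= en (1 / 2) * mb x (r0 / 2 ^ k)"
 proof (cases k)
 case (Suc j)
 hence "~ P j" using not_less_Least[of j P] unfolding k_def[symmetric] by auto
 have "mi E x (r0 / 2 ^ k) <= mi E x (r0 / 2 ^ j)"
 using r0 by (intro mu_mono Int_mono subset_ball) (auto simp: Suc field_simps)
 also have "... <= en g1 * mb x (r0 / 2 ^ j)" using `\<not> P j` by (simp add: P_def)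
 also have "... = en g1 * mb x (2 * (r0 / 2 ^ k))" by (simp add: Suc)
 also have "... <= en g1 * (en Cd * mb x (r0 / 2 ^ k))" using r0 by (intro mult_left_mono dbl) auto
 also have "... = en g0 * mb x (r0 / 2 ^ k)"
 using g1 Cd by (simp add: mult.assoc[symmetric] ennreal_mult[symmetric] mult.commute)
 also have "... <= en (1 / 2) * mb x (r0 / 2 ^ k)" by (intro mult_right_mono ennreal_leI g1) auto
 finally show ?thesis .
 qed (use half in simp)
 moreover have "r0 / 2 ^ k <= r0 / 1" using r0 by (intro divide_left_mono) auto
 ultimately show ?thesis using Pk r0 by (intro exI[of _ "r0 / 2 ^ k"]) (auto simp: P_def)
qed

lemma crossing_content:
 fixes S :: "'a set"
 assumes E[measurable]:"E:sets M" and ap:"appr Om (indr E) ps G" and b:"!!i x. 0 <= ps i x & ps i x <= 1"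
 and r0:"r0 > 0" and S:"!!x. x:S ==> cball x (2 * Lam * r0) <= Om & ball x (Lam * r0) <= V & ~ thin E r0 x &
 mi E x r0 <= en (1 / 2) * mb x r0"
 shows "HC (5 * Lam * r0) S <= en (cbox0 / g1) * liminf (%i. NI V (G i))"
proof (rule boxing[OF E ap b g1(1)], intro ballI)
 fix x assume x:"x:S"
 obtain r where r:"0 < r" "r <= r0" "en g1 * mb x r <= mi E x r" "mi E x r <= en (1 / 2) * mb x r"
 using crossing[OF r0] S[OF x] by blast
 have "en g1 * mb x r <= min (mi E x r) (\<mu> (ball x r - E))"
 using r(3) ball_half[OF E r(1,4)] by (auto simp: min_def)
 moreover have "Lam * r <= Lam * r0" "2 * Lam * r <= 2 * Lam * r0" using r(2) Lam by auto
 hence "ball x (Lam * r) <= V" "cball x (2 * Lam * r) <= Om"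
 using S[OF x] subset_ball[of "Lam * r" "Lam * r0" x] subset_cball[of "2 * Lam * r" "2 * Lam * r0" x] by blast+
 ultimately show "EX r>0. r <= r0 & en g1 * mb x r <= min (mi E x r) (\<mu> (ball x r - E)) &
 ball x (Lam * r) <= V & cball x (2 * Lam * r) <= Om" using r by blast
qed

lemma ennreal_small_0:
 fixes m :: ennreal
 assumes "!!d. d > 0 ==> m <= en (C * d)" and C:"C > 0" shows "m = 0"
proof -
 have "m <= 0"
 proof (rule ennreal_le_epsilon)
 fix e :: real assume "0 < e"
 hence "m <= en (C * (e / C))" using C by (intro assms(1)) simp
 thus "m <= 0 + en e" using C by simp
 qed
 thus ?thesis by simp
qed

text \<open>At a thin point the density is at most one half at small scales; where it does not tend
  to zero, it exceeds some \<open>1 / Suc n\<close> at arbitrarily small ones. Boxing bounds the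
  content of such points by the energy near \<open>A\<close>, and \<open>thin_small\<close> makes
  that energy as small as desired.\<close>

lemma thin_pos_null:
 fixes A :: "'a set"
 assumes E[measurable]:"E:sets M" and Om:"open Om" and P:"tv Om (indr E) < oo"
 and K0:"compact K0" "K0 <= Om" and A:"A <= K0" "ALL x:A. thin E R x & ~ dens0 E x" and R:"R > 0" and R':"R' > 0"
 shows "HC R' A = 0"
proof -
 obtain P where P:"tv Om (indr E) = en P" "0 <= P" using P by (cases "tv Om (indr E)") auto
 define B where "B n = {x:A. ALL R>0. EX r. 0 < r & r <= R & ~ \<mu> (ball x r Int E) <= en (1 / Suc n) * mb x r}" for n
 obtain e0 where e0:"e0 > 0" "nbd K0 e0 <= Om" by (rule compact_nbd[OF K0 Om])
 have L0:"0 < Lam" using Lam by simp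
 have "HC R' (B n) = 0" for n
 proof (rule ennreal_small_0)
 show "0 < cbox0 / (1 / Suc n) * 8" using cbox0_pos by simp
 fix d :: real assume d:"d > 0"
 obtain ps G where ap:"appr Om (indr E) ps G" "!!i x. 0 <= ps i x & ps i x <= 1" "!!i. NI Om (G i) <= en (P + d)"
 using per_seq[OF eq_refl[OF P(1)] d P(2)] by blast
 have "ALL x:A. thin E R x" using A(2) by blast
 from thin_small[OF E Om ap(1,2) K0 A(1) this R P d ap(3) zero_less_one] obtain s where
 s:"0 < s" "s <= 1" "liminf (%i. NI (nbd A s) (G i)) <= en (8 * d)" by blast
 \<comment> \<open>The four bounds serve thinness, the neighbourhood of small energy, the scale of
   the content and the distance to the boundary of \<open>Om\<close>.\<close>
 define rh where "rh = min R (min (s / Lam) (min (R' / (5 * Lam)) (e0 / (3 * Lam))))"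
 have rh:"0 < rh" "rh <= R" "Lam * rh <= s" "5 * Lam * rh <= R'" "3 * Lam * rh <= e0"
 proof -
 show "0 < rh" "rh <= R" using R R' s e0 L0 by (auto simp: rh_def)
 have "rh <= s / Lam" "rh <= R' / (5 * Lam)" "rh <= e0 / (3 * Lam)" by (auto simp: rh_def)
 thus "Lam * rh <= s" "5 * Lam * rh <= R'" "3 * Lam * rh <= e0" using L0 by (auto simp: pos_le_divide_eq mult.commute)
 qed
 have "HC R' (B n) <= HC (5 * Lam * rh) (B n)" by (rule content_antimono[OF rh(4)])
 also have "... <= en (cbox0 / (1 / Suc n)) * liminf (%i. NI (nbd A s) (G i))"
 proof (rule boxing[OF E ap(1,2)], simp, intro ballI)
 fix x assume x:"x:B n"
 hence xA:"x:A" by (simp add: B_def)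
 obtain r where r:"0 < r" "r <= rh" "~ \<mu> (ball x r Int E) <= en (1 / Suc n) * mb x r" using x rh(1) unfolding B_def by blast
 have "mi E x r <= en g0 * mb x r" using A(2) xA r rh by (auto simp: thin_def)
 also have "... <= en (1 / 2) * mb x r" by (intro mult_right_mono ennreal_leI g1) auto
 finally have "mi E x r <= \<mu> (ball x r - E)" by (rule ball_half[OF E r(1)])
 hence 1:"en (1 / Suc n) * mb x r <= min (mi E x r) (\<mu> (ball x r - E))" using r(3) by (auto simp: min_def)
 have "Lam * r <= Lam * rh" using r(2) L0 by simp
 hence "ball x (Lam * r) <= nbd A s" using xA rh(3) subset_ball[of "Lam * r" s x] by (auto simp: nbd_def)
 moreover have "2 * Lam * r < e0" using `Lam * r \<le> Lam * rh` rh(5) e0 by linarith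
 hence "cball x (2 * Lam * r) <= nbd K0 e0" using xA A(1) by (force simp: nbd_def)
 ultimately show "EX r>0. r <= rh & en (1 / Suc n) * mb x r <= min (mi E x r) (\<mu> (ball x r - E)) &
 ball x (Lam * r) <= nbd A s & cball x (2 * Lam * r) <= Om" using 1 r e0(2) by blast
 qed
 also have "... <= en (cbox0 / (1 / Suc n)) * en (8 * d)" by (rule mult_left_mono[OF s(3)]) simp
 also have "... = en (cbox0 / (1 / Suc n) * 8 * d)" using cbox0_pos d by (subst ennreal_mult[symmetric]) (auto simp: mult.assoc)
 finally show "HC R' (B n) <= en (cbox0 / (1 / Suc n) * 8 * d)" .
 qed
 hence "HC R' (UN n. B n) = 0" by (rule content_UN_0)
 moreover have "A <= (UN n. B n)"
 proof
 fix x assume x:"x:A"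
 then obtain ga where ga:"ga > 0" "!!R. R > 0 ==> EX r. 0 < r & r <= R & ~ \<mu> (ball x r Int E) <= en ga * mb x r"
 using A(2) unfolding dens0_iff by meson
 obtain n where "1 / Suc n < ga" using nat_approx_posE[OF ga(1)] by auto
 hence "en (1 / Suc n) * mb x r <= en ga * mb x r" for r by (intro mult_right_mono ennreal_leI) auto
 hence le:"~ \<mu> (ball x r Int E) <= en ga * mb x r ==> ~ \<mu> (ball x r Int E) <= en (1 / Suc n) * mb x r" for r
 by (meson order_trans)
 have "x:B n" unfolding B_def
 proof (intro CollectI conjI x allI impI)
 fix R :: real assume "R > 0"
 thus "EX r. 0 < r & r <= R & ~ \<mu> (ball x r Int E) <= en (1 / Suc n) * mb x r"
 using ga(2)[of R] le by blast
 qed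
 thus "x:(UN n. B n)" by blast
 qed
 ultimately show ?thesis using content_mono[of A "UN n. B n" R'] by simp
qed

text \<open>The gap between density zero and failure of thinness at all scales;
  \<open>exc_null\<close> shows that it is negligible.\<close>

definition exc :: "'a set => 'a set => 'a set" where
 "exc Om E = {x:Om. ~ dens0 E x & (EX R>0. thin E R x)}"

lemma thin_antimono:"thin E R x ==> R' <= R ==> thin E R' x"
 unfolding thin_def by (meson order_trans)

lemma exc_null:
 assumes E:"E:sets M" and Om:"open (Om::'a set)" and P:"tv Om (indr E) < oo" and R':"R' > 0"
 shows "HC R' (exc Om E) = 0"
proof -
 obtain K :: "nat => 'a set" where K:"!!n. compact (K n)" "!!n. K n <= Om" "!!n m. n <= m ==> K n <= K m"
 "!!L. compact L ==> L <= Om ==> EX n. L <= K n" using exhaustion[OF Om] by blast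
 define A where "A n = {x:K n. thin E (1 / Suc n) x & ~ dens0 E x}" for n
 have "HC R' (A n) = 0" for n
 by (rule thin_pos_null[OF E Om P K(1,2)[of n], where R = "1 / Suc n"]) (auto simp: A_def R')
 hence "HC R' (UN n. A n) = 0" by (rule content_UN_0)
 moreover have "exc Om E <= (UN n. A n)"
 proof
 fix x assume x:"x:exc Om E"
 then obtain R where R:"R > 0" "thin E R x" "x:Om" "~ dens0 E x" by (auto simp: exc_def)
 obtain n where n:"{x} <= K n" using K(4)[of "{x}"] R(3) by auto
 obtain m where m:"1 / Suc m < R" using nat_approx_posE[OF R(1)] by auto
 have "1 / Suc (max n m) <= 1 / Suc m" by (intro divide_left_mono) auto
 hence "thin E (1 / Suc (max n m)) x" using thin_antimono[OF R(2)] m by auto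
 hence "x:A (max n m)" using n K(3)[of n "max n m"] R(4) by (auto simp: A_def)
 thus "x:(UN n. A n)" by blast
 qed
 ultimately show ?thesis using content_mono[of "exc Om E" "UN n. A n" R'] by simp
qed

lemma thin_exhaust:
 fixes K :: "nat => 'a set"
 assumes K:"!!n m. n <= m ==> K n <= K m" "!!L. compact L ==> L <= Om ==> EX n. L <= K n"
 and x:"x:Om" "dens0 E x"
 shows "EX m. x:K m & thin E (1 / Suc m) x"
proof -
 obtain n where n:"{x} <= K n" using K(2)[of "{x}"] x by auto
 obtain R where R:"R > 0" "thin E R x" using x(2) g0(1) unfolding dens0_iff thin_def by blast
 obtain m where m:"1 / Suc m < R" using nat_approx_posE[OF R(1)] by auto
 have "1 / Suc (max n m) <= 1 / Suc m" by (intro divide_left_mono) auto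
 hence "1 / Suc (max n m) <= R" using m by linarith
 hence "thin E (1 / Suc (max n m)) x" by (rule thin_antimono[OF R(2)])
 thus ?thesis using n K(1)[of n "max n m"] by auto
qed

text \<open>Points of density zero are thin from some scale on, and near thin points
  \<open>thin_measure\<close> bounds the measure of \<open>E\<close> by a multiple of
  \<open>s\<close>, which tends to zero.\<close>

lemma dens0_null:
 assumes E:"E:sets M" and Om:"open (Om::'a set)" and P:"tv Om (indr E) < oo"
 shows "AM x. x:Om --> dens0 E x --> x ~: E"
proof -
 obtain P where P:"tv Om (indr E) = en P" "0 <= P" using P by (cases "tv Om (indr E)") auto
 obtain ps G where ap:"appr Om (indr E) ps G" "!!i x. 0 <= ps i x & ps i x <= 1" "!!i. NI Om (G i) <= en (P + 1)"
 using per_seq[OF eq_refl[OF P(1)] zero_less_one P(2)] by blast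
 obtain K :: "nat => 'a set" where K:"!!n. compact (K n)" "!!n. K n <= Om" "!!n m. n <= m ==> K n <= K m"
 "!!L. compact L ==> L <= Om ==> EX n. L <= K n" using exhaustion[OF Om] by blast
 define A where "A n = {x:K n. thin E (1 / Suc n) x}" for n
 have "\<mu> (A n Int E) = 0" for n
 proof (rule ennreal_small_0)
 obtain e0 where e0:"e0 > 0" "nbd (K n) e0 <= Om" by (rule compact_nbd[OF K(1,2) Om])
 fix d :: real assume d:"d > 0"
 define s where "s = min d (min (1 / Suc n / 3) (e0 / 5))"
 have s:"0 < s" "s <= d" "5 * s <= e0" using d e0 by (auto simp: s_def)
 have "s <= 1 / Suc n / 3" unfolding s_def by (intro min.coboundedI2 min.coboundedI1) simp
 hence s3:"3 * s <= 1 / Suc n" by (simp add: field_simps)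
 have bA:"bounded (A n)" using compact_imp_bounded[OF K(1)[of n]] by (rule bounded_subset) (auto simp: A_def)
 have sub:"nbd (A n) (5 * s) <= Om" using e0(2) s(3) by (force simp: nbd_def A_def)
 have "A n Int E <= nbd (A n) (2 * s) Int E" using s(1) by (auto simp: nbd_def)
 hence "\<mu> (A n Int E) <= \<mu> (nbd (A n) (2 * s) Int E)" by (rule mu_mono)
 also have "... <= en (s / 8) * liminf (%i. NI (nbd (A n) (3 * s)) (G i))"
 by (rule thin_measure[OF E ap(1,2) bA _ s(1) s3 sub]) (simp add: A_def)
 also have "... <= en (s / 8) * en (P + 1)"
 proof (intro mult_left_mono liminf_bound)
 fix i
 have "nbd (A n) (3 * s) <= Om" using nbd_mono[of "3 * s" "5 * s" "A n"] sub s(1) by auto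
 thus "NI (nbd (A n) (3 * s)) (G i) <= en (P + 1)"
 by (intro order_trans[OF ni_mono ap(3)[of i]]) auto
 qed simp
 also have "... = en (s / 8 * (P + 1))" using s P by (subst ennreal_mult[symmetric]) auto
 also have "... <= en ((P + 1) * d)" 
 proof (rule ennreal_leI)
 have "s / 8 * (P + 1) <= d * (P + 1)" using s P by (intro mult_right_mono) auto
 thus "s / 8 * (P + 1) <= (P + 1) * d" by (simp only: mult.commute)
 qed
 finally show "\<mu> (A n Int E) <= en ((P + 1) * d)" .
 qed (use P in auto)
 hence "\<mu> (UN n. A n Int E) = 0" by (rule mu_UN_0)
 hence "AM x. x ~: (UN n. A n Int E)" by (rule mu0_AE)
 thus ?thesis
 proof eventually_elim
 case (elim x)
 show ?case
 proof (intro impI notI)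
 assume "x:Om" "dens0 E x" "x:E"
 thus False using thin_exhaust[OF K(3,4)] elim unfolding A_def by blast
 qed
 qed
qed

text \<open>The thin points have neighbourhoods in which the energy is small. Points there that
  neither have density zero nor lie in \<open>exc\<close> cross an intermediate density, so boxing
  bounds their content. Since the conclusion holds for every open \<open>G\<close> containing
  \<open>S\<close>, one \<open>G\<close> can later serve many sets at once.\<close>

lemma dens0_quasiopen:
 assumes E:"E:sets M" and Om:"open (Om::'a set)" and P:"tv Om (indr E) < oo" and ep:"0 < ep"
 shows "EX S. HC 1 S <= en ep & (ALL G. open G --> S <= G --> open ({x:Om. dens0 E x} Un G))"
proof -
 let ?O = "{x:Om. dens0 E x}"
 have tvf:"tv Om (indr E) < oo" by fact
 obtain P where P:"tv Om (indr E) = en P" "0 <= P" using P by (cases "tv Om (indr E)") auto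
 obtain K :: "nat => 'a set" where K:"!!n. compact (K n)" "!!n. K n <= Om" "!!n m. n <= m ==> K n <= K m"
 "!!L. compact L ==> L <= Om ==> EX n. L <= K n" using exhaustion[OF Om] by blast
 define A where "A n = {x:K n. thin E (1 / Suc n) x}" for n
 have L0:"0 < Lam" using Lam by simp
 have nb:"EX t>0. HC 1 (nbd (A n) (2 * t) - ?O) <= en et" if et:"et > 0" for n et
 proof -
 define d where "d = et / (cbox0 / g1 * 8)"
 have bg:"0 < cbox0 / g1" using cbox0_pos g1(1) by simp
 have d:"d > 0" unfolding d_def using et cbox0_pos g1(1) by (intro divide_pos_pos mult_pos_pos) auto
 obtain e0 where e0:"e0 > 0" "nbd (K n) e0 <= Om" by (rule compact_nbd[OF K(1,2) Om])
 define s0 where "s0 = min (1 / Suc n) (min (1 / 5) e0)"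
 have s0:"0 < s0" "s0 <= 1 / Suc n" "5 * s0 <= 1" "s0 <= e0" using e0 by (auto simp: s0_def)
 obtain ps G where ap:"appr Om (indr E) ps G" "!!i x. 0 <= ps i x & ps i x <= 1" "!!i. NI Om (G i) <= en (P + d)"
 using per_seq[OF eq_refl[OF P(1)] d P(2)] by blast
 have AK:"A n <= K n" and tA:"ALL x:A n. thin E (1 / Suc n) x" by (auto simp: A_def)
 from thin_small[OF E Om ap(1,2) K(1,2) AK tA _ P d ap(3) s0(1)] obtain s where
 s:"0 < s" "s <= s0" "liminf (%i. NI (nbd (A n) s) (G i)) <= en (8 * d)" by auto
 define t where "t = s / 5"
 have t:"0 < t" "5 * t = s" using s by (auto simp: t_def)
 have r0:"0 < th * t" "Lam * (th * t) <= t"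
 using th(1) t(1) mult_right_mono[OF th(2), of t] by (auto simp: mult.assoc)
 have "HC (5 * Lam * (th * t)) (nbd (A n) (2 * t) - ?O - exc Om E) <= en (cbox0 / g1) * liminf (%i. NI (nbd (A n) s) (G i))"
 proof (rule crossing_content[OF E ap(1,2) r0(1)])
 fix y assume y:"y:nbd (A n) (2 * t) - ?O - exc Om E"
 then obtain a where a:"a:A n" "dist a y < 2 * t" by (auto simp: nbd_def)
 have near:"cball y (2 * t) <= nbd (A n) s"
 proof
 fix z assume "z:cball y (2 * t)"
 hence "dist a z < 5 * t" using a(2) dist_triangle[of a z y] t(1) by auto
 thus "z:nbd (A n) s" using a(1) t by (auto simp: nbd_def)
 qed
 have sO:"nbd (A n) s <= Om" using e0(2) s(2) s0(4) AK by (force simp: nbd_def)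
 have "y:Om" using near sO t(1) by (meson centre_in_cball less_imp_le mult_pos_pos subsetD zero_less_numeral)
 hence "~ thin E (th * t) y" using y r0(1) by (auto simp: exc_def)
 moreover have "thin E (1 / Suc n) a" using a(1) by (simp add: A_def)
 hence "mi E y (th * t) <= en (1 / 2) * mb y (th * t)"
 by (rule thin_near[OF _ a(2)]) (use t s s0 in auto)
 moreover have "cball y (2 * Lam * (th * t)) <= cball y (2 * t)" using r0(2) by (intro subset_cball) auto
 moreover have "ball y (Lam * (th * t)) <= cball y (2 * t)"
 by (rule subset_trans[OF ball_subset_cball subset_cball]) (use r0(2) t(1) in linarith)
 ultimately show "cball y (2 * Lam * (th * t)) <= Om & ball y (Lam * (th * t)) <= nbd (A n) s & ~ thin E (th * t) y &
 mi E y (th * t) <= en (1 / 2) * mb y (th * t)" using near sO by blast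
 qed
 also have "... <= en (cbox0 / g1) * en (8 * d)" by (rule mult_left_mono[OF s(3)]) simp
 also have "... = en (cbox0 / g1 * (8 * d))" using bg d by (subst ennreal_mult[symmetric]) auto
 also have "cbox0 / g1 * (8 * d) = et" using cbox0_pos g1(1) by (simp add: d_def)
 finally have c1:"HC (5 * Lam * (th * t)) (nbd (A n) (2 * t) - ?O - exc Om E) <= en et" .
 have "HC 1 (nbd (A n) (2 * t) - ?O) <= HC 1 ((nbd (A n) (2 * t) - ?O - exc Om E) Un exc Om E)"
 by (rule content_mono) auto
 also have "... <= HC 1 (nbd (A n) (2 * t) - ?O - exc Om E) + HC 1 (exc Om E)" by (rule content_Un)
 also have "... = HC 1 (nbd (A n) (2 * t) - ?O - exc Om E)" using exc_null[OF E Om tvf, of 1] by simp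
 also have "... <= HC (5 * Lam * (th * t)) (nbd (A n) (2 * t) - ?O - exc Om E)"
 by (rule content_antimono) (use r0 t s s0 in linarith)
 also note c1
 finally show ?thesis using t(1) by blast
 qed
 have "ALL n. EX t>0. HC 1 (nbd (A n) (2 * t) - ?O) <= en (ep * (1 / 2) ^ Suc n)"
 using nb ep by auto
 from choice[OF this] obtain t where t:"ALL n. 0 < t n & HC 1 (nbd (A n) (2 * t n) - ?O) <= en (ep * (1 / 2) ^ Suc n)" ..
 \<comment> \<open>This open set contains \<open>?O\<close>, and for every \<open>G\<close>
   containing the excess \<open>N - ?O\<close> the sets \<open>?O Un G\<close> and
   \<open>N Un G\<close> are equal.\<close>
 define N where "N = (UN n. nbd (A n) (2 * t n))"
 have "HC 1 (N - ?O) <= (\<Sum>n. HC 1 (nbd (A n) (2 * t n) - ?O))"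
 unfolding N_def using content_UN[of 1 "%n. nbd (A n) (2 * t n) - ?O"] by (simp only: UN_simps)
 also have "... <= (\<Sum>n. en (ep * (1 / 2) ^ Suc n))" using t by (intro suminf_le) auto
 also have "... = en ep"
 using sums_mult[OF power_half_series, of ep] ep by (intro suminf_ennreal_eq) auto
 finally have "HC 1 (N - ?O) <= en ep" .
 moreover have "?O <= N"
 proof
 fix x assume "x:?O"
 then obtain m where "x:K m" "thin E (1 / Suc m) x" using thin_exhaust[OF K(3,4)] by blast
 hence "x:A m" by (simp add: A_def)
 hence "x:nbd (A m) (2 * t m)" using t by (auto simp: nbd_def intro!: bexI[of _ x])
 thus "x:N" by (auto simp: N_def)
 qed
 hence "open (?O Un G)" if "open G" "N - ?O <= G" for G
 proof -
 have "?O Un G = N Un G" using `?O \<subseteq> N` that(2) by blast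
 thus ?thesis using that(1) by (simp add: N_def open_Un open_UN)
 qed
 ultimately show ?thesis by blast
qed

end

section \<open>A coarea inequality for some level in a given interval\<close>

context doubling_space begin

lemma dens0_mono:"dens0 E' x ==> E <= E' ==> dens0 E x"
 unfolding dens0_iff by (meson Int_mono mu_mono order_refl order_trans)

lemma dct0:
 fixes f :: "nat => 'a => real"
 assumes [measurable]:"w:bM" "!!i. f i:bM" and w:"(NN x. w x) < oo"
 and f:"AM x. w x ~= 0 --> (%i. f i x) ~~> 0 & (ALL i. abs (f i x) <= B)"
 shows "(%i. NN x. ea (f i x) * w x) ~~> 0"
proof -
 have "(%i. NN x. ea (f i x) * w x) ~~> (NN x. 0)"
 proof (rule nn_integral_dominated_convergence[where w = "%x. en B * w x"])
 show "AM x. ea (f i x) * w x <= en B * w x" for i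
 using f
 proof eventually_elim
 case (elim x)
 thus ?case by (cases "w x = 0") (auto intro!: mult_right_mono ennreal_leI)
 qed
 show "(NN x. en B * w x) < oo" using w by (simp add: nn_integral_cmult ennreal_mult_less_top)
 show "AM x. (%i. ea (f i x) * w x) ~~> 0"
 using f nn_integral_noteq_infinite[OF assms(1) w[unfolded less_top_ennreal, THEN less_imp_neq]]
 proof eventually_elim
 case (elim x)
 show ?case
 proof (cases "w x = 0")
 case False
 hence "(%i. ea (f i x)) ~~> en 0" using elim(1) by (intro tendsto_ennrealI tendsto_rabs_zero) auto
 hence "(%i. w x * ea (f i x)) ~~> w x * en 0" using elim(2) by (intro ennreal_tendsto_cmult) (auto simp: less_top)
 thus ?thesis by (simp add: mult.commute)
 qed simp
 qed
 qed measurable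
 thus ?thesis by simp
qed

lemma subseq_diag:
 assumes "!!n::nat. evs (%i. P n i)"
 shows "EX r::nat => nat. strict_mono r & (ALL n. P n (r n))"
proof -
 obtain N where N:"!!n i. N n <= i ==> P n i" using assms unfolding eventually_sequentially by metis
 define r where "r n = n + (SUM k<=n. N k)" for n
 have "strict_mono r" by (rule strict_monoI_Suc) (simp add: r_def)
 moreover have "N n <= r n" for n unfolding r_def by (rule trans_le_add2) (auto intro: member_le_sum)
 ultimately show ?thesis using N by blast
qed

text \<open>A subsequence has summable errors on the \<open>n\<close>-th compact set of an
  exhaustion, and each point lies in all but finitely many of these sets.\<close>

lemma lconv_AE_subseq:
 fixes W :: "'a set"
 assumes W:"open W" and [measurable]:"!!i. F i:bM" "f:bM" and L:"lconv W F f"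
 shows "EX r::nat => nat. strict_mono r & (AM x. x:W --> (%i. F (r i) x) ~~> f x)"
proof -
 obtain K :: "nat => 'a set" where K:"!!n. compact (K n)" "!!n. K n <= W" "!!n m. n <= m ==> K n <= K m"
 "!!L. compact L ==> L <= W ==> EX n. L <= K n" using exhaustion[OF W] by blast
 have [measurable]:"K n:sets M" for n using K(1) by (intro borel_M' borel_closed compact_imp_closed)
 have "evs (%i. NI (K n) (%x. ea (F i x - f x)) < en ((1 / 2) ^ Suc n))" for n
 by (rule order_tendstoD(2)[OF lconvD[OF L K(1,2)]]) simp
 from subseq_diag[of "%n i. NI (K n) (%x. ea (F i x - f x)) < en ((1 / 2) ^ Suc n)", OF this] obtain r :: "nat => nat" where r:"strict_mono r"
 "ALL n. NI (K n) (%x. ea (F (r n) x - f x)) < en ((1 / 2) ^ Suc n)" by blast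
 have "AM x. (\<Sum>i. ea (F (r i) x - f x) * ind (K i) x) ~= oo"
 proof (rule nn_integral_noteq_infinite)
 have "(NN x. (\<Sum>i. ea (F (r i) x - f x) * ind (K i) x)) = (\<Sum>i. NI (K i) (%x. ea (F (r i) x - f x)))"
 by (rule nn_integral_suminf) measurable
 also have "... <= (\<Sum>i. en ((1 / 2) ^ Suc i))" using r(2) by (intro suminf_le less_imp_le) auto
 also have "... = en 1" by (rule suminf_ennreal_eq[OF _ power_half_series]) simp
 finally show "(NN x. (\<Sum>i. ea (F (r i) x - f x) * ind (K i) x)) ~= oo" by (auto simp: top_unique)
 qed measurable
 hence "AM x. x:W --> (%i. F (r i) x) ~~> f x"
 proof eventually_elim
 case (elim x)
 show ?case
 proof
 assume "x:W"
 then obtain m where m:"{x} <= K m" using K(4)[of "{x}"] by auto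
 have "(%i. ea (F (r i) x - f x) * ind (K i) x) ~~> 0"
 by (rule suminf_lim0) (use elim in simp)
 moreover have "evs (%i. ea (F (r i) x - f x) * ind (K i) x = ea (F (r i) x - f x))"
 unfolding eventually_sequentially 
 proof (intro exI[of _ m] allI impI)
 fix n assume "m <= n"
 hence "x:K n" using m K(3)[of m n] by blast
 thus "ea (F (r n) x - f x) * ind (K n) x = ea (F (r n) x - f x)" by simp
 qed
 ultimately have "(%i. ea (F (r i) x - f x)) ~~> en 0" by (simp add: Lim_transform_eventually)
 hence "(%i. abs (F (r i) x - f x)) ~~> 0" by (subst (asm) tendsto_ennreal_iff) auto
 hence "(%i. F (r i) x - f x) ~~> 0" by (subst (asm) tendsto_rabs_zero_iff)
 thus "(%i. F (r i) x) ~~> f x" by (rule LIM_zero_cancel)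
 qed
 qed
 thus ?thesis using r(1) by blast
qed

text \<open>Fubini: the set of pairs \<open>(t, x)\<close> with \<open>f x = t\<close> has one-point
  sections over each \<open>x\<close>.\<close>

lemma AE_level_null:
 assumes [measurable]:"f:bM"
 shows "AE t in lborel. AM x. f x ~= (t::real)"
proof -
 interpret pair_sigma_finite lborel M by standard
 have "(\<integral>\<^sup>+t. (NN x. ind {z. fst z = snd z} (t, f x)) \<partial>lborel) = (\<integral>\<^sup>+x. (\<integral>\<^sup>+t. ind {z. fst z = snd z} (t, f x) \<partial>lborel) \<partial>M)"
 by (rule Fubini'[symmetric]) measurable
 also have "... = (NN x. 0)"
 proof (rule nn_integral_cong)
 fix x
 have "(\<integral>\<^sup>+t. ind {z. fst z = snd z} (t, f x) \<partial>lborel) = (\<integral>\<^sup>+t. ind {f x} t \<partial>lborel)"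
 by (intro nn_integral_cong) (auto simp: indicator_def)
 thus "(\<integral>\<^sup>+t. ind {z. fst z = snd z} (t, f x) \<partial>lborel) = (0::ennreal)" by simp
 qed
 finally have "(\<integral>\<^sup>+t. (NN x. ind {z. fst z = snd z} (t, f x)) \<partial>lborel) = 0" by simp
 hence "AE t in lborel. (NN x. ind {z. fst z = snd z} (t, f x)) = 0"
 by (subst (asm) nn_integral_0_iff_AE) auto
 thus ?thesis
 proof eventually_elim
 case (elim t)
 have "AM x. ind {z. fst z = snd z} (t, f x) = (0::ennreal)"
 using elim by (subst (asm) nn_integral_0_iff_AE) auto
 thus ?case by eventually_elim (auto simp: indicator_def split: if_splits)
 qed
qed

text \<open>By averaging over the levels: the band truncations at level \<open>t\<close> have
  energies whose integral over \<open>t\<close> is at most \<open>A\<close> by Fubini, and Fatou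
  passes to the limit. The factor two makes failure at every level a strict contradiction.\<close>

lemma coarea:
 fixes Om :: "'a set"
 assumes Om:"open Om" and f[measurable]:"f:bM" and A:"tv Om f < en A" and L:"0 < L"
 shows "EX t. a < t & t < a + L & tv Om (indr {x. t < f x}) <= en (2 * A / L)"
proof (rule ccontr)
 assume neg:"~ ?thesis"
 have A0:"0 < A" using A by (cases "A > 0") (auto simp: ennreal_neg)
 interpret pair_sigma_finite lborel M by standard
 have [measurable]:"Om:sets M" using Om by (intro borel_M') auto
 obtain F0 G0 where FG0:"appr Om f F0 G0" "!!i. NI Om (G0 i) < en A" using tv_less[OF A] by blast
 obtain r :: "nat => nat" where r:"strict_mono r" "AM x. x:Om --> (%i. F0 (r i) x) ~~> f x"
 using lconv_AE_subseq[OF Om apprD(2)[OF FG0(1)] f appr_lconv[OF FG0(1)]] by blast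
 define F G where "F i = F0 (r i)" and "G i = G0 (r i)" for i
 have FG:"!!i. wug Om (F i) (G i)" "!!i. F i:bM" "!!i. G i:bM" "!!i. NI Om (G i) <= en A"
 "AM x. x:Om --> (%i. F i x) ~~> f x"
 using apprD[OF FG0(1)] FG0(2) r(2) by (auto simp: F_def G_def less_imp_le)
 note [measurable] = FG(2,3)
 \<comment> \<open>Widths of the bands. As they tend to zero, the truncations converge to the
   indicator of the superlevel set away from the level set itself, which is null for almost every
   level.\<close>
 define s where "s i = rs i" for i
 have s:"s i > 0" "s ~~> 0" for i using LIMSEQ_inverse_real_of_nat by (auto simp: s_def[abs_def] inverse_eq_divide)
 define g where "g i t x = en (1 / s i) * G i x * ind {x. t <= F i x & F i x <= t + s i} x" for i t x
 define ps where "ps i t x = max 0 (min 1 ((F i x - t) / s i))" for i t x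
 define h where "h i t = NI Om (g i t)" for i t
 have hm[measurable]:"h i:borel_measurable lborel" for i unfolding h_def[abs_def] g_def by measurable
 have "(NL {a<..<a+L} (%t. h i t)) <= en A" for i
 proof -
 have "(NL {a<..<a+L} (%t. h i t)) <= (\<integral>\<^sup>+t. (NN x. g i t x * ind Om x) \<partial>lborel)"
 unfolding h_def by (intro nn_integral_mono) (auto simp: indicator_def)
 also have "... = (\<integral>\<^sup>+x. (\<integral>\<^sup>+t. g i t x * ind Om x \<partial>lborel) \<partial>M)"
 unfolding g_def by (rule Fubini'[symmetric]) measurable
 also have "... = NI Om (G i)"
 proof (rule nn_integral_cong)
 fix x
 have "(\<integral>\<^sup>+t. g i t x * ind Om x \<partial>lborel) = (\<integral>\<^sup>+t. (en (1 / s i) * G i x * ind Om x) * ind {F i x - s i..F i x} t \<partial>lborel)"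
 by (intro nn_integral_cong) (auto simp: g_def indicator_def)
 also have "... = en (1 / s i) * G i x * ind Om x * en (s i)"
 using s(1)[of i] by (subst nn_integral_cmult) auto
 also have "... = en (1 / s i * s i) * (G i x * ind Om x)"
 using s(1)[of i] by (subst ennreal_mult) (auto simp: ac_simps)
 finally show "(\<integral>\<^sup>+t. g i t x * ind Om x \<partial>lborel) = G i x * ind Om x" using s(1)[of i] by simp
 qed
 also have "... <= en A" by (rule FG)
 finally show ?thesis .
 qed
 hence "(\<integral>\<^sup>+t. liminf (%i. h i t * ind {a<..<a+L} t) \<partial>lborel) <= en A"
 by (intro order_trans[OF nn_integral_liminf] Liminf_le) auto
 moreover have "AE t in lborel. en (2 * A / L) * ind {a<..<a+L} t <= liminf (%i. h i t * ind {a<..<a+L} t)"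
 using AE_level_null[OF f]
 proof eventually_elim
 case (elim t)
 show ?case
 proof (cases "t:{a<..<a+L}")
 case True
 have "appr Om (indr {x. t < f x}) (%i. ps i t) (%i. g i t)" unfolding appr_def
 proof (intro conjI allI)
 fix i
 show "wug Om (ps i t) (g i t)" unfolding ps_def[abs_def] g_def[abs_def] by (rule wug_band[OF FG(1,2) s(1)])
 have b:"abs (ps i t x) <= 1" for x by (auto simp: ps_def)
 have "NI K (%x. ea (ps i t x)) < oo" if "compact K" for K :: "'a set"
 proof -
 have "NI K (%x. ea (ps i t x)) <= NI K (%x. 1)" using b by (intro ni_mono) auto
 also have "... < oo" using bounded_fin[OF compact_imp_bounded[OF that]] borel_closed[OF compact_imp_closed[OF that]] by (simp add: emeasure_M borel_M')
 finally show ?thesis .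
 qed
 moreover have "ps i t:bM" unfolding ps_def[abs_def] by measurable
 ultimately show "locint Om (ps i t)" unfolding locint_def by blast
 next
 show "lconv Om (%i. ps i t) (indr {x. t < f x})" unfolding lconv_def
 proof (intro allI impI)
 fix K :: "'a set" assume K:"compact K" "K <= Om"
 have [measurable]:"K:sets M" using K(1) by (intro borel_M' borel_closed compact_imp_closed)
 show "(%i. NI K (%x. ea (ps i t x - indr {x. t < f x} x))) ~~> 0"
 proof (rule dct0[where B = 1])
 show "(NN x. ind K x) < oo" using bounded_fin[OF compact_imp_bounded[OF K(1)]] by (simp add: emeasure_M)
 show "AM x. (ind K x :: ennreal) ~= 0 --> (%i. ps i t x - indr {x. t < f x} x) ~~> 0 & (ALL i. abs (ps i t x - indr {x. t < f x} x) <= 1)"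
 using elim FG(5)
 proof eventually_elim
 case (elim x)
 have lim:"(%i. ps i t x - indr {x. t < f x} x) ~~> 0" if "x:K"
 proof -
 have c:"(%i. F i x) ~~> f x" using elim(2) that K(2) by blast
 have "evs (%i. ps i t x = indr {x. t < f x} x)"
 proof (cases "t < f x")
 case True
 have "(%i. F i x - s i) ~~> f x - 0" by (intro tendsto_diff c s)
 hence "evs (%i. t < F i x - s i)" using True by (intro order_tendstoD(1)) auto
 thus ?thesis by eventually_elim (use True s(1) in "simp add: ps_def le_divide_eq min_def max_def")
 next
 case False
 hence "f x < t" using elim(1) by simp
 hence "evs (%i. F i x < t)" by (rule order_tendstoD(2)[OF c])
 thus ?thesis
 proof eventually_elim
 case (elim i)
 hence "(F i x - t) / s i < 0" using s(1)[of i] by (simp add: divide_neg_pos)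
 thus ?case using False by (simp add: ps_def)
 qed
 qed
 hence "evs (%i. 0 = ps i t x - indr {x. t < f x} x)" by eventually_elim simp
 thus ?thesis by (rule Lim_transform_eventually[OF tendsto_const])
 qed
 have "abs (ps i t x - indr {x. t < f x} x) <= 1" for i by (auto simp: ps_def indicator_def)
 thus ?case using lim by (auto simp: indicator_def)
 qed
 qed (auto simp: ps_def)
 qed
 qed
 hence "tv Om (indr {x. t < f x}) <= liminf (%i. h i t)" unfolding h_def by (rule tv_le)
 moreover have "en (2 * A / L) < tv Om (indr {x. t < f x})" using neg True by (auto simp: not_le)
 ultimately show ?thesis using True by (simp add: less_imp_le order_trans)
 qed simp
 qed
 hence "(\<integral>\<^sup>+t. en (2 * A / L) * ind {a<..<a+L} t \<partial>lborel) <= (\<integral>\<^sup>+t. liminf (%i. h i t * ind {a<..<a+L} t) \<partial>lborel)"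
 by (rule nn_integral_mono_AE)
 moreover have "(\<integral>\<^sup>+t. en (2 * A / L) * ind {a<..<a+L} t \<partial>lborel) = en (2 * A)"
 using L A0 by (subst nn_integral_cmult) (auto simp: ennreal_mult[symmetric])
 ultimately have "en (2 * A) <= en A" by simp
 thus False using A0 by simp
qed

end

section \<open>Level sets of a function of finite variation\<close>

context poincare_space begin

text \<open>Outside the negligible set \<open>exc\<close>, a point that is not of density zero is
  not thin at any scale, so \<open>crossing_content\<close> applies.\<close>

lemma levelset_content:
 fixes S :: "'a set"
 assumes E:"E:sets M" and Om:"open Om" and p:"tv Om (indr E) <= en p" "0 <= p" and r0:"r0 > 0"
 and S:"!!x. x:S ==> cball x (2 * Lam * r0) <= Om & ~ dens0 E x & mi E x r0 <= en (1 / 2) * mb x r0"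
 shows "HC (5 * Lam * r0) S <= en (cbox0 / g1 * p)"
proof -
 have fin:"tv Om (indr E) < oo" using p(1) by (auto intro: le_less_trans)
 have bg:"0 < cbox0 / g1" using cbox0_pos g1(1) by simp
 have Lr:"0 < Lam * r0" using Lam r0 by simp
 have "HC (5 * Lam * r0) (S - exc Om E) <= en (cbox0 / g1 * p)"
 proof (rule ennreal_le_epsilon)
 fix e :: real assume e:"0 < e"
 define d where "d = e / (cbox0 / g1)"
 have d:"0 < d" using e bg by (simp only: d_def divide_pos_pos)
 obtain ps G where ap:"appr Om (indr E) ps G" "!!i x. 0 <= ps i x & ps i x <= 1" "!!i. NI Om (G i) <= en (p + d)"
 using per_seq[OF p(1) d p(2)] by blast
 have "HC (5 * Lam * r0) (S - exc Om E) <= en (cbox0 / g1) * liminf (%i. NI Om (G i))"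
 proof (rule crossing_content[OF E ap(1,2) r0])
 fix x assume x:"x:S - exc Om E"
 hence c:"cball x (2 * Lam * r0) <= Om" using S by blast
 have "ball x (Lam * r0) <= cball x (2 * Lam * r0)" using Lr by auto
 moreover have "x:cball x (2 * Lam * r0)" using Lr by auto
 ultimately show "cball x (2 * Lam * r0) <= Om & ball x (Lam * r0) <= Om & ~ thin E r0 x & mi E x r0 <= en (1 / 2) * mb x r0"
 using S[of x] x c r0 unfolding exc_def by blast
 qed
 also have "... <= en (cbox0 / g1) * en (p + d)" by (intro mult_left_mono liminf_bound ap(3)) simp
 also have "... = en (cbox0 / g1 * (p + d))" using bg p d by (subst ennreal_mult) auto
 also have "cbox0 / g1 * (p + d) = cbox0 / g1 * p + e" using cbox0_pos g1(1) by (simp add: d_def distrib_left)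
 also have "ennreal ... = en (cbox0 / g1 * p) + en e" using bg p e by (intro ennreal_plus mult_nonneg_nonneg) auto
 finally show "HC (5 * Lam * r0) (S - exc Om E) <= en (cbox0 / g1 * p) + en e" .
 qed
 moreover have "HC (5 * Lam * r0) S <= HC (5 * Lam * r0) ((S - exc Om E) Un exc Om E)"
 by (rule content_mono) auto
 moreover have "HC (5 * Lam * r0) (exc Om E) = 0" using Lr by (intro exc_null[OF E Om fin]) simp
 ultimately show ?thesis using order_trans[OF _ content_Un[of "5 * Lam * r0" "S - exc Om E" "exc Om E"]] by fastforce
qed

end

context doubling_space begin

lemma ball_lower:
 fixes S :: "'a set"
 assumes S:"bounded S" and r0:"r0 > 0"
 shows "EX c>0. ALL x:S. en c <= mb x r0"
proof -
 obtain z D where D:"ALL x:S. dist z x <= D" using S unfolding bounded_def by auto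
 have k0:"0 < cmp ((abs D + r0) / r0)" using cmp_ge_1[of "(abs D + r0) / r0"] by simp
 obtain m where m:"mb z r0 = en m" "0 < m"
 using ball_pos[OF r0, of z] ball_fin[OF r0, of z] by (cases "mb z r0") auto
 have "en (m / cmp ((abs D + r0) / r0)) <= mb x r0" if "x:S" for x
 proof -
 have sub:"ball z r0 <= ball x (abs D + r0)"
 proof
 fix y assume "y:ball z r0"
 thus "y:ball x (abs D + r0)" using D that dist_triangle[of x y z] by (force simp: dist_commute)
 qed
 have "abs D + r0 <= (abs D + r0) / r0 * r0" using r0 by simp
 from ball_cmp[OF r0 this sub] have "en m <= en (cmp ((abs D + r0) / r0)) * mb x r0" unfolding m .
 hence "en m / en (cmp ((abs D + r0) / r0)) <= mb x r0"
 using k0 by (intro divide_le_posI_ennreal) auto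
 thus ?thesis using k0 m by (simp add: divide_ennreal)
 qed
 thus ?thesis using k0 m(2) by (intro exI[of _ "m / cmp ((abs D + r0) / r0)"]) auto
qed

lemma markov:
 assumes [measurable]:"f:bM" "C:sets M" and t:"t > (0::real)"
 shows "en t * \<mu> (C Int {x. t < f x}) <= NI C (%x. ea (f x))"
proof -
 have "en t * \<mu> (C Int {x. t < f x}) = en t * eM (C Int {x. t < f x})" by (subst emeasure_M) auto
 also have "... = (NN x. en t * ind (C Int {x. t < f x}) x)" by (rule nn_integral_cmult_indicator[symmetric]) measurable
 also have "... <= NI C (%x. ea (f x))"
 using t by (intro nn_integral_mono) (auto simp: indicator_def)
 finally show ?thesis .
qed

lemma high_half:
 fixes S :: "'a set"
 assumes f:"f:bM" and C:"C:sets M" "NI C (%x. ea (f x)) <= en (t * c / 2)"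
 and t:"t > 0" and c:"c >= 0" and x:"ball x r0 <= C" "en c <= mb x r0"
 shows "mi {x. t < f x} x r0 <= en (1 / 2) * mb x r0"
proof -
 have "mi {x. t < f x} x r0 <= \<mu> (C Int {x. t < f x})" using x(1) by (intro mu_mono) auto
 also have "... = en (1 / t) * (en t * \<mu> (C Int {x. t < f x}))"
 using t by (simp add: mult.assoc[symmetric] ennreal_mult[symmetric])
 also have "... <= en (1 / t) * en (t * c / 2)"
 by (intro mult_left_mono order_trans[OF markov[OF f C(1) t] C(2)]) simp
 also have "... = en (1 / 2) * en c" using t c by (subst (1 2) ennreal_mult[symmetric]) auto
 also have "... <= en (1 / 2) * mb x r0" by (intro mult_left_mono x) simp
 finally show ?thesis .
qed

lemma compact_nbd2:
 fixes K :: "'a set"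
 assumes K:"compact K" "K <= Om" "open Om"
 shows "EX e C. e > 0 & compact C & C <= Om & nbd K e <= C"
proof -
 obtain e where e:"e > 0" "nbd K e <= Om"
 using compact_subset_open_imp_ball_epsilon_subset[OF K(1,3,2)] unfolding nbd_def by blast
 define C where "C = closure (nbd K (e / 2))"
 have "bounded (nbd K (e / 2))"
 proof -
 obtain x0 r where r:"!!x. x:K ==> dist x0 x <= r" using compact_imp_bounded[OF K(1)] unfolding bounded_def by blast
 have "dist x0 y <= r + e / 2" if y:"y:nbd K (e / 2)" for y
 proof -
 obtain a where a:"a:K" "dist a y < e / 2" using y by (auto simp: nbd_def)
 thus ?thesis using r[OF a(1)] dist_triangle[of x0 y a] by linarith
 qed
 thus ?thesis unfolding bounded_def by blast
 qed
 hence "compact C" unfolding C_def by (intro compact_if) auto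
 moreover have "C <= nbd K e"
 proof
 fix y assume "y:C"
 then obtain z where z:"z:nbd K (e / 2)" "dist z y < e / 2" unfolding C_def closure_approachable using e(1) by (meson half_gt_zero)
 then obtain a where "a:K" "dist a z < e / 2" by (auto simp: nbd_def)
 thus "y:nbd K e" using z(2) dist_triangle[of a y z] by (force simp: nbd_def)
 qed
 moreover have "nbd K (e / 2) <= C" unfolding C_def by (rule closure_subset)
 ultimately show ?thesis using e by (intro exI[of _ "e / 2"] exI[of _ C]) auto
qed

end

context poincare_space begin

text \<open>The coarea inequality gives one level of finite perimeter in each interval of length
  \<open>de\<close>. At a point of \<open>Om\<close> outside all \<open>Op j\<close>, superlevel
  sets of arbitrarily high levels fail to have density zero; as such levels can be chosen with
  arbitrarily small perimeter, these points have zero content.\<close>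

lemma level_sets:
 fixes Om :: "'a set" and de :: real
 assumes Om:"open Om" and f:"locint Om f" and tvf:"tv Om f < oo" and de:"0 < de"
 shows "EX T::int => real. (ALL j. de * j < T j & T j < de * (j + 1)) &
 (ALL j. AM x. x:Om --> dens0 {y. T j < f y} x --> f x <= T j) &
 (ALL ep>0. EX S. HC 1 S <= en ep & (ALL G. open G --> S <= G -->
 (ALL j. open ({x:Om. dens0 {y. T j < f y} x} Un G)) & Om <= G Un (UN j. {x:Om. dens0 {y. T j < f y} x})))"
proof -
 have fm[measurable]:"f:bM" using f by (simp add: locint_def)
 obtain A0 where A0:"tv Om f = en A0" "0 <= A0" using tvf by (cases "tv Om f") auto
 define A where "A = A0 + 1"
 have A:"tv Om f < en A" "0 < A" using A0 by (auto simp: A_def ennreal_less_iff)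
 have Em:"{y. t < f y}:sets M" for t
 proof -
 have "{y:space M. t < f y}:sets M" by measurable
 thus ?thesis by simp
 qed
 have "ALL j::int. EX t. de * j < t & t < de * j + de & tv Om (indr {x. t < f x}) <= en (2 * A / de)"
 using coarea[OF Om fm A(1) de] by blast
 from choice[OF this] obtain T :: "int => real" where
 T:"ALL j. de * j < T j & T j < de * j + de & tv Om (indr {x. T j < f x}) <= en (2 * A / de)" ..
 hence fin:"tv Om (indr {x. T j < f x}) < oo" for j by (auto intro: le_less_trans)
 define Op where "Op j = {x:Om. dens0 {y. T j < f y} x}" for j
 define Z where "Z = Om - (UN j. Op j)"
 obtain K :: "nat => 'a set" where K:"!!n. compact (K n)" "!!n. K n <= Om" "!!n m. n <= m ==> K n <= K m"
 "!!L. compact L ==> L <= Om ==> EX n. L <= K n" using exhaustion[OF Om] by blast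
 have L0:"0 < Lam" using Lam by simp
 have "HC 1 (K n Int Z) = 0" for n
 proof (rule ennreal_small_0)
 show "0 < cbox0 / g1" using cbox0_pos g1(1) by simp
 fix d :: real assume d:"0 < d"
 obtain e C where e:"e > 0" "compact C" "C <= Om" "nbd (K n) e <= C"
 using compact_nbd2[OF K(1)[of n] K(2) Om] by (elim exE conjE) (rule that)
 define r0 where "r0 = min (1 / (5 * Lam)) (e / (3 * Lam))"
 have r0:"0 < r0" "5 * Lam * r0 <= 1" "3 * Lam * r0 <= e"
 proof -
 show "0 < r0" using L0 e(1) by (auto simp: r0_def)
 have "r0 <= 1 / (5 * Lam)" "r0 <= e / (3 * Lam)" by (auto simp: r0_def)
 thus "5 * Lam * r0 <= 1" "3 * Lam * r0 <= e" using L0 by (auto simp: pos_le_divide_eq mult.commute)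
 qed
 obtain c where c:"c > 0" "ALL x:K n. en c <= mb x r0"
 using ball_lower[OF compact_imp_bounded[OF K(1)] r0(1)] by blast
 have Cm:"C:sets M" by (rule compact_sets[OF e(2)])
 obtain I where I:"NI C (%x. ea (f x)) = en I" "0 <= I"
 using f e(2,3) unfolding locint_def by (cases "NI C (%x. ea (f x))") auto
 \<comment> \<open>High enough for a level of perimeter at most \<open>d\<close> and, by Markov's
   inequality, for its superlevel set to fill at most half of each ball of radius
   \<open>r0\<close>.\<close>
 define N where "N = max (2 * A / d) (2 * I / c)"
 have N:"0 < N" "2 * A / N <= d" "I <= N * c / 2"
 proof -
 show N0:"0 < N" using A(2) d by (auto simp: N_def intro: less_le_trans[OF _ max.cobounded1])
 have "2 * A / d <= N" "2 * I / c <= N" by (auto simp: N_def)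
 thus "2 * A / N <= d" "I <= N * c / 2" using N0 d c(1) by (auto simp: field_simps)
 qed
 obtain t where t:"N < t" "tv Om (indr {x. t < f x}) <= en (2 * A / N)"
 using coarea[OF Om fm A(1) N(1)] by blast
 have "HC 1 (K n Int Z) <= HC (5 * Lam * r0) (K n Int Z)" by (rule content_antimono[OF r0(2)])
 also have "... <= en (cbox0 / g1 * d)"
 proof (rule levelset_content[OF Em Om _ less_imp_le[OF d] r0(1)])
 show "tv Om (indr {x. t < f x}) <= en d" by (rule order_trans[OF t(2) ennreal_leI[OF N(2)]])
 fix x assume x:"x:K n Int Z"
 have r:"2 * Lam * r0 < e" using r0(1,3) L0 mult_pos_pos[OF L0 r0(1)] by linarith
 have "r0 <= 2 * Lam * r0" using mult_right_mono[OF Lam, of r0] r0(1) by linarith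
 have sub:"cball x (2 * Lam * r0) <= C" using e(4) x r by (force simp: nbd_def)
 hence s2:"ball x r0 <= C" using `r0 \<le> 2 * Lam * r0` by (auto intro: subset_trans[OF ball_subset_cball] simp: subset_iff)
 have "~ dens0 {y. t < f y} x"
 proof
 assume a:"dens0 {y. t < f y} x"
 define j where "j = \<lceil>t / de\<rceil>"
 have "t / de <= j" by (simp add: j_def)
 hence "t <= de * j" using de by (simp add: divide_le_eq mult.commute)
 hence "dens0 {y. T j < f y} x" using T[rule_format, of j] by (intro dens0_mono[OF a]) auto
 thus False using x unfolding Z_def Op_def by blast
 qed
 moreover have "mi {y. t < f y} x r0 <= en (1 / 2) * mb x r0"
 proof (rule high_half[OF fm Cm _ _ _ s2])
 have "N * c / 2 <= t * c / 2" using t(1) c(1) by simp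
 thus "NI C (%x. ea (f x)) <= en (t * c / 2)" unfolding I using N(3) by (intro ennreal_leI) linarith
 qed (use t N c x in auto)
 ultimately show "cball x (2 * Lam * r0) <= Om & ~ dens0 {y. t < f y} x & mi {y. t < f y} x r0 <= en (1 / 2) * mb x r0"
 using sub e(3) by blast
 qed
 finally show "HC 1 (K n Int Z) <= en (cbox0 / g1 * d)" .
 qed
 hence "HC 1 (UN n. K n Int Z) = 0" by (rule content_UN_0)
 moreover have "Z <= (UN n. K n Int Z)"
 proof
 fix x assume x:"x:Z"
 hence "EX n. {x} <= K n" by (intro K(4)) (auto simp: Z_def)
 thus "x:(UN n. K n Int Z)" using x by auto
 qed
 ultimately have Z0:"HC 1 Z = 0" using content_mono[of Z "UN n. K n Int Z" 1] by simp
 have "EX S. HC 1 S <= en ep & (ALL G. open G --> S <= G --> (ALL j. open (Op j Un G)) & Om <= G Un (UN j. Op j))"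
 if ep:"ep > 0" for ep :: real
 proof -
 have "ALL n. EX S. HC 1 S <= en (ep * (1 / 2) ^ Suc n) & (ALL G. open G --> S <= G --> open (Op (int_decode n) Un G))"
 unfolding Op_def using dens0_quasiopen[OF Em Om fin] ep by simp
 from choice[OF this] obtain S where
 S:"ALL n. HC 1 (S n) <= en (ep * (1 / 2) ^ Suc n) & (ALL G. open G --> S n <= G --> open (Op (int_decode n) Un G))" ..
 have "HC 1 (UN n. S n) <= (\<Sum>n. HC 1 (S n))" by (rule content_UN)
 also have "... <= (\<Sum>n. en (ep * (1 / 2) ^ Suc n))" using S by (intro suminf_le) auto
 also have "... = en ep" using sums_mult[OF power_half_series, of ep] ep by (intro suminf_ennreal_eq) auto
 finally have "HC 1 (UN n. S n) + HC 1 Z <= en ep" by (simp add: Z0)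
 hence "HC 1 ((UN n. S n) Un Z) <= en ep" by (rule order_trans[OF content_Un])
 moreover have "open (Op j Un G)" if "open G" "(UN n. S n) Un Z <= G" for G j
 using S[rule_format, of "int_encode j"] that by auto
 moreover have "Om <= G Un (UN j. Op j)" if "(UN n. S n) Un Z <= G" for G using that by (auto simp: Z_def)
 ultimately show ?thesis by (intro exI[of _ "(UN n. S n) Un Z"] conjI allI impI)
 qed
 moreover have "AM x. x:Om --> dens0 {y. T j < f y} x --> f x <= T j" for j
 using dens0_null[OF Em Om fin[of j]] by eventually_elim auto
 ultimately show ?thesis using T unfolding Op_def by (intro exI[of _ T] conjI allI) (simp_all add: distrib_left)
qed

end

section \<open>Lipschitz functions close to \<open>u\<close> on compact sets\<close>

context doubling_space begin

text \<open>A sup-convolution of \<open>b\<close>. A Lebesgue number \<open>rh\<close> lets points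
  within \<open>rh\<close> be compared through a common centre \<open>z\<close>, giving
  \<open>b y <= b z <= a z + J <= a x + J\<close>; for distant points the slope \<open>L\<close>
  outweighs the total oscillation.\<close>

lemma lipschitz_insertion:
 fixes K :: "'a set" and a b :: "'a => real"
 assumes K:"compact K" and loc:"!!z. z:K ==> EX r>0. ALL y:K. dist z y < r --> b y <= b z & a z <= a y"
 and J:"!!z. z:K ==> b z - a z <= J" and bd:"!!z. z:K ==> b z <= Bb" "!!z. z:K ==> Ba <= a z"
 shows "EX L c. lips L c & (ALL x:K. b x <= c x & c x <= a x + J)"
proof (cases "K = {}")
 case True
 thus ?thesis by (intro exI[of _ 0] exI[of _ "%_. 0"]) (simp add: lips_def)
next
 case False
 from loc have "ALL z:K. EX r>0. ALL y:K. dist z y < r --> b y <= b z & a z <= a y" by blast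
 from bchoice[OF this] obtain r where r:"ALL z:K. 0 < r z & (ALL y:K. dist z y < r z --> b y <= b z & a z <= a y)" ..
 have cov:"K <= \<Union> ((%z. ball z (r z)) ` K)" using r by force
 obtain rh where rh:"rh > 0" "!!x. x:K ==> EX G:(%z. ball z (r z)) ` K. ball x rh <= G"
 by (rule Heine_Borel_lemma[OF K cov]) auto
 define L where "L = max 0 ((Bb - Ba - J) / rh)"
 have L:"0 <= L" "Bb - L * rh <= Ba + J"
 proof -
 have "(Bb - Ba - J) / rh <= L" by (simp add: L_def)
 thus "Bb - L * rh <= Ba + J" using rh(1) by (simp add: divide_le_eq)
 qed (simp add: L_def)
 define c where "c x = (SUP y\<in>K. b y - L * dist x y)" for x
 have bdd:"bdd_above ((%y. b y - L * dist x y) ` K)" for x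
 proof (rule bdd_aboveI2)
 fix y assume "y:K"
 thus "b y - L * dist x y <= Bb" using bd(1)[of y] mult_nonneg_nonneg[OF L(1) zero_le_dist, of x y] by linarith
 qed
 have up:"b y - L * dist x y <= c x" if "y:K" for x y unfolding c_def by (rule cSUP_upper[OF that bdd])
 have one:"c x <= c x' + L * dist x x'" for x x'
 unfolding c_def[of x]
 proof (rule cSUP_least[OF False])
 fix y assume y:"y:K"
 have "L * dist x' y <= L * (dist x x' + dist x y)" using L(1) dist_triangle[of x' y x] by (intro mult_left_mono) (auto simp: dist_commute)
 thus "b y - L * dist x y <= c x' + L * dist x x'" using up[OF y, of x'] by (simp add: distrib_left)
 qed
 have "lips L c" unfolding lips_def
 using L(1) one by (auto simp: abs_le_iff dist_commute) (metis add.commute diff_le_eq dist_commute)+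
 moreover have "b x <= c x & c x <= a x + J" if x:"x:K" for x
 proof
 show "b x <= c x" using up[OF x, of x] by simp
 show "c x <= a x + J" unfolding c_def
 proof (rule cSUP_least[OF False])
 fix y assume y:"y:K"
 show "b y - L * dist x y <= a x + J"
 proof (cases "dist x y < rh")
 case True
 obtain z where z:"z:K" "ball x rh <= ball z (r z)" using rh(2)[OF x] by blast
 hence "dist z x < r z" "dist z y < r z" using True rh(1) by (auto simp: subset_iff)
 hence "b y <= b z" "a z <= a x" using r z(1) x y by blast+
 thus ?thesis using J[OF z(1)] mult_nonneg_nonneg[OF L(1), of "dist x y"] by simp
 next
 case False
 hence "L * rh <= L * dist x y" using L(1) by (intro mult_left_mono) auto
 thus ?thesis using bd(1)[OF y] bd(2)[OF x] L(2) by linarith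
 qed
 qed
 qed
 ultimately show ?thesis by blast
qed

text \<open>The least level reached at a point exists since \<open>j0\<close> bounds the levels from
  below on \<open>K\<close>. The sets are relatively open in \<open>K\<close>, which makes this
  integer-valued function upper semicontinuous in the strong form needed for
  \<open>lipschitz_insertion\<close>; compactness bounds it above.\<close>

lemma level_index:
 fixes K :: "'a set" and Op :: "int => 'a set"
 assumes K:"compact K" and mono:"!!i j. i <= j ==> Op i <= Op j" and cl:"!!j. closed (K - Op j)"
 and cov:"K <= (UN j. Op j)" and j0:"K Int Op j0 = {}"
 shows "EX J. (ALL x:K. x:Op (J x) & x ~: Op (J x - 1)) & (ALL z:K. EX r>0. ALL y:K. dist z y < r --> J y <= J z) & (EX m. ALL x:K. J x <= m)"
proof -
 define J where "J x = j0 + int (LEAST n. x:Op (j0 + int n))" for x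
 have ex:"EX n. x:Op (j0 + int n)" if "x:K" for x
 proof -
 obtain j where "x:Op j" using cov `x \<in> K` by auto
 moreover have "Op j <= Op (j0 + int (nat (j - j0)))" by (rule mono) simp
 ultimately show ?thesis by blast
 qed
 have J1:"x:Op (J x)" if "x:K" for x unfolding J_def using LeastI_ex[OF ex[OF that]] .
 have Jle:"J x <= j" if x:"x:K" "x:Op j" for x j
 proof -
 have "j0 <= j"
 proof (rule ccontr)
 assume "~ j0 <= j"
 hence "Op j <= Op j0" by (intro mono) simp
 thus False using x j0 by blast
 qed
 hence "x:Op (j0 + int (nat (j - j0)))" using x by simp
 hence "(LEAST n. x:Op (j0 + int n)) <= nat (j - j0)" by (rule Least_le)
 thus ?thesis using `j0 \<le> j` by (simp add: J_def)
 qed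
 have "x ~: Op (J x - 1)" if "x:K" for x using Jle[OF that, of "J x - 1"] by auto
 moreover have "EX r>0. ALL y:K. dist z y < r --> J y <= J z" if z:"z:K" for z
 proof -
 have "z : - (K - Op (J z))" using J1[OF z] by simp
 moreover have "open (- (K - Op (J z)))" using cl by (simp only: open_closed double_complement)
 ultimately obtain r where "r > 0" "ball z r <= - (K - Op (J z))" using open_contains_ball by blast
 thus ?thesis using Jle by (intro exI[of _ r]) auto
 qed
 moreover have "EX m. ALL x:K. J x <= m"
 proof -
 have op:"!!j. j:(UNIV::int set) ==> open (- (K - Op j))" using cl by (simp only: open_closed double_complement)
 have cov':"K <= (UN j:UNIV. - (K - Op j))" using cov by auto
 obtain T where T:"finite T" "K <= (UN j:T. - (K - Op j))" by (rule compactE_image[OF K op cov'])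
 have "J x <= Max (insert 0 T)" if x:"x:K" for x
 proof -
 obtain j where j:"j:T" "x:Op j" using T(2) x by blast
 hence "J x <= j" using Jle[OF x] by simp
 also have "j <= Max (insert 0 T)" using j T(1) by (intro Max_ge) auto
 finally show ?thesis .
 qed
 thus ?thesis by blast
 qed
 ultimately show ?thesis using J1 by (intro exI[of _ J]) blast
qed

lemma mu_Un:"\<mu> (A Un B) <= \<mu> A + \<mu> B"
proof -
 obtain A' B' where *: "A':sets borel" "A <= A'" "\<mu> A' = \<mu> A" "B':sets borel" "B <= B'" "\<mu> B' = \<mu> B"
 using br unfolding borel_regular_outer_measure_def by metis
 have "\<mu> (A Un B) <= \<mu> (A' Un B')" using * by (intro mu_mono) auto
 also have "... <= \<mu> A' + \<mu> B'"
 using emeasure_subadditive[of A' M B'] * by (simp add: emeasure_M borel_M' sets.Un)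
 finally show ?thesis using * by simp
qed

lemma dens0_Un:
 assumes "dens0 E x" "dens0 E' x" shows "dens0 (E Un E') x"
 unfolding dens0_iff
proof (intro allI impI)
 fix ga :: real assume "ga > 0"
 hence g:"ga / 2 > 0" by simp
 obtain R R' where R:"R > 0" "!!r. 0 < r ==> r <= R ==> mi E x r <= en (ga / 2) * mb x r"
 and R':"R' > 0" "!!r. 0 < r ==> r <= R' ==> mi E' x r <= en (ga / 2) * mb x r"
 using assms(1)[unfolded dens0_iff, rule_format, OF g] assms(2)[unfolded dens0_iff, rule_format, OF g] by blast
 have "mi (E Un E') x r <= en ga * mb x r" if r:"0 < r" "r <= min R R'" for r
 proof -
 have "mi (E Un E') x r <= mi E x r + mi E' x r"
 using mu_Un by (simp add: Int_Un_distrib)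
 also have "... <= en (ga / 2) * mb x r + en (ga / 2) * mb x r" using R R' r by (intro add_mono) auto
 also have "... = en (ga / 2 + ga / 2) * mb x r" using g by (subst ennreal_plus) (auto simp: distrib_right)
 finally show ?thesis by simp
 qed
 thus "EX R>0. ALL r. 0 < r --> r <= R --> mi (E Un E') x r <= en ga * mb x r"
 using R(1) R'(1) by (intro exI[of _ "min R R'"]) auto
qed

lemma not_dens0_UNIV:"~ dens0 UNIV (x::'a)"
proof
 assume "dens0 UNIV x"
 then obtain R where R:"R > 0" "mb x R <= en (1 / 2) * mb x R"
 unfolding dens0_iff by (metis Int_UNIV_right half_gt_zero order_refl zero_less_one)
 obtain m where m:"mb x R = en m" "0 < m"
 using ball_pos[OF R(1), of x] ball_fin[OF R(1), of x] by (cases "mb x R") auto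
 hence "en m <= en (1 / 2 * m)" using R(2) by (subst ennreal_mult) auto
 thus False using m(2) by (subst (asm) ennreal_le_iff) auto
qed

lemma dens0_cong:
 fixes Om :: "'a set"
 assumes x:"open Om" "x:Om" and eq:"AM y. y:Om --> (y:E \<longleftrightarrow> y:E')"
 shows "dens0 E x \<longleftrightarrow> dens0 E' x"
proof -
 obtain e where e:"e > 0" "ball x e <= Om" using x open_contains_ball by blast
 obtain N where N:"{y:space M. ~ (y:Om --> (y:E \<longleftrightarrow> y:E'))} <= N" "eM N = 0" "N:sets M"
 by (rule AE_E[OF eq])
 have N0:"\<mu> N = 0" using N by (simp add: emeasure_M)
 have "mi E x r = mi E' x r" if "r < e" for r
 proof -
 have s:"ball x r <= Om" using e(2) that by auto
 have "mi E x r <= \<mu> ((ball x r Int E') Un N)" "mi E' x r <= \<mu> ((ball x r Int E) Un N)"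
 using s N(1) by (auto intro!: mu_mono)
 moreover have "\<mu> (A Un N) <= \<mu> A" for A using mu_Un[of A N] N0 by simp
 ultimately show ?thesis by (intro antisym) (rule order_trans, assumption, assumption)+
 qed
 hence "\<forall>\<^sub>F r in at_right 0. mi E x r / mb x r = mi E' x r / mb x r"
 unfolding eventually_at_right_field using e(1) by (intro exI[of _ e]) auto
 thus ?thesis unfolding dens0_def by (rule tendsto_cong)
qed

lemma upper_le:"dens0 {y. ereal t < u y} x ==> ul u x <= ereal t"
 unfolding upper_approx_limit_def dens0_def by (rule INF_lower) auto

lemma upper_ge:"~ dens0 {y. ereal t < u y} x ==> ereal t <= ul u x"
 unfolding upper_approx_limit_def dens0_def[symmetric]
proof (rule INF_greatest)
 fix t' assume n:"~ dens0 {y. ereal t < u y} x" and "t':{t'. dens0 {y. ereal t' < u y} x}"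
 hence d:"dens0 {y. ereal t' < u y} x" by simp
 show "ereal t <= ereal t'"
 proof (rule ccontr)
 assume "~ ?thesis"
 hence "{y. ereal t < u y} <= {y. ereal t' < u y}" by (auto intro: less_trans[of "ereal t'" "ereal t"])
 thus False using dens0_mono[OF d] n by blast
 qed
qed

lemma lower_ge:"dens0 {y. u y < ereal t} x ==> ereal t <= ll u x"
 unfolding lower_approx_limit_def dens0_def by (rule SUP_upper) auto

lemma lower_le:"~ dens0 {y. u y < ereal t} x ==> ll u x <= ereal t"
 unfolding lower_approx_limit_def dens0_def[symmetric]
proof (rule SUP_least)
 fix t' assume n:"~ dens0 {y. u y < ereal t} x" and "t':{t'. dens0 {y. u y < ereal t'} x}"
 hence d:"dens0 {y. u y < ereal t'} x" by simp
 show "ereal t' <= ereal t"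
 proof (rule ccontr)
 assume "~ ?thesis"
 hence "{y. u y < ereal t} <= {y. u y < ereal t'}" by (auto intro: less_trans[of _ "ereal t" "ereal t'"])
 thus False using dens0_mono[OF d] n by blast
 qed
qed

text \<open>The least levels of the two families enclose \<open>u\<close> between \<open>a\<close>
  and \<open>b\<close>, overshooting the approximate limits by at most \<open>2 * de\<close> on each
  side. A Lipschitz function between \<open>b\<close> and \<open>a + J\<close> is then shifted so as
  to leave the margin \<open>de\<close> on both sides of \<open>u\<close>.\<close>

lemma separate:
 fixes K Om :: "'a set" and T T' :: "int => real" and f :: "'a => real"
 defines "Op \<equiv> %j. {x:Om. dens0 {y. T j < f y} x}" and "Op' \<equiv> %j. {x:Om. dens0 {y. T' j < - f y} x}"
 assumes Om:"open Om" and K:"compact K" "K <= Om" and u:"AM x. x:Om --> u x = ereal (f x)" and de:"0 < de"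
 and T:"!!j. de * j < T j & T j < de * (j + 1)" "!!j. AM x. x:Om --> dens0 {y. T j < f y} x --> f x <= T j"
 and T':"!!j. de * j < T' j & T' j < de * (j + 1)" "!!j. AM x. x:Om --> dens0 {y. T' j < - f y} x --> - f x <= T' j"
 and cl:"!!j. closed (K - Op j)" "!!j. closed (K - Op' j)" and cov:"K <= (UN j. Op j)" "K <= (UN j. Op' j)"
 shows "EX L al bt. lips L al & lips L bt & (ALL x. al x <= bt x) & (AM x. x:K --> al x + de <= f x & f x <= bt x - de) &
 (ALL x:K. ereal (al x) <= ul u x & ul u x <= ereal (bt x)) &
 (ALL J>=0. (ALL x:K. ul u x - ll u x <= ereal J) --> (ALL x. bt x - al x <= J + 6 * de))"
proof -
 have Tm:"T i <= T j" "T' i <= T' j" if "i <= j" for i j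
 proof -
 have "de * (real_of_int i + 1) <= de * real_of_int j" if "i < j" using de that by (intro mult_left_mono) auto
 thus "T i <= T j" "T' i <= T' j" using that T(1)[of i] T(1)[of j] T'(1)[of i] T'(1)[of j] by (cases "i = j"; force)+
 qed
 have mono:"Op i <= Op j" "Op' i <= Op' j" if "i <= j" for i j
 using Tm[OF that] unfolding Op_def Op'_def by (auto elim!: dens0_mono)
 \<comment> \<open>For levels in this order the two sets cover the space, which would then have
   density zero.\<close>
 have clash: False if "dens0 {y. s < f y} x" "dens0 {y. s' < - f y} x" "s < - s'" for s s' x
 proof -
 have "{y. s < f y} Un {y. s' < - f y} = UNIV" using that(3) by auto
 thus False using dens0_Un[OF that(1,2)] not_dens0_UNIV by simp
 qed
 \<comment> \<open>By compactness \<open>K\<close> lies in a single \<open>B m\<close>. Levels of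
   the two families with \<open>i + j + 2 <= 0\<close> exclude each other, so the other family
   misses \<open>K\<close> at level \<open>- m - 2\<close>.\<close>
 have low:"EX j0. K Int A j0 = {}" if A:"!!j. closed (K - B j)" "K <= (UN j. B j)" "!!i j. i <= j ==> B i <= B j"
 "!!x i j. x:K ==> x:B i ==> x:A j ==> i + j + 2 > 0" for A B :: "int => 'a set"
 proof -
 have op:"!!j. j:(UNIV::int set) ==> open (- (K - B j))" using A(1) by (simp only: open_closed double_complement)
 have cov':"K <= (UN j:UNIV. - (K - B j))" using A(2) by auto
 obtain S where S:"finite S" "K <= (UN j:S. - (K - B j))" by (rule compactE_image[OF K(1) op cov'])
 define m where "m = Max (insert 0 S)"
 have "K <= B m"
 proof
 fix x assume x:"x:K"
 then obtain j where j:"j:S" "x:B j" using S(2) by blast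
 hence "B j <= B m" unfolding m_def using S(1) by (intro A(3) Max_ge) auto
 thus "x:B m" using j(2) by blast
 qed
 hence "K Int A (- m - 2) = {}" using A(4)[of _ m "- m - 2"] by auto
 thus ?thesis ..
 qed
 have ij:"i + j + 2 > 0" if x:"x:Op i" "x:Op' j" for x i j
 proof (rule ccontr)
 assume "~ ?thesis"
 hence "real_of_int (i + j + 2) <= 0" by linarith
 hence "de * (real_of_int i + 1) + de * (real_of_int j + 1) <= 0"
 using de mult_nonneg_nonpos[of de "real_of_int (i + j + 2)"] by (simp add: algebra_simps)
 hence "T i < - T' j" using T(1)[of i] T'(1)[of j] by linarith
 thus False using clash[of "T i" x "T' j"] x by (auto simp: Op_def Op'_def)
 qed
 obtain j0 where j0:"K Int Op j0 = {}" using low[of Op' Op] cl(2) cov(2) mono(2) ij by (smt (verit, best))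
 obtain j0' where j0':"K Int Op' j0' = {}" using low[of Op Op'] cl(1) cov(1) mono(1) ij by (smt (verit, best))
 obtain N m where N:"!!x. x:K ==> x:Op (N x) & x ~: Op (N x - 1)" "!!z. z:K ==> EX r>0. ALL y:K. dist z y < r --> N y <= N z"
 "!!x. x:K ==> N x <= m" using level_index[of K Op, OF K(1) mono(1) cl(1) cov(1) j0] by metis
 obtain N' m' where N':"!!x. x:K ==> x:Op' (N' x) & x ~: Op' (N' x - 1)" "!!z. z:K ==> EX r>0. ALL y:K. dist z y < r --> N' y <= N' z"
 "!!x. x:K ==> N' x <= m'" using level_index[of K Op', OF K(1) mono(2) cl(2) cov(2) j0'] by metis
 define b a where "b x = T (N x)" and "a x = - T' (N' x)" for x
 have dN:"dens0 {y. b x < f y} x" "~ dens0 {y. T (N x - 1) < f y} x" "b x <= T (N x - 1) + 2 * de" if "x:K" for x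
 using N(1)[OF that] K(2) that T(1)[of "N x"] T(1)[of "N x - 1"] by (auto simp: Op_def b_def algebra_simps)
 have dN':"dens0 {y. - a x < - f y} x" "~ dens0 {y. T' (N' x - 1) < - f y} x" "- a x <= T' (N' x - 1) + 2 * de" if "x:K" for x
 using N'(1)[OF that] K(2) that T'(1)[of "N' x"] T'(1)[of "N' x - 1"] by (auto simp: Op'_def a_def algebra_simps)
 have ab:"a x <= b x" if "x:K" for x using clash[OF dN(1)[OF that] dN'(1)[OF that]] by force
 have uf:"dens0 {y. ereal t < u y} x \<longleftrightarrow> dens0 {y. t < f y} x" "dens0 {y. u y < ereal t} x \<longleftrightarrow> dens0 {y. - t < - f y} x" if "x:K" for x t
 by (rule dens0_cong[OF Om]; use u that K(2) in "auto elim!: eventually_mono")+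
 have up:"ul u x <= ereal (b x)" "ereal (T (N x - 1)) <= ul u x" "ereal (a x) <= ul u x" if x:"x:K" for x
 proof -
 show "ul u x <= ereal (b x)" by (rule upper_le) (simp add: uf[OF x] dN[OF x])
 show "ereal (T (N x - 1)) <= ul u x" by (rule upper_ge) (simp add: uf[OF x] dN[OF x])
 show "ereal (a x) <= ul u x"
 proof (rule ereal_le_real)
 fix t assume "ul u x <= ereal t"
 show "ereal (a x) <= ereal t"
 proof (rule ccontr)
 assume "~ ?thesis"
 then obtain s where s:"t < s" "s < a x" using dense by (auto simp: not_le)
 have "dens0 {y. ereal s < u y} x"
 using upper_ge[of s u x] `ul u x \<le> ereal t` s(1) by (metis ereal_less_eq(3) leD order_trans)
 thus False using clash[of s x "- a x"] dN'(1)[OF x] s(2) by (simp add: uf[OF x])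
 qed
 qed
 qed
 have lo:"ereal (a x) <= ll u x" "ll u x <= ereal (- T' (N' x - 1))" if x:"x:K" for x
 proof -
 show "ereal (a x) <= ll u x" by (rule lower_ge) (simp only: uf[OF x] dN'[OF x])
 show "ll u x <= ereal (- T' (N' x - 1))" by (rule lower_le) (simp add: uf[OF x] dN'[OF x])
 qed
 have bd:"b x <= T m" "- T' m' <= a x" if "x:K" for x using N(3)[OF that] N'(3)[OF that] Tm by (auto simp: b_def a_def)
 define J where "J = (if K = {} then 0 else (SUP x\<in>K. b x - a x))"
 have bddJ:"bdd_above ((%x. b x - a x) ` K)" by (rule bdd_aboveI2[of _ _ "T m + T' m'"]) (use bd in force)
 have J:"b x - a x <= J" if "x:K" for x using that cSUP_upper[OF that bddJ] by (auto simp: J_def)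
 have J0:"0 <= J" using J ab by (cases "K = {}") (force simp: J_def)+
 have loc:"EX r>0. ALL y:K. dist z y < r --> b y <= b z & a z <= a y" if z:"z:K" for z
 proof -
 obtain r r' where "r > 0" "ALL y:K. dist z y < r --> N y <= N z" "r' > 0" "ALL y:K. dist z y < r' --> N' y <= N' z"
 using N(2)[OF z] N'(2)[OF z] by blast
 thus ?thesis using Tm by (intro exI[of _ "min r r'"]) (auto simp: b_def a_def)
 qed
 obtain L c where c:"lips L c" "!!x. x:K ==> b x <= c x & c x <= a x + J"
 using lipschitz_insertion[OF K(1) loc J bd] by blast
 define al bt where "al x = c x - J - de" and "bt x = c x + de" for x
 have "AM x. ALL j. (x:Om --> dens0 {y. T j < f y} x --> f x <= T j) & (x:Om --> dens0 {y. T' j < - f y} x --> - f x <= T' j)"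
 using T(2) T'(2) by (simp add: AE_all_countable AE_conj_iff)
 hence ae:"AM x. x:K --> al x + de <= f x & f x <= bt x - de"
 proof eventually_elim
 case (elim x)
 show ?case
 proof
 assume x:"x:K"
 have "f x <= b x" "- f x <= - a x" using elim dN(1)[OF x] dN'(1)[OF x] x K(2) unfolding b_def a_def by auto
 thus "al x + de <= f x & f x <= bt x - de" using c(2)[OF x] by (simp add: al_def bt_def)
 qed
 qed
 have uu:"ereal (al x) <= ul u x & ul u x <= ereal (bt x)" if x:"x:K" for x
 using c(2)[OF x] up(1,3)[OF x] de by (auto simp: al_def bt_def intro: order_trans[rotated] order_trans)
 \<comment> \<open>The width is \<open>J + 2 * de\<close>, and \<open>J\<close> exceeds the largest
   jump by at most \<open>4 * de\<close>.\<close>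
 have last:"bt x - al x <= J1 + 6 * de" if J1:"J1 >= 0" "ALL x:K. ul u x - ll u x <= ereal J1" for J1 x
 proof -
 have "b x - a x <= J1 + 4 * de" if x:"x:K" for x
 proof -
 obtain p q where p:"ul u x = ereal p" "ll u x = ereal q"
 using up[OF x] lo[OF x] by (cases "ul u x"; cases "ll u x") auto
 have "T (N x - 1) <= p" "q <= - T' (N' x - 1)" "p - q <= J1" using up(2)[OF x] lo(2)[OF x] J1(2) x p by auto
 thus ?thesis using dN(3)[OF x] dN'(3)[OF x] by linarith
 qed
 hence "J <= J1 + 4 * de" using J1(1) de by (auto simp: J_def intro!: cSUP_least)
 thus ?thesis by (simp add: al_def bt_def)
 qed
 have "lips L al" "lips L bt" using c(1) by (auto simp: lips_def al_def bt_def)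
 moreover have "ALL x. al x <= bt x" using J0 de by (simp add: al_def bt_def)
 ultimately show ?thesis using ae uu last by (intro exI[of _ L] exI[of _ al] exI[of _ bt] conjI allI impI ballI) auto
qed

section \<open>A partition of unity in a quasiopen set\<close>

lemma wug_support:
 assumes f:"wug UNIV f G" and F:"closed (F::'a set)" "!!x. x ~: F ==> f x = 0"
 shows "wug UNIV f (%x. G x * ind F x)"
proof -
 obtain g where g:"creg UNIV f g" "AM x. g x = G x * ind UNIV x" by (rule wug_creg[OF f])
 have [measurable]:"g:bB" using g(1) by (simp add: creg_def)
 have [measurable]:"F:sets M" using F(1) by (intro borel_M' borel_closed)
 have [measurable]:"G:bM" by (rule wug_meas[OF f])
 show ?thesis
 proof (rule wug_patch[where P = "%j x. j = 0 \<or> x ~: F" and g = "%j x. if j = (0::nat) then g x else 0"])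
 show "bfin UNIV (%x. G x * ind F x)"
 by (rule bfin_mono[OF wug_fin[OF f]]) (auto simp: indicator_def)
 show "AM x. x:UNIV --> (EX j. (j = 0 \<or> x ~: F) & (if j = (0::nat) then g x else 0) <= G x * ind F x)"
 using g(2) by eventually_elim (metis (full_types) UNIV_I indicator_simps(1) mult.right_neutral order_refl zero_le zero_neq_one)
 show "arc_ae UNIV (%p s t. (ALL j. openin (top_of_set {s..t}) {r:{s..t}. j = 0 \<or> p r ~: F} &
 (NL {r:{s..t}. j = 0 \<or> p r ~: F} (%r. (if j = (0::nat) then g (p r) else 0))) < oo &
 (ALL a b. s <= a --> a < b --> b <= t --> (ALL r:{a..b}. j = 0 \<or> p r ~: F) -->
 ea (f (p b) - f (p a)) <= lint a b (%r. if j = 0 then g (p r) else 0))))"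
 proof (rule curve_ae_mono)
 show "arc_ae UNIV (reg f g)"
 using g(1) by (simp add: creg_def)
 fix p :: "real => 'a" and l assume p:"pcurve p l"
 and r:"arcs p l UNIV (reg f g p)"
 show "arcs p l UNIV (%s t. (ALL j. openin (top_of_set {s..t}) {r:{s..t}. j = 0 \<or> p r ~: F} &
 (NL {r:{s..t}. j = 0 \<or> p r ~: F} (%r. (if j = (0::nat) then g (p r) else 0))) < oo &
 (ALL a b. s <= a --> a < b --> b <= t --> (ALL r:{a..b}. j = 0 \<or> p r ~: F) -->
 ea (f (p b) - f (p a)) <= lint a b (%r. if j = 0 then g (p r) else 0))))"
 proof (intro allI impI)
 fix s t and j :: nat assume st:"0 <= s" "s < t" "t <= l"
 hence rg:"reg f g p s t" using r by simp
 show "openin (top_of_set {s..t}) {r:{s..t}. j = 0 \<or> p r ~: F} &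
 (NL {r:{s..t}. j = 0 \<or> p r ~: F} (%r. (if j = (0::nat) then g (p r) else 0))) < oo &
 (ALL a b. s <= a --> a < b --> b <= t --> (ALL r:{a..b}. j = 0 \<or> p r ~: F) -->
 ea (f (p b) - f (p a)) <= lint a b (%r. if j = 0 then g (p r) else 0))"
 proof (cases "j = 0")
 case True
 hence "{r:{s..t}. j = 0 \<or> p r ~: F} = {s..t}" by auto
 thus ?thesis using rg True by (simp add: reg_def del: mem_Collect_eq atLeastAtMost_iff)
 next
 case False
 have "open (p -` (- F))" using pcurve_continuous[OF p] F(1) by (intro open_vimage) auto
 hence "openin (top_of_set {s..t}) ({s..t} Int p -` (- F))" by (rule openin_open_Int)
 moreover have "{s..t} Int p -` (- F) = {r:{s..t}. j = 0 \<or> p r ~: F}" using False by auto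
 moreover have "f (p b) = f (p a)" if "a < b" "ALL r:{a..b}. j = 0 \<or> p r ~: F" for a b
 proof -
 have "p a ~: F" "p b ~: F" using that False by auto
 thus ?thesis using F(2) by simp
 qed
 ultimately show ?thesis using False by auto
 qed
 qed
 qed
 qed auto
qed

text \<open>Clamping to \<open>[0, 1]\<close> is a contraction even at infinite values, so it keeps
  the gradient and does not increase the norm.\<close>

lemma Cap1_real:
 assumes "cap A < c"
 shows "EX f g. wug UNIV f g & f:bM & (ALL x. 0 <= f x & f x <= 1) & (ALL x:A. f x = 1) &
 (NN x. en (f x)) + (NN x. g x) < c"
proof -
 obtain u where u:"u:N11 \<mu> UNIV" "ALL x:A. 1 <= u x" "N11_norm \<mu> UNIV u < c"
 using assms unfolding Cap1_def INF_less_iff by auto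
 have "EX g. weak_upper_gradient \<mu> UNIV u g & L1_norm \<mu> UNIV u + (NN x. g x) < c"
 proof (rule ccontr)
 assume n:"~ ?thesis"
 have "c - L1_norm \<mu> UNIV u <= (INF g\<in>{g. weak_upper_gradient \<mu> UNIV u g}. NI UNIV g)"
 proof (rule INF_greatest)
 fix g assume "g:{g. weak_upper_gradient \<mu> UNIV u g}"
 hence "c <= L1_norm \<mu> UNIV u + (NN x. g x)" using n by (auto simp: not_less)
 thus "c - L1_norm \<mu> UNIV u <= NI UNIV g"
 using u(3) by (subst ennreal_minus_le_iff) (auto simp: N11_norm_def)
 qed
 hence "c <= N11_norm \<mu> UNIV u" using u(3) unfolding N11_norm_def by (subst (asm) ennreal_minus_le_iff) auto
 thus False using u(3) by simp
 qed
 then obtain g where g:"weak_upper_gradient \<mu> UNIV u g" "L1_norm \<mu> UNIV u + (NN x. g x) < c" by blast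
 obtain G where G:"ecwug UNIV u G" "AM x. G x = g x * ind UNIV x"
 by (rule wug_ecwug[OF _ g(1)]) simp
 have [measurable]:"G:bB" by (rule ecwug_borel[OF G(1)])
 have um[measurable]:"u:bM" 
 proof -
 have "sets (restrict_space M UNIV) = sets M" by (auto simp: sets_restrict_space)
 thus ?thesis using u(1) measurable_cong_sets[of "restrict_space M UNIV" M borel borel] unfolding N11_def by blast
 qed
 define f where "f x = real_of_ereal (max 0 (min 1 (u x)))" for x
 have cl:"ea (real_of_ereal (max 0 (min 1 a)) - real_of_ereal (max 0 (min 1 b))) <= e2ennreal (abs (a - b))" for a b :: ereal
 by (cases a; cases b) (auto simp: max_def min_def top_unique zero_ereal_def one_ereal_def intro!: ennreal_leI)
 have f01:"0 <= f x & f x <= 1" for x by (cases "u x") (auto simp: f_def max_def min_def zero_ereal_def one_ereal_def)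
 have "cwug UNIV f G" unfolding cwug_def
 proof
 show "arc_ae UNIV (inc f G)"
 using G(1) unfolding ecwug_def f_def by (elim conjE curve_ae_mono) (meson cl order_trans)
 qed simp
 moreover have Gg:"(NN x. G x) = (NN x. g x)" using G(2) by (intro nn_integral_cong_AE) (auto elim: eventually_mono)
 have "(NN x. G x) < oo" using g(2) unfolding Gg by (auto simp: less_top[symmetric])
 ultimately have "wug UNIV f G" unfolding wug_def by (auto intro!: bfinI borel_measurable_M)
 moreover have "(NN x. en (f x)) <= L1_norm \<mu> UNIV u"
 unfolding L1_norm_def
 proof (simp, rule nn_integral_mono)
 fix x show "en (f x) <= e2ennreal (abs (u x))"
 by (cases "u x") (auto simp: f_def max_def min_def zero_ereal_def one_ereal_def intro!: ennreal_leI)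
 qed
 hence "(NN x. en (f x)) + (NN x. G x) < c" using g(2) unfolding Gg by (meson add_right_mono le_less_trans)
 moreover have "f x = 1" if "x:A" for x using u(2) that by (simp add: f_def min_absorb1)
 moreover have "f:bM" unfolding f_def[abs_def] by measurable
 ultimately show ?thesis using f01 by blast
qed

lemma wug_modify:
 assumes "wug A f G" and "curve_ae (%p l. ALL r:{0..l}. f' (p r) = f (p r))"
 shows "wug A f' G"
proof -
 obtain G' where G':"cwug A f G'" "AM x. x:A --> G' x <= G x" using assms(1) by (auto simp: wug_def)
 have "cwug A f' G'" unfolding cwug_def
 proof
 show "G':bB" by (rule cwug_borel[OF G'(1)])
 have "curve_ae (%p l. arcs p l A (inc f G' p) & (ALL r:{0..l}. f' (p r) = f (p r)))"
 using G'(1) assms(2) unfolding cwug_def by (intro curve_ae_conj) auto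
 thus "arc_ae A (inc f' G')"
 by (rule curve_ae_mono) auto
 qed
 thus ?thesis using assms(1) G'(2) unfolding wug_def by blast
qed

lemma cutoff:
 fixes K V :: "'a set"
 assumes K:"compact K" "K <= V" "open V"
 shows "EX L rh C. lips L rh & (ALL x. 0 <= rh x & rh x <= 1) & (ALL x:K. rh x = 1) & compact C & C <= V & (ALL x. x ~: C --> rh x = 0)"
proof (cases "K = {}")
 case True
 thus ?thesis by (intro exI[of _ 0] exI[of _ "%_. 0"] exI[of _ "{}"]) (simp add: lips_def)
next
 case False
 obtain e C where e:"e > 0" "compact C" "C <= V" "nbd K e <= C"
 using compact_nbd2[OF K] by (elim exE conjE) (rule that)
 define rh where "rh x = max 0 (1 - infdist x K / e)" for x
 have "lips (1 / e) rh" unfolding lips_def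
 proof (intro conjI allI)
 fix x y
 have "abs (rh x - rh y) <= abs (infdist x K / e - infdist y K / e)" unfolding rh_def by linarith
 also have "... = abs (infdist x K - infdist y K) / e" using e(1) by (simp add: diff_divide_distrib[symmetric])
 also have "... <= dist x y / e" using e(1) by (intro divide_right_mono infdist_triangle_abs) auto
 finally show "abs (rh x - rh y) <= 1 / e * dist x y" by simp
 qed (use e in simp)
 moreover have "rh x = 0" if "x ~: C" for x
 proof -
 have "e <= infdist x K" using that e(4) nbd_iff[OF False, of x e] by auto
 thus ?thesis using e(1) by (simp add: rh_def le_divide_eq)
 qed
 moreover have "0 <= rh x & rh x <= 1" for x using e(1) infdist_nonneg[of x K] by (simp add: rh_def)
 moreover have "rh x = 1" if "x:K" for x using that by (simp add: rh_def)
 ultimately show ?thesis using e(2,3) by blast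
qed

lemma null_sets_M:"\<mu> A = 0 ==> A:sets M"
proof -
 assume A:"\<mu> A = 0"
 have "\<mu> (A Int x) + \<mu> ((UNIV - A) Int x) = \<mu> x" for x
 proof (rule antisym)
 have "\<mu> (A Int x) <= 0" using mu_mono[of "A Int x" A] A by simp
 thus "\<mu> (A Int x) + \<mu> ((UNIV - A) Int x) <= \<mu> x" by (simp add: mu_mono)
 have "x = (A Int x) Un ((UNIV - A) Int x)" by auto
 thus "\<mu> x <= \<mu> (A Int x) + \<mu> ((UNIV - A) Int x)" using mu_Un by metis
 qed
 thus ?thesis by (simp add: sets_outer_meas[OF outer] lambda_system_def)
qed

lemma mu_le_Cap1:
 assumes "cap A < c" shows "\<mu> A < c"
proof -
 obtain f g where f:"f:bM" "ALL x:A. f x = 1" "(NN x. en (f x)) + (NN x. g x) < c"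
 using Cap1_real[OF assms] by blast
 have m:"{x. 1 <= f x}:sets M"
 proof -
 have "{x:space M. 1 <= f x}:sets M" using f(1) by measurable
 thus ?thesis by simp
 qed
 have "\<mu> A <= \<mu> {x. 1 <= f x}" using f(2) by (intro mu_mono) auto
 also have "... = (NN x. ind {x. 1 <= f x} x)" using m by (simp add: emeasure_M)
 also have "... <= (NN x. en (f x))" by (intro nn_integral_mono) (auto simp: indicator_def)
 also have "... < c" by (rule le_less_trans[OF _ f(3)]) simp
 finally show ?thesis .
qed

lemma Cap0_null:"cap A = 0 ==> \<mu> A = 0"
 using mu_le_Cap1[of A "\<mu> A"] by (cases "\<mu> A = 0") (auto simp: zero_less_iff_neq_zero)

text \<open>Redefining the functions as one on the exceptional set \<open>N\<close> of zero capacity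
  keeps their gradients, because almost every curve avoids \<open>N\<close>. The partition built
  from them then vanishes identically on \<open>N\<close>, so at each point of \<open>U\<close>
  either it sums to one or all its terms are zero.\<close>

lemma capseq:
 fixes ps :: "nat => 'a => real"
 assumes ps:"!!n. wug UNIV (ps n) (g n)" "!!n. ps n:bM" "!!n x. 0 <= ps n x & ps n x <= 1"
 and small:"!!n. (NN x. en (ps n x)) + (NN x. g n x) <= en ((1 / 4) ^ n)"
 shows "EX ps' N. (ALL n. wug UNIV (ps' n) (g n) & ps' n:bM & (ALL x. ps n x <= ps' n x & ps' n x <= 1)) &
 cap N = 0 & (ALL x:N. ALL n. ps' n x = 1) & (ALL x. x ~: N --> (EX n. ps' n x < 1 / 3)) &
 curve_ae (%p l. EX n. ALL r:{0..l}. ps' n (p r) < 1 / 3)"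
proof -
 note [measurable] = ps(2)
 define Q where "Q x \<longleftrightarrow> (ALL k. EX N. ALL n>=N. ps n x < rs k)" for x
 define N where "N = {x. ~ Q x}"
 have "{x:space M. ~ Q x}:sets M" unfolding Q_def by measurable
 hence Nm:"N:sets M" by (simp add: N_def)
 have QI:"Q x" if "ALL ep>0. EX N. ALL n>=N. ps n x < ep" for x using that by (simp add: Q_def)
 have cap:"cap N = 0"
 proof -
 have "cap N <= cap {x. ~ (ALL ep>0. EX N. ALL n>=N. ps n x < ep)}" using QI by (intro Cap1_mono) (unfold N_def, blast)
 also have "... = 0" by (rule Cap1_eventually_small[OF ps(1,2) _ small]) (use ps(3) in blast)
 finally show ?thesis by simp
 qed
 define ps' where "ps' n x = (if x:N then 1 else ps n x)" for n x
 have sum:"(\<Sum>n. en ((1 / 4) ^ n)) < oo"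
 proof -
 have "(\<Sum>n. en ((1 / 4) ^ n)) = en (1 / (1 - 1 / 4))" by (rule suminf_ennreal_eq[OF _ geometric_sums]) auto
 thus ?thesis by simp
 qed
 have le1:"(NN x. en (ps n x)) <= en ((1 / 4) ^ n)" "(NN x. g n x) <= en ((1 / 4) ^ n)" for n
 by (rule order_trans[OF _ small[of n]]; simp)+
 have "(\<Sum>n. NN x. en (ps n x)) < oo" "(\<Sum>n. NN x. g n x) < oo"
 using le1 by (intro le_less_trans[OF suminf_le sum]; simp)+
 hence cae:"curve_ae (%p l. ALL ep>0. EX N. ALL n>=N. ALL r:{0..l}. ps n (p r) < ep)"
 by (intro curve_ae_eventually_small[OF ps(1,2)]) (use ps(3) in blast)+
 have cae2:"curve_ae (%p l. (ALL r:{0..l}. p r ~: N) & (EX n. ALL r:{0..l}. ps n (p r) < 1 / 3))"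
 proof (rule curve_ae_mono[OF cae], intro conjI ballI)
 fix p :: "real => 'a" and l r :: real assume a:"ALL ep>0. EX N. ALL n>=N. ALL r:{0..l}. ps n (p r) < ep" and r:"r:{0..l::real}"
 hence "Q (p r)" by (intro QI) blast
 thus "p r ~: N" by (simp add: N_def)
 next
 fix p :: "real => 'a" and l :: real assume a:"ALL ep>0. EX N. ALL n>=N. ALL r:{0..l}. ps n (p r) < ep"
 have "(0::real) < 1 / 3" by simp
 with a obtain N where "ALL n>=N. ALL r:{0..l::real}. ps n (p r) < 1 / 3" by blast
 thus "EX n. ALL r:{0..l::real}. ps n (p r) < 1 / 3" by blast
 qed
 have "wug UNIV (ps' n) (g n)" for n
 by (rule wug_modify[OF ps(1)[of n]], rule curve_ae_mono[OF cae2]) (auto simp: ps'_def)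
 moreover have "ps' n:bM" for n unfolding ps'_def[abs_def] using Nm by measurable
 moreover have "ps n x <= ps' n x & ps' n x <= 1" for n x using ps(3)[of n x] by (auto simp: ps'_def)
 moreover have "EX n. ps' n x < 1 / 3" if "x ~: N" for x
 proof -
 have "Q x" using that by (simp add: N_def)
 hence "EX N. ALL n>=N. ps n x < rs 2" unfolding Q_def by blast
 thus ?thesis using that by (auto simp: ps'_def)
 qed
 moreover have "curve_ae (%p l. EX n. ALL r:{0..l}. ps' n (p r) < 1 / 3)"
 by (rule curve_ae_mono[OF cae2]) (auto simp: ps'_def)
 moreover have "ALL x:N. ALL n. ps' n x = 1" by (simp add: ps'_def)
 ultimately show ?thesis using cap by (intro exI[of _ ps'] exI[of _ N] conjI allI impI) auto
qed

text \<open>Each open set \<open>U Un G n\<close> is exhausted by compact sets \<open>KV n m\<close>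
  with Lipschitz cutoffs \<open>rh\<close>. The factor \<open>h n\<close> vanishes on
  \<open>G n\<close> and thereby moves the support into a compact subset of \<open>U\<close>. Along
  almost every curve some \<open>ps n\<close> stays below \<open>1 / 3\<close>, so that
  \<open>h n\<close> is one on the whole curve and the partial sums become one uniformly on its
  compact subarcs in \<open>U\<close>.\<close>

lemma partition_ex:
 fixes ps :: "nat => 'a => real" and U :: "'a set" and G :: "nat => 'a set"
 assumes ps:"!!n. wug UNIV (ps n) (g n)" "!!n. ps n:bM" "!!n x. 0 <= ps n x & ps n x <= 1"
 and G:"!!n. open (G n)" "!!n x. x:G n ==> ps n x = 1" and U:"!!n. open (U Un G n)"
 and cae:"curve_ae (%p l. EX n. ALL r:{0..l}. ps n (p r) < 1 / 3)"
 shows "EX Ph e K. (ALL k::nat. wug UNIV (Ph k) (e k) & Ph k:bM & (NN x. e k x) < oo) &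
 (ALL k x. 0 <= Ph k x & Ph k x <= 1 & Ph k x <= Ph (Suc k) x & (x ~: K k --> Ph k x = 0 & e k x = 0)) &
 (ALL k. compact (K k) & K k <= U & K k <= K (Suc k) & K k <= (UN n. - G n) & (ALL V. (ALL n. open (V Un G n)) --> closed (K k - V))) &
 (ALL x:U. (EX n. ps n x < 1 / 3) --> (EX N. ALL k>=N. Ph k x = 1)) & (ALL x. (ALL n. ps n x = 1) --> (ALL k. Ph k x = 0)) &
 arc_ae U (%p s t. (EX N. ALL k>=N. ALL r:{s..t}. Ph k (p r) = 1))"
proof -
 note [measurable] = ps(2)
 have "EX K::nat => 'a set. (ALL m. compact (K m) & K m <= U Un G n) & (ALL L. compact L --> L <= U Un G n --> (EX m. L <= K m))" for n
 using exhaustion[OF U[of n]] by metis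
 hence "ALL n. EX K::nat => 'a set. (ALL m. compact (K m) & K m <= U Un G n) & (ALL L. compact L --> L <= U Un G n --> (EX m. L <= K m))" ..
 from choice[OF this] obtain KV :: "nat => nat => 'a set" where
 KV:"ALL n. (ALL m. compact (KV n m) & KV n m <= U Un G n) & (ALL L. compact L --> L <= U Un G n --> (EX m. L <= KV n m))" ..
 define n1 m1 where "n1 i = fst (prod_decode i)" and "m1 i = snd (prod_decode i)" for i
 have "ALL i. EX t::real \<times> ('a => real) \<times> 'a set. lips (fst t) (fst (snd t)) & (ALL x. 0 <= fst (snd t) x & fst (snd t) x <= 1) &
 (ALL x:KV (n1 i) (m1 i). fst (snd t) x = 1) & compact (snd (snd t)) & snd (snd t) <= U Un G (n1 i) & (ALL x. x ~: snd (snd t) --> fst (snd t) x = 0)"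
 using cutoff[OF _ _ U] KV by simp
 from choice[OF this] obtain t :: "nat => real \<times> ('a => real) \<times> 'a set" where
 t:"ALL i. lips (fst (t i)) (fst (snd (t i))) & (ALL x. 0 <= fst (snd (t i)) x & fst (snd (t i)) x <= 1) &
 (ALL x:KV (n1 i) (m1 i). fst (snd (t i)) x = 1) & compact (snd (snd (t i))) & snd (snd (t i)) <= U Un G (n1 i) & (ALL x. x ~: snd (snd (t i)) --> fst (snd (t i)) x = 0)" ..
 \<comment> \<open>Removing the open set \<open>G (n1 i)\<close> from the compact support of the
   cutoff leaves a compact subset of \<open>U\<close>.\<close>
 define L rh C where "L i = fst (t i)" and "rh i = fst (snd (t i))" and "C i = snd (snd (t i)) - G (n1 i)" for i
 have rh:"lips (L i) (rh i)" "0 <= rh i x" "rh i x <= 1" "x:KV (n1 i) (m1 i) ==> rh i x = 1" "x ~: C i Un G (n1 i) ==> rh i x = 0" for i x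
 using t by (auto simp: L_def rh_def C_def)
 have C:"compact (C i)" "C i <= U" "C i <= - G (n1 i)" "(ALL n. open (V Un G n)) ==> closed (C i - V)" for i V
 proof -
 have c:"compact (snd (snd (t i)))" "snd (snd (t i)) <= U Un G (n1 i)" using t by auto
 show "compact (C i)" unfolding C_def using c(1) G(1) by (rule compact_diff)
 show "C i <= U" "C i <= - G (n1 i)" using c by (auto simp: C_def)
 assume "ALL n. open (V Un G n)"
 hence "compact (snd (snd (t i)) - (V Un G (n1 i)))" using c(1) by (intro compact_diff) auto
 moreover have "snd (snd (t i)) - (V Un G (n1 i)) = C i - V" by (auto simp: C_def)
 ultimately show "closed (C i - V)" by (simp add: compact_imp_closed)
 qed
 have [measurable]:"C i:sets M" for i using C(1)[of i] by (intro borel_M' borel_closed compact_imp_closed)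
 have [measurable]:"rh i:bM" for i
 using lips_continuous[OF rh(1), of UNIV] by (intro borel_measurable_M borel_measurable_continuous_onI) auto
 \<comment> \<open>One where \<open>ps n\<close> is at most \<open>1 / 3\<close> and zero where it
   is at least \<open>2 / 3\<close>, in particular on \<open>G n\<close>.\<close>
 define h where "h n x = max 0 (min 1 (2 - 3 * ps n x))" for n x
 have h:"wug UNIV (h n) (%x. (g n x + g n x + g n x) + 0)" "0 <= h n x" "h n x <= 1" for n x
 proof -
 show "wug UNIV (h n) (%x. (g n x + g n x + g n x) + 0)"
 by (rule wug_contract[OF wug_add[OF wug_add[OF ps(1) ps(1)] ps(1)] wug_zero[of _ 0]]) (auto simp: h_def)
 qed (auto simp: h_def)
 have [measurable]:"h n:bM" for n unfolding h_def[abs_def] by measurable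
 have [measurable]:"g n:bM" for n by (rule wug_meas[OF ps(1)])
 define ph where "ph i x = rh i x * h (n1 i) x" for i x
 define d where "d i x = (g (n1 i) x + g (n1 i) x + g (n1 i) x) + en (L i)" for i x
 define D where "D i x = d i x * ind (C i) x" for i x
 have bd:"bfin UNIV (d i)" for i unfolding d_def[abs_def]
 by (intro bfin_add bfin_const wug_fin[OF ps(1)]) auto
 have ph0:"ph i x = 0" if "x ~: C i" for i x
 using rh(5)[of x i] that G(2)[of x "n1 i"] by (cases "x:G (n1 i)") (auto simp: ph_def h_def)
 have ph01:"0 <= ph i x & ph i x <= 1" for i x
 using rh(2,3)[of i x] h(2,3)[of "n1 i" x] by (simp add: ph_def mult_le_one)
 have phw:"wug UNIV (ph i) (D i)" for i
 proof -
 have "wug UNIV (ph i) (d i)" unfolding ph_def[abs_def]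
 proof (rule wug_mult[OF wug_lips[OF rh(1)] h(1)])
 show "AM x. x:UNIV --> ea (rh i x) * (g (n1 i) x + g (n1 i) x + g (n1 i) x + 0) + ea (h (n1 i) x) * en (L i) <= d i x"
 proof (intro AE_I2 impI)
 fix x
 have "ea (rh i x) * (g (n1 i) x + g (n1 i) x + g (n1 i) x + 0) <= 1 * (g (n1 i) x + g (n1 i) x + g (n1 i) x + 0)"
 using rh(2,3)[of i x] by (intro mult_right_mono) auto
 moreover have "ea (h (n1 i) x) * en (L i) <= 1 * en (L i)" using h(2,3)[of "n1 i" x] by (intro mult_right_mono) auto
 ultimately show "ea (rh i x) * (g (n1 i) x + g (n1 i) x + g (n1 i) x + 0) + ea (h (n1 i) x) * en (L i) <= d i x"
 unfolding d_def by (intro add_mono) auto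
 qed
 show "bfin UNIV (d i)" by (rule bd)
 qed (auto simp: d_def[abs_def])
 thus ?thesis unfolding D_def[abs_def] by (rule wug_support[OF _ compact_imp_closed[OF C(1)] ph0])
 qed
 have Dfin:"(NN x. D i x) < oo" for i
 proof -
 obtain r where r:"C i <= ball ctr r"
 using compact_imp_bounded[OF C(1)[of i]] bounded_subset_ballD by blast
 have "(NN x. D i x) <= NI (UNIV Int ball ctr r) (d i)"
 unfolding D_def using r by (intro ni_mono) auto
 also have "... < oo" using bd[of i] unfolding bfin_def by blast
 finally show ?thesis .
 qed
 \<comment> \<open>Maxima keep the values in \<open>[0, 1]\<close>, and once some term is one, all
   later values are one. The actual partition functions are the differences of consecutive
   \<open>Ph k\<close>.\<close>
 define Ph where "Ph = rec_nat (ph 0) (%k P x. max (P x) (ph (Suc k) x))"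
 have Phs:"Ph 0 = ph 0" "Ph (Suc k) = (%x. max (Ph k x) (ph (Suc k) x))" for k by (simp_all add: Ph_def)
 define e where "e k x = (SUM i<=k. D i x)" for k x
 define K where "K k = (UN i<=k. C i)" for k
 have [measurable]:"ph i:bM" for i unfolding ph_def[abs_def] by measurable
 have Phw:"wug UNIV (Ph k) (e k) & Ph k:bM" for k
 proof (induction k)
 case 0
 show ?case using phw[of 0] by (simp add: Phs e_def[abs_def])
 next
 case (Suc k)
 hence [measurable]:"Ph k:bM" by blast
 have "wug UNIV (%x. max (Ph k x) (ph (Suc k) x)) (%x. e k x + D (Suc k) x)" using Suc phw by (intro wug_max) auto
 thus ?case by (simp add: Phs e_def[abs_def])
 qed
 have efin:"(NN x. e k x) < oo" for k unfolding e_def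
 using Dfin wug_meas[OF phw] by (subst nn_integral_sum) (auto simp: less_top[symmetric])
 have Ph01:"0 <= Ph k x & Ph k x <= 1" for k x by (induction k) (use ph01 in "auto simp: Phs max_def")
 have Phge:"ph i x <= Ph k x" if "i <= k" for i k x using that by (induction k) (auto simp: Phs le_Suc_eq)
 have Ph0:"Ph k x = 0" if "!!i. i <= k ==> ph i x = 0" for k x using that by (induction k) (auto simp: Phs)
 have one:"ALL k>=i. Ph k x = 1" if "ph i x = 1" for i x using Phge[of i _ x] Ph01[of _ x] that by (metis antisym)
 have ph1:"ph (prod_encode (n, m)) x = 1" if "x:KV n m" "ps n x < 1 / 3" for n m x
 using that rh(4)[of x "prod_encode (n, m)"] by (simp add: ph_def n1_def m1_def h_def)
 have r4:"EX N. ALL k>=N. Ph k x = 1" if x:"x:U" "ps n x < 1 / 3" for n x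
 proof -
 have "compact {x}" "{x} <= U Un G n" using x by auto
 then obtain m where "{x} <= KV n m" using KV by blast
 thus ?thesis using one[OF ph1[of x n m]] x by blast
 qed
 have r6:"arc_ae U (%p s t. (EX N. ALL k>=N. ALL r:{s..t}. Ph k (p r) = 1))"
 proof (rule curve_ae_mono[OF cae], intro allI impI)
 fix p :: "real => 'a" and l s t assume p:"pcurve p l" "EX n. ALL r:{0..l}. ps n (p r) < 1 / 3" "0 <= s" "s < t" "t <= l" "p ` {s..t} <= U"
 then obtain n where n:"ALL r:{0..l}. ps n (p r) < 1 / 3" by blast
 have "compact (p ` {s..t})" by (intro compact_continuous_image continuous_on_subset[OF pcurve_continuous[OF p(1)]]) auto
 moreover have "p ` {s..t} <= U Un G n" using p(6) by blast
 ultimately obtain m where m:"p ` {s..t} <= KV n m" using KV by blast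
 have "Ph k (p r) = 1" if "prod_encode (n, m) <= k" "r:{s..t}" for k r
 proof -
 have "ph (prod_encode (n, m)) (p r) = 1" using m n that(2) p(3,5) by (intro ph1) auto
 thus ?thesis using one that(1) by blast
 qed
 thus "EX N. ALL k>=N. ALL r:{s..t}. Ph k (p r) = 1" by blast
 qed
 have r5:"Ph k x = 0" if "ALL n. ps n x = 1" for k x using that by (intro Ph0) (simp add: ph_def h_def)
 have r2:"Ph k x = 0 & e k x = 0" if "x ~: K k" for k x
 using that ph0 by (auto simp: K_def e_def D_def intro!: Ph0)
 have r1:"Ph k x <= Ph (Suc k) x" for k x by (simp add: Phs)
 have r3:"compact (K k) & K k <= U & K k <= K (Suc k) & K k <= (UN n. - G n) & (ALL V. (ALL n. open (V Un G n)) --> closed (K k - V))" for k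
 proof (intro conjI allI impI)
 show "compact (K k)" unfolding K_def using C(1) by (intro compact_UN) auto
 show "K k <= U" "K k <= K (Suc k)" "K k <= (UN n. - G n)" using C(2,3) by (force simp: K_def)+
 fix V assume V:"ALL n. open (V Un G n)"
 have "K k - V = (UN i<=k. C i - V)" by (auto simp: K_def)
 thus "closed (K k - V)" by (simp only:) (intro closed_UN finite_atMost ballI C(4) V)
 qed
 show ?thesis
 proof (intro exI[of _ Ph] exI[of _ e] exI[of _ K] conjI)
 show "ALL k. wug UNIV (Ph k) (e k) & Ph k:bM & (NN x. e k x) < oo" using Phw efin by blast
 show "ALL k x. 0 <= Ph k x & Ph k x <= 1 & Ph k x <= Ph (Suc k) x & (x ~: K k --> Ph k x = 0 & e k x = 0)" using Ph01 r1 r2 by blast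
 show "ALL x:U. (EX n. ps n x < 1 / 3) --> (EX N. ALL k>=N. Ph k x = 1)" using r4 by blast
 show "ALL x. (ALL n. ps n x = 1) --> (ALL k. Ph k x = 0)" using r5 by blast
 qed (rule allI, rule r3, rule r6)
qed

end

section \<open>The function \<open>v\<close> and the variation of the tails of
  \<open>v - u\<close>\<close>

lemma liminf_eventually_le:
 fixes a :: "nat => ennreal"
 assumes "liminf a = en b" "0 <= b" "0 < e"
 shows "evs (%i. en b <= a i + en e)"
proof (cases "b < e")
 case True
 hence "en b <= a i + en e" for i by (intro add_increasing) (auto intro: ennreal_leI)
 thus ?thesis by simp
next
 case False
 hence "en (b - e) < liminf a" using assms by (simp add: ennreal_less_iff)
 hence "evs (%i. en (b - e) < a i)" by (rule less_LiminfD)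
 thus ?thesis
 proof eventually_elim
 case (elim i)
 have "en b = en (b - e) + en e" using False assms by (subst ennreal_plus[symmetric]) auto
 thus ?case using elim by (simp add: add_right_mono less_imp_le)
 qed
qed

lemma tendsto0_eventually_le:"a ~~> 0 ==> 0 < e ==> evs (%i. a i <= en e)" for a :: "nat => ennreal"
 by (drule order_tendstoD(2)[of _ _ _ "en e"]) (auto elim: eventually_mono)

lemma suminf_telescope_le:
 fixes b :: "nat => real"
 assumes "!!k. b k <= b (Suc k)" "!!k. b k <= c"
 shows "(\<Sum>k. en (b (Suc k) - b k)) <= en (c - b 0)"
proof (rule suminf_le_const[OF summableI])
 fix n
 have "(SUM k<n. en (b (Suc k) - b k)) = en (SUM k<n. b (Suc k) - b k)" using assms(1) by (subst sum_ennreal) auto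
 also have "... <= en (c - b 0)" unfolding sum_lessThan_telescope using assms(2)[of n] by (intro ennreal_leI) simp
 finally show "(SUM k<n. en (b (Suc k) - b k)) <= en (c - b 0)" .
qed

text \<open>The data behind \<open>v\<close>: partial sums \<open>Ph\<close> of the partition,
  approximations \<open>F i\<close> of \<open>f\<close> on \<open>W\<close> with energy at most
  \<open>c\<close>, and obstacles at distance \<open>d0\<close> from \<open>f\<close> on each
  \<open>K k\<close>. The alternative in \<open>ev2\<close> makes the series for \<open>v\<close>
  finite at every point of \<open>U\<close>, not just almost everywhere.\<close>

locale construction = doubling_space \<mu> Cd for \<mu> :: "'a::complete_space set => ennreal" and Cd :: real +
 fixes U W :: "'a set" and Ph :: "nat => 'a => real" and e :: "nat => 'a => ennreal" and K :: "nat => 'a set"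
 and f :: "'a => real" and F :: "nat => 'a => real" and G :: "nat => 'a => ennreal" and c :: real
 and L :: "nat => real" and al bt :: "nat => 'a => real" and d0 de :: real
 assumes U:"U:sets M" "U <= W" and W:"open W"
 and Phw:"!!k. wug UNIV (Ph k) (e k)" and Phm[measurable]:"!!k. Ph k:bM" and efin:"!!k. (NN x. e k x) < oo"
 and Ph01:"!!k x. 0 <= Ph k x" "!!k x. Ph k x <= 1" "!!k x. Ph k x <= Ph (Suc k) x"
 and Ph0:"!!k x. x ~: K k ==> Ph k x = 0" and e0:"!!k x. x ~: K k ==> e k x = 0"
 and K:"!!k. compact (K k)" "!!k. K k <= U" "!!k. K k <= K (Suc k)"
 and ev:"AM x. x:U --> (EX N. ALL k>=N. Ph k x = 1)"
 and ev2:"!!x. x:U ==> (EX N. ALL k>=N. Ph k x = 1) \<or> (ALL k. Ph k x = 0)"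
 and cae:"arc_ae U (%p s t. (EX N. ALL k>=N. ALL r:{s..t}. Ph k (p r) = 1))"
 and Fw:"!!i. wug W (F i) (G i)" and Fm[measurable]:"!!i. F i:bM"
 and Flim:"AM x. x:W --> (%i. F i x) ~~> f x" and Gc:"!!i. NI W (G i) <= en c" and c:"0 <= c"
 and fm[measurable]:"f:bM"
 and lip:"!!k. lips (L k) (al k)" "!!k. lips (L k) (bt k)" and albt:"!!k x. al k x <= bt k x"
 and falbt:"!!k. AM x. x:K k --> al k x + d0 <= f x & f x <= bt k x - d0" and d0:"0 < d0" and de:"0 < de"
begin

text \<open>The sum of the first \<open>k\<close> partition functions: \<open>Ph\<close> shifted by
  one, so that consecutive differences give \<open>et k\<close> for \<open>k = 0\<close>
  too.\<close>

definition Th :: "nat => 'a => real" where "Th k x = (case k of 0 => 0 | Suc j => Ph j x)"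
definition et :: "nat => 'a => real" where "et k x = consec Ph k x"
definition E :: "nat => 'a => ennreal" where "E k x = e k x + (case k of 0 => 0 | Suc j => e j x)"
definition md :: "nat => nat => 'a => real" where "md k i x = med (F i x) (al k x) (bt k x)"
definition bad :: "nat => nat => 'a set" where "bad k i = {x. ~ (al k x < F i x & F i x < bt k x)}"
definition gr :: "nat => nat => 'a => ennreal" where "gr k i x = G i x + en (L k) * ind (bad k i) x"
definition dl :: "nat => real" where "dl k = de * (1 / 2) ^ Suc k"
text \<open>The weight \<open>E k + et k\<close> controls two things at once: the gradient of the
  partition function times \<open>md k i - f\<close>, and the contribution to the distance in
  \<open>L1\<close>.\<close>

definition dev :: "nat => nat => ennreal" where "dev k i = (NN x. ea (md k i x - f x) * (E k x + en (et k x)))"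
text \<open>Bounds the energy added by truncation. It is written as a bounded function times an
  integrable weight to suit \<open>dct0\<close>.\<close>

definition clp :: "nat => nat => ennreal" where "clp k i = (NN x. ea (indr (bad k i) x) * (en (L k) * ind (K k) x))"
definition mass :: "nat => nat => ennreal" where "mass k i = (NN x. en (Th k x) * G i x)"

lemma dl:"0 < dl k" "dl (Suc k) <= dl k"
 using de by (auto simp: dl_def)

lemma Gm[measurable]:"G i:bM" by (rule wug_meas[OF Fw])
lemma em[measurable]:"e i:bM" by (rule wug_meas[OF Phw])
lemma Km[measurable]:"K k:sets M" using K(1) by (intro borel_M' borel_closed compact_imp_closed)
lemma Wm[measurable]:"W:sets M" using W by (intro borel_M') auto
lemma alm[measurable]:"al k:bM" "bt k:bM"
 using lips_continuous[OF lip(1), of UNIV] lips_continuous[OF lip(2), of UNIV] by (auto intro!: borel_measurable_M borel_measurable_continuous_onI)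
lemma Em[measurable]:"E k:bM" unfolding E_def[abs_def] by (cases k) auto
lemma Thm[measurable]:"Th k:bM" unfolding Th_def[abs_def] by (cases k) auto
lemma etTh:"et k x = Th (Suc k) x - Th k x" by (simp add: et_def consec_def Th_def)
lemma etm[measurable]:"et k:bM" unfolding etTh[abs_def] by measurable
lemma mdm[measurable]:"md k i:bM" unfolding md_def[abs_def] med_def by measurable
lemma badm[measurable]:"bad k i:sets M"
proof -
 have "{x:space M. ~ (al k x < F i x & F i x < bt k x)}:sets M" by measurable
 thus ?thesis by (simp add: bad_def)
qed

lemma Kmono:"i <= j ==> K i <= K j"
 by (rule lift_Suc_mono_le[of K]) (use K in auto)

lemma Th01:"0 <= Th k x" "Th k x <= 1" "Th k x <= Th (Suc k) x"
 using Ph01 by (auto simp: Th_def split: nat.split)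

lemma et01:"0 <= et k x" "et k x <= 1" using Th01[of k x] Th01(2)[of "Suc k" x] by (auto simp: etTh)

lemma et0:"x ~: K k ==> et k x = 0"
 using Ph0[of x k] Ph0[of x "k - 1"] K(3)[of "k - 1"] by (cases k) (auto simp: et_def consec_def)

lemma E0:"x ~: K k ==> E k x = 0"
 using e0[of x k] e0[of x "k - 1"] K(3)[of "k - 1"] by (cases k) (auto simp: E_def)

lemma Efin:"(NN x. E k x) < oo"
 using efin unfolding E_def by (cases k) (auto simp: nn_integral_add ennreal_add_eq_top less_top)

lemma etw:"wug UNIV (et k) (E k)"
proof (cases k)
 case 0
 thus ?thesis using Phw[of 0] by (simp add: et_def[abs_def] consec_def E_def[abs_def])
next
 case (Suc j)
 thus ?thesis using wug_add[OF Phw[of k] wug_uminus[OF Phw[of j]]]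
 by (simp add: et_def[abs_def] consec_def E_def[abs_def])
qed

lemma muK:"\<mu> (K k) < oo" by (rule bounded_fin[OF compact_imp_bounded[OF K(1)]])

lemma et_fin:"EX n. ALL k>=n. et k x = 0"
proof (cases "x:U")
 case True
 show ?thesis
 proof (cases "ALL k. Ph k x = 0")
 case False
 then obtain N where N:"ALL k>=N. Ph k x = 1" using ev2[OF True] by blast
 have "et k x = 0" if "Suc N <= k" for k
 using that N by (cases k) (auto simp: et_def consec_def)
 thus ?thesis by blast
 qed (auto simp: et_def consec_def split: nat.split)
next
 case False
 thus ?thesis using et0 K(2) by blast
qed

lemma md_bounds:"al k x <= md k i x" "md k i x <= bt k x"
 using albt[of k x] by (auto simp: md_def med_def)

text \<open>The margin \<open>d0\<close> makes truncation inactive in the limit at almost every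
  point of \<open>K k\<close>.\<close>

lemma limit_K:"AM x. x:K k --> (%i. md k i x - f x) ~~> 0 & (%i. indr (bad k i) x) ~~> 0"
 using Flim falbt[of k]
proof eventually_elim
 case (elim x)
 show ?case
 proof (intro impI conjI)
 assume x:"x:K k"
 hence l:"(%i. F i x) ~~> f x" and fx:"al k x + d0 <= f x" "f x <= bt k x - d0" using elim K(2) U(2) by blast+
 have "(%i. max (al k x) (min (F i x) (bt k x))) ~~> max (al k x) (min (f x) (bt k x))" by (intro tendsto_intros l)
 also have "max (al k x) (min (f x) (bt k x)) = f x" using fx d0 by simp
 finally show "(%i. md k i x - f x) ~~> 0" unfolding md_def med_def by (simp add: LIM_zero)
 have "evs (%i. al k x < F i x)" "evs (%i. F i x < bt k x)"
 using fx d0 by (intro order_tendstoD[OF l]; simp)+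
 hence "evs (%i. 0 = indr (bad k i) x)" by eventually_elim (simp add: bad_def)
 thus "(%i. indr (bad k i) x) ~~> 0" by (rule Lim_transform_eventually[OF tendsto_const])
 qed
qed

lemma etint:"(NN x. en (et k x)) < oo"
proof -
 have "(NN x. en (et k x)) <= (NN x. ind (K k) x)"
 using et01(2) et0 by (intro nn_integral_mono) (auto simp: indicator_def)
 also have "... < oo" using muK by (simp add: emeasure_M)
 finally show ?thesis .
qed

lemma dev_lim:"dev k ~~> 0"
proof -
 obtain B where B:"!!x. x:K k ==> abs (bt k x - al k x) <= B"
 proof -
 have "compact ((%x. bt k x - al k x) ` K k)"
 using K(1) lips_continuous[OF lip(1)] lips_continuous[OF lip(2)] by (intro compact_continuous_image continuous_on_diff) auto
 hence "bounded ((%x. bt k x - al k x) ` K k)" by (rule compact_imp_bounded)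
 thus thesis using that unfolding bounded_iff by auto
 qed
 show ?thesis unfolding dev_def[abs_def]
 proof (rule dct0[where B = B])
 show "(NN x. E k x + en (et k x)) < oo"
 using Efin[of k] etint[of k] by (subst nn_integral_add) (auto simp: ennreal_add_eq_top less_top)
 show "AM x. E k x + en (et k x) ~= 0 --> (%i. md k i x - f x) ~~> 0 & (ALL i. abs (md k i x - f x) <= B)"
 using limit_K[of k] falbt[of k]
 proof eventually_elim
 case (elim x)
 show ?case
 proof
 assume "E k x + en (et k x) ~= 0"
 hence x:"x:K k" using E0[of x k] et0[of x k] by (cases "x:K k") auto
 have "abs (md k i x - f x) <= B" for i using elim(2) x B[OF x] md_bounds(1)[of k x i] md_bounds(2)[of k i x] d0 by auto
 thus "(%i. md k i x - f x) ~~> 0 & (ALL i. abs (md k i x - f x) <= B)" using elim(1) x by blast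
 qed
 qed
 qed measurable
qed

lemma clp_lim:"clp k ~~> 0" unfolding clp_def[abs_def]
proof (rule dct0[where B = 1])
 show "(NN x. en (L k) * ind (K k) x) < oo"
 using muK[of k] by (subst nn_integral_cmult_indicator) (auto simp: emeasure_M ennreal_mult_less_top)
 show "AM x. en (L k) * ind (K k) x ~= 0 --> (%i. indr (bad k i) x) ~~> 0 & (ALL i. abs (indr (bad k i) x) <= 1)"
 using limit_K[of k] by eventually_elim (auto simp: indicator_def split: if_splits)
qed measurable

lemma mass_le:"mass k i <= en c"
proof -
 have "mass k i <= NI W (G i)" unfolding mass_def
 proof (rule nn_integral_mono)
 fix x
 have "x ~: W ==> x ~: K j" for j using K(2)[of j] U(2) by blast
 hence "x ~: W ==> Th k x = 0" using Ph0 by (cases k) (auto simp: Th_def)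
 moreover have "en (Th k x) * G i x <= 1 * G i x" using Th01(2)[of k x] by (intro mult_right_mono) auto
 ultimately show "en (Th k x) * G i x <= G i x * ind W x" by (auto simp: indicator_def)
 qed
 thus ?thesis using Gc by (rule order_trans)
qed

text \<open>The masses need not converge along the sequence, hence the lower limit.\<close>

definition bb :: "nat => real" where "bb k = enn2real (liminf (mass k))"

lemma liminf_mass_le:"liminf (mass k) <= en c"
 by (rule Liminf_le) (use mass_le in auto)

lemma bb:"liminf (mass k) = en (bb k)" "0 <= bb k" "bb k <= c" "bb k <= bb (Suc k)" "bb 0 = 0"
proof -
 have fin:"liminf (mass k) < top" for k using liminf_mass_le[of k] by (auto intro: le_less_trans)
 show e1:"liminf (mass k) = en (bb k)" for k using fin[of k] by (simp add: bb_def)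
 show p:"0 <= bb k" for k by (simp add: bb_def)
 show "bb k <= c" using liminf_mass_le[of k] c unfolding e1 by (simp add: ennreal_le_iff)
 have "mass k i <= mass (Suc k) i" for i unfolding mass_def using Th01(3)
 by (intro nn_integral_mono mult_right_mono ennreal_leI) auto
 hence "liminf (mass k) <= liminf (mass (Suc k))" by (intro Liminf_mono always_eventually) auto
 thus "bb k <= bb (Suc k)" unfolding e1 using p by (simp add: ennreal_le_iff)
 show "bb 0 = 0" by (simp add: bb_def mass_def[abs_def] Th_def Liminf_const)
qed

lemma mass_add:"k <= n ==> (NN x. en (Th n x - Th k x) * G i x) + mass k i = mass n i"
proof -
 assume "k <= n"
 hence le:"Th k x <= Th n x" for x by (rule lift_Suc_mono_le[of "%k. Th k x", rotated]) (rule Th01)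
 show ?thesis unfolding mass_def
 by (subst nn_integral_add[symmetric]) (auto intro!: nn_integral_cong simp: distrib_right[symmetric] le Th01 simp flip: ennreal_plus)
qed

text \<open>At a single index the difference of masses is close to that of the lower limits,
  provided that the larger mass is nearly minimal, which happens infinitely often, and that the
  smaller one is not far below its lower limit, which holds eventually.\<close>

lemma mass_diff:
 assumes kn:"k <= n" and s:"0 < s" and i:"mass n i <= en (bb n + s)" "en (bb k) <= mass k i + en s"
 shows "(NN x. en (Th n x - Th k x) * G i x) <= en (bb n - bb k + 2 * s)"
proof -
 let ?X = "NN x. en (Th n x - Th k x) * G i x"
 have "?X + en (bb k) <= ?X + (mass k i + en s)" using i(2) by (rule add_left_mono)
 also have "... = mass n i + en s" using mass_add[OF kn, of i] by (simp add: add.assoc[symmetric])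
 also have "... <= en (bb n + s) + en s" using i(1) by (rule add_right_mono)
 also have "... = en (bb n + 2 * s)" using s bb(2)[of n] by (subst ennreal_plus[symmetric]) auto
 finally have *: "?X + en (bb k) <= en (bb n + 2 * s)" .
 show ?thesis
 proof (cases ?X)
 case (real h)
 hence "en (h + bb k) <= en (bb n + 2 * s)" using * bb(2)[of k] by simp
 hence "h + bb k <= bb n + 2 * s" using bb(2)[of n] s by (subst (asm) ennreal_le_iff) auto
 thus ?thesis using real by (auto intro!: ennreal_leI)
 qed (use * in "auto simp: top_unique")
qed

lemma mass_freq:"0 < s ==> \<exists>\<^sub>F i in sequentially. mass n i <= en (bb n + s)"
proof -
 assume "0 < s"
 hence "liminf (mass n) < en (bb n + s)" unfolding bb(1) using bb(2)[of n] by (simp add: ennreal_less_iff)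
 from liminf_freq[OF this] show ?thesis by (rule frequently_elim1) simp
qed

text \<open>Each \<open>k\<close> takes an index of its own. The smallness conditions hold
  eventually and the upper bound on the mass infinitely often, so they can be met together.
  Telescoping of \<open>bb\<close> then keeps the total energy of all terms within \<open>c\<close>
  plus errors.\<close>

lemma ex_index:"EX io. ALL k. dev k (io k) <= en (dl k) & clp k (io k) <= en (dl k) &
 (NN x. en (et k x) * G (io k) x) <= en (bb (Suc k) - bb k + dl k)"
proof (rule choice, rule allI)
 fix k
 have s:"0 < dl k / 2" using dl(1)[of k] by simp
 have "evs (%i. dev k i <= en (dl k) & clp k i <= en (dl k) & en (bb k) <= mass k i + en (dl k / 2))"
 by (intro eventually_conj tendsto0_eventually_le dev_lim clp_lim liminf_eventually_le bb dl s)
 from frequently_eventually_conj[OF mass_freq[OF s, of "Suc k"] this] obtain i where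
 i:"mass (Suc k) i <= en (bb (Suc k) + dl k / 2)" "dev k i <= en (dl k)" "clp k i <= en (dl k)" "en (bb k) <= mass k i + en (dl k / 2)"
 by (auto dest: frequently_ex)
 have "(NN x. en (et k x) * G i x) <= en (bb (Suc k) - bb k + dl k)"
 using mass_diff[OF _ s i(1,4)] by (simp add: etTh)
 thus "EX i. dev k i <= en (dl k) & clp k i <= en (dl k) & (NN x. en (et k x) * G i x) <= en (bb (Suc k) - bb k + dl k)"
 using i by blast
qed

definition io :: "nat => nat" where "io = (SOME io. ALL k. dev k (io k) <= en (dl k) & clp k (io k) <= en (dl k) &
 (NN x. en (et k x) * G (io k) x) <= en (bb (Suc k) - bb k + dl k))"

lemma io:"dev k (io k) <= en (dl k)" "clp k (io k) <= en (dl k)"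
 "(NN x. en (et k x) * G (io k) x) <= en (bb (Suc k) - bb k + dl k)"
 using someI_ex[OF ex_index, folded io_def] by blast+

definition w :: "nat => 'a => real" where "w k = md k (io k)"
definition v :: "'a => real" where "v x = (\<Sum>k. et k x * w k x)"
text \<open>The tail of \<open>v - f\<close>. It is defined on the whole space and vanishes outside
  \<open>U\<close>, where all partition functions do.\<close>

definition fN :: "nat => 'a => real" where "fN N x = (\<Sum>k. et (k + N) x * (w (k + N) x - f x))"

lemma wm[measurable]:"w k:bM" unfolding w_def by measurable

lemma grm[measurable]:"gr k i:bM" unfolding gr_def[abs_def] by measurable

lemma md_wug:"wug W (md k i) (gr k i)"
 unfolding md_def[abs_def] gr_def[abs_def] bad_def by (rule wug_med[OF Fw Fm lip albt])

lemma etgr:"(NN x. en (et k x) * gr k i x) <= (NN x. en (et k x) * G i x) + clp k i"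
proof -
 have "(NN x. en (et k x) * gr k i x) <= (NN x. en (et k x) * G i x + ea (indr (bad k i) x) * (en (L k) * ind (K k) x))"
 proof (rule nn_integral_mono)
 fix x
 have "en (et k x) * (en (L k) * ind (bad k i) x) <= ea (indr (bad k i) x) * (en (L k) * ind (K k) x)"
 using et0[of x k] et01(2)[of k x] mult_right_mono[of "en (et k x)" 1 "en (L k)"] by (auto simp: indicator_def)
 thus "en (et k x) * gr k i x <= en (et k x) * G i x + ea (indr (bad k i) x) * (en (L k) * ind (K k) x)"
 unfolding gr_def distrib_left by (rule add_left_mono)
 qed
 also have "... = (NN x. en (et k x) * G i x) + clp k i" unfolding clp_def by (rule nn_integral_add) measurable
 finally show ?thesis .
qed

lemma etga:"(NN x. en (et k x) * gr k (io k) x) <= en (bb (Suc k) - bb k + 2 * dl k)"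
proof -
 have "(NN x. en (et k x) * gr k (io k) x) <= en (bb (Suc k) - bb k + dl k) + en (dl k)"
 by (rule order_trans[OF etgr]) (intro add_mono io)
 also have "... = en (bb (Suc k) - bb k + 2 * dl k)"
 using dl(1)[of k] bb(4)[of k] by (subst ennreal_plus[symmetric]) (auto simp: algebra_simps)
 finally show ?thesis .
qed

lemma sum_dl:"(\<Sum>k. en (dl (k + N))) = en (de * (1 / 2) ^ N)"
proof -
 have "(%k. de * (1 / 2) ^ N * (1 / 2) ^ Suc k) sums (de * (1 / 2) ^ N * 1)" by (intro sums_mult power_half_series)
 hence "(%k. dl (k + N)) sums (de * (1 / 2) ^ N)" by (simp add: dl_def power_add ac_simps)
 thus ?thesis using dl(1) by (intro suminf_ennreal_eq) (auto intro: less_imp_le)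
qed

lemma v_fin:"(%k. et k x * w k x) sums v x"
proof -
 obtain n where "ALL k>=n. et k x = 0" using et_fin by blast
 hence "summable (%k. et k x * w k x)" by (intro summable_finite[of "{..<n}"]) auto
 thus ?thesis unfolding v_def by (rule summable_sums)
qed

lemma fN_sum:"(%k. et (k + N) x * (w (k + N) x - f x)) sums fN N x"
proof -
 obtain n where "ALL k>=n. et k x = 0" using et_fin by blast
 hence "summable (%k. et (k + N) x * (w (k + N) x - f x))" by (intro summable_finite[of "{..<n}"]) auto
 thus ?thesis unfolding fN_def by (rule summable_sums)
qed

lemma fNm[measurable]:"fN N:bM" unfolding fN_def[abs_def] by measurable
lemma vm[measurable]:"v:bM" unfolding v_def[abs_def] by measurable

lemma fN_split:"fN N x = (SUM k:{N..<N + n}. et k x * (w k x - f x)) + fN (N + n) x"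
proof -
 have "fN N x = (\<Sum>k. et (k + n + N) x * (w (k + n + N) x - f x)) + (SUM k<n. et (k + N) x * (w (k + N) x - f x))"
 unfolding fN_def by (rule suminf_split_initial_segment[OF sums_summable[OF fN_sum]])
 moreover have "(SUM k<n. et (k + N) x * (w (k + N) x - f x)) = (SUM k:{N..<N + n}. et k x * (w k x - f x))"
 using sum.shift_bounds_nat_ivl[of "%k. et k x * (w k x - f x)" 0 N n] by (simp add: lessThan_atLeast0 add.commute)
 ultimately show ?thesis by (simp add: fN_def ac_simps)
qed

lemma fN_L1:"(NN x. ea (fN N x)) <= en (de * (1 / 2) ^ N)"
proof -
 have "(NN x. ea (fN N x)) <= (NN x. (\<Sum>k. ea (w (k + N) x - f x) * en (et (k + N) x)))"
 proof (rule nn_integral_mono)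
 fix x
 obtain n where n:"ALL k>=n. et k x = 0" using et_fin by blast
 have "abs (fN N x) = abs (SUM k<n. et (k + N) x * (w (k + N) x - f x))"
 unfolding fN_def using n by (subst suminf_finite[of "{..<n}"]) auto
 also have "... <= (SUM k<n. abs (et (k + N) x * (w (k + N) x - f x)))" by (rule sum_abs)
 also have "... = (SUM k<n. abs (w (k + N) x - f x) * et (k + N) x)" using et01(1) by (simp add: abs_mult mult.commute)
 finally have "ea (fN N x) <= (SUM k<n. ea (w (k + N) x - f x) * en (et (k + N) x))"
 using et01(1) by (simp add: ennreal_mult[symmetric] sum_ennreal ennreal_leI)
 also have "... <= (\<Sum>k. ea (w (k + N) x - f x) * en (et (k + N) x))" by (intro sum_le_suminf summableI) auto
 finally show "ea (fN N x) <= (\<Sum>k. ea (w (k + N) x - f x) * en (et (k + N) x))" .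
 qed
 also have "... = (\<Sum>k. NN x. ea (w (k + N) x - f x) * en (et (k + N) x))" by (rule nn_integral_suminf) measurable
 also have "... <= (\<Sum>k. en (dl (k + N)))"
 proof (intro suminf_le summableI)
 fix k
 have "(NN x. ea (w (k + N) x - f x) * en (et (k + N) x)) <= dev (k + N) (io (k + N))"
 unfolding dev_def w_def by (intro nn_integral_mono mult_left_mono) auto
 thus "(NN x. ea (w (k + N) x - f x) * en (et (k + N) x)) <= en (dl (k + N))" using io(1) by (rule order_trans)
 qed
 finally show ?thesis unfolding sum_dl .
qed

lemma v_fN:"AM x. x:U --> v x - f x = fN 0 x"
 using ev
proof eventually_elim
 case (elim x)
 show ?case
 proof
 assume "x:U"
 then obtain N where N:"ALL k>=N. Ph k x = 1" using elim by blast
 have z:"et k x = 0" if "k ~: {..N}" for k using that N by (cases k) (auto simp: et_def consec_def)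
 have "v x = (SUM k<=N. et k x * w k x)" unfolding v_def using z by (intro suminf_finite) auto
 moreover have "fN 0 x = (SUM k<=N. et k x * (w k x - f x))" unfolding fN_def using z by (simp, intro suminf_finite) auto
 moreover have "(SUM k<=N. et k x) = Th (Suc N) x" unfolding etTh using sum_lessThan_telescope[of "%k. Th k x" "Suc N"]
 by (simp only: lessThan_Suc_atMost) (simp add: Th_def)
 hence "(SUM k<=N. et k x) = 1" using N by (simp add: Th_def)
 ultimately show "v x - f x = fN 0 x" by (simp add: right_diff_distrib sum_subtractf sum_distrib_right[symmetric])
 qed
qed

text \<open>Terms of index at most \<open>N\<close> are supported in \<open>K N\<close>, so it is
  the tail from \<open>Suc N\<close> that agrees with the whole series off
  \<open>K N\<close>.\<close>

lemma fN_eq:"x ~: K N ==> fN (Suc N) x = fN 0 x"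
proof -
 assume x:"x ~: K N"
 have "et k x = 0" if "k:{0..<0 + Suc N}" for k using et0[of x k] Kmono[of k N] x that by auto
 thus ?thesis using fN_split[of 0 x "Suc N"] by simp
qed

definition Gv :: "'a => ennreal" where
 "Gv x = (\<Sum>k. en (consec Ph k x) * gr k (io k) x + ea (w k x - w (Suc k) x) * e k x)"

text \<open>Per index the error is \<open>4 * dl k\<close>: two parts from \<open>etga\<close>, and
  two from comparing \<open>w k\<close> and \<open>w (Suc k)\<close> with \<open>f\<close>, as
  \<open>dl (Suc k) <= dl k\<close>.\<close>

lemma Gv_le:"(NN x. Gv x) <= en (c + 4 * de)"
proof -
 have "(NN x. Gv x) = (\<Sum>k. NN x. en (et k x) * gr k (io k) x + ea (w k x - w (Suc k) x) * e k x)"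
 unfolding Gv_def et_def[symmetric] by (rule nn_integral_suminf) measurable
 also have "... <= (\<Sum>k. en (bb (Suc k) - bb k) + en (4 * dl k))"
 proof (intro suminf_le summableI)
 fix k
 have "(NN x. ea (w k x - w (Suc k) x) * e k x) <=
 (NN x. ea (w k x - f x) * (E k x + en (et k x)) + ea (w (Suc k) x - f x) * (E (Suc k) x + en (et (Suc k) x)))"
 proof (rule nn_integral_mono)
 fix x
 have "ea (w k x - w (Suc k) x) * e k x <= en (abs (w k x - f x) + abs (w (Suc k) x - f x)) * e k x"
 by (intro mult_right_mono ennreal_leI) auto
 also have "... = ea (w k x - f x) * e k x + ea (w (Suc k) x - f x) * e k x" by (simp add: distrib_right)
 also have "... <= ea (w k x - f x) * (E k x + en (et k x)) + ea (w (Suc k) x - f x) * (E (Suc k) x + en (et (Suc k) x))"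
 by (intro add_mono mult_left_mono) (auto simp: E_def intro: add_increasing add_increasing2)
 finally show "ea (w k x - w (Suc k) x) * e k x <= ea (w k x - f x) * (E k x + en (et k x)) + ea (w (Suc k) x - f x) * (E (Suc k) x + en (et (Suc k) x))" .
 qed
 also have "... = dev k (io k) + dev (Suc k) (io (Suc k))" unfolding dev_def w_def by (rule nn_integral_add) measurable
 also have "... <= en (dl k) + en (dl k)" by (intro add_mono io order_trans[OF io(1)] ennreal_leI dl)
 finally have 1:"(NN x. ea (w k x - w (Suc k) x) * e k x) <= en (dl k) + en (dl k)" .
 have "(NN x. en (et k x) * gr k (io k) x + ea (w k x - w (Suc k) x) * e k x) =
 (NN x. en (et k x) * gr k (io k) x) + (NN x. ea (w k x - w (Suc k) x) * e k x)" by (rule nn_integral_add) measurable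
 also have "... <= en (bb (Suc k) - bb k + 2 * dl k) + (en (dl k) + en (dl k))" by (intro add_mono etga 1)
 also have "... = en (bb (Suc k) - bb k) + en (4 * dl k)"
 using dl(1)[of k] bb(4)[of k] by (simp flip: ennreal_plus)
 finally show "(NN x. en (et k x) * gr k (io k) x + ea (w k x - w (Suc k) x) * e k x) <= en (bb (Suc k) - bb k) + en (4 * dl k)" .
 qed
 also have "... = (\<Sum>k. en (bb (Suc k) - bb k)) + (\<Sum>k. en (4 * dl k))" by (rule suminf_add[symmetric]) (auto intro: summableI)
 also have "(\<Sum>k. en (4 * dl k)) = en (4 * de)"
 using sums_mult[OF power_half_series, of "4 * de"] de by (intro suminf_ennreal_eq) (auto simp: dl_def ac_simps)
 also have "(\<Sum>k. en (bb (Suc k) - bb k)) <= en (c - bb 0)" by (rule suminf_telescope_le) (use bb in auto)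
 also have "en (c - bb 0) + en (4 * de) = en (c + 4 * de)" using c de bb(5) by (simp flip: ennreal_plus)
 finally show ?thesis by (simp add: add_right_mono)
qed

lemma v_wug:"wug U v Gv"
proof (rule wug_partition[where Ph = Ph and w = w and e = e and g = "%k. gr k (io k)" and W = W])
 show "wug W (w k) (gr k (io k))" for k unfolding w_def by (rule md_wug)
 show "v x = (SUM k<=N. consec Ph k x * w k x)" if "!!k. N <= k ==> Ph k x = 1" for x N
 proof -
 have z:"et k x = 0" if "k ~: {..N}" for k using that `\<And>k. N \<le> k \<Longrightarrow> Ph k x = 1` by (cases k) (auto simp: et_def consec_def)
 show ?thesis unfolding v_def et_def[symmetric] using z by (intro suminf_finite) auto
 qed
 show "Gv:bM" unfolding Gv_def[abs_def] et_def[symmetric] by measurable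
 have "NI U Gv <= (NN x. Gv x)" by (intro nn_integral_mono) (auto simp: indicator_def)
 from order_trans[OF this Gv_le] show "bfin U Gv" by (intro bfinI) (auto intro: le_less_trans)
qed (use Phw U Ph01 cae in "auto simp: Gv_def")

text \<open>In finitely many terms \<open>f\<close> is replaced by its truncated approximations
  \<open>md k m\<close> with one common index \<open>m\<close>. The energy then counts twice, once
  for the \<open>w k\<close> and once for the \<open>md k m\<close>, which explains the factor two.
  The terms beyond \<open>N + n\<close> are small in \<open>L1\<close> and are left out of the
  approximation.\<close>

lemma fN_tv:
 assumes B:"!!k. bb k <= B"
 shows "tv UNIV (fN N) <= en (2 * (B - bb N) + 3 * (de * (1 / 2) ^ N))"
proof (rule tv_diag[OF open_UNIV])
 fix ep :: real and Kc :: "'a set" assume ep:"ep > 0"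
 obtain n where n:"de * (1 / 2) ^ n <= ep / 2"
 proof -
 obtain n where "(1 / 2) ^ n < ep / 2 / de" using real_arch_pow_inv[of "ep / 2 / de" "1 / 2"] ep de by auto
 hence "de * (1 / 2) ^ n <= ep / 2" using de by (simp add: less_divide_eq mult.commute)
 thus thesis by (rule that)
 qed
 define S where "S = {N..<N + n}"
 have e8:"0 < ep / 8" using ep by simp
 have l1:"(%m. SUM k:S. dev k m) ~~> 0" "(%m. SUM k:S. clp k m) ~~> 0"
 using tendsto_sum[of S dev "%_. 0"] tendsto_sum[of S clp "%_. 0"] dev_lim clp_lim by auto
 have "evs (%m. (SUM k:S. dev k m) <= en (ep / 8) & (SUM k:S. clp k m) <= en (ep / 8) & en (bb N) <= mass N m + en (ep / 8))"
 by (intro eventually_conj tendsto0_eventually_le l1 liminf_eventually_le bb e8)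
 from frequently_eventually_conj[OF mass_freq[OF e8, of "N + n"] this] obtain m where
 m:"mass (N + n) m <= en (bb (N + n) + ep / 8)" "(SUM k:S. dev k m) <= en (ep / 8)" "(SUM k:S. clp k m) <= en (ep / 8)"
 "en (bb N) <= mass N m + en (ep / 8)"
 by (auto dest: frequently_ex)
 define H where "H k x = ea (et k x) * (gr k (io k) x + gr k m x) + ea (w k x + - md k m x) * E k x" for k x
 have Hm[measurable]:"H k:bM" for k unfolding H_def[abs_def] by measurable
 define I where "I k = (NN x. en (et k x) * G m x)" for k
 have H1:"(NN x. H k x) <= en (bb (Suc k) - bb k) + en (3 * dl k) + I k + clp k m + dev k m" for k
 proof -
 have "(NN x. H k x) <= (NN x. (en (et k x) * gr k (io k) x + en (et k x) * gr k m x) +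
 (ea (w k x - f x) * (E k x + en (et k x)) + ea (md k m x - f x) * (E k x + en (et k x))))"
 proof (rule nn_integral_mono)
 fix x
 have "ea (w k x + - md k m x) * E k x <= en (abs (w k x - f x) + abs (md k m x - f x)) * E k x"
 by (intro mult_right_mono ennreal_leI) auto
 also have "... = ea (w k x - f x) * E k x + ea (md k m x - f x) * E k x" by (simp add: distrib_right)
 also have "... <= ea (w k x - f x) * (E k x + en (et k x)) + ea (md k m x - f x) * (E k x + en (et k x))"
 by (intro add_mono mult_left_mono) auto
 finally show "H k x <= (en (et k x) * gr k (io k) x + en (et k x) * gr k m x) +
 (ea (w k x - f x) * (E k x + en (et k x)) + ea (md k m x - f x) * (E k x + en (et k x)))"
 unfolding H_def using et01(1)[of k x] by (intro add_mono) (simp_all add: distrib_left)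
 qed
 also have "... = ((NN x. en (et k x) * gr k (io k) x) + (NN x. en (et k x) * gr k m x)) + (dev k (io k) + dev k m)"
 unfolding dev_def w_def by (simp add: nn_integral_add)
 also have "... <= (en (bb (Suc k) - bb k + 2 * dl k) + (I k + clp k m)) + (en (dl k) + dev k m)"
 unfolding I_def by (intro add_mono etga etgr io order_refl)
 also have "... = (en (bb (Suc k) - bb k + 2 * dl k) + en (dl k)) + I k + clp k m + dev k m" by (simp add: ac_simps)
 also have "en (bb (Suc k) - bb k + 2 * dl k) + en (dl k) = en (bb (Suc k) - bb k) + en (3 * dl k)"
 using dl(1)[of k] bb(4)[of k] by (simp flip: ennreal_plus)
 finally show ?thesis .
 qed
 have telA:"(SUM k:S. bb (Suc k) - bb k) = bb (N + n) - bb N" unfolding S_def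
 using sum_Suc_diff'[of N "N + n" bb] by simp
 have sB:"(SUM k:S. en (bb (Suc k) - bb k)) = en (bb (N + n) - bb N)"
 using bb(4) telA by (subst sum_ennreal) auto
 have sD:"(SUM k:S. en (3 * dl k)) <= en (3 * (de * (1 / 2) ^ N))"
 proof -
 have "(SUM k:S. en (3 * dl k)) = (SUM k<n. en (3 * dl (k + N)))"
 unfolding S_def using sum.shift_bounds_nat_ivl[of "%k. en (3 * dl k)" 0 N n] by (simp add: lessThan_atLeast0 add.commute)
 also have "... <= (\<Sum>k. en (3 * dl (k + N)))" by (intro sum_le_suminf summableI) auto
 also have "... = en 3 * (\<Sum>k. en (dl (k + N)))" using dl(1) by (simp add: ennreal_mult'' ennreal_suminf_cmult less_imp_le)
 also have "... = en (3 * (de * (1 / 2) ^ N))" unfolding sum_dl using de by (simp add: ennreal_mult'')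
 finally show ?thesis .
 qed
 \<comment> \<open>With a common index the weights \<open>et k\<close> add up to
   \<open>Th (N + n) - Th N\<close>, so one application of \<open>mass_diff\<close> bounds the whole
   sum and errors do not accumulate with \<open>n\<close>.\<close>
 have sI:"(SUM k:S. I k) <= en (bb (N + n) - bb N + ep / 4)"
 proof -
 have "(SUM k:S. I k) = (NN x. (SUM k:S. en (et k x) * G m x))" unfolding I_def by (rule nn_integral_sum[symmetric]) measurable
 also have "... = (NN x. en (Th (N + n) x - Th N x) * G m x)"
 proof (rule nn_integral_cong)
 fix x
 have "(SUM k:S. et k x) = Th (N + n) x - Th N x" unfolding S_def etTh
 using sum_Suc_diff'[of N "N + n" "%k. Th k x"] by simp
 thus "(SUM k:S. en (et k x) * G m x) = en (Th (N + n) x - Th N x) * G m x"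
 using et01(1) by (simp add: sum_distrib_right[symmetric] sum_ennreal)
 qed
 also have "... <= en (bb (N + n) - bb N + 2 * (ep / 8))" by (rule mass_diff[OF _ e8 m(1,4)]) simp
 finally show ?thesis by simp
 qed
 have bn:"bb N <= bb (N + n)" by (rule lift_Suc_mono_le[of bb]) (use bb in auto)
 have "(SUM k:S. NN x. H k x) <= (SUM k:S. en (bb (Suc k) - bb k) + en (3 * dl k) + I k + clp k m + dev k m)" by (intro sum_mono H1)
 also have "... = (SUM k:S. en (bb (Suc k) - bb k)) + (SUM k:S. en (3 * dl k)) + (SUM k:S. I k) + (SUM k:S. clp k m) + (SUM k:S. dev k m)" by (simp add: sum.distrib)
 also have "... <= en (bb (N + n) - bb N) + en (3 * (de * (1 / 2) ^ N)) + en (bb (N + n) - bb N + ep / 4) + en (ep / 8) + en (ep / 8)"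
 unfolding sB by (intro add_mono sD sI m order_refl)
 also have "... = en (2 * (bb (N + n) - bb N) + 3 * (de * (1 / 2) ^ N) + ep / 2)"
 proof -
 have "en a + en b + en (a + ep / 4) + en (ep / 8) + en (ep / 8) = en (2 * a + b + ep / 2)"
 if "0 <= a" "0 <= b" for a b using that ep by (simp add: add_nonneg_nonneg flip: ennreal_plus)
 thus ?thesis using bn de by simp
 qed
 also have "... <= en (2 * (B - bb N) + 3 * (de * (1 / 2) ^ N) + ep)"
 using B[of "N + n"] ep by (intro ennreal_leI) simp
 also have "... = en (2 * (B - bb N) + 3 * (de * (1 / 2) ^ N)) + en ep"
 using B[of N] de ep by (intro ennreal_plus) auto
 finally have HS:"(SUM k:S. NN x. H k x) <= en (2 * (B - bb N) + 3 * (de * (1 / 2) ^ N)) + en ep" .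
 have Hk:"(NN x. H k x) < oo" if "k:S" for k
 proof -
 have "(NN x. H k x) <= (SUM k:S. NN x. H k x)" using that by (intro member_le_sum) (auto simp: S_def)
 from order_trans[OF this HS] show ?thesis by (auto intro: le_less_trans)
 qed
 \<comment> \<open>Each term is supported in the compact subset \<open>K k\<close> of
   \<open>W\<close> and therefore extends by zero with the same gradient.\<close>
 define P where "P x = (SUM k:S. if x:W then et k x * (w k x + - md k m x) else 0)" for x
 have wP:"wug UNIV P (%x. SUM k:S. H k x * ind W x)" unfolding P_def[abs_def]
 proof (rule wug_sum)
 fix k assume k:"k:S"
 have "wug W (%x. et k x * (w k x + - md k m x)) (H k)"
 proof (rule wug_mult[OF wug_subset[OF etw Wm subset_UNIV] wug_add[OF md_wug wug_uminus[OF md_wug], of k "io k" k m, folded w_def]])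
 have "NI W (H k) <= (NN x. H k x)" by (intro nn_integral_mono) (auto simp: indicator_def)
 thus "bfin W (H k)" using Hk[OF k] by (intro bfinI) (auto intro: le_less_trans)
 qed (auto simp: H_def)
 thus "wug UNIV (%x. if x:W then et k x * (w k x + - md k m x) else 0) (%x. H k x * ind W x)"
 by (rule wug_zero_ext[OF _ compact_imp_closed[OF K(1)[of k]] W]) (use K(2) U(2) et0 in auto)
 qed (auto simp: S_def)
 have iP:"NI UNIV (%x. (SUM k:S. H k x * ind W x)) <= (SUM k:S. NN x. H k x)"
 proof -
 have "NI UNIV (%x. (SUM k:S. H k x * ind W x)) <= (NN x. (SUM k:S. H k x))"
 by (intro nn_integral_mono) (auto simp: indicator_def intro!: sum_mono)
 also have "... = (SUM k:S. NN x. H k x)" by (rule nn_integral_sum) measurable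
 finally show ?thesis .
 qed
 have Pm[measurable]:"P:bM" unfolding P_def[abs_def] by measurable
 have PfN:"(NN x. ea (P x - fN N x)) <= en ep"
 proof -
 have "(NN x. ea (P x - fN N x)) <= (NN x. (SUM k:S. ea (md k m x - f x) * (E k x + en (et k x))) + ea (fN (N + n) x))"
 proof (rule nn_integral_mono)
 fix x
 have "P x = (SUM k:S. et k x * (w k x - md k m x))"
 unfolding P_def using et0[of x] K(2) U(2) by (intro sum.cong) auto
 hence "P x - fN N x = (SUM k:S. et k x * (f x - md k m x)) - fN (N + n) x"
 unfolding fN_split[of N x n] S_def[symmetric] by (simp add: sum_subtractf[symmetric] algebra_simps)
 hence "abs (P x - fN N x) <= (SUM k:S. abs (et k x * (f x - md k m x))) + abs (fN (N + n) x)"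
 using sum_abs[of "%k. et k x * (f x - md k m x)" S] by linarith
 also have "(SUM k:S. abs (et k x * (f x - md k m x))) = (SUM k:S. abs (md k m x - f x) * et k x)"
 using et01(1) by (intro sum.cong) (auto simp: abs_mult abs_minus_commute mult.commute)
 finally have "ea (P x - fN N x) <= en ((SUM k:S. abs (md k m x - f x) * et k x) + abs (fN (N + n) x))" by (rule ennreal_leI)
 also have "... = (SUM k:S. ea (md k m x - f x) * en (et k x)) + ea (fN (N + n) x)"
 using et01(1) by (subst ennreal_plus) (auto intro!: sum_nonneg simp: sum_ennreal[symmetric] ennreal_mult)
 also have "... <= (SUM k:S. ea (md k m x - f x) * (E k x + en (et k x))) + ea (fN (N + n) x)"
 by (intro add_right_mono sum_mono mult_left_mono) auto
 finally show "ea (P x - fN N x) <= (SUM k:S. ea (md k m x - f x) * (E k x + en (et k x))) + ea (fN (N + n) x)" .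
 qed
 also have "... = (SUM k:S. dev k m) + (NN x. ea (fN (N + n) x))"
 unfolding dev_def by (subst nn_integral_add) (auto simp: nn_integral_sum)
 also have "... <= en (ep / 8) + en (de * (1 / 2) ^ (N + n))" by (intro add_mono m fN_L1)
 also have "... <= en (ep / 8) + en (ep / 2)"
 proof (intro add_left_mono ennreal_leI)
 have "de * (1 / 2) ^ (N + n) <= de * (1 / 2) ^ n" using de by (intro mult_left_mono power_decreasing) auto
 thus "de * (1 / 2) ^ (N + n) <= ep / 2" using n by linarith
 qed
 also have "... = en (ep / 8 + ep / 2)" using ep by (intro ennreal_plus[symmetric]) auto
 also have "... <= en ep" using ep by (intro ennreal_leI) auto
 finally show ?thesis .
 qed
 have lP:"locint UNIV P" unfolding locint_def
 proof (intro conjI allI impI Pm)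
 fix Kd :: "'a set"
 have "NI Kd (%x. ea (P x)) <= (NN x. ea (P x - fN N x) + ea (fN N x))"
 by (intro nn_integral_mono) (auto simp: indicator_def intro!: ennreal_leI simp flip: ennreal_plus)
 also have "... = (NN x. ea (P x - fN N x)) + (NN x. ea (fN N x))" by (rule nn_integral_add) measurable
 also have "... <= en ep + en (de * (1 / 2) ^ N)" by (intro add_mono PfN fN_L1)
 also have "... < oo" by simp
 finally show "NI Kd (%x. ea (P x)) < oo" .
 qed
 have "NI Kc (%x. ea (P x - fN N x)) <= (NN x. ea (P x - fN N x))" by (intro nn_integral_mono) (auto simp: indicator_def)
 hence "NI Kc (%x. ea (P x - fN N x)) <= en ep" using PfN by (rule order_trans)
 thus "EX F G. wug UNIV F G & locint UNIV F & NI Kc (%x. ea (F x - fN N x)) <= en ep &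
 (NI UNIV G) <= en (2 * (B - bb N) + 3 * (de * (1 / 2) ^ N)) + en ep"
 using wP lP order_trans[OF iP HS] by (intro exI[of _ P] exI conjI)
qed

lemma w_N11:
 "(%x. ereal (w k x)):N11 \<mu> {x. 0 < et k x}"
proof -
 let ?A = "{x. 0 < et k x}"
 have "{x:space M. 0 < et k x}:sets M" by measurable
 hence A:"?A:sets M" by simp
 have AK:"?A <= K k" using et0[of _ k] by force
 have wA:"wug ?A (w k) (gr k (io k))" unfolding w_def by (rule wug_subset[OF md_wug A]) (use AK K(2) U(2) in blast)
 obtain R where R:"!!x. x:K k ==> abs (al k x) + abs (bt k x) <= R"
 proof -
 have "compact ((%x. abs (al k x) + abs (bt k x)) ` K k)"
 using K(1) lips_continuous[OF lip(1)] lips_continuous[OF lip(2)] by (intro compact_continuous_image continuous_intros) auto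
 hence "bounded ((%x. abs (al k x) + abs (bt k x)) ` K k)" by (rule compact_imp_bounded)
 thus thesis using that unfolding bounded_iff by auto
 qed
 have "NI ?A (%x. ea (w k x)) <= NI (K k) (%x. en R)"
 proof (rule ni_mono[OF AK], rule ennreal_leI)
 fix x assume "x:?A"
 thus "abs (w k x) <= R" using R[of x] AK md_bounds(1)[of k x "io k"] md_bounds(2)[of k "io k" x] unfolding w_def by fastforce
 qed
 also have "... < oo" using muK[of k] by (subst nn_integral_cmult_indicator) (auto simp: emeasure_M ennreal_mult_less_top)
 finally have 1:"NI ?A (%x. ea (w k x)) < oo" .
 have "NI ?A (gr k (io k)) <= (NN x. G (io k) x * ind W x + en (L k) * ind (K k) x)"
 using AK K(2)[of k] U(2) by (intro nn_integral_mono) (auto simp: gr_def indicator_def)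
 also have "... = NI W (G (io k)) + en (L k) * \<mu> (K k)"
 by (subst nn_integral_add) (auto simp: nn_integral_cmult_indicator emeasure_M)
 also have "... <= en c + en (L k) * \<mu> (K k)" by (intro add_right_mono Gc)
 also have "... < oo" using muK[of k] by (auto simp: ennreal_mult_less_top)
 finally have 2:"NI ?A (gr k (io k)) < oo" .
 show ?thesis by (rule wug_N11(2)[OF wA wm 1 2])
qed

end

section \<open>Exceptional points outside \<open>U\<close>, and the assembly of the theorem\<close>

lemma ereal_le_0I:"(!!s. 0 < s ==> a <= ereal s) ==> a <= 0"
 using ereal_dense2[of 0 a] by (force simp: not_le[symmetric])

lemma ereal_ge_0I:"(!!s. s < 0 ==> ereal s <= a) ==> 0 <= a"
 using ereal_dense2[of a 0] by (force simp: not_le[symmetric])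

context doubling_space begin

lemma tv_uminus_le:"tv W (%x. - f x) <= tv W f"
 unfolding tv_def[of W f]
proof (rule INF_greatest, clarify)
 fix F G assume "appr W f F G"
 from tv_le[OF appr_uminus[OF this]] show "tv W (%x. - f x) <= liminf (%i. NI W (G i))" .
qed

lemma lower_le_upper:"ll u x <= ul u x"
 unfolding upper_approx_limit_def lower_approx_limit_def dens0_def[symmetric]
proof (intro INF_greatest SUP_least)
 fix s t assume a:"s:{t. dens0 {y. ereal t < u y} x}" "t:{t. dens0 {y. u y < ereal t} x}"
 show "ereal t <= ereal s"
 proof (rule ccontr)
 assume "~ ?thesis"
 hence "{y. ereal s < u y} Un {y. u y < ereal t} = UNIV" by (auto simp: not_le not_less intro: less_le_trans[of "ereal s" "ereal t"])
 thus False using dens0_Un[of "{y. ereal s < u y}" x "{y. u y < ereal t}"] a not_dens0_UNIV by auto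
 qed
qed

text \<open>\<open>U\<close> differs from the intersection of the open sets \<open>U Un G n\<close>
  by a set that lies in every \<open>G n\<close>; small capacity implies small measure, so this set
  is null.\<close>

lemma quasiopen_sets:
 assumes "quasiopen1 \<mu> U" shows "U:sets M"
proof -
 have "ALL n. EX G. open G & cap G < en (rs n) & open (U Un G)"
 using assms unfolding quasiopen1_def by simp
 from choice[OF this] obtain G where G:"ALL n. open (G n) & cap (G n) < en (rs n) & open (U Un G n)" ..
 define N where "N = (\<Inter>n. U Un G n) - U"
 have "\<mu> N = 0"
 proof (rule ccontr)
 assume n0:"\<mu> N ~= 0"
 have le:"\<mu> N < en (rs n)" for n
 using G mu_le_Cap1[of "G n"] mu_mono[of N "G n"] by (auto simp: N_def intro: le_less_trans)
 then obtain m where m:"\<mu> N = en m" "0 < m" using le[of 0] n0 by (cases "\<mu> N") (auto simp: top_unique)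
 obtain n where "rs n < m" using nat_approx_posE[OF m(2)] by auto
 thus False using le[of n] m by (simp add: ennreal_less_iff)
 qed
 hence "N:sets M" by (rule null_sets_M)
 moreover have "(\<Inter>n. U Un G n):sets M" using G by (intro sets.countable_INT' borel_M') auto
 moreover have "U = (\<Inter>n. U Un G n) - N" by (auto simp: N_def)
 ultimately show ?thesis by (metis sets.Diff)
qed

text \<open>One open set of small capacity serves \<open>U\<close> and both properties, because each
  property holds for every open set that contains the respective \<open>S\<close>.\<close>

lemma good_open:
 fixes U :: "'a set"
 assumes U:"quasiopen1 \<mu> U" and Q:"!!ep. ep > 0 ==> EX S. HC 1 S <= en ep & (ALL G. open G --> S <= G --> Q G)"
 "!!ep. ep > 0 ==> EX S. HC 1 S <= en ep & (ALL G. open G --> S <= G --> Q' G)" and c:"0 < c"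
 shows "EX G f g. open G & open (U Un G) & Q G & Q' G & wug UNIV f g & f:bM & (ALL x. 0 <= f x & f x <= 1) &
 (ALL x:G. f x = 1) & (NN x. en (f x)) + (NN x. g x) <= en c"
proof -
 have c2:"0 < c / 2" using c by simp
 obtain G1 where G1:"open G1" "cap G1 < en (c / 2)" "open (U Un G1)" using U c2 unfolding quasiopen1_def by blast
 \<comment> \<open>Two contents of at most \<open>et\<close> stay below \<open>3 * et\<close>, and
   \<open>2 * Cd ^ 2 * (3 * et)\<close> is \<open>c / 4\<close>.\<close>
 define et where "et = c / (24 * Cd ^ 2)"
 have C:"0 < Cd ^ 2" using Cd by simp
 have et:"0 < et" using c C by (simp add: et_def)
 obtain S S' where S:"HC 1 S <= en et" "ALL G. open G --> S <= G --> Q G"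
 and S':"HC 1 S' <= en et" "ALL G. open G --> S' <= G --> Q' G" using Q[OF et] by blast
 have "HC 1 (S Un S') <= en et + en et" by (rule order_trans[OF content_Un add_mono[OF S(1) S'(1)]])
 also have "... < en (3 * et)" using et by (simp add: ennreal_less_iff flip: ennreal_plus)
 finally obtain G2 where G2:"open G2" "S Un S' <= G2" "cap G2 <= en (2 * Cd ^ 2) * en (3 * et)"
 by (rule content_Cap1[OF _ order_refl])
 note G2(3)
 also have "en (2 * Cd ^ 2) * en (3 * et) = en (c / 4)"
 using C et by (subst ennreal_mult[symmetric]) (auto simp: et_def)
 also have "... < en (c / 2)" using c by (simp add: ennreal_less_iff)
 finally have G2c:"cap G2 < en (c / 2)" .
 obtain f1 g1 where 1:"wug UNIV f1 g1" "f1:bM" "ALL x. 0 <= f1 x & f1 x <= 1" "ALL x:G1. f1 x = 1"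
 "(NN x. en (f1 x)) + (NN x. g1 x) < en (c / 2)" using Cap1_real[OF G1(2)] by blast
 obtain f2 g2 where 2:"wug UNIV f2 g2" "f2:bM" "ALL x. 0 <= f2 x & f2 x <= 1" "ALL x:G2. f2 x = 1"
 "(NN x. en (f2 x)) + (NN x. g2 x) < en (c / 2)" using Cap1_real[OF G2c] by blast
 note [measurable] = 1(2) 2(2) wug_meas[OF 1(1)] wug_meas[OF 2(1)]
 define f where "f x = max (f1 x) (f2 x)" for x
 have "(NN x. en (f x)) <= (NN x. en (f1 x) + en (f2 x))"
 by (intro nn_integral_mono) (auto simp: f_def max_def)
 also have "... = (NN x. en (f1 x)) + (NN x. en (f2 x))" by (rule nn_integral_add) measurable
 finally have "(NN x. en (f x)) + (NN x. g1 x + g2 x) <=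
 ((NN x. en (f1 x)) + (NN x. en (f2 x))) + ((NN x. g1 x) + (NN x. g2 x))"
 by (subst nn_integral_add) (auto intro: add_right_mono)
 also have "... = ((NN x. en (f1 x)) + (NN x. g1 x)) + ((NN x. en (f2 x)) + (NN x. g2 x))" by (simp add: ac_simps)
 also have "... <= en (c / 2) + en (c / 2)" using 1(5) 2(5) by (intro add_mono less_imp_le)
 also have "... = en c" using c by (simp flip: ennreal_plus)
 finally have "(NN x. en (f x)) + (NN x. g1 x + g2 x) <= en c" .
 moreover have "wug UNIV f (%x. g1 x + g2 x)" unfolding f_def[abs_def] by (rule wug_max[OF 1(1) 2(1)])
 moreover have "f:bM" unfolding f_def[abs_def] by measurable
 moreover have "ALL x. 0 <= f x & f x <= 1" using 1(3) 2(3) by (auto simp: f_def le_max_iff_disj)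
 moreover have "ALL x:G1 Un G2. f x = 1" using 1(3,4) 2(3,4) by (auto simp: f_def max_def intro: antisym)
 moreover have "open (U Un (G1 Un G2))" using open_Un[OF G1(3) G2(1)] by (simp add: Un_assoc)
 moreover have "Q (G1 Un G2)" "Q' (G1 Un G2)" using S(2) S'(2) G1(1) G2(1,2) by auto
 ultimately show ?thesis using G1(1) G2(1)
 by (intro exI[of _ "G1 Un G2"] exI[of _ f] exI[of _ "%x. g1 x + g2 x"] conjI) auto
qed

end

context poincare_space begin

text \<open>Off \<open>K N\<close> the function \<open>h\<close> agrees with \<open>fN N\<close>,
  whose variation and norm tend to zero with \<open>N\<close>. Coarea finds a level between
  \<open>t / 4\<close> and \<open>t / 2\<close> whose superlevel set has arbitrarily small perimeter
  and fills at most half of each ball of radius \<open>r0\<close>, so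
  \<open>levelset_content\<close> bounds the content.\<close>

lemma one_sided_null:
 fixes Z :: "'a set" and K :: "nat => 'a set" and fN :: "nat => 'a => real"
 assumes m:"!!N. fN N:bM" and p:"!!N. tv UNIV (fN N) <= en (p N)" "p ~~> 0"
 and q:"!!N. (NN x. ea (fN N x)) <= en (q N)" "q ~~> 0"
 and eq:"!!N. AM x. x ~: K N --> fN N x = h x" and K:"!!N. closed (K N)" "!!N. Z Int K N = {}"
 and t:"t > 0" and R:"R > 0"
 shows "HC R {x:Z. ALL s. 0 < s --> s < t --> ~ dens0 {y. s < h y} x} = 0" (is "HC R ?S = 0")
proof -
 have L0:"0 < Lam" using Lam by simp
 define r0 where "r0 = R / (5 * Lam)"
 have r0:"0 < r0" "5 * Lam * r0 = R" using R L0 by (auto simp: r0_def)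
 have "HC R (?S Int ball ctr (real n)) = 0" for n
 proof (rule ennreal_small_0)
 show "0 < cbox0 / g1" using cbox0_pos g1(1) by simp
 fix d :: real assume d:"0 < d"
 obtain c where c:"c > 0" "ALL x:ball ctr (real n). en c <= mb x r0"
 using ball_lower[OF bounded_ball r0(1)] by blast
 \<comment> \<open>On an interval of levels of length \<open>t / 4\<close>, variation below
   \<open>d * t / 8\<close> yields perimeter at most \<open>d\<close>. The bound on \<open>q\<close>
   is what \<open>high_half\<close> asks for at a level above \<open>t / 4\<close>.\<close>
 have "evs (%N. p N < d * t / 8 & q N < t / 4 * c / 2)"
 by (intro eventually_conj order_tendstoD(2)[OF p(2)] order_tendstoD(2)[OF q(2)]) (use d t c in auto)
 from eventually_happens'[OF sequentially_bot this] obtain N where N:"p N < d * t / 8" "q N < t / 4 * c / 2" by blast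
 have "tv UNIV (fN N) < en (d * t / 8)"
 by (rule le_less_trans[OF p(1)]) (use N(1) d t in "simp add: ennreal_lessI")
 from coarea[OF open_UNIV m this, of "t / 4" "t / 4"] t obtain s where
 s:"t / 4 < s" "s < t / 2" "tv UNIV (indr {x. s < fN N x}) <= en d" by auto
 have E:"{x. s < fN N x}:sets M"
 proof -
 have "{x:space M. s < fN N x}:sets M" using m by measurable
 thus ?thesis by simp
 qed
 have "HC (5 * Lam * r0) (?S Int ball ctr (real n)) <= en (cbox0 / g1 * d)"
 proof (rule levelset_content[OF E open_UNIV s(3) less_imp_le[OF d] r0(1)], intro conjI)
 fix x assume x:"x:?S Int ball ctr (real n)"
 have o:"open (- K N)" "x : - K N" using K x by (auto simp: open_Compl)
 have "dens0 {x. s < fN N x} x \<longleftrightarrow> dens0 {y. s < h y} x"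
 by (rule dens0_cong[OF o]) (use eq[of N] in "auto elim!: eventually_mono")
 thus "~ dens0 {x. s < fN N x} x" using x s t by auto
 show "mi {x. s < fN N x} x r0 <= en (1 / 2) * mb x r0"
 proof (rule high_half[OF m, of UNIV])
 have "t / 4 * c / 2 <= s * c / 2" using s(1) c(1) by simp
 thus "NI UNIV (%x. ea (fN N x)) <= en (s * c / 2)"
 using order_trans[OF q(1) ennreal_leI, of N "s * c / 2"] N(2) by (simp del: times_divide_eq_left)
 show "en c <= mb x r0" using c x by blast
 qed (use s t c in auto)
 qed simp
 thus "HC R (?S Int ball ctr (real n)) <= en (cbox0 / g1 * d)" by (simp add: r0(2))
 qed
 hence "HC R (UN n. ?S Int ball ctr (real n)) = 0" by (rule content_UN_0)
 moreover have "?S <= (UN n. ?S Int ball ctr (real n))"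
 proof
 fix x assume "x:?S"
 moreover obtain n where "dist ctr x < real n" using reals_Archimedean2 by blast
 ultimately show "x:(UN n. ?S Int ball ctr (real n))" by auto
 qed
 ultimately show ?thesis using content_mono[of ?S "UN n. ?S Int ball ctr (real n)" R] by simp
qed

text \<open>If small levels of \<open>h\<close> and of \<open>- h\<close> both gave density zero, so
  would the union of the two superlevel sets, which contains one of \<open>abs h\<close>. Hence a
  point with nonzero upper limit is exceptional for one of the signs, at all levels below some
  \<open>rs n\<close>.\<close>

lemma two_sided_null:
 fixes Z :: "'a set" and K :: "nat => 'a set" and fN :: "nat => 'a => real" and z :: "'a => ereal"
 assumes m:"!!N. fN N:bM" and p:"!!N. tv UNIV (fN N) <= en (p N)" "p ~~> 0"
 and q:"!!N. (NN x. ea (fN N x)) <= en (q N)" "q ~~> 0"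
 and eq:"!!N. AM x. x ~: K N --> fN N x = h x" and K:"!!N. closed (K N)" "!!N. Z Int K N = {}"
 and z:"AM x. z x = ereal (h x)"
 shows "hausdorff_codim1 \<mu> {x:Z. ul (%y. abs (z y)) x ~= 0} = 0"
proof -
 define A where "A n = {x:Z. ALL s. 0 < s --> s < rs n --> ~ dens0 {y. s < h y} x}" for n
 define B where "B n = {x:Z. ALL s. 0 < s --> s < rs n --> ~ dens0 {y. s < - h y} x}" for n
 let ?Y = "{x:Z. ul (%y. abs (z y)) x ~= 0}"
 have "?Y <= (UN n. A n) Un (UN n. B n)"
 proof
 fix x assume x:"x:?Y"
 have zd:"dens0 {y. ereal s < abs (z y)} x \<longleftrightarrow> dens0 {y. s < abs (h y)} x" for s
 by (rule dens0_cong[OF open_UNIV UNIV_I]) (use z in "auto elim!: eventually_mono")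
 have "EX s>0. ~ dens0 {y. s < abs (h y)} x"
 proof (rule ccontr)
 assume "~ ?thesis"
 hence "ul (%y. abs (z y)) x <= ereal s" if "s > 0" for s
 using upper_le[of s "%y. abs (z y)" x] that zd by auto
 hence "ul (%y. abs (z y)) x <= 0" by (rule ereal_le_0I)
 moreover have "ereal s <= ul (%y. abs (z y)) x" if "s < 0" for s
 proof (rule upper_ge)
 have "{y. ereal s < abs (z y)} = UNIV" using that by (auto intro: less_le_trans[of _ 0])
 thus "~ dens0 {y. ereal s < abs (z y)} x" using not_dens0_UNIV by simp
 qed
 hence "0 <= ul (%y. abs (z y)) x" by (rule ereal_ge_0I)
 ultimately show False using x by simp
 qed
 then obtain s0 where s0:"s0 > 0" "~ dens0 {y. s0 < abs (h y)} x" by blast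
 obtain n where n:"rs n < s0" using nat_approx_posE[OF s0(1)] by auto
 show "x:(UN n. A n) Un (UN n. B n)"
 proof (cases "x:A n")
 case False
 then obtain s where s:"0 < s" "s < rs n" "dens0 {y. s < h y} x" using x by (auto simp: A_def)
 have "~ dens0 {y. s' < - h y} x" if "0 < s'" "s' < rs n" for s'
 proof
 assume "dens0 {y. s' < - h y} x"
 hence "dens0 ({y. s < h y} Un {y. s' < - h y}) x" by (rule dens0_Un[OF s(3)])
 hence "dens0 {y. s0 < abs (h y)} x" by (rule dens0_mono) (use s(2) that n in auto)
 thus False using s0(2) by simp
 qed
 thus ?thesis using x by (auto simp: B_def)
 qed auto
 qed
 hence le:"HC R ?Y <= HC R ((UN n. A n) Un (UN n. B n))" for R by (rule content_mono)
 have "HC R ?Y = 0" if R:"R > 0" for R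
 proof -
 have "HC R (A n) = 0" for n unfolding A_def
 by (rule one_sided_null[OF m p q eq K _ R]) simp
 moreover have "HC R (B n) = 0" for n unfolding B_def
 proof (rule one_sided_null[OF _ _ p(2) _ q(2) _ K _ R, where fN = "%N x. - fN N x"])
 show "tv UNIV (%x. - fN N x) <= en (p N)" for N by (rule order_trans[OF tv_uminus_le p(1)])
 qed (use m q(1) eq in "auto elim!: eventually_mono")
 ultimately have "HC R (UN n. A n) = 0" "HC R (UN n. B n) = 0" by (auto intro!: content_UN_0)
 thus ?thesis using le[of R] content_Un[of R "UN n. A n" "UN n. B n"] by simp
 qed
 hence "\<forall>\<^sub>F R in at_right 0. HC R ?Y = 0" by (rule eventually_mono[OF eventually_at_right_less[of 0]])
 hence "((%R. HC R ?Y) \<longlongrightarrow> 0) (at_right 0)" by (rule tendsto_eventually)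
 thus ?thesis unfolding hausdorff_codim1_def by (intro tendsto_Lim) auto
qed

end

lemma ennreal_eq_0I:"(!!N. (a::ennreal) <= en (p N)) ==> p ~~> 0 ==> a = 0"
proof -
 assume a:"!!N. a <= en (p N)" and "p ~~> 0"
 hence "(%N. en (p N)) ~~> en 0" by (intro tendsto_ennrealI)
 hence "a <= en 0" by (rule tendsto_lowerbound) (use a in auto)
 thus "a = 0" by simp
qed

theorem theorem4p6:
  fixes \<mu> :: "'a::complete_space set \<Rightarrow> ennreal"
    and U \<Omega> :: "'a set"
    and u :: "'a \<Rightarrow> ereal"
    and \<epsilon> :: real
  assumes "borel_regular_outer_measure \<mu>"
    and "doubling \<mu>"
    and "poincare_1_1 \<mu>"
    and "U \<subseteq> \<Omega>"
    and "quasiopen1 \<mu> U"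
    and "open \<Omega>"
    and "u \<in> L1_loc \<mu> \<Omega>"
    and "total_variation \<mu> \<Omega> u \<Omega> < \<infinity>"
    and "0 < \<epsilon>" and "\<epsilon> < 1"
  shows "\<exists>(\<eta> :: nat \<Rightarrow> 'a \<Rightarrow> ereal) (u' :: nat \<Rightarrow> 'a \<Rightarrow> ereal) (v :: 'a \<Rightarrow> ereal).
    partition_of_unity \<mu> U \<eta> \<and>
    (\<forall>j. \<eta> j \<in> N11_c \<mu> U) \<and>
    (\<forall>j. u' j \<in> N11 \<mu> {x. \<eta> j x > 0}) \<and>
    (\<forall>x\<in>U. (\<lambda>j. if \<eta> j x = 0 then 0 else \<eta> j x * u' j x) sums v x) \<and>
    L1_norm \<mu> U (\<lambda>x. v x - u x) < ennreal \<epsilon> \<and>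
    v \<in> N11_loc \<mu> U \<and>
    (\<integral>\<^sup>+x\<in>U. minimal_wug \<mu> U v x \<partial>outer_meas \<mu>) < total_variation \<mu> \<Omega> u U + ennreal \<epsilon> \<and>
    (SUP x\<in>unity_set U \<eta>. \<bar>v x - upper_approx_limit \<mu> u x\<bar>)
      \<le> 9 * (SUP x\<in>U. upper_approx_limit \<mu> u x - lower_approx_limit \<mu> u x) + ereal \<epsilon> \<and>
    total_variation \<mu> UNIV (zero_ext U (\<lambda>x. v x - u x)) UNIV
      < 2 * total_variation \<mu> \<Omega> u U + ennreal \<epsilon> \<and>
    total_variation \<mu> UNIV (zero_ext U (\<lambda>x. v x - u x)) (- U) = 0 \<and>
    hausdorff_codim1 \<mu>
      {x \<in> - U. upper_approx_limit \<mu> (\<lambda>y. \<bar>zero_ext U (\<lambda>x. v x - u x) y\<bar>) x \<noteq> 0} = 0"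
proof -
 obtain Cd where Cd:"Cd >= 1" "!!x r. r > 0 ==> 0 < \<mu> (ball x (2 * r)) & \<mu> (ball x (2 * r)) <= en Cd * \<mu> (ball x r) & \<mu> (ball x r) < oo"
 using assms(2) unfolding doubling_def by blast
 obtain CP Lam where P:"0 < CP" "1 <= Lam" "ALL x. ALL r>0. ALL u:L1_loc \<mu> UNIV. ALL g. upper_gradient UNIV u g -->
 L1_norm \<mu> (ball x r) (%y. u y - ereal (ball_average \<mu> u x r)) / \<mu> (ball x r)
 <= en (CP * r) * ((\<integral>\<^sup>+y\<in>ball x (Lam * r). g y \<partial>outer_meas \<mu>) / \<mu> (ball x (Lam * r)))"
 using assms(3) unfolding poincare_1_1_def by blast
 interpret poincare_space \<mu> Cd CP Lam
 by unfold_locales (use assms(1) Cd P in "auto simp del: infinity_ennreal_def")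
 note UO = assms(4) and qU = assms(5) and \<Omega> = assms(6) and uL = assms(7) and tvu = assms(8) and \<epsilon> = assms(9)
 \<comment> \<open>The largest losses below are \<open>6 * de\<close> in the pointwise bound and
   \<open>5 * de\<close> in each of the two energy bounds.\<close>
 define de where "de = \<epsilon> / 20"
 have de:"0 < de" using \<epsilon> by (simp add: de_def)
 define f where "f = (%x. if x:\<Omega> then real_of_ereal (u x) else 0)"
 have fl:"locint \<Omega> f" and fu:"AM x. x:\<Omega> --> u x = ereal (f x)" using L1_loc_real[OF uL \<Omega>] by (auto simp: f_def)
 have fm:"f:bM" using fl by (simp add: locint_def)
 have tvf:"tv \<Omega> f < oo" using tvu by (simp add: total_variation_domain[OF \<Omega>] tv_open_eq[OF \<Omega> fm fu])
 have tvf':"tv \<Omega> (%x. - f x) < oo" using tv_uminus_le tvf by (rule le_less_trans)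
 have fl':"locint \<Omega> (%x. - f x)" using fl by (simp add: locint_def)
 obtain T :: "int => real" where T0:"ALL j. de * j < T j & T j < de * (j + 1)"
 "ALL j. AM x. x:\<Omega> --> dens0 {y. T j < f y} x --> f x <= T j"
 "ALL \<epsilon>>0. EX S. HC 1 S <= en \<epsilon> & (ALL G. open G --> S <= G -->
 (ALL j. open ({x:\<Omega>. dens0 {y. T j < f y} x} Un G)) & \<Omega> <= G Un (UN j. {x:\<Omega>. dens0 {y. T j < f y} x}))"
 using level_sets[OF \<Omega> fl tvf de] by (elim exE conjE) (rule that)
 note T = T0[rule_format]
 obtain T' :: "int => real" where T'0:"ALL j. de * j < T' j & T' j < de * (j + 1)"
 "ALL j. AM x. x:\<Omega> --> dens0 {y. T' j < - f y} x --> - f x <= T' j"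
 "ALL \<epsilon>>0. EX S. HC 1 S <= en \<epsilon> & (ALL G. open G --> S <= G -->
 (ALL j. open ({x:\<Omega>. dens0 {y. T' j < - f y} x} Un G)) & \<Omega> <= G Un (UN j. {x:\<Omega>. dens0 {y. T' j < - f y} x}))"
 using level_sets[OF \<Omega> fl' tvf' de] by (elim exE conjE) (rule that)
 note T' = T'0[rule_format]
 define Op Op' where "Op j = {x:\<Omega>. dens0 {y. T j < f y} x}" and "Op' j = {x:\<Omega>. dens0 {y. T' j < - f y} x}" for j
 define P where "P n G ps g \<longleftrightarrow> open G & open (U Un G) & ((ALL j. open (Op j Un G)) & \<Omega> <= G Un (UN j. Op j)) &
 ((ALL j. open (Op' j Un G)) & \<Omega> <= G Un (UN j. Op' j)) & wug UNIV ps g & ps:bM &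
 (ALL x. 0 <= ps x & ps x <= 1) & (ALL x:G. ps x = 1) & (NN x. en (ps x)) + (NN x. g x) <= en ((1 / 4) ^ n)"
 for n G ps g
 \<comment> \<open>The rate for which \<open>Cap1_eventually_small\<close> can afford the factors
   \<open>2 ^ n\<close>.\<close>
 have p:"0 < (1 / 4 :: real) ^ n" for n by simp
 have "EX G ps g. P n G ps g" for n unfolding P_def
 by (rule good_open[OF qU, where Q = "%G. (ALL j. open (Op j Un G)) & \<Omega> <= G Un (UN j. Op j)"
 and Q' = "%G. (ALL j. open (Op' j Un G)) & \<Omega> <= G Un (UN j. Op' j)", OF T(3)[folded Op_def] T'(3)[folded Op'_def] p])
 then obtain Gn ps g where "P n (Gn n) (ps n) (g n)" for n by metis
 note t = this[unfolded P_def]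
 have G:"open (Gn n)" "open (U Un Gn n)" "ALL j. open (Op j Un Gn n)" "\<Omega> <= Gn n Un (UN j. Op j)" "ALL j. open (Op' j Un Gn n)" "\<Omega> <= Gn n Un (UN j. Op' j)" for n
 using t[of n] by - (elim conjE, assumption)+
 have ps0:"wug UNIV (ps n) (g n)" "ps n:bM" "ALL x. 0 <= ps n x & ps n x <= 1" "ALL x:Gn n. ps n x = 1"
 "(NN x. en (ps n x)) + (NN x. g n x) <= en ((1 / 4) ^ n)" for n
 using t[of n] by - (elim conjE, assumption)+
 note ps = ps0(1,2) ps0(3)[rule_format] ps0(4)[rule_format] ps0(5)
 obtain ps' Nul where ps'0:"ALL n. wug UNIV (ps' n) (g n) & ps' n:bM & (ALL x. ps n x <= ps' n x & ps' n x <= 1)"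
 and Nul:"cap Nul = 0" "ALL x:Nul. ALL n. ps' n x = 1" "ALL x. x ~: Nul --> (EX n. ps' n x < 1 / 3)"
 and cae:"curve_ae (%p l. EX n. ALL r:{0..l}. ps' n (p r) < 1 / 3)"
 using capseq[OF ps(1,2,3,5)] by (elim exE conjE) (rule that)
 have ps':"wug UNIV (ps' n) (g n)" "ps' n:bM" "0 <= ps' n x & ps' n x <= 1" "x:Gn n ==> ps' n x = 1" for n x
 proof -
 show "wug UNIV (ps' n) (g n)" "ps' n:bM" using ps'0 by blast+
 have le:"ps n x <= ps' n x" "ps' n x <= 1" using ps'0 by blast+
 thus "0 <= ps' n x & ps' n x <= 1" using ps(3)[of n x] by auto
 show "x:Gn n ==> ps' n x = 1" using le ps(4)[of x n] by auto
 qed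
 obtain Ph e K where P1:"ALL k::nat. wug UNIV (Ph k) (e k) & Ph k:bM & (NN x. e k x) < oo"
 and P2:"ALL k x. 0 <= Ph k x & Ph k x <= 1 & Ph k x <= Ph (Suc k) x & (x ~: K k --> Ph k x = 0 & e k x = 0)"
 and P3:"ALL k. compact (K k) & K k <= U & K k <= K (Suc k) & K k <= (UN n. - Gn n) & (ALL V. (ALL n. open (V Un Gn n)) --> closed (K k - V))"
 and P4:"ALL x:U. (EX n. ps' n x < 1 / 3) --> (EX N. ALL k>=N. Ph k x = 1)" and P5:"ALL x. (ALL n. ps' n x = 1) --> (ALL k. Ph k x = 0)"
 and P6:"arc_ae U (%p s t. (EX N. ALL k>=N. ALL r:{s..t}. Ph k (p r) = 1))"
 by (rule partition_ex[where G = Gn, OF ps'(1,2,3) G(1) ps'(4) G(2) cae, THEN exE], assumption, elim exE conjE, rule that)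
 have K:"compact (K k)" "K k <= U" "K k <= \<Omega>" "closed (K k - Op j)" "closed (K k - Op' j)" "K k <= (UN j. Op j)" "K k <= (UN j. Op' j)" for k j
 proof -
 have c:"compact (K k)" "K k <= U" "K k <= (UN n. - Gn n)" "ALL V. (ALL n. open (V Un Gn n)) --> closed (K k - V)"
 using spec[OF P3, of k] by - (elim conjE, assumption)+
 show "compact (K k)" "K k <= U" by (rule c)+
 show "K k <= \<Omega>" using c(2) UO by (rule order_trans)
 show "closed (K k - Op j)" "closed (K k - Op' j)" by (intro c(4)[rule_format] spec[OF G(3)] spec[OF G(5)])+
 have "x:(UN j. Op j) & x:(UN j. Op' j)" if xK:"x:K k" for x
 proof -
 obtain n where "x ~: Gn n" using subsetD[OF c(3) xK] by (elim UN_E) simp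
 thus ?thesis using subsetD[OF G(4) subsetD[OF `K k \<subseteq> \<Omega>` xK], of n] subsetD[OF G(6) subsetD[OF `K k \<subseteq> \<Omega>` xK], of n] by (simp only: Un_iff) simp
 qed
 thus "K k <= (UN j. Op j)" "K k <= (UN j. Op' j)" by (intro subsetI, simp only:)+
 qed
 define S where "S k L al bt \<longleftrightarrow> lips L al & lips L bt & (ALL x. al x <= bt x) & (AM x. x:K k --> al x + de <= f x & f x <= bt x - de) &
 (ALL x:K k. ereal (al x) <= ul u x & ul u x <= ereal (bt x)) &
 (ALL J>=0. (ALL x:K k. ul u x - ll u x <= ereal J) --> (ALL x. bt x - al x <= J + 6 * de))"
 for k L al bt
 have "EX L al bt. S k L al bt" for k unfolding S_def
 by (rule separate[OF \<Omega> K(1,3) fu de T(1,2) T'(1,2) K(4,5)[unfolded Op_def Op'_def] K(6,7)[unfolded Op_def Op'_def]])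
 then obtain L al bt where "S k (L k) (al k) (bt k)" for k by metis
 note s = this[unfolded S_def]
 have ab:"lips (L k) (al k)" "lips (L k) (bt k)" "al k x <= bt k x" "AM x. x:K k --> al k x + de <= f x & f x <= bt k x - de"
 "x:K k ==> ereal (al k x) <= ul u x & ul u x <= ereal (bt k x)" for k x
 using s[of k] by blast+
 have abJ:"bt k x - al k x <= J + 6 * de" if "J >= 0" "ALL x:K k. ul u x - ll u x <= ereal J" for k x J
 using s[of k] that by blast
 define tU where "tU = total_variation \<mu> \<Omega> u U"
 have "tU <= total_variation \<mu> \<Omega> u \<Omega>" unfolding tU_def total_variation_def using UO by (intro INF_superset_mono) auto
 hence "tU < oo" using tvu by (rule le_less_trans)
 then obtain r where r:"tU = en r" "0 <= r" by (cases tU) auto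
 have "tU < en (r + de)" using r de by (simp add: ennreal_less_iff)
 \<comment> \<open>The approximations live on an open set that is nearly optimal for
   \<open>U\<close>, since their energy is to be compared with the variation on \<open>U\<close> and
   not with that on the whole domain.\<close>
 then obtain W where W:"open W" "U <= W" "W <= \<Omega>" "total_variation_open \<mu> W u < en (r + de)"
 unfolding tU_def total_variation_def INF_less_iff by auto
 have fuW:"AM x. x:W --> u x = ereal (f x)" using fu by eventually_elim (use W(3) in blast)
 have "tv W f < en (r + de)" using W(4) tv_open_eq[OF W(1) fm fuW] by simp
 then obtain F0 G0 where FG0:"appr W f F0 G0" "!!i. NI W (G0 i) < en (r + de)" using tv_less by blast
 obtain rr :: "nat => nat" where rr:"AM x. x:W --> (%i. F0 (rr i) x) ~~> f x"
 using lconv_AE_subseq[OF W(1) apprD(2)[OF FG0(1)] fm appr_lconv[OF FG0(1)]] by blast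
 have Um:"U:sets M" by (rule quasiopen_sets[OF qU])
 have evU:"EX N. ALL k>=N. Ph k x = 1" if "x:U" "x ~: Nul" for x using P4 Nul(3) that by blast
 have AEN:"AM x. x ~: Nul" by (rule mu0_AE[OF Cap0_null[OF Nul(1)]])
 interpret C: construction \<mu> Cd U W Ph e K f "%i. F0 (rr i)" "%i. G0 (rr i)" "r + de" L al bt de de
 proof unfold_locales
 show "AM x. x:U --> (EX N. ALL k>=N. Ph k x = 1)" using AEN by eventually_elim (use evU in blast)
 show "(EX N. ALL k>=N. Ph k x = 1) \<or> (ALL k. Ph k x = 0)" if "x:U" for x using evU[OF that] P5 Nul(2) by blast
 show "NI W (G0 (rr i)) <= en (r + de)" for i using FG0(2) by (rule less_imp_le)
 show "wug W (F0 (rr i)) (G0 (rr i))" "F0 (rr i):bM" for i using apprD[OF FG0(1)] by blast+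
 show "AM x. x:K k --> al k x + de <= f x & f x <= bt k x - de" for k by (rule ab)
 show "U:sets M" "U <= W" "open W" by (rule Um W)+
 show "0 <= r + de" using r(2) de by simp
 show "f:bM" "0 < de" by fact+
 show "arc_ae U (%p s t. (EX N. ALL k>=N. ALL r:{s..t}. Ph k (p r) = 1))" by (rule P6)
 show "AM x. x:W --> (%i. F0 (rr i) x) ~~> f x" by (rule rr)
 show "wug UNIV (Ph k) (e k)" "Ph k:bM" "(NN x. e k x) < oo" for k using P1 by blast+
 show "0 <= Ph k x" "Ph k x <= 1" "Ph k x <= Ph (Suc k) x" "x ~: K k ==> Ph k x = 0" "x ~: K k ==> e k x = 0" for k x using P2 by blast+
 show "compact (K k)" "K k <= U" "K k <= K (Suc k)" for k using P3 by blast+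
 show "lips (L k) (al k)" "lips (L k) (bt k)" "al k x <= bt k x" for k x by (rule ab)+
 qed
 define etE where "etE j x = ereal (C.et j x)" for j x
 define uE where "uE j x = ereal (C.w j x)" for j x
 define vE where "vE x = ereal (C.v x)" for x
 have etsum:"(\<Sum>j. etE j x) = 1" if x:"x:U" "x ~: Nul" for x
 proof -
 obtain N where N:"ALL k>=N. Ph k x = 1" using evU[OF x] by blast
 have z:"C.et k x = 0" if "k ~: {..N}" for k using that N by (cases k) (auto simp: C.et_def consec_def)
 have "(SUM k<=N. C.et k x) = C.Th (Suc N) x" unfolding C.etTh using sum_lessThan_telescope[of "%k. C.Th k x" "Suc N"]
 by (simp only: lessThan_Suc_atMost) (simp add: C.Th_def)
 also have "... = 1" using N by (simp add: C.Th_def)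
 finally have "(%k. C.et k x) sums 1" using sums_finite[of "{..N}" "%k. C.et k x"] z by simp
 hence "(%k. etE k x) sums ereal 1" unfolding etE_def by (subst sums_ereal)
 thus ?thesis by (simp add: sums_iff one_ereal_def)
 qed
 have 1:"partition_of_unity \<mu> U etE" unfolding partition_of_unity_def
 proof
 show "ALL j x. 0 <= etE j x" using C.et01 by (simp add: etE_def)
 have "cap {x:U. (\<Sum>j. etE j x) ~= 1} <= cap Nul" using etsum by (intro Cap1_mono) blast
 thus "cap {x:U. (\<Sum>j. etE j x) ~= 1} = 0" using Nul(1) by simp
 qed
 have 2:"etE j:N11_c \<mu> U" for j unfolding N11_c_def
 proof (intro CollectI conjI)
 have "(%x. ereal (C.et j x)):N11 \<mu> UNIV"
 by (rule wug_N11(2)[OF C.etw C.etm]) (use C.etint[of j] C.Efin[of j] C.et01(1) in simp_all)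
 thus "etE j:N11 \<mu> UNIV" by (simp add: etE_def[abs_def])
 have "{x. etE j x ~= 0} <= K j" using C.et0[of _ j] by (auto simp: etE_def)
 hence cl:"closure {x. etE j x ~= 0} <= K j" by (rule closure_minimal) (rule compact_imp_closed[OF K(1)])
 thus "closure {x. etE j x ~= 0} <= U" using K(2) by blast
 show "compact (closure {x. etE j x ~= 0})" using compact_Int_closed[OF K(1)[of j] closed_closure, of "{x. etE j x ~= 0}"] cl by (simp add: Int_absorb1)
 qed
 have 3:"uE j:N11 \<mu> {x. etE j x > 0}" for j using C.w_N11[of j] by (simp add: uE_def[abs_def] etE_def)
 have 4:"(%j. if etE j x = 0 then 0 else etE j x * uE j x) sums vE x" for x
 proof -
 have "(%j. if etE j x = 0 then 0 else etE j x * uE j x) = (%j. ereal (C.et j x * C.w j x))" by (auto simp: etE_def uE_def zero_ereal_def)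
 thus ?thesis using C.v_fin[of x] by (simp only: vE_def sums_ereal)
 qed
 define zz where "zz = zero_ext U (%x. vE x - u x)"
 have fN0:"C.fN N x = 0" if "x ~: U" for N x
 proof -
 have "C.et k x = 0" for k using C.et0[of x k] K(2)[of k] that by blast
 thus ?thesis by (simp add: C.fN_def)
 qed
 have zz:"AM x. zz x = ereal (C.fN 0 x)"
 using C.v_fN fu
 proof eventually_elim
 case (elim x)
 thus ?case using UO fN0[of x 0] by (cases "x:U") (auto simp: zz_def zero_ext_def vE_def)
 qed
 have L1:"L1_norm \<mu> U (%x. vE x - u x) <= en de"
 proof -
 have "L1_norm \<mu> U (%x. vE x - u x) <= (NN x. ea (C.fN 0 x))" unfolding L1_norm_def
 proof (rule nn_integral_mono_AE)
 show "AM x. e2ennreal (abs (vE x - u x)) * ind U x <= ea (C.fN 0 x)"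
 using zz by eventually_elim (auto simp: zz_def zero_ext_def indicator_def)
 qed
 also have "... <= en de" using C.fN_L1[of 0] by simp
 finally show ?thesis .
 qed
 have 5:"L1_norm \<mu> U (%x. vE x - u x) < en \<epsilon>"
 by (rule le_less_trans[OF L1]) (use \<epsilon> in "simp add: de_def ennreal_less_iff")
 have Gvi:"NI U C.Gv <= en (r + de + 4 * de)"
 by (rule order_trans[OF _ C.Gv_le]) (auto intro!: nn_integral_mono simp: indicator_def)
 have 6:"vE:N11_loc \<mu> U" unfolding N11_loc_def
 proof (intro CollectI ballI)
 fix x assume "x:U"
 then obtain rh where rh:"rh > 0" "cball x rh <= \<Omega>" using \<Omega> UO open_contains_cball by (metis subsetD)
 have m:"U Int ball x rh:sets M" using Um by auto
 have "NI (U Int ball x rh) (%y. ea (C.v y)) <= (NN y. ea (C.fN 0 y) + ea (f y) * ind (cball x rh) y)"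
 proof (rule nn_integral_mono_AE)
 show "AM y. ea (C.v y) * ind (U Int ball x rh) y <= ea (C.fN 0 y) + ea (f y) * ind (cball x rh) y"
 using C.v_fN
 proof eventually_elim
 case (elim y)
 show ?case
 proof (cases "y:U Int ball x rh")
 case True
 hence "abs (C.v y) <= abs (C.fN 0 y) + abs (f y)" using elim by auto
 hence "ea (C.v y) <= ea (C.fN 0 y) + ea (f y)" by (simp add: ennreal_leI flip: ennreal_plus)
 thus ?thesis using True by auto
 qed simp
 qed
 qed
 also have "... = (NN y. ea (C.fN 0 y)) + NI (cball x rh) (%y. ea (f y))"
 using fm by (subst nn_integral_add) auto
 also have "... < oo"
 proof -
 have "(NN y. ea (C.fN 0 y)) < oo" using C.fN_L1[of 0] by (auto intro: le_less_trans)
 moreover have "NI (cball x rh) (%y. ea (f y)) < oo" using fl rh(2) by (simp add: locint_def)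
 ultimately show ?thesis by simp
 qed
 finally have a:"NI (U Int ball x rh) (%y. ea (C.v y)) < oo" .
 have "NI (U Int ball x rh) C.Gv <= NI U C.Gv" by (intro ni_mono) auto
 from order_trans[OF this Gvi] have b:"NI (U Int ball x rh) C.Gv < oo" by (auto intro: le_less_trans)
 show "EX rh>0. vE:N11 \<mu> (U Int ball x rh)"
 using rh(1) wug_N11(2)[OF wug_subset[OF C.v_wug m] C.vm a b] by (auto simp: vE_def[abs_def])
 qed
 have 7:"(\<integral>\<^sup>+x\<in>U. minimal_wug \<mu> U vE x \<partial>outer_meas \<mu>) < tU + en \<epsilon>"
 proof -
 obtain G' where G':"ecwug U vE G'" "AM x. x:U --> G' x <= C.Gv x" using wug_cwug[OF C.v_wug] by (auto simp: vE_def[abs_def])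
 have "lion U G'"
 using lion_mono_AE[OF bfin_lion[OF wug_fin[OF C.v_wug]] G'(2)] .
 hence "NI U (minimal_wug \<mu> U vE) <= NI U G'" by (rule minimal_wug_le[OF Um G'(1)])
 also have "... <= NI U C.Gv" by (rule nn_integral_mono_AE) (use G'(2) in "auto simp: indicator_def")
 also have "... <= en (r + de + 4 * de)" by (rule Gvi)
 also have "... < en (r + \<epsilon>)" using r(2) \<epsilon> by (simp add: ennreal_less_iff de_def)
 finally show ?thesis using r \<epsilon> by simp
 qed
 let ?J = "SUP x\<in>U. ul u x - ll u x"
 have 8:"(SUP x\<in>unity_set U etE. abs (vE x - ul u x)) <= 9 * ?J + ereal \<epsilon>"
 proof (rule SUP_least)
 fix x assume "x:unity_set U etE"
 hence x:"x:U" "(\<Sum>j. etE j x) = 1" by (auto simp: unity_set_def)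
 have J0:"0 <= ?J" by (rule SUP_upper2[OF x(1)]) (simp add: ereal_diff_positive lower_le_upper)
 show "abs (vE x - ul u x) <= 9 * ?J + ereal \<epsilon>"
 proof (cases "?J = oo")
 case False
 then obtain j where j:"?J = ereal j" "0 <= j" using J0 by (cases ?J) auto
 have Jk:"bt k y - al k y <= j + 6 * de" for k y
 proof (rule abJ[OF j(2)], rule ballI)
 fix z assume "z:K k"
 hence "ul u z - ll u z <= ?J" using K(2) by (intro SUP_upper) blast
 thus "ul u z - ll u z <= ereal j" by (simp only: j(1))
 qed
 obtain n where n:"ALL k>=n. C.et k x = 0" using C.et_fin by blast
 have s1:"(%k. C.et k x) sums (SUM k<n. C.et k x)" using n by (intro sums_finite) auto
 hence "(%k. etE k x) sums ereal (SUM k<n. C.et k x)" unfolding etE_def by (subst sums_ereal)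
 hence one:"(SUM k<n. C.et k x) = 1" using x(2) by (simp add: sums_iff one_ereal_def)
 have vx:"C.v x = (SUM k<n. C.et k x * C.w k x)" unfolding C.v_def using n by (intro suminf_finite) auto
 have "EX k. C.et k x ~= 0" using one by (metis sum.neutral zero_neq_one)
 then obtain k0 where "x:K k0" using C.et0 by blast
 then obtain p where p:"ul u x = ereal p" using ab(5)[of x k0] by (cases "ul u x") auto
 \<comment> \<open>Wherever \<open>et k\<close> is positive, \<open>w k\<close> and the upper limit
   lie between the same two obstacles, whose distance is at most the largest jump plus
   \<open>6 * de\<close>.\<close>
 have wp:"C.et k x * abs (C.w k x - p) <= C.et k x * (j + 6 * de)" for k
 proof (cases "x:K k")
 case True
 hence "al k x <= p" "p <= bt k x" using ab(5)[of x k] by (auto simp: p)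
 moreover have "al k x <= C.w k x" "C.w k x <= bt k x" unfolding C.w_def by (rule C.md_bounds)+
 ultimately have "abs (C.w k x - p) <= j + 6 * de" using Jk[of k x] by linarith
 thus ?thesis using C.et01(1) by (intro mult_left_mono) auto
 qed (simp add: C.et0)
 have "C.v x - p = C.v x - (SUM k<n. C.et k x) * p" by (simp add: one)
 also have "... = (SUM k<n. C.et k x * (C.w k x - p))" unfolding vx by (simp add: sum_distrib_right right_diff_distrib sum_subtractf)
 finally have "abs (C.v x - p) <= (SUM k<n. abs (C.et k x * (C.w k x - p)))" by (simp add: sum_abs)
 also have "... <= (SUM k<n. C.et k x * (j + 6 * de))" using wp C.et01(1) by (intro sum_mono) (simp add: abs_mult)
 also have "... = j + 6 * de" by (simp add: sum_distrib_right[symmetric] one)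
 also have "... <= 9 * j + \<epsilon>" using j(2) \<epsilon> by (simp add: de_def)
 finally have "abs (C.v x - p) <= 9 * j + \<epsilon>" .
 thus ?thesis unfolding j(1) vE_def p by (simp add: numeral_eq_ereal)
 qed simp
 qed
 have tz:"total_variation_open \<mu> V zz = tv V (C.fN N)" if "open V" "!!x. x:V ==> C.fN N x = C.fN 0 x" for V N
 by (rule tv_open_eq[OF that(1) C.fNm]) (use zz that(2) in "auto elim!: eventually_mono")
 have 9:"total_variation \<mu> UNIV zz UNIV < 2 * tU + en \<epsilon>"
 proof -
 have "total_variation \<mu> UNIV zz UNIV = tv UNIV (C.fN 0)" by (simp add: total_variation_domain tz)
 also have "... <= en (2 * (r + de - C.bb 0) + 3 * (de * (1 / 2) ^ 0))" by (rule C.fN_tv[OF C.bb(3)])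
 also have "... < en (2 * r + \<epsilon>)" using r(2) \<epsilon> by (simp add: ennreal_less_iff de_def C.bb(5))
 also have "... = 2 * tU + en \<epsilon>" using r \<epsilon> by (simp add: ennreal_mult)
 finally show ?thesis .
 qed
 \<comment> \<open>In \<open>fN_tv\<close> the limit \<open>B\<close> of the \<open>bb k\<close> is
   used instead of their upper bound, so that the variation of the tails tends to zero.\<close>
 have inc:"incseq C.bb" using C.bb(4) by (rule incseq_SucI)
 hence "convergent C.bb" by (intro Bseq_monoseq_convergent BseqI'[of _ "r + de"] disjI1) (use C.bb(2,3) in "auto simp: monoseq_def incseq_def")
 then obtain B where B:"C.bb ~~> B" unfolding convergent_def by blast
 have bB:"C.bb k <= B" for k by (rule incseq_le[OF inc B])
 define p where "p N = 2 * (B - C.bb (Suc N)) + 3 * (de * (1 / 2) ^ Suc N)" for N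
 have hp:"(%N. (1 / 2 :: real) ^ Suc N) ~~> 0" by (rule LIMSEQ_Suc) (simp add: LIMSEQ_realpow_zero)
 have p0:"p ~~> 0"
 proof -
 have "p ~~> 2 * (B - B) + 3 * (de * 0)" unfolding p_def[abs_def] by (intro tendsto_intros LIMSEQ_Suc[OF B] hp)
 thus ?thesis by simp
 qed
 have ptv:"tv UNIV (C.fN (Suc N)) <= en (p N)" for N unfolding p_def by (rule C.fN_tv[OF bB])
 have 10:"total_variation \<mu> UNIV zz (- U) = 0"
 proof (rule ennreal_eq_0I[OF _ p0])
 fix N
 \<comment> \<open>An open neighbourhood of \<open>- U\<close> on which \<open>v - u\<close> agrees
   almost everywhere with a late tail.\<close>
 have o:"open (- K N)" by (rule open_Compl[OF compact_imp_closed[OF K(1)]])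
 have "total_variation \<mu> UNIV zz (- U) <= total_variation_open \<mu> (- K N) zz"
 unfolding total_variation_def using o K(2)[of N] by (intro INF_lower) auto
 also have "... = tv (- K N) (C.fN (Suc N))" by (rule tz[OF o]) (simp add: C.fN_eq)
 also have "... <= tv UNIV (C.fN (Suc N))" using o by (intro tv_mono borel_M') auto
 also have "... <= en (p N)" by (rule ptv)
 finally show "total_variation \<mu> UNIV zz (- U) <= en (p N)" .
 qed
 have 11:"hausdorff_codim1 \<mu> {x:- U. ul (%y. abs (zz y)) x ~= 0} = 0"
 proof (rule two_sided_null[OF C.fNm ptv p0, where q = "%N. de * (1 / 2) ^ Suc N" and K = K and h = "C.fN 0"])
 show "(NN x. ea (C.fN (Suc N) x)) <= en (de * (1 / 2) ^ Suc N)" for N by (rule C.fN_L1)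
 show "(%N. de * (1 / 2) ^ Suc N) ~~> 0" using tendsto_mult[OF tendsto_const hp, of de] by simp
 show "AM x. x ~: K N --> C.fN (Suc N) x = C.fN 0 x" for N by (simp add: C.fN_eq)
 show "closed (K N)" "- U Int K N = {}" for N using compact_imp_closed[OF K(1)] K(2) by auto
 qed (rule zz)
 show ?thesis
 using 1 2 3 4 5 6 7 8 9 10 11 unfolding zz_def tU_def
 by (intro exI[of _ etE] exI[of _ uE] exI[of _ vE] conjI allI ballI) assumption+
qed

end
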